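(* Let $n\in\mathbb{N}$, and assume that the $U$-cylindrical $H$-fractional process $Z$ lives in the finite Wiener chaos $\mathcal{H}^{\oplus n}$ and that the Banach space $X$ is $n$-good. Let $G:X^*\times U\to\mathcal{D}^H(T)$ be weakly integrable with respect to $Z$ and let $\overline G:X^*\to\mathcal{D}^H(T;U)$ be the operator associated with $G$. If $\overline G^*\in\gamma(\mathcal{D}^H(T;U);X)$, then $G$ is integrable with respect to $Z$, and for every $r>0$ it holds that $$\|\xi\|_{L^r(\Omega;X)}\eqsim\|\overline G^*\|_{\gamma(\mathcal{D}^H(T;U);X)},$$ where $\xi$ is the integral of $G$ with respect to $Z$.
   Context: $A\eqsim B$ means $c_1A\le B\le c_2A$ with finite positive constants $c_1,c_2$; here the constants do not depend on $G$. Wiener chaos: $V$ is a real separable Hilbert space, $(\Omega,\mathcal{F},\mathbb{P})$ carries a $V$-isonormal Gaussian process $(W(v))_{v\in V}$ generating $\mathcal{F}$ (augmented by the $\mathbb{P}$-zero sets); $H_k(x)=\frac{(-1)^k}{k!}e^{x^2/2}\frac{d^k}{dx^k}(e^{-x^2/2})$; $\mathcal{H}_k$ is the closed linear subspace of $L^2(\Omega)$ generated by $\{H_k(W(v)):\|v\|_V=1\}$; $\mathcal{H}^{\oplus n}=\bigoplus_{i=0}^n\mathcal{H}_i$. Setting: $H\in(0,1)$, $U$ is a separable Hilbert space, $X$ a Banach space, $\mathfrak{T}$ is $\mathbb{R}$, $[0,\infty)$ or $[0,\tau]$, $T\subseteq\mathfrak{T}$ is an interval. A $U$-cylindrical $H$-fractional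 process $Z=(Z_t)_{t\in\mathfrak{T}}$ is a family of bounded linear operators $Z_t:U\to L^2(\Omega)$ such that each $Z_t(u)$ is centered and $\mathbb{E}Z_s(u)Z_t(v)=R_H(s,t)\langle u,v\rangle_U$, with $R_H(s,t)=\frac12(|s|^{2H}+|t|^{2H}-|t-s|^{2H})$. It lives in $\mathcal{H}^{\oplus n}$ if $Z_t(u)\in\mathcal{H}^{\oplus n}$ for all $t$, $u$. $\mathcal{D}^H(T)$ is the Hilbert space obtained by completing the real step functions $\sum_jf_j\mathbf 1_{[t_{j-1},t_j)}$ ($t_j\in T$) in the inner product determined by $\langle\mathbf 1_{[a,b)},\mathbf 1_{[c,d)}\rangle=\frac12(|d-a|^{2H}+|b-c|^{2H}-|d-b|^{2H}-|c-a|^{2H})$. For $u\in U$, $g\mapsto\int_Tg\,dZ(u)$ is the continuous linear extension to $\mathcal{D}^H(T)$ of $\mathbf 1_{[a,b)}\mapsto Z_b(u)-Z_a(u)$. $\mathcal{D}^H(T;U)=\mathcal{D}^H(T)\otimes_2U$ is the Hilbert tensor product and $I_T:\mathcal{D}^H(T;U)\to L^2(\Omega)$ is the linear isometry with $I_T(g\otimes u)=\int_Tg\,dZ(u)$. A bilinear map $G:X^*\times U\to\mathcal{D}^H(T)$ is weakly integrable if there is $C>0$ such that the Hilbert–Schmidt norm satisfies $\|G(\varphi,\cdot)\|_{\mathcal{L}_2(U;\mathcal{D}^H(T))}\le C\|\varphi\|_{X^*}$ for all $\varphi\in X^*$. Then there is a unique bounded linear operator $\overline G:X^*\to\mathcal{D}^H(T;U)$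 with $\langle\overline G\varphi,g\otimes u\rangle_{\mathcal{D}^H(T;U)}=\langle G(\varphi,u),g\rangle_{\mathcal{D}^H(T)}$ for all $\varphi,g,u$. Its adjoint $\overline G^*$ maps $\mathcal{D}^H(T;U)$ into $X^{**}$; $\overline G^*\in\gamma(\mathcal{D}^H(T;U);X)$ means that it takes values in $X$ and is $\gamma$-radonifying. A weakly integrable $G$ is integrable with respect to $Z$ if there is $\xi\in L^0(\Omega;X)$ (the integral of $G$) with $\langle\varphi,\xi\rangle=I_T(\overline G\varphi)$ a.s. for every $\varphi\in X^*$. $\gamma(\mathcal{V};X)$, for a Hilbert space $\mathcal{V}$, is the space of $\gamma$-radonifying operators: the closure of the finite rank operators in the norm given for $R=\sum_{k=1}^m\langle\cdot,e_k\rangle x_k$ ($\{e_k\}$ orthonormal) by $\|R\|_{\gamma}^2=\mathbb{E}\|\sum_k\gamma_kx_k\|_X^2$, $\gamma_k$ independent standard Gaussian. $X$ is $n$-good if there are finite positive constants $c_1,c_2$ such that $c_1\|\sum_k\varepsilon^{(2)}_kx_k\|_{L^2(\Omega;X)}\le\|\sum_k\varepsilon^{(1)}_kx_k\|_{L^2(\Omega;X)}\le c_2\|\sum_k\varepsilon^{(2)}_kx_k\|_{L^2(\Omega;X)}$ for every $m$, every two orthonormal sets $\{\varepsilon^{(1)}_k\}_{k=1}^m,\{\varepsilon^{(2)}_k\}_{k=1}^m\subseteq\mathcal{H}^{\oplus n}$, and every $\{x_k\}_{k=1}^m\subseteq X$. *)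

theory Defs
  imports "HOL-Probability.Probability"
begin

section \<open>Square integrable random variables\<close>

text \<open>
  Elements of \<open>L\<^sup>2(\<Omega>)\<close> and \<open>L\<^sup>0(\<Omega>;X)\<close> are handled through representatives; identities between
  them are almost sure identities.  A linear map into \<open>L\<^sup>2(\<Omega>)\<close> is therefore a choice of
  representatives that is linear almost surely for each fixed pair of arguments.
\<close>

definition L2 :: "'o measure \<Rightarrow> ('o \<Rightarrow> real) set" where
  "L2 M = {Y \<in> borel_measurable M. integrable M (\<lambda>\<omega>. (Y \<omega>)\<^sup>2)}"

definition L2_norm :: "'o measure \<Rightarrow> ('o \<Rightarrow> 'x::real_normed_vector) \<Rightarrow> real" where
  "L2_norm M Y = sqrt (\<integral>\<omega>. (norm (Y \<omega>))\<^sup>2 \<partial>M)"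

definition Lr_norm :: "'o measure \<Rightarrow> real \<Rightarrow> ('o \<Rightarrow> 'x::real_normed_vector) \<Rightarrow> real" where
  "Lr_norm M r Y = (\<integral>\<omega>. norm (Y \<omega>) powr r \<partial>M) powr (1 / r)"

definition L2_operator :: "'o measure \<Rightarrow> ('b::real_normed_vector \<Rightarrow> 'o \<Rightarrow> real) \<Rightarrow> bool" where
  "L2_operator M A \<longleftrightarrow>
     (\<forall>x. A x \<in> L2 M) \<and>
     (\<forall>x y. AE \<omega> in M. A (x + y) \<omega> = A x \<omega> + A y \<omega>) \<and>
     (\<forall>c x. AE \<omega> in M. A (c *\<^sub>R x) \<omega> = c * A x \<omega>) \<and>
     (\<exists>C. \<forall>x. L2_norm M (A x) \<le> C * norm x)"

definition L2_closed_span :: "'o measure \<Rightarrow> ('o \<Rightarrow> real) set \<Rightarrow> ('o \<Rightarrow> real) set" where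
  "L2_closed_span M A =
     {Y \<in> L2 M. \<forall>\<epsilon>>0. \<exists>F a. finite F \<and> F \<subseteq> A \<and> L2_norm M (\<lambda>\<omega>. Y \<omega> - (\<Sum>f\<in>F. a f * f \<omega>)) < \<epsilon>}"

text \<open>
  Strong measurability (the relevant notion of a random variable with values in a possibly
  nonseparable Banach space): a pointwise limit of simple functions.
\<close>

definition strongly_measurable :: "'o measure \<Rightarrow> ('o \<Rightarrow> 'x::topological_space) \<Rightarrow> bool" where
  "strongly_measurable M \<xi> \<longleftrightarrow>
     (\<exists>s. (\<forall>i. simple_function M (s i)) \<and> (\<forall>\<omega>\<in>space M. (\<lambda>i. s i \<omega>) \<longlonglongrightarrow> \<xi> \<omega>))"


section \<open>Wiener chaos\<close>

definition centered_gaussian :: "'o measure \<Rightarrow> ('o \<Rightarrow> real) \<Rightarrow> bool" where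
  "centered_gaussian M Y \<longleftrightarrow>
     Y \<in> borel_measurable M \<and>
     ((AE \<omega> in M. Y \<omega> = 0) \<or> (\<exists>\<sigma>>0. distributed M lborel Y (normal_density 0 \<sigma>)))"

text \<open>A centred Gaussian family (every finite linear combination is centred Gaussian) whose
  covariance is the inner product.\<close>

definition isonormal_process ::
    "'o measure \<Rightarrow> ('v::{real_inner,polish_space} \<Rightarrow> 'o \<Rightarrow> real) \<Rightarrow> bool" where
  "isonormal_process M W \<longleftrightarrow>
     prob_space M \<and>
     (\<forall>F a. finite F \<longrightarrow> centered_gaussian M (\<lambda>\<omega>. \<Sum>v\<in>F. a v * W v \<omega>)) \<and>
     (\<forall>v w. (\<integral>\<omega>. W v \<omega> * W w \<omega> \<partial>M) = v \<bullet> w)"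

definition generates_modulo_null :: "'o measure \<Rightarrow> ('v \<Rightarrow> 'o \<Rightarrow> real) \<Rightarrow> bool" where
  "generates_modulo_null M W \<longleftrightarrow>
     sets M = sigma_sets (space M)
       ({W v -` B \<inter> space M | v B. B \<in> sets borel} \<union> null_sets M)"

definition hermite :: "nat \<Rightarrow> real \<Rightarrow> real" where
  "hermite k x = (- 1) ^ k / fact k * exp (x\<^sup>2 / 2) * (deriv ^^ k) (\<lambda>y. exp (- (y\<^sup>2) / 2)) x"

definition wiener_chaos ::
    "'o measure \<Rightarrow> ('v::{real_inner,polish_space} \<Rightarrow> 'o \<Rightarrow> real) \<Rightarrow> nat \<Rightarrow> ('o \<Rightarrow> real) set" where
  "wiener_chaos M W k = L2_closed_span M {(\<lambda>\<omega>. hermite k (W v \<omega>)) | v. norm v = 1}"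

definition wiener_chaos_upto ::
    "'o measure \<Rightarrow> ('v::{real_inner,polish_space} \<Rightarrow> 'o \<Rightarrow> real) \<Rightarrow> nat \<Rightarrow> ('o \<Rightarrow> real) set" where
  "wiener_chaos_upto M W n =
     {Y \<in> L2 M. \<exists>Ys. (\<forall>i\<le>n. Ys i \<in> wiener_chaos M W i) \<and> (AE \<omega> in M. Y \<omega> = (\<Sum>i\<le>n. Ys i \<omega>))}"

definition L2_orthonormal :: "'o measure \<Rightarrow> nat \<Rightarrow> (nat \<Rightarrow> 'o \<Rightarrow> real) \<Rightarrow> bool" where
  "L2_orthonormal M m \<epsilon> \<longleftrightarrow>
     (\<forall>j<m. \<forall>k<m. (\<integral>\<omega>. \<epsilon> j \<omega> * \<epsilon> k \<omega> \<partial>M) = (if j = k then 1 else 0))"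

definition n_good ::
    "'o measure \<Rightarrow> ('v::{real_inner,polish_space} \<Rightarrow> 'o \<Rightarrow> real) \<Rightarrow> nat \<Rightarrow> 'x::banach itself \<Rightarrow> bool"
  where
  "n_good M W n (_ :: 'x itself) \<longleftrightarrow>
     (\<exists>c1>0. \<exists>c2>0. \<forall>m \<epsilon>1 \<epsilon>2. \<forall>x :: nat \<Rightarrow> 'x.
        (\<forall>k<m. \<epsilon>1 k \<in> wiener_chaos_upto M W n) \<and> L2_orthonormal M m \<epsilon>1 \<and>
        (\<forall>k<m. \<epsilon>2 k \<in> wiener_chaos_upto M W n) \<and> L2_orthonormal M m \<epsilon>2 \<longrightarrow>
        c1 * L2_norm M (\<lambda>\<omega>. \<Sum>k<m. \<epsilon>2 k \<omega> *\<^sub>R x k)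
          \<le> L2_norm M (\<lambda>\<omega>. \<Sum>k<m. \<epsilon>1 k \<omega> *\<^sub>R x k) \<and>
        L2_norm M (\<lambda>\<omega>. \<Sum>k<m. \<epsilon>1 k \<omega> *\<^sub>R x k)
          \<le> c2 * L2_norm M (\<lambda>\<omega>. \<Sum>k<m. \<epsilon>2 k \<omega> *\<^sub>R x k))"


section \<open>Cylindrical fractional processes and their Wiener integrals\<close>

definition time_domain :: "real set \<Rightarrow> bool" where
  "time_domain TT \<longleftrightarrow> TT = UNIV \<or> TT = {0..} \<or> (\<exists>\<tau>>0. TT = {0..\<tau>})"

definition R_H :: "real \<Rightarrow> real \<Rightarrow> real \<Rightarrow> real" where
  "R_H H s t = (\<bar>s\<bar> powr (2 * H) + \<bar>t\<bar> powr (2 * H) - \<bar>t - s\<bar> powr (2 * H)) / 2"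

definition cylindrical_fractional_process ::
    "'o measure \<Rightarrow> real \<Rightarrow> real set \<Rightarrow> (real \<Rightarrow> 'u::{real_inner,polish_space} \<Rightarrow> 'o \<Rightarrow> real) \<Rightarrow> bool"
  where
  "cylindrical_fractional_process M H TT Z \<longleftrightarrow>
     (\<forall>t\<in>TT. L2_operator M (Z t) \<and> (\<forall>u. (\<integral>\<omega>. Z t u \<omega> \<partial>M) = 0)) \<and>
     (\<forall>s\<in>TT. \<forall>t\<in>TT. \<forall>u v. (\<integral>\<omega>. Z s u \<omega> * Z t v \<omega> \<partial>M) = R_H H s t * (u \<bullet> v))"

definition step_functions :: "real set \<Rightarrow> (real \<Rightarrow> real) set" where
  "step_functions T =
     {(\<lambda>x. \<Sum>j<m. c j * indicat_real {t j..<t (Suc j)} x) | (m::nat) t c.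
        \<forall>j<m. t j \<in> T \<and> t (Suc j) \<in> T \<and> t j \<le> t (Suc j)}"

text \<open>
  The Hilbert space \<open>\<D>\<^sup>H(T)\<close> is determined up to isometric isomorphism as a completion of the step
  functions: a Hilbert space \<open>'d\<close> together with a linear map \<open>\<iota>\<close> on step functions that has
  dense range and induces the prescribed inner product of indicator functions.
\<close>

definition DH_completion ::
    "real \<Rightarrow> real set \<Rightarrow> ((real \<Rightarrow> real) \<Rightarrow> 'd::{real_inner,complete_space}) \<Rightarrow> bool" where
  "DH_completion H T \<iota> \<longleftrightarrow>
     (\<forall>f\<in>step_functions T. \<forall>g\<in>step_functions T. \<iota> (\<lambda>x. f x + g x) = \<iota> f + \<iota> g) \<and>
     (\<forall>c. \<forall>f\<in>step_functions T. \<iota> (\<lambda>x. c * f x) = c *\<^sub>R \<iota> f) \<and>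
     (\<forall>a\<in>T. \<forall>b\<in>T. \<forall>c\<in>T. \<forall>d\<in>T. a \<le> b \<longrightarrow> c \<le> d \<longrightarrow>
        \<iota> (indicat_real {a..<b}) \<bullet> \<iota> (indicat_real {c..<d}) =
        (\<bar>d - a\<bar> powr (2 * H) + \<bar>b - c\<bar> powr (2 * H)
          - \<bar>d - b\<bar> powr (2 * H) - \<bar>c - a\<bar> powr (2 * H)) / 2) \<and>
     closure (\<iota> ` step_functions T) = UNIV"

text \<open>\<open>J u g\<close> represents \<open>\<integral>\<^sub>T g dZ(u)\<close>.\<close>

definition fractional_integral ::
    "'o measure \<Rightarrow> real set \<Rightarrow> (real \<Rightarrow> 'u \<Rightarrow> 'o \<Rightarrow> real)
      \<Rightarrow> ((real \<Rightarrow> real) \<Rightarrow> 'd::{real_inner,complete_space}) \<Rightarrow> ('u \<Rightarrow> 'd \<Rightarrow> 'o \<Rightarrow> real) \<Rightarrow> bool" where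
  "fractional_integral M T Z \<iota> J \<longleftrightarrow>
     (\<forall>u. L2_operator M (J u)) \<and>
     (\<forall>u. \<forall>a\<in>T. \<forall>b\<in>T. a \<le> b \<longrightarrow>
        (AE \<omega> in M. J u (\<iota> (indicat_real {a..<b})) \<omega> = Z b u \<omega> - Z a u \<omega>))"

definition bilinear_map ::
    "('a::real_vector \<Rightarrow> 'b::real_vector \<Rightarrow> 'c::real_vector) \<Rightarrow> bool" where
  "bilinear_map f \<longleftrightarrow> (\<forall>y. linear (\<lambda>x. f x y)) \<and> (\<forall>x. linear (f x))"

text \<open>
  Likewise \<open>'w\<close> with \<open>tens\<close> is the Hilbert tensor product of \<open>'d\<close> and \<open>'u\<close>, that is, the completion
  of the algebraic tensor product in the inner product determined on elementary tensors.
\<close>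

definition hilbert_tensor ::
    "('d::{real_inner,complete_space} \<Rightarrow> 'u::{real_inner,complete_space}
      \<Rightarrow> 'w::{real_inner,complete_space}) \<Rightarrow> bool" where
  "hilbert_tensor tens \<longleftrightarrow>
     bilinear_map tens \<and>
     (\<forall>g u h v. tens g u \<bullet> tens h v = (g \<bullet> h) * (u \<bullet> v)) \<and>
     closure (span {tens g u | g u. True}) = UNIV"

definition cylindrical_integral ::
    "'o measure \<Rightarrow> ('d \<Rightarrow> 'u \<Rightarrow> 'w::{real_inner,complete_space}) \<Rightarrow> ('u \<Rightarrow> 'd \<Rightarrow> 'o \<Rightarrow> real)
      \<Rightarrow> ('w \<Rightarrow> 'o \<Rightarrow> real) \<Rightarrow> bool" where
  "cylindrical_integral M tens J I \<longleftrightarrow>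
     L2_operator M I \<and>
     (\<forall>w. L2_norm M (I w) = norm w) \<and>
     (\<forall>g u. AE \<omega> in M. I (tens g u) \<omega> = J u g \<omega>)"


section \<open>Weak integrability and integrability\<close>

definition orthonormal_basis :: "'u::{real_inner,polish_space} set \<Rightarrow> bool" where
  "orthonormal_basis B \<longleftrightarrow>
     (\<forall>e\<in>B. \<forall>f\<in>B. e \<bullet> f = (if e = f then 1 else 0)) \<and> closure (span B) = UNIV"

definition hilbert_schmidt ::
    "('u::{real_inner,polish_space} \<Rightarrow> 'd::{real_inner,complete_space}) \<Rightarrow> bool" where
  "hilbert_schmidt A \<longleftrightarrow>
     bounded_linear A \<and> (\<forall>B. orthonormal_basis B \<longrightarrow> (\<lambda>e. (norm (A e))\<^sup>2) summable_on B)"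

text \<open>The value does not depend on the chosen orthonormal basis.\<close>

definition hs_norm ::
    "('u::{real_inner,polish_space} \<Rightarrow> 'd::{real_inner,complete_space}) \<Rightarrow> real" where
  "hs_norm A = sqrt (\<Sum>\<^sub>\<infinity>e\<in>(SOME B. orthonormal_basis B). (norm (A e))\<^sup>2)"

definition weakly_integrable ::
    "(('x::banach \<Rightarrow>\<^sub>L real) \<Rightarrow> 'u::{real_inner,polish_space} \<Rightarrow> 'd::{real_inner,complete_space})
      \<Rightarrow> bool" where
  "weakly_integrable G \<longleftrightarrow>
     bilinear_map G \<and>
     (\<exists>C>0. \<forall>\<phi>. hilbert_schmidt (G \<phi>) \<and> hs_norm (G \<phi>) \<le> C * norm \<phi>)"

definition associated_operator ::
    "('d::{real_inner,complete_space} \<Rightarrow> 'u::{real_inner,polish_space}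
        \<Rightarrow> 'w::{real_inner,complete_space})
      \<Rightarrow> (('x::banach \<Rightarrow>\<^sub>L real) \<Rightarrow> 'u \<Rightarrow> 'd) \<Rightarrow> (('x \<Rightarrow>\<^sub>L real) \<Rightarrow>\<^sub>L 'w) \<Rightarrow> bool" where
  "associated_operator tens G Gbar \<longleftrightarrow> (\<forall>\<phi> g u. Gbar \<phi> \<bullet> tens g u = G \<phi> u \<bullet> g)"

definition is_integral ::
    "'o measure \<Rightarrow> ('w::{real_inner,complete_space} \<Rightarrow> 'o \<Rightarrow> real)
      \<Rightarrow> (('x::banach \<Rightarrow>\<^sub>L real) \<Rightarrow>\<^sub>L 'w) \<Rightarrow> ('o \<Rightarrow> 'x) \<Rightarrow> bool" where
  "is_integral M I Gbar \<xi> \<longleftrightarrow>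
     strongly_measurable M \<xi> \<and> (\<forall>\<phi>. AE \<omega> in M. blinfun_apply \<phi> (\<xi> \<omega>) = I (Gbar \<phi>) \<omega>)"


section \<open>Radonifying operators\<close>

definition adjoint_into_bidual ::
    "(('x::banach \<Rightarrow>\<^sub>L real) \<Rightarrow>\<^sub>L 'w::{real_inner,complete_space})
      \<Rightarrow> 'w \<Rightarrow> (('x \<Rightarrow>\<^sub>L real) \<Rightarrow>\<^sub>L real)" where
  "adjoint_into_bidual A w = blinfun_inner_left w o\<^sub>L A"

definition bidual_embedding :: "'x::banach \<Rightarrow> (('x \<Rightarrow>\<^sub>L real) \<Rightarrow>\<^sub>L real)" where
  "bidual_embedding x = Blinfun (\<lambda>\<phi>. blinfun_apply \<phi> x)"

text \<open>The adjoint takes values in \<open>'x\<close>, viewed inside its bidual, and is \<open>R\<close> as a map into \<open>'x\<close>.\<close>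

definition adjoint_is ::
    "(('x::banach \<Rightarrow>\<^sub>L real) \<Rightarrow>\<^sub>L 'w::{real_inner,complete_space}) \<Rightarrow> ('w \<Rightarrow>\<^sub>L 'x) \<Rightarrow> bool" where
  "adjoint_is A R \<longleftrightarrow> (\<forall>w. adjoint_into_bidual A w = bidual_embedding (R w))"

definition finite_rank_rep ::
    "('w::{real_inner,complete_space} \<Rightarrow>\<^sub>L 'x::banach) \<Rightarrow> nat \<Rightarrow> (nat \<Rightarrow> 'w) \<Rightarrow> (nat \<Rightarrow> 'x) \<Rightarrow> bool" where
  "finite_rank_rep R m e x \<longleftrightarrow>
     (\<forall>j<m. \<forall>k<m. e j \<bullet> e k = (if j = k then 1 else 0)) \<and>
     (\<forall>w. blinfun_apply R w = (\<Sum>k<m. (w \<bullet> e k) *\<^sub>R x k))"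

text \<open>The \<open>L\<^sup>2\<close> norm of \<open>\<Sum>k<m. \<gamma>\<^sub>k x\<^sub>k\<close>, the \<open>\<gamma>\<^sub>k\<close> being the coordinates of the standard Gaussian
  product measure.\<close>

definition gaussian_sum_norm :: "nat \<Rightarrow> (nat \<Rightarrow> 'x::banach) \<Rightarrow> real" where
  "gaussian_sum_norm m x =
     L2_norm (\<Pi>\<^sub>M k\<in>{..<m}. std_normal_distribution) (\<lambda>\<gamma>. \<Sum>k<m. \<gamma> k *\<^sub>R x k)"

text \<open>By rotation invariance of the Gaussian measure, the value does not depend on the
  representation.\<close>

definition gamma_norm_finite_rank ::
    "('w::{real_inner,complete_space} \<Rightarrow>\<^sub>L 'x::banach) \<Rightarrow> real" where
  "gamma_norm_finite_rank R = (THE c. \<exists>m e x. finite_rank_rep R m e x \<and> c = gaussian_sum_norm m x)"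

text \<open>
  The closure of the finite rank operators is their completion, realised inside the bounded
  operators: the \<open>\<gamma>\<close>-norm dominates the operator norm, so \<open>\<gamma>\<close>-Cauchy sequences converge in operator
  norm, and the \<open>\<gamma>\<close>-norm of the limit is the limit of the \<open>\<gamma>\<close>-norms.
\<close>

definition gamma_approximation ::
    "('w::{real_inner,complete_space} \<Rightarrow>\<^sub>L 'x::banach) \<Rightarrow> (nat \<Rightarrow> 'w \<Rightarrow>\<^sub>L 'x) \<Rightarrow> bool" where
  "gamma_approximation R F \<longleftrightarrow>
     (\<forall>i. \<exists>m e x. finite_rank_rep (F i) m e x) \<and>
     (\<forall>\<epsilon>>0. \<exists>N. \<forall>i\<ge>N. \<forall>j\<ge>N. gamma_norm_finite_rank (F i - F j) < \<epsilon>) \<and>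
     F \<longlonglongrightarrow> R"

definition gamma_radonifying :: "('w::{real_inner,complete_space} \<Rightarrow>\<^sub>L 'x::banach) \<Rightarrow> bool" where
  "gamma_radonifying R \<longleftrightarrow> (\<exists>F. gamma_approximation R F)"

definition gamma_norm :: "('w::{real_inner,complete_space} \<Rightarrow>\<^sub>L 'x::banach) \<Rightarrow> real" where
  "gamma_norm R =
     (THE c. \<exists>F. gamma_approximation R F \<and> (\<lambda>i. gamma_norm_finite_rank (F i)) \<longlonglongrightarrow> c)"

end

theory Submission
  imports Defs
begin

text \<open>
  The integral of a finite rank operator \<open>\<Sum>k<m. \<langle>\<cdot>, e\<^sub>k\<rangle> x\<^sub>k\<close> is \<open>\<Sum>k<m. I(e\<^sub>k) x\<^sub>k\<close>. The map \<open>I\<close> is an isometry,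
  and its values lie in the chaos \<open>\<H>\<close> of order at most \<open>n\<close>: this holds for increments of \<open>Z\<close>, hence for
  step functions and elementary tensors, and it survives limits because \<open>\<H>\<close> is closed in \<open>L\<^sup>2\<close>
  (\<open>cylindrical_integral_in_chaos\<close>). So everything reduces to two estimates for sums
  \<open>Y = \<Sum>k<m. \<epsilon>\<^sub>k x\<^sub>k\<close> with coefficients in \<open>\<H>\<close>, with constants that do not depend on \<open>m\<close>, the \<open>\<epsilon>\<^sub>k\<close> and the \<open>x\<^sub>k\<close>:

  \<^item> If the \<open>\<epsilon>\<^sub>k\<close> are orthonormal, the \<open>L\<^sup>2\<close> norm of \<open>Y\<close> is comparable to the \<open>L\<^sup>2\<close> norm of the Gaussian sum
    \<open>\<Sum>k<m. \<gamma>\<^sub>k x\<^sub>k\<close> (\<open>chaos_gaussian_comparison\<close>). When \<open>V\<close> is infinite dimensional and \<open>n \<ge> 1\<close>, the first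
    chaos contains arbitrarily long orthonormal Gaussian systems \<open>W(h\<^sub>k)\<close>, with which an \<open>n\<close>-good space
    compares \<open>Y\<close>. Otherwise \<open>\<H>\<close> has finite dimension, which bounds \<open>m\<close>, and crude bounds by the norms of the \<open>x\<^sub>k\<close> are enough.

  \<^item> All \<open>L\<^sup>r\<close> norms of \<open>Y\<close> are comparable (\<open>chaos_sum_moments\<close> and \<open>moment_comparison\<close>).

  By the first estimate a sequence of finite rank operators that is Cauchy in the \<open>\<gamma>\<close>-norm has integrals
  that are Cauchy in \<open>L\<^sup>2(\<Omega>;X)\<close>. Their limit is the integral of the limit operator, its \<open>L\<^sup>2\<close> norm is
  comparable to the \<open>\<gamma>\<close>-norm, and the moment bounds pass to it by Fatou. The integral is unique because
  two strongly measurable maps that agree almost surely under each functional agree almost surely.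

  The moment estimate is hypercontractivity. The Mehler operator \<open>P\<^sub>\<rho> f(x) = E f(\<rho>x + \<sigma>y)\<close>, \<open>\<rho>\<^sup>2 + \<sigma>\<^sup>2 = 1\<close>,
  maps \<open>L\<^sup>2\<close> to \<open>L\<^sup>4\<close> with norm one for small \<open>\<rho>\<close>: in dimension one by an estimate of its kernel, in higher
  dimensions by Cauchy--Schwarz, one coordinate at a time. A polynomial of degree \<open>d\<close>, restricted to the ellipse
  \<open>\<rho>x + \<sigma>y\<close> and averaged over the sign of \<open>\<sigma>\<close>, is a polynomial of degree \<open>d\<close> in \<open>\<rho>\<close>, so its value at \<open>\<rho> = 1\<close>
  is a fixed linear combination of the values at \<open>d + 1\<close> small \<open>\<rho>\<^sub>i\<close>. Applied to \<open>\<phi> \<circ> F\<close> with a functional \<open>\<phi>\<close>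
  that norms \<open>F(x)\<close>, this bounds \<open>|F|\<close>, and likewise each power \<open>|F|\<^sup>k\<close>, pointwise by finitely many \<open>P\<^sub>\<rho> |F|\<^sup>k\<close>. The
  resulting inequality \<open>E |F|\<^bsup>4k\<^esup> \<le> C (E |F|\<^bsup>2k\<^esup>)\<^sup>2\<close> does not see the Banach space, and iterating it over
  \<open>k = 1, 2, 4, \<dots>\<close> controls all moments.
\<close>

section \<open>Norming functionals\<close>

text \<open>
  Homogeneity is required as an inequality only, which is stable under infima; equality follows.
\<close>

definition sublinear :: "('x::real_normed_vector \<Rightarrow> real) \<Rightarrow> bool" where
  "sublinear p \<longleftrightarrow> (\<forall>x y. p (x + y) \<le> p x + p y) \<and> (\<forall>s>0. \<forall>x. p (s *\<^sub>R x) \<le> s * p x)"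

lemma sublinear_add: "sublinear p \<Longrightarrow> p (x + y) \<le> p x + p y"
  unfolding sublinear_def by blast

lemma sublinear_scale:
  assumes p: "sublinear p" and s: "s \<ge> 0"
  shows "p (s *\<^sub>R x) = s * p x"
proof -
  have le: "p (t *\<^sub>R y) \<le> t * p y" if "t > 0" for t y
    using p that unfolding sublinear_def by blast
  show ?thesis
  proof (cases "s = 0")
    case True
    show ?thesis using True le[of 2 0] le[of "1/2" 0] by simp
  next
    case False
    then have s: "s > 0" using s by simp
    then have "p x \<le> inverse s * p (s *\<^sub>R x)" using le[of "inverse s" "s *\<^sub>R x"] by simp
    then show ?thesis using s le[OF s, of x] by (simp add: field_simps)
  qed
qed

lemma sublinear_lower: "sublinear p \<Longrightarrow> - p (- x) \<le> p x"
  using sublinear_add[of p x "- x"] sublinear_scale[of p 0 0] by simp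

text \<open>
  The Hahn--Banach extension step in a form that avoids subspaces: the tilted functional \<open>q\<close> lies
  below \<open>p\<close> and satisfies \<open>q x \<le> p (x + y) - p y\<close>. If \<open>p\<close> is minimal among sublinear functionals,
  then \<open>q = p\<close>, and \<open>p\<close> is additive.
\<close>

lemma sublinear_tilt:
  fixes p :: "'x::real_normed_vector \<Rightarrow> real" and x y :: 'x and t :: real
  assumes p: "sublinear p"
  defines "q \<equiv> \<lambda>x. INF t\<in>{0..}. p (x + t *\<^sub>R y) - t * p y"
  shows "sublinear q" and "q x \<le> p x" and "t \<ge> 0 \<Longrightarrow> q x \<le> p (x + t *\<^sub>R y) - t * p y"
proof -
  have bdd: "bdd_below ((\<lambda>t. p (x + t *\<^sub>R y) - t * p y) ` {0..})" for x
  proof (rule bdd_belowI2)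
    fix t :: real assume "t \<in> {0..}"
    then have "t * p y = p ((x + t *\<^sub>R y) + (- x))" using sublinear_scale[OF p] by simp
    also have "\<dots> \<le> p (x + t *\<^sub>R y) + p (- x)" by (rule sublinear_add[OF p])
    finally show "- p (- x) \<le> p (x + t *\<^sub>R y) - t * p y" by simp
  qed
  show le: "q x \<le> p (x + t *\<^sub>R y) - t * p y" if "t \<ge> 0" for x t
    unfolding q_def using that by (intro cINF_lower bdd) auto
  show "q x \<le> p x" using le[of 0 x] by simp
  show "sublinear q"
    unfolding sublinear_def
  proof (intro conjI allI impI)
    fix x x'
    have 1: "q (x + x') - (p (x + t *\<^sub>R y) - t * p y) \<le> q x'" if t: "t \<ge> 0" for t
      unfolding q_def
    proof -
      have "q (x + x') - (p (x + t *\<^sub>R y) - t * p y) \<le> p (x' + t' *\<^sub>R y) - t' * p y" if t': "t' \<ge> 0" for t'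
      proof -
        have "q (x + x') \<le> p ((x + t *\<^sub>R y) + (x' + t' *\<^sub>R y)) - (t + t') * p y"
          using le[of "t + t'" "x + x'"] t t' by (simp add: algebra_simps)
        also have "\<dots> \<le> p (x + t *\<^sub>R y) + p (x' + t' *\<^sub>R y) - (t + t') * p y"
          using sublinear_add[OF p, of "x + t *\<^sub>R y" "x' + t' *\<^sub>R y"] by simp
        finally show ?thesis by (simp add: algebra_simps)
      qed
      then show "(INF t\<in>{0..}. p (x + x' + t *\<^sub>R y) - t * p y) - (p (x + t *\<^sub>R y) - t * p y) \<le> (INF t\<in>{0..}. p (x' + t *\<^sub>R y) - t * p y)"
        unfolding q_def by (intro cINF_greatest) auto
    qed
    have "q (x + x') - q x' \<le> q x"
      using 1 unfolding q_def by (intro cINF_greatest) (auto simp: algebra_simps)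
    then show "q (x + x') \<le> q x + q x'" by simp
  next
    fix s :: real and x assume s: "s > 0"
    have "q (s *\<^sub>R x) / s \<le> p (x + t *\<^sub>R y) - t * p y" if "t \<ge> 0" for t
    proof -
      have "q (s *\<^sub>R x) \<le> p (s *\<^sub>R x + (s * t) *\<^sub>R y) - (s * t) * p y" using le[of "s * t" "s *\<^sub>R x"] s that by simp
      also have "s *\<^sub>R x + (s * t) *\<^sub>R y = s *\<^sub>R (x + t *\<^sub>R y)" by (simp add: algebra_simps)
      also have "p (s *\<^sub>R (x + t *\<^sub>R y)) = s * p (x + t *\<^sub>R y)" using sublinear_scale[OF p] s by simp
      finally show ?thesis using s by (simp add: field_simps)
    qed
    then have "q (s *\<^sub>R x) / s \<le> q x" unfolding q_def by (intro cINF_greatest) auto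
    then show "q (s *\<^sub>R x) \<le> s * q x" using s by (simp add: field_simps)
  qed
qed

lemma exists_minimal_sublinear:
  assumes p0: "sublinear p0"
  shows "\<exists>p. sublinear p \<and> p \<le> p0 \<and> (\<forall>q. sublinear q \<longrightarrow> q \<le> p \<longrightarrow> q = p)"
proof -
  let ?A = "{p. sublinear p \<and> p \<le> p0}"
  let ?P = "\<lambda>p q :: 'a \<Rightarrow> real. q \<le> p"
  have "\<exists>m\<in>?A. \<forall>a\<in>?A. ?P m a \<longrightarrow> a = m"
  proof (rule predicate_Zorn)
    show "partial_order_on ?A (relation_of ?P ?A)"
      by (rule partial_order_on_relation_ofI) auto
    fix C assume C: "C \<in> Chains (relation_of ?P ?A)"
    then have CA: "C \<subseteq> ?A" and tot: "\<And>p q. p \<in> C \<Longrightarrow> q \<in> C \<Longrightarrow> p \<le> q \<or> q \<le> p"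
      unfolding Chains_def relation_of_def by auto
    show "\<exists>u\<in>?A. \<forall>a\<in>C. ?P a u"
    proof (cases "C = {}")
      case True
      then show ?thesis using p0 by auto
    next
      case False
      define u where "u = (\<lambda>x. INF p\<in>C. p x)"
      have bdd: "bdd_below ((\<lambda>p. p x) ` C)" for x
      proof (rule bdd_belowI2)
        fix p assume "p \<in> C"
        then have "sublinear p" "p (- x) \<le> p0 (- x)" using CA by (auto simp: le_fun_def)
        then show "- p0 (- x) \<le> p x" using sublinear_lower[of p x] by simp
      qed
      have le: "u x \<le> p x" if "p \<in> C" for p x
        unfolding u_def using that by (intro cINF_lower bdd)
      have "sublinear u"
        unfolding sublinear_def
      proof (intro conjI allI impI)
        fix x y
        have *: "u (x + y) \<le> p x + p' y" if pp: "p \<in> C" "p' \<in> C" for p p'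
        proof -
          obtain r where r: "r \<in> C" "r \<le> p" "r \<le> p'" using tot[OF pp] pp by blast
          have "u (x + y) \<le> r (x + y)" by (rule le[OF r(1)])
          also have "\<dots> \<le> r x + r y" using CA r(1) by (auto intro: sublinear_add)
          also have "\<dots> \<le> p x + p' y" using r by (auto simp: le_fun_def intro: add_mono)
          finally show ?thesis .
        qed
        have "u (x + y) - p x \<le> u y" if "p \<in> C" for p
          using *[OF that] False unfolding u_def by (intro cINF_greatest) (auto simp: algebra_simps)
        then have "u (x + y) - u y \<le> u x"
          using False unfolding u_def by (intro cINF_greatest) (auto simp: algebra_simps)
        then show "u (x + y) \<le> u x + u y" by simp
      next
        fix s :: real and x assume s: "s > 0"
        have "u (s *\<^sub>R x) / s \<le> p x" if "p \<in> C" for p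
        proof -
          have "u (s *\<^sub>R x) \<le> p (s *\<^sub>R x)" by (rule le[OF that])
          also have "\<dots> = s * p x" using CA that s by (intro sublinear_scale) auto
          finally show ?thesis using s by (simp add: field_simps)
        qed
        then have "u (s *\<^sub>R x) / s \<le> u x" using False unfolding u_def by (intro cINF_greatest) auto
        then show "u (s *\<^sub>R x) \<le> s * u x" using s by (simp add: field_simps)
      qed
      moreover have "u \<le> p0"
      proof -
        obtain p where "p \<in> C" using False by blast
        then show ?thesis using le[of p] CA unfolding le_fun_def by (blast intro: order_trans)
      qed
      ultimately show ?thesis using le by (auto simp: le_fun_def)
    qed
  qed
  then show ?thesis by (auto intro: order_trans)
qed

text \<open>
  Tilting the norm in the direction \<open>x\<close> gives a sublinear functional with value at most \<open>- norm x\<close>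
  at \<open>- x\<close>. A minimal sublinear functional below it is linear by \<open>sublinear_tilt\<close>, is dominated by
  the norm, and is forced to attain \<open>norm x\<close> at \<open>x\<close>.
\<close>

lemma norming_functional:
  fixes x :: "'x::real_normed_vector"
  shows "\<exists>\<phi> :: 'x \<Rightarrow>\<^sub>L real. norm \<phi> \<le> 1 \<and> blinfun_apply \<phi> x = norm x"
proof -
  have n: "sublinear (norm :: 'x \<Rightarrow> real)"
    unfolding sublinear_def by (auto intro: norm_triangle_ineq)
  define p0 where "p0 = (\<lambda>z. INF t\<in>{0..}. norm (z + t *\<^sub>R x) - t * norm x)"
  have p0: "sublinear p0" "\<And>z. p0 z \<le> norm z" "p0 (- x) \<le> norm (- x + 1 *\<^sub>R x) - 1 * norm x"
    unfolding p0_def using sublinear_tilt(1,2)[OF n, where y=x] sublinear_tilt(3)[OF n, where y=x and t=1 and x="- x"] by auto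
  obtain f where f: "sublinear f" "f \<le> p0" and min: "\<And>q. sublinear q \<Longrightarrow> q \<le> f \<Longrightarrow> q = f"
    using exists_minimal_sublinear[OF p0(1)] by blast
  have add: "f (z + y) = f z + f y" for z y
  proof -
    define q where "q = (\<lambda>z. INF t\<in>{0..}. f (z + t *\<^sub>R y) - t * f y)"
    have "sublinear q" "q \<le> f" unfolding q_def le_fun_def using sublinear_tilt(1,2)[OF f(1), where y=y] by auto
    then have "q = f" by (rule min)
    moreover have "q z \<le> f (z + 1 *\<^sub>R y) - 1 * f y"
      unfolding q_def by (rule sublinear_tilt(3)[OF f(1)]) simp
    ultimately show ?thesis using sublinear_add[OF f(1), of z y] by simp
  qed
  have neg: "f (- z) = - f z" for z using add[of z "- z"] sublinear_scale[OF f(1), of 0 0] by simp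
  have scale: "f (c *\<^sub>R z) = c * f z" for c z
  proof (cases "c \<ge> 0")
    case False
    then have "f ((- c) *\<^sub>R z) = - c * f z" by (intro sublinear_scale[OF f(1)]) auto
    then show ?thesis using neg[of "c *\<^sub>R z"] by simp
  qed (rule sublinear_scale[OF f(1)])
  have le: "f z \<le> norm z" for z using f(2) p0(2)[of z] by (auto simp: le_fun_def intro: order_trans)
  have abs: "\<bar>f z\<bar> \<le> norm z" for z using le[of z] le[of "- z"] neg[of z] by simp
  have bl: "bounded_linear f"
    by (rule bounded_linear_intro[where K=1]) (use add scale abs in auto)
  define \<phi> where "\<phi> = Blinfun f"
  have \<phi>: "blinfun_apply \<phi> = f" unfolding \<phi>_def by (rule bounded_linear_Blinfun_apply[OF bl])
  have "norm \<phi> \<le> 1" by (rule norm_blinfun_bound) (use abs \<phi> in auto)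
  moreover have "f x = norm x"
  proof -
    have "f (- x) \<le> p0 (- x)" using f(2) by (simp add: le_fun_def)
    then have "f (- x) \<le> - norm x" using p0(3) by simp
    then show ?thesis using neg[of x] le[of x] by simp
  qed
  ultimately show ?thesis using \<phi> by auto
qed

section \<open>Square integrable maps into a Banach space\<close>

lemma ennreal_power2_le_imp_le:
  fixes x y :: ennreal
  assumes "x^2 \<le> y^2" shows "x \<le> y"
proof (rule ccontr)
  assume "\<not> x \<le> y"
  then have "y < x" by simp
  then obtain r where r: "r \<ge> 0" "y = ennreal r" by (metis ennreal_cases top.not_eq_extremum top.extremum_strict)
  show False
  proof (cases x)
    case (real u)
    with assms \<open>y < x\<close> r have "u\<^sup>2 \<le> r\<^sup>2" by (auto simp: ennreal_power)
    moreover have "r < u" using \<open>y < x\<close> r real by (simp add: ennreal_less_iff)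
    ultimately show False using r(1) power_strict_mono[of r u 2] by simp
  next
    case top
    with assms r show False by (simp add: power2_eq_square top_unique flip: ennreal_mult)
  qed
qed

lemma integral_Cauchy_Schwarz:
  fixes f g :: "'o \<Rightarrow> real"
  assumes f: "integrable M (\<lambda>\<omega>. (f \<omega>)\<^sup>2)" and g: "integrable M (\<lambda>\<omega>. (g \<omega>)\<^sup>2)"
    and [measurable]: "f \<in> borel_measurable M" "g \<in> borel_measurable M"
  shows "integrable M (\<lambda>\<omega>. f \<omega> * g \<omega>)"
    and "(\<integral>\<omega>. f \<omega> * g \<omega> \<partial>M) \<le> sqrt (\<integral>\<omega>. (f \<omega>)\<^sup>2 \<partial>M) * sqrt (\<integral>\<omega>. (g \<omega>)\<^sup>2 \<partial>M)"
proof -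
  have ab: "\<bar>a * b\<bar> \<le> a\<^sup>2 + b\<^sup>2" for a b :: real
  proof -
    have "2 * (\<bar>a\<bar> * \<bar>b\<bar>) \<le> a\<^sup>2 + b\<^sup>2" using sum_squares_bound[of "\<bar>a\<bar>" "\<bar>b\<bar>"] by (simp add: mult.assoc)
    moreover have "0 \<le> a\<^sup>2 + b\<^sup>2" by simp
    ultimately show ?thesis unfolding abs_mult by linarith
  qed
  show fg: "integrable M (\<lambda>\<omega>. f \<omega> * g \<omega>)"
  proof (rule Bochner_Integration.integrable_bound[OF Bochner_Integration.integrable_add[OF f g]])
    show "AE \<omega> in M. norm (f \<omega> * g \<omega>) \<le> norm ((f \<omega>)\<^sup>2 + (g \<omega>)\<^sup>2)"
    proof (rule AE_I2)
      fix \<omega>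
      show "norm (f \<omega> * g \<omega>) \<le> norm ((f \<omega>)\<^sup>2 + (g \<omega>)\<^sup>2)"
        unfolding real_norm_def using ab[of "f \<omega>" "g \<omega>"] by (rule order_trans) (rule abs_ge_self)
    qed
  qed measurable
  define a where "a = sqrt (\<integral>\<omega>. (f \<omega>)\<^sup>2 \<partial>M)"
  define b where "b = sqrt (\<integral>\<omega>. (g \<omega>)\<^sup>2 \<partial>M)"
  have a2: "a \<ge> 0" "(\<integral>\<omega>. (f \<omega>)\<^sup>2 \<partial>M) = a\<^sup>2" and b2: "b \<ge> 0" "(\<integral>\<omega>. (g \<omega>)\<^sup>2 \<partial>M) = b\<^sup>2"
    unfolding a_def b_def by auto
  have "(\<integral>\<omega>. f \<omega> * g \<omega> \<partial>M) \<le> a * b"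
  proof (cases "a = 0 \<or> b = 0")
    case True
    then have "AE \<omega> in M. f \<omega> * g \<omega> = 0"
    proof
      assume "a = 0"
      then have "AE \<omega> in M. (f \<omega>)\<^sup>2 = 0" using integral_nonneg_eq_0_iff_AE[OF f] a2(2) by simp
      then show ?thesis by (rule AE_mp) simp
    next
      assume "b = 0"
      then have "AE \<omega> in M. (g \<omega>)\<^sup>2 = 0" using integral_nonneg_eq_0_iff_AE[OF g] b2(2) by simp
      then show ?thesis by (rule AE_mp) simp
    qed
    then have "(\<integral>\<omega>. f \<omega> * g \<omega> \<partial>M) = (\<integral>\<omega>. 0 \<partial>M)" by (intro integral_cong_AE) simp_all
    then show ?thesis using a2 b2 by simp
  next
    case False
    then have p: "a > 0" "b > 0" using a2 b2 by auto
    have "f \<omega> * g \<omega> \<le> a * b / 2 * ((f \<omega>)\<^sup>2 / a\<^sup>2 + (g \<omega>)\<^sup>2 / b\<^sup>2)" for \<omega>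
    proof -
      have "f \<omega> * g \<omega> = a * b / 2 * (2 * (f \<omega> / a) * (g \<omega> / b))" using p by simp
      also have "\<dots> \<le> a * b / 2 * ((f \<omega> / a)\<^sup>2 + (g \<omega> / b)\<^sup>2)"
        using p by (intro mult_left_mono sum_squares_bound) auto
      finally show ?thesis by (simp add: power_divide)
    qed
    note le = this
    have i1: "integrable M (\<lambda>\<omega>. (f \<omega>)\<^sup>2 / a\<^sup>2)" and i2: "integrable M (\<lambda>\<omega>. (g \<omega>)\<^sup>2 / b\<^sup>2)"
      by (rule integrable_divide_zero, rule f, rule integrable_divide_zero, rule g)
    have "(\<integral>\<omega>. f \<omega> * g \<omega> \<partial>M) \<le> (\<integral>\<omega>. a * b / 2 * ((f \<omega>)\<^sup>2 / a\<^sup>2 + (g \<omega>)\<^sup>2 / b\<^sup>2) \<partial>M)"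
      by (rule integral_mono[OF fg integrable_mult_right[OF Bochner_Integration.integrable_add[OF i1 i2]] le])
    also have "\<dots> = a * b / 2 * ((\<integral>\<omega>. (f \<omega>)\<^sup>2 \<partial>M) / a\<^sup>2 + (\<integral>\<omega>. (g \<omega>)\<^sup>2 \<partial>M) / b\<^sup>2)"
      by (simp only: integral_mult_right_zero Bochner_Integration.integral_add[OF i1 i2] integral_divide_zero)
    also have "\<dots> = a * b" unfolding a2 b2 using p by simp
    finally show ?thesis .
  qed
  then show "(\<integral>\<omega>. f \<omega> * g \<omega> \<partial>M) \<le> sqrt (\<integral>\<omega>. (f \<omega>)\<^sup>2 \<partial>M) * sqrt (\<integral>\<omega>. (g \<omega>)\<^sup>2 \<partial>M)"
    unfolding a_def b_def .
qed

lemma integral_Minkowski: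
  fixes f g :: "'o \<Rightarrow> real"
  assumes f: "integrable M (\<lambda>\<omega>. (f \<omega>)\<^sup>2)" and g: "integrable M (\<lambda>\<omega>. (g \<omega>)\<^sup>2)"
    and [measurable]: "f \<in> borel_measurable M" "g \<in> borel_measurable M"
  shows "integrable M (\<lambda>\<omega>. (f \<omega> + g \<omega>)\<^sup>2)"
    and "sqrt (\<integral>\<omega>. (f \<omega> + g \<omega>)\<^sup>2 \<partial>M) \<le> sqrt (\<integral>\<omega>. (f \<omega>)\<^sup>2 \<partial>M) + sqrt (\<integral>\<omega>. (g \<omega>)\<^sup>2 \<partial>M)"
proof -
  note fg = integral_Cauchy_Schwarz(1)[OF assms]
  show "integrable M (\<lambda>\<omega>. (f \<omega> + g \<omega>)\<^sup>2)"
    unfolding power2_sum mult.assoc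
    by (rule Bochner_Integration.integrable_add[OF Bochner_Integration.integrable_add[OF f g] integrable_mult_right[OF fg]])
  define a where "a = sqrt (\<integral>\<omega>. (f \<omega>)\<^sup>2 \<partial>M)"
  define b where "b = sqrt (\<integral>\<omega>. (g \<omega>)\<^sup>2 \<partial>M)"
  have a2: "a \<ge> 0" "(\<integral>\<omega>. (f \<omega>)\<^sup>2 \<partial>M) = a\<^sup>2" and b2: "b \<ge> 0" "(\<integral>\<omega>. (g \<omega>)\<^sup>2 \<partial>M) = b\<^sup>2"
    unfolding a_def b_def by auto
  have le: "(\<integral>\<omega>. f \<omega> * g \<omega> \<partial>M) \<le> a * b"
    unfolding a_def b_def by (rule integral_Cauchy_Schwarz(2)[OF assms])
  have "(\<integral>\<omega>. (f \<omega> + g \<omega>)\<^sup>2 \<partial>M) = (\<integral>\<omega>. (f \<omega>)\<^sup>2 + (g \<omega>)\<^sup>2 + 2 * (f \<omega> * g \<omega>) \<partial>M)"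
    unfolding power2_sum by (simp only: mult.assoc)
  also have "\<dots> = a\<^sup>2 + b\<^sup>2 + 2 * (\<integral>\<omega>. f \<omega> * g \<omega> \<partial>M)"
    unfolding a2(2)[symmetric] b2(2)[symmetric]
    by (simp only: integral_mult_right_zero Bochner_Integration.integral_add[OF Bochner_Integration.integrable_add[OF f g] integrable_mult_right[OF fg]]
        Bochner_Integration.integral_add[OF f g])
  also have "\<dots> \<le> (a + b)\<^sup>2" unfolding power2_sum using le by simp
  finally have "sqrt (\<integral>\<omega>. (f \<omega> + g \<omega>)\<^sup>2 \<partial>M) \<le> sqrt ((a + b)\<^sup>2)" by (rule real_sqrt_le_mono)
  also have "\<dots> = a + b" using a2(1) b2(1) by simp
  finally show "sqrt (\<integral>\<omega>. (f \<omega> + g \<omega>)\<^sup>2 \<partial>M) \<le> sqrt (\<integral>\<omega>. (f \<omega>)\<^sup>2 \<partial>M) + sqrt (\<integral>\<omega>. (g \<omega>)\<^sup>2 \<partial>M)"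
    unfolding a_def b_def .
qed

lemma strongly_measurableE:
  assumes "strongly_measurable M Y"
  obtains s where "\<And>i. simple_function M (s i)" "\<And>\<omega>. \<omega> \<in> space M \<Longrightarrow> (\<lambda>i. s i \<omega>) \<longlonglongrightarrow> Y \<omega>"
proof -
  from assms obtain s where *: "(\<forall>i. simple_function M (s i)) \<and> (\<forall>\<omega>\<in>space M. (\<lambda>i. s i \<omega>) \<longlonglongrightarrow> Y \<omega>)"
    unfolding strongly_measurable_def by (rule exE)
  show thesis by (rule that[of s]) (use * in simp_all)
qed

lemma strongly_measurableI:
  assumes "\<And>i. simple_function M (s i)" "\<And>\<omega>. \<omega> \<in> space M \<Longrightarrow> (\<lambda>i. s i \<omega>) \<longlonglongrightarrow> Y \<omega>"
  shows "strongly_measurable M Y"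
  unfolding strongly_measurable_def by (rule exI[of _ s]) (simp add: assms)

lemma strongly_measurable_norm:
  fixes Y :: "'o \<Rightarrow> 'x::real_normed_vector"
  assumes "strongly_measurable M Y"
  shows "(\<lambda>\<omega>. norm (Y \<omega>)) \<in> borel_measurable M"
proof -
  obtain s where s: "\<And>i. simple_function M (s i)" "\<And>\<omega>. \<omega> \<in> space M \<Longrightarrow> (\<lambda>i. s i \<omega>) \<longlonglongrightarrow> Y \<omega>"
    by (rule strongly_measurableE[OF assms]) (rule that)
  have "simple_function M (norm \<circ> s i)" for i by (rule simple_function_compose[OF s(1)])
  then have m: "(\<lambda>\<omega>. norm (s i \<omega>)) \<in> borel_measurable M" for i
    using borel_measurable_simple_function[of M "norm \<circ> s i"] by (simp only: o_def)
  have l: "(\<lambda>i. norm (s i \<omega>)) \<longlonglongrightarrow> norm (Y \<omega>)" if "\<omega> \<in> space M" for \<omega>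
    by (intro tendsto_norm s(2) that)
  show ?thesis by (rule borel_measurable_LIMSEQ_real[OF l m])
qed

text \<open>
  All closure properties below come from this one: simple functions approximating the arguments are
  combined pointwise.
\<close>

lemma strongly_measurable_compose2:
  assumes Y: "strongly_measurable M Y" and Z: "strongly_measurable M Z" and c: "\<And>y z. isCont (\<lambda>p. h (fst p) (snd p)) (y, z)"
  shows "strongly_measurable M (\<lambda>\<omega>. h (Y \<omega>) (Z \<omega>))"
proof -
  obtain s where s: "\<And>i. simple_function M (s i)" "\<And>\<omega>. \<omega> \<in> space M \<Longrightarrow> (\<lambda>i. s i \<omega>) \<longlonglongrightarrow> Y \<omega>"
    by (rule strongly_measurableE[OF Y]) (rule that)
  obtain t where t: "\<And>i. simple_function M (t i)" "\<And>\<omega>. \<omega> \<in> space M \<Longrightarrow> (\<lambda>i. t i \<omega>) \<longlonglongrightarrow> Z \<omega>"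
    by (rule strongly_measurableE[OF Z]) (rule that)
  show ?thesis
  proof (rule strongly_measurableI[where s="\<lambda>i \<omega>. h (s i \<omega>) (t i \<omega>)"])
    show "simple_function M (\<lambda>\<omega>. h (s i \<omega>) (t i \<omega>))" for i
      by (rule simple_function_compose2[OF s(1) t(1)])
    show "(\<lambda>i. h (s i \<omega>) (t i \<omega>)) \<longlonglongrightarrow> h (Y \<omega>) (Z \<omega>)" if "\<omega> \<in> space M" for \<omega>
      using isCont_tendsto_compose[OF c tendsto_Pair[OF s(2)[OF that] t(2)[OF that]]] by (simp only: fst_conv snd_conv)
  qed
qed

lemma strongly_measurable_real:
  fixes f :: "'o \<Rightarrow> real"
  shows "strongly_measurable M f \<longleftrightarrow> f \<in> borel_measurable M"
proof
  assume "f \<in> borel_measurable M"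
  from borel_measurable_implies_sequence_metric[OF this, of 0]
  obtain F where F: "\<forall>i. simple_function M (F i)" "\<forall>x\<in>space M. (\<lambda>i. F i x) \<longlonglongrightarrow> f x"
    by (elim exE conjE)
  show "strongly_measurable M f"
    by (rule strongly_measurableI[of _ F]) (use F in simp_all)
next
  assume "strongly_measurable M f"
  then obtain s where s: "\<And>i. simple_function M (s i)" "\<And>\<omega>. \<omega> \<in> space M \<Longrightarrow> (\<lambda>i. s i \<omega>) \<longlonglongrightarrow> f \<omega>"
    by (rule strongly_measurableE) (rule that)
  show "f \<in> borel_measurable M"
    by (rule borel_measurable_LIMSEQ_real[OF s(2) borel_measurable_simple_function[OF s(1)]])
qed

lemma strongly_measurable_const: "strongly_measurable M (\<lambda>_. x)"
  by (rule strongly_measurableI[where s="\<lambda>_ _. x"]) simp_all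

lemma strongly_measurable_scaleR_const:
  fixes x :: "'x::real_normed_vector"
  assumes "f \<in> borel_measurable M"
  shows "strongly_measurable M (\<lambda>\<omega>. f \<omega> *\<^sub>R x)"
proof (rule strongly_measurable_compose2[where h="\<lambda>a b. a *\<^sub>R x", OF _ strongly_measurable_const[of M "0::real"]])
  show "strongly_measurable M f" using assms by (simp add: strongly_measurable_real)
qed (intro continuous_intros)

lemma strongly_measurable_blinfun:
  fixes \<phi> :: "'x::real_normed_vector \<Rightarrow>\<^sub>L real"
  assumes "strongly_measurable M Y"
  shows "(\<lambda>\<omega>. blinfun_apply \<phi> (Y \<omega>)) \<in> borel_measurable M"
  unfolding strongly_measurable_real[symmetric]
  by (rule strongly_measurable_compose2[where h="\<lambda>a b. blinfun_apply \<phi> a", OF assms strongly_measurable_const[of M "0::real"]])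
    (intro continuous_intros)

lemma strongly_measurable_add:
  fixes Y Z :: "'o \<Rightarrow> 'x::real_normed_vector"
  assumes "strongly_measurable M Y" "strongly_measurable M Z"
  shows "strongly_measurable M (\<lambda>\<omega>. Y \<omega> + Z \<omega>)"
  by (rule strongly_measurable_compose2[where h="(+)", OF assms]) (intro continuous_intros)

lemma strongly_measurable_diff:
  fixes Y Z :: "'o \<Rightarrow> 'x::real_normed_vector"
  assumes "strongly_measurable M Y" "strongly_measurable M Z"
  shows "strongly_measurable M (\<lambda>\<omega>. Y \<omega> - Z \<omega>)"
  by (rule strongly_measurable_compose2[where h="(-)", OF assms]) (intro continuous_intros)

lemma strongly_measurable_scaleR:
  fixes Y :: "'o \<Rightarrow> 'x::real_normed_vector"
  assumes "strongly_measurable M Y"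
  shows "strongly_measurable M (\<lambda>\<omega>. c *\<^sub>R Y \<omega>)"
  by (rule strongly_measurable_compose2[where h="\<lambda>a b. c *\<^sub>R a", OF assms strongly_measurable_const[of M "0::real"]])
    (intro continuous_intros)

text \<open>
  The space need not be separable, but the values of a sequence of simple functions converging to
  \<open>Y - Z\<close> form a countable set. Functionals norming these countably many vectors detect whether
  \<open>Y - Z\<close> vanishes.
\<close>

lemma strongly_measurable_AE_eqI:
  fixes Y Z :: "'o \<Rightarrow> 'x::real_normed_vector"
  assumes Y: "strongly_measurable M Y" and Z: "strongly_measurable M Z"
    and eq: "\<And>\<phi> :: 'x \<Rightarrow>\<^sub>L real. AE \<omega> in M. blinfun_apply \<phi> (Y \<omega>) = blinfun_apply \<phi> (Z \<omega>)"
  shows "AE \<omega> in M. Y \<omega> = Z \<omega>"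
proof -
  obtain s where s: "\<And>i. simple_function M (s i)" "\<And>\<omega>. \<omega> \<in> space M \<Longrightarrow> (\<lambda>i. s i \<omega>) \<longlonglongrightarrow> Y \<omega> - Z \<omega>"
    by (rule strongly_measurableE[OF strongly_measurable_diff[OF Y Z]]) (rule that)
  define S where "S = (\<Union>i. s i ` space M)"
  have "countable S" unfolding S_def using simple_functionD(1)[OF s(1)] by (auto intro: countable_finite)
  obtain \<phi> :: "'x \<Rightarrow> ('x \<Rightarrow>\<^sub>L real)" where \<phi>: "\<And>v. norm (\<phi> v) \<le> 1" "\<And>v. blinfun_apply (\<phi> v) v = norm v"
    using norming_functional by metis
  have "AE \<omega> in M. \<forall>v\<in>S. blinfun_apply (\<phi> v) (Y \<omega>) = blinfun_apply (\<phi> v) (Z \<omega>)"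
    using eq by (subst AE_ball_countable[OF \<open>countable S\<close>]) auto
  then show ?thesis
  proof (rule AE_mp, intro AE_I2 impI)
    fix \<omega> assume \<omega>: "\<omega> \<in> space M" and v: "\<forall>v\<in>S. blinfun_apply (\<phi> v) (Y \<omega>) = blinfun_apply (\<phi> v) (Z \<omega>)"
    let ?D = "Y \<omega> - Z \<omega>"
    have le: "norm (s i \<omega>) \<le> norm (s i \<omega> - ?D)" for i
    proof -
      have "s i \<omega> \<in> S" using \<omega> unfolding S_def by blast
      then have "norm (s i \<omega>) = blinfun_apply (\<phi> (s i \<omega>)) (s i \<omega> - ?D)"
        using v by (simp add: blinfun.diff_right \<phi>)
      also have "\<dots> \<le> norm (\<phi> (s i \<omega>)) * norm (s i \<omega> - ?D)"
        using norm_blinfun[of "\<phi> (s i \<omega>)" "s i \<omega> - ?D"] by (simp add: abs_le_iff)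
      also have "\<dots> \<le> 1 * norm (s i \<omega> - ?D)" by (intro mult_right_mono \<phi>) auto
      finally show ?thesis by simp
    qed
    have "(\<lambda>i. norm (s i \<omega> - ?D)) \<longlonglongrightarrow> norm (?D - ?D)"
      by (intro tendsto_intros s(2) \<omega>)
    moreover have "(\<lambda>i. norm (s i \<omega>)) \<longlonglongrightarrow> norm ?D" by (intro tendsto_intros s(2) \<omega>)
    ultimately have "norm ?D \<le> norm (?D - ?D)" using le by (intro LIMSEQ_le) auto
    then show "Y \<omega> = Z \<omega>" by simp
  qed
qed

text \<open>
  Representatives of \<open>L\<^sup>2(\<Omega>;X)\<close>. For real random variables this is \<open>L2\<close>.
\<close>

definition SL2 :: "'o measure \<Rightarrow> ('o \<Rightarrow> 'x::real_normed_vector) set" where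
  "SL2 M = {Y. strongly_measurable M Y \<and> integrable M (\<lambda>\<omega>. (norm (Y \<omega>))\<^sup>2)}"

lemma SL2_real: "SL2 M = L2 M"
  unfolding SL2_def L2_def by (auto simp: strongly_measurable_real)

lemma L2_norm_nonneg [simp]: "L2_norm M Y \<ge> 0"
  unfolding L2_norm_def by simp

lemma L2_norm_power2: "(L2_norm M Y)\<^sup>2 = (\<integral>\<omega>. (norm (Y \<omega>))\<^sup>2 \<partial>M)"
  unfolding L2_norm_def by simp

lemma
  fixes Y Z :: "'o \<Rightarrow> 'x::real_normed_vector"
  assumes Y: "Y \<in> SL2 M" and Z: "Z \<in> SL2 M"
  shows SL2_add: "(\<lambda>\<omega>. Y \<omega> + Z \<omega>) \<in> SL2 M"
    and L2_norm_triangle: "L2_norm M (\<lambda>\<omega>. Y \<omega> + Z \<omega>) \<le> L2_norm M Y + L2_norm M Z"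
proof -
  have sm: "strongly_measurable M (\<lambda>\<omega>. Y \<omega> + Z \<omega>)"
    using Y Z unfolding SL2_def by (auto intro: strongly_measurable_add)
  note mink = integral_Minkowski[of M "\<lambda>\<omega>. norm (Y \<omega>)" "\<lambda>\<omega>. norm (Z \<omega>)"]
  have i: "integrable M (\<lambda>\<omega>. (norm (Y \<omega>) + norm (Z \<omega>))\<^sup>2)"
    using mink(1) Y Z unfolding SL2_def by (auto intro: strongly_measurable_norm)
  have le: "(norm (Y \<omega> + Z \<omega>))\<^sup>2 \<le> (norm (Y \<omega>) + norm (Z \<omega>))\<^sup>2" for \<omega>
    by (intro power_mono norm_triangle_ineq) auto
  have m: "(\<lambda>\<omega>. norm (Y \<omega> + Z \<omega>)) \<in> borel_measurable M" by (rule strongly_measurable_norm[OF sm])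
  have i': "integrable M (\<lambda>\<omega>. (norm (Y \<omega> + Z \<omega>))\<^sup>2)"
    by (rule Bochner_Integration.integrable_bound[OF i]) (use le m in auto)
  then show "(\<lambda>\<omega>. Y \<omega> + Z \<omega>) \<in> SL2 M" using sm unfolding SL2_def by blast
  have "L2_norm M (\<lambda>\<omega>. Y \<omega> + Z \<omega>) \<le> sqrt (\<integral>\<omega>. (norm (Y \<omega>) + norm (Z \<omega>))\<^sup>2 \<partial>M)"
    unfolding L2_norm_def by (intro real_sqrt_le_mono integral_mono i i' le)
  also have "\<dots> \<le> L2_norm M Y + L2_norm M Z"
    unfolding L2_norm_def using mink(2) Y Z unfolding SL2_def by (auto intro: strongly_measurable_norm)
  finally show "L2_norm M (\<lambda>\<omega>. Y \<omega> + Z \<omega>) \<le> L2_norm M Y + L2_norm M Z" .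
qed

lemma SL2_scaleR: "Y \<in> SL2 M \<Longrightarrow> (\<lambda>\<omega>. c *\<^sub>R Y \<omega>) \<in> SL2 M"
  unfolding SL2_def by (auto intro: strongly_measurable_scaleR simp: power_mult_distrib)

lemma L2_norm_scaleR: "L2_norm M (\<lambda>\<omega>. c *\<^sub>R Y \<omega>) = \<bar>c\<bar> * L2_norm M Y"
  unfolding L2_norm_def by (simp add: power_mult_distrib real_sqrt_mult)

lemma L2_norm_minus: "L2_norm M (\<lambda>\<omega>. Y \<omega> - Z \<omega>) = L2_norm M (\<lambda>\<omega>. Z \<omega> - Y \<omega>)"
  unfolding L2_norm_def by (simp add: norm_minus_commute)

lemma SL2_diff: "Y \<in> SL2 M \<Longrightarrow> Z \<in> SL2 M \<Longrightarrow> (\<lambda>\<omega>. Y \<omega> - Z \<omega>) \<in> SL2 M"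
  using SL2_add[of Y M "\<lambda>\<omega>. (-1) *\<^sub>R Z \<omega>"] SL2_scaleR[of Z M "-1"] by simp

lemma SL2_zero: "(\<lambda>_. 0) \<in> SL2 M"
  unfolding SL2_def by (auto intro: strongly_measurable_const)

lemma SL2_sum: "finite A \<Longrightarrow> (\<And>k. k \<in> A \<Longrightarrow> Y k \<in> SL2 M) \<Longrightarrow> (\<lambda>\<omega>. \<Sum>k\<in>A. Y k \<omega>) \<in> SL2 M"
  by (induction A rule: finite_induct) (auto intro: SL2_add SL2_zero)

lemma L2_norm_sum:
  assumes "finite A" "\<And>k. k \<in> A \<Longrightarrow> Y k \<in> SL2 M"
  shows "L2_norm M (\<lambda>\<omega>. \<Sum>k\<in>A. Y k \<omega>) \<le> (\<Sum>k\<in>A. L2_norm M (Y k))"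
  using assms
proof (induction A rule: finite_induct)
  case empty
  show ?case by (simp add: L2_norm_def)
next
  case (insert a A)
  then show ?case using L2_norm_triangle[of "Y a" M "\<lambda>\<omega>. \<Sum>k\<in>A. Y k \<omega>"] SL2_sum[of A Y M] by simp
qed

lemma L2_norm_triangle_diff:
  assumes "X \<in> SL2 M" "Y \<in> SL2 M" "Z \<in> SL2 M"
  shows "L2_norm M (\<lambda>\<omega>. X \<omega> - Z \<omega>) \<le> L2_norm M (\<lambda>\<omega>. X \<omega> - Y \<omega>) + L2_norm M (\<lambda>\<omega>. Y \<omega> - Z \<omega>)"
  using L2_norm_triangle[OF SL2_diff[OF assms(1,2)] SL2_diff[OF assms(2,3)]] by simp

lemma L2_norm_diff_abs:
  assumes "X \<in> SL2 M" "Y \<in> SL2 M"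
  shows "\<bar>L2_norm M X - L2_norm M Y\<bar> \<le> L2_norm M (\<lambda>\<omega>. X \<omega> - Y \<omega>)"
  using L2_norm_triangle[OF SL2_diff[OF assms] assms(2)] L2_norm_triangle[OF SL2_diff[OF assms(2,1)] assms(1)]
    L2_norm_minus[of M X Y] by simp

lemma L2_norm_cong_AE:
  assumes "X \<in> SL2 M" "Y \<in> SL2 M" "AE \<omega> in M. X \<omega> = Y \<omega>"
  shows "L2_norm M X = L2_norm M Y"
  unfolding L2_norm_def using assms
  by (intro arg_cong[where f=sqrt] integral_cong_AE) (auto simp: SL2_def strongly_measurable_norm)

lemma L2_norm_eq_0:
  assumes "Y \<in> SL2 M"
  shows "L2_norm M Y = 0 \<longleftrightarrow> (AE \<omega> in M. Y \<omega> = 0)"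
  using integral_nonneg_eq_0_iff_AE[of M "\<lambda>\<omega>. (norm (Y \<omega>))\<^sup>2"] assms unfolding L2_norm_def SL2_def by auto

lemma SL2_scaleR_const:
  assumes "f \<in> L2 M"
  shows "(\<lambda>\<omega>. f \<omega> *\<^sub>R x) \<in> SL2 M" "L2_norm M (\<lambda>\<omega>. f \<omega> *\<^sub>R x) = L2_norm M f * norm x"
  using assms unfolding SL2_def L2_def L2_norm_def
  by (auto intro: strongly_measurable_scaleR_const simp: power_mult_distrib real_sqrt_mult)

lemma SL2_blinfun:
  fixes \<phi> :: "'x::real_normed_vector \<Rightarrow>\<^sub>L real"
  assumes "Y \<in> SL2 M"
  shows "(\<lambda>\<omega>. blinfun_apply \<phi> (Y \<omega>)) \<in> L2 M"
    and "L2_norm M (\<lambda>\<omega>. blinfun_apply \<phi> (Y \<omega>)) \<le> norm \<phi> * L2_norm M Y"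
proof -
  have le: "(blinfun_apply \<phi> (Y \<omega>))\<^sup>2 \<le> (norm \<phi>)\<^sup>2 * (norm (Y \<omega>))\<^sup>2" for \<omega>
    using power_mono[OF norm_blinfun[of \<phi> "Y \<omega>"], of 2] by (simp add: power_mult_distrib)
  have i: "integrable M (\<lambda>\<omega>. (norm \<phi>)\<^sup>2 * (norm (Y \<omega>))\<^sup>2)" using assms unfolding SL2_def by auto
  have m [measurable]: "(\<lambda>\<omega>. blinfun_apply \<phi> (Y \<omega>)) \<in> borel_measurable M"
    using assms unfolding SL2_def by (auto intro: strongly_measurable_blinfun)
  have i': "integrable M (\<lambda>\<omega>. (blinfun_apply \<phi> (Y \<omega>))\<^sup>2)"
    by (rule Bochner_Integration.integrable_bound[OF i]) (use le in auto)
  then show "(\<lambda>\<omega>. blinfun_apply \<phi> (Y \<omega>)) \<in> L2 M" unfolding L2_def using m by blast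
  have "L2_norm M (\<lambda>\<omega>. blinfun_apply \<phi> (Y \<omega>)) \<le> sqrt (\<integral>\<omega>. (norm \<phi>)\<^sup>2 * (norm (Y \<omega>))\<^sup>2 \<partial>M)"
    unfolding L2_norm_def using le i i' by (intro real_sqrt_le_mono integral_mono) auto
  also have "\<dots> = norm \<phi> * L2_norm M Y" unfolding L2_norm_def by (simp add: real_sqrt_mult)
  finally show "L2_norm M (\<lambda>\<omega>. blinfun_apply \<phi> (Y \<omega>)) \<le> norm \<phi> * L2_norm M Y" .
qed

lemma L2_norm_nn_integral:
  assumes "Y \<in> SL2 M"
  shows "(\<integral>\<^sup>+\<omega>. ennreal (norm (Y \<omega>))^2 \<partial>M) = ennreal ((L2_norm M Y)\<^sup>2)"
  using assms unfolding L2_norm_power2 SL2_def by (simp add: ennreal_power nn_integral_eq_integral)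

text \<open>Fatou's lemma for the squared norms.\<close>

lemma L2_Fatou:
  fixes w :: "nat \<Rightarrow> 'o \<Rightarrow> 'x::real_normed_vector"
  assumes w: "\<And>j. w j \<in> SL2 M" and lim: "AE \<omega> in M. (\<lambda>j. w j \<omega>) \<longlonglongrightarrow> Z \<omega>"
    and Z: "strongly_measurable M Z" and C: "\<And>j. L2_norm M (w j) \<le> C"
  shows "Z \<in> SL2 M" and "L2_norm M Z \<le> C"
proof -
  have C0: "C \<ge> 0" using C[of 0] L2_norm_nonneg[of M "w 0"] by linarith
  have m [measurable]: "(\<lambda>\<omega>. norm (w j \<omega>)) \<in> borel_measurable M" for j
    using w[of j] unfolding SL2_def by (simp add: strongly_measurable_norm)
  have mZ [measurable]: "(\<lambda>\<omega>. norm (Z \<omega>)) \<in> borel_measurable M" by (rule strongly_measurable_norm[OF Z])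
  have "AE \<omega> in M. ennreal (norm (Z \<omega>))^2 \<le> liminf (\<lambda>j. ennreal (norm (w j \<omega>))^2)"
  proof (rule AE_mp[OF lim], rule AE_I2, rule impI)
    fix \<omega> assume l: "(\<lambda>j. w j \<omega>) \<longlonglongrightarrow> Z \<omega>"
    have "(\<lambda>j. ennreal ((norm (w j \<omega>))\<^sup>2)) \<longlonglongrightarrow> ennreal ((norm (Z \<omega>))\<^sup>2)"
      by (intro tendsto_ennrealI tendsto_power tendsto_norm l)
    then have "liminf (\<lambda>j. ennreal ((norm (w j \<omega>))\<^sup>2)) = ennreal ((norm (Z \<omega>))\<^sup>2)"
      by (rule lim_imp_Liminf[rotated]) simp
    then show "ennreal (norm (Z \<omega>))^2 \<le> liminf (\<lambda>j. ennreal (norm (w j \<omega>))^2)"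
      by (simp add: ennreal_power)
  qed
  then have "(\<integral>\<^sup>+\<omega>. ennreal (norm (Z \<omega>))^2 \<partial>M) \<le> (\<integral>\<^sup>+\<omega>. liminf (\<lambda>j. ennreal (norm (w j \<omega>))^2) \<partial>M)"
    by (rule nn_integral_mono_AE)
  also have "\<dots> \<le> liminf (\<lambda>j. \<integral>\<^sup>+\<omega>. ennreal (norm (w j \<omega>))^2 \<partial>M)"
    by (rule nn_integral_liminf) measurable
  also have "\<dots> = liminf (\<lambda>j. ennreal ((L2_norm M (w j))\<^sup>2))" using L2_norm_nn_integral[OF w] by simp
  also have "\<dots> \<le> liminf (\<lambda>j::nat. ennreal (C\<^sup>2))"
    by (intro Liminf_mono eventuallyI ennreal_leI power_mono C) simp
  also have "\<dots> = ennreal (C\<^sup>2)" by (rule Liminf_const) simp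
  finally have le: "(\<integral>\<^sup>+\<omega>. ennreal ((norm (Z \<omega>))\<^sup>2) \<partial>M) \<le> ennreal (C\<^sup>2)" by (simp add: ennreal_power)
  have "integrable M (\<lambda>\<omega>. (norm (Z \<omega>))\<^sup>2)"
  proof (rule integrableI_bounded)
    show "(\<integral>\<^sup>+\<omega>. ennreal (norm ((norm (Z \<omega>))\<^sup>2)) \<partial>M) < \<infinity>"
      using order_le_less_trans[OF le ennreal_less_top] by simp
  qed measurable
  then show Z2: "Z \<in> SL2 M" unfolding SL2_def using Z by simp
  have "ennreal ((L2_norm M Z)\<^sup>2) \<le> ennreal (C\<^sup>2)"
    using le L2_norm_nn_integral[OF Z2] by (simp add: ennreal_power)
  then have "(L2_norm M Z)\<^sup>2 \<le> C\<^sup>2" by simp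
  then show "L2_norm M Z \<le> C" using C0 by (rule power2_le_imp_le)
qed

lemma (in prob_space) nn_integral_norm_le_L2_norm:
  assumes "Y \<in> SL2 M"
  shows "(\<integral>\<^sup>+\<omega>. ennreal (norm (Y \<omega>)) \<partial>M) \<le> ennreal (L2_norm M Y)"
proof -
  have [measurable]: "(\<lambda>\<omega>. norm (Y \<omega>)) \<in> borel_measurable M"
    using assms unfolding SL2_def by (simp add: strongly_measurable_norm)
  have "(\<integral>\<^sup>+\<omega>. ennreal (norm (Y \<omega>)) * 1 \<partial>M)^2 \<le> (\<integral>\<^sup>+\<omega>. ennreal (norm (Y \<omega>))^2 \<partial>M) * (\<integral>\<^sup>+\<omega>. 1^2 \<partial>M)"
    by (rule Cauchy_Schwarz_nn_integral) measurable
  also have "\<dots> = (ennreal (L2_norm M Y))^2"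
    using L2_norm_nn_integral[OF assms] emeasure_space_1 by (simp add: ennreal_power)
  finally have "(\<integral>\<^sup>+\<omega>. ennreal (norm (Y \<omega>)) \<partial>M)^2 \<le> (ennreal (L2_norm M Y))^2" by simp
  then show ?thesis by (rule ennreal_power2_le_imp_le)
qed

text \<open>
  The \<open>L\<^sup>2\<close> norm dominates the \<open>L\<^sup>1\<close> norm on a probability space, so the series of norms has finite
  expectation.
\<close>

lemma (in prob_space) AE_summable_norm:
  assumes f: "\<And>i. f i \<in> SL2 M" and le: "\<And>i. L2_norm M (f i) \<le> c * (1/2)^i"
  shows "AE \<omega> in M. summable (\<lambda>i. norm (f i \<omega>))"
proof -
  have [measurable]: "(\<lambda>\<omega>. norm (f i \<omega>)) \<in> borel_measurable M" for i
    using f[of i] unfolding SL2_def by (simp add: strongly_measurable_norm)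
  have c0: "c \<ge> 0" using order_trans[OF L2_norm_nonneg le[of 0]] by simp
  have "(\<integral>\<^sup>+\<omega>. (\<Sum>i. ennreal (norm (f i \<omega>))) \<partial>M) = (\<Sum>i. \<integral>\<^sup>+\<omega>. ennreal (norm (f i \<omega>)) \<partial>M)"
    by (rule nn_integral_suminf) measurable
  also have "\<dots> \<le> (\<Sum>i. ennreal (c * (1/2)^i))"
    by (intro suminf_le order_trans[OF nn_integral_norm_le_L2_norm[OF f]] ennreal_leI le summableI)
  also have "\<dots> = ennreal (\<Sum>i. c * (1/2)^i)"
    using c0 by (intro suminf_ennreal2 summable_mult summable_geometric) auto
  also have "\<dots> < \<infinity>" by simp
  finally have "(\<integral>\<^sup>+\<omega>. (\<Sum>i. ennreal (norm (f i \<omega>))) \<partial>M) \<noteq> \<infinity>" by simp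
  then have "AE \<omega> in M. (\<Sum>i. ennreal (norm (f i \<omega>))) \<noteq> \<infinity>"
    by (rule nn_integral_PInf_AE[rotated]) measurable
  then show ?thesis
    by (rule AE_mp) (intro AE_I2 impI summable_suminf_not_top, simp_all)
qed

lemma subsequence_choice:
  assumes "\<And>i::nat. \<exists>N::nat. \<forall>j\<ge>N. P i j"
  obtains r where "strict_mono r" "\<And>i j. j \<ge> r i \<Longrightarrow> P i j"
proof -
  obtain N where N: "\<And>i j. j \<ge> N i \<Longrightarrow> P i j" using assms by metis
  define r where "r = (\<lambda>i. \<Sum>k\<le>i. Suc (N k))"
  have "strict_mono r" unfolding strict_mono_Suc_iff r_def by simp
  moreover have "P i j" if "j \<ge> r i" for i j
  proof (rule N)
    have "Suc (N i) \<le> r i" unfolding r_def by (rule member_le_sum) auto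
    then show "N i \<le> j" using that by simp
  qed
  ultimately show thesis by (rule that)
qed

lemma (in prob_space) AE_convergent_subsequence:
  fixes Z :: "'a \<Rightarrow> 'x::real_normed_vector"
  assumes Y: "\<And>i. Y i \<in> SL2 M" and Z: "Z \<in> SL2 M" and lim: "(\<lambda>i. L2_norm M (\<lambda>\<omega>. Y i \<omega> - Z \<omega>)) \<longlonglongrightarrow> 0"
  obtains r where "strict_mono r" "AE \<omega> in M. (\<lambda>i. Y (r i) \<omega>) \<longlonglongrightarrow> Z \<omega>"
proof -
  have "\<exists>N. \<forall>j\<ge>N. L2_norm M (\<lambda>\<omega>. Y j \<omega> - Z \<omega>) < (1/2)^i" for i :: nat
    using order_tendstoD(2)[OF lim, of "(1/2)^i"] by (simp add: eventually_sequentially)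
  then obtain r where r: "strict_mono r" "\<And>i j. j \<ge> r i \<Longrightarrow> L2_norm M (\<lambda>\<omega>. Y j \<omega> - Z \<omega>) < (1/2)^i"
    by (rule subsequence_choice[where P="\<lambda>i j. L2_norm M (\<lambda>\<omega>. Y j \<omega> - Z \<omega>) < (1/2)^i"]) (rule that)
  have "AE \<omega> in M. summable (\<lambda>i. norm (Y (r i) \<omega> - Z \<omega>))"
    by (rule AE_summable_norm[where c=1]) (use r(2)[OF order_refl] in \<open>simp_all add: SL2_diff Y Z less_imp_le\<close>)
  then have "AE \<omega> in M. (\<lambda>i. Y (r i) \<omega>) \<longlonglongrightarrow> Z \<omega>"
  proof (rule AE_mp, intro AE_I2 impI)
    fix \<omega> assume "summable (\<lambda>i. norm (Y (r i) \<omega> - Z \<omega>))"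
    then have "(\<lambda>i. norm (Y (r i) \<omega> - Z \<omega>)) \<longlonglongrightarrow> 0" by (rule summable_LIMSEQ_zero)
    then show "(\<lambda>i. Y (r i) \<omega>) \<longlonglongrightarrow> Z \<omega>" by (simp add: tendsto_norm_zero_iff LIM_zero_iff)
  qed
  then show thesis by (rule that[OF r(1)])
qed

text \<open>
  The simple functions that converge pointwise are cut off where they exceed \<open>2 norm (Y \<omega>)\<close>. This
  keeps the pointwise limit and makes dominated convergence applicable.
\<close>

lemma SL2_simple_approx:
  fixes Y :: "'o \<Rightarrow> 'x::real_normed_vector"
  assumes Y: "Y \<in> SL2 M" and e: "e > 0"
  shows "\<exists>u. simple_function M u \<and> u \<in> SL2 M \<and> L2_norm M (\<lambda>\<omega>. Y \<omega> - u \<omega>) < e"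
proof -
  have sY: "strongly_measurable M Y" and iY: "integrable M (\<lambda>\<omega>. (norm (Y \<omega>))\<^sup>2)" using Y unfolding SL2_def by auto
  obtain s where s: "\<And>i. simple_function M (s i)" "\<And>\<omega>. \<omega> \<in> space M \<Longrightarrow> (\<lambda>i. s i \<omega>) \<longlonglongrightarrow> Y \<omega>"
    by (rule strongly_measurableE[OF sY]) (rule that)
  have ssm: "strongly_measurable M f" if "simple_function M f" for f :: "'o \<Rightarrow> 'x"
    by (rule strongly_measurableI[where s="\<lambda>_. f"]) (simp_all add: that)
  \<comment> \<open>the cut-off at twice the norm is inactive in the limit unless \<open>Y \<omega> = 0\<close>, where it forces the value \<open>0\<close>\<close>
  define u where "u = (\<lambda>i \<omega>. if norm (s i \<omega>) \<le> 2 * norm (Y \<omega>) then s i \<omega> else 0)"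
  have [measurable]: "(\<lambda>\<omega>. norm (Y \<omega>)) \<in> borel_measurable M" "(\<lambda>\<omega>. norm (s i \<omega>)) \<in> borel_measurable M" for i
    using strongly_measurable_norm[OF sY] strongly_measurable_norm[OF ssm[OF s(1)]] by auto
  have us: "simple_function M (u i)" for i
    unfolding u_def by (intro simple_function_If s(1)) auto
  have ule: "norm (u i \<omega>) \<le> 2 * norm (Y \<omega>)" for i \<omega> unfolding u_def by simp
  have umeas [measurable]: "(\<lambda>\<omega>. norm (u i \<omega>)) \<in> borel_measurable M" for i
    by (rule strongly_measurable_norm[OF ssm[OF us]])
  have u2: "u i \<in> SL2 M" for i
  proof -
    have "integrable M (\<lambda>\<omega>. (norm (u i \<omega>))\<^sup>2)"
    proof (rule Bochner_Integration.integrable_bound[OF integrable_mult_right[OF iY, of 4]])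
      have "(norm (u i \<omega>))\<^sup>2 \<le> 4 * (norm (Y \<omega>))\<^sup>2" for \<omega>
        using power_mono[OF ule[of i \<omega>], of 2] by (simp add: power_mult_distrib)
      then show "AE \<omega> in M. norm ((norm (u i \<omega>))\<^sup>2) \<le> norm (4 * (norm (Y \<omega>))\<^sup>2)" by simp
    qed measurable
    then show ?thesis unfolding SL2_def using ssm[OF us] by simp
  qed
  have ulim: "(\<lambda>i. u i \<omega>) \<longlonglongrightarrow> Y \<omega>" if \<omega>: "\<omega> \<in> space M" for \<omega>
  proof (cases "Y \<omega> = 0")
    case True
    then have "u i \<omega> = 0" for i using ule[of i \<omega>] by simp
    then show ?thesis using True by simp
  next
    case False
    have "(\<lambda>i. norm (s i \<omega>)) \<longlonglongrightarrow> norm (Y \<omega>)" by (intro tendsto_norm s(2) \<omega>)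
    moreover have "norm (Y \<omega>) < 2 * norm (Y \<omega>)" using False by simp
    ultimately have "eventually (\<lambda>i. norm (s i \<omega>) < 2 * norm (Y \<omega>)) sequentially" by (rule order_tendstoD(2))
    then have "eventually (\<lambda>i. s i \<omega> = u i \<omega>) sequentially" by (rule eventually_mono) (simp add: u_def)
    from Lim_transform_eventually[OF s(2)[OF \<omega>] this] show ?thesis .
  qed
  have "(\<lambda>i. \<integral>\<omega>. (norm (Y \<omega> - u i \<omega>))\<^sup>2 \<partial>M) \<longlonglongrightarrow> (\<integral>\<omega>. 0 \<partial>M)"
  proof (rule integral_dominated_convergence[where w="\<lambda>\<omega>. 9 * (norm (Y \<omega>))\<^sup>2"])
    show "(\<lambda>\<omega>. (norm (Y \<omega> - u i \<omega>))\<^sup>2) \<in> borel_measurable M" for i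
      using SL2_diff[OF Y u2[of i]] unfolding SL2_def by (simp add: borel_measurable_integrable)
    show "integrable M (\<lambda>\<omega>. 9 * (norm (Y \<omega>))\<^sup>2)" using iY by simp
    show "AE \<omega> in M. (\<lambda>i. (norm (Y \<omega> - u i \<omega>))\<^sup>2) \<longlonglongrightarrow> 0"
    proof (rule AE_I2)
      fix \<omega> assume \<omega>: "\<omega> \<in> space M"
      have "(\<lambda>i. (norm (Y \<omega> - u i \<omega>))\<^sup>2) \<longlonglongrightarrow> (norm (Y \<omega> - Y \<omega>))\<^sup>2" by (intro tendsto_intros ulim \<omega>)
      then show "(\<lambda>i. (norm (Y \<omega> - u i \<omega>))\<^sup>2) \<longlonglongrightarrow> 0" by simp
    qed
    show "AE \<omega> in M. norm ((norm (Y \<omega> - u i \<omega>))\<^sup>2) \<le> 9 * (norm (Y \<omega>))\<^sup>2" for i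
    proof (rule AE_I2)
      fix \<omega>
      have "norm (Y \<omega> - u i \<omega>) \<le> 3 * norm (Y \<omega>)"
        using norm_triangle_ineq4[of "Y \<omega>" "u i \<omega>"] ule[of i \<omega>] by simp
      then show "norm ((norm (Y \<omega> - u i \<omega>))\<^sup>2) \<le> 9 * (norm (Y \<omega>))\<^sup>2"
        using power_mono[of "norm (Y \<omega> - u i \<omega>)" "3 * norm (Y \<omega>)" 2] by (simp add: power_mult_distrib)
    qed
  qed simp
  then have "(\<lambda>i. L2_norm M (\<lambda>\<omega>. Y \<omega> - u i \<omega>)) \<longlonglongrightarrow> sqrt 0"
    unfolding L2_norm_def by (intro tendsto_real_sqrt) simp
  then have "eventually (\<lambda>i. L2_norm M (\<lambda>\<omega>. Y \<omega> - u i \<omega>) < e) sequentially"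
    using e by (intro order_tendstoD(2)) auto
  then obtain i where "L2_norm M (\<lambda>\<omega>. Y \<omega> - u i \<omega>) < e" by (auto simp: eventually_sequentially)
  then show ?thesis using us u2 by blast
qed

text \<open>
  A subsequence with geometrically decreasing differences converges almost surely, as in the
  Riesz--Fischer theorem. The members of the subsequence are first replaced by nearby simple
  functions, so that the limit is strongly measurable by definition.
\<close>

lemma (in prob_space) SL2_complete:
  fixes Y :: "nat \<Rightarrow> 'a \<Rightarrow> 'x::banach"
  assumes Y: "\<And>i. Y i \<in> SL2 M"
    and cauchy: "\<And>e. e > 0 \<Longrightarrow> \<exists>N. \<forall>i\<ge>N. \<forall>j\<ge>N. L2_norm M (\<lambda>\<omega>. Y i \<omega> - Y j \<omega>) < e"
  obtains Z where "Z \<in> SL2 M" "(\<lambda>i. L2_norm M (\<lambda>\<omega>. Y i \<omega> - Z \<omega>)) \<longlonglongrightarrow> 0"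
proof -
  have "\<exists>N. \<forall>j\<ge>N. \<forall>k\<ge>j. L2_norm M (\<lambda>\<omega>. Y j \<omega> - Y k \<omega>) < (1/2)^i" for i :: nat
  proof -
    obtain N where N: "\<forall>j\<ge>N. \<forall>k\<ge>N. L2_norm M (\<lambda>\<omega>. Y j \<omega> - Y k \<omega>) < (1/2)^i" using cauchy[of "(1/2)^i"] by auto
    show ?thesis by (rule exI[of _ N]) (use N in \<open>auto dest: order_trans\<close>)
  qed
  then obtain r where r: "strict_mono r" "\<And>i j. j \<ge> r i \<Longrightarrow> \<forall>k\<ge>j. L2_norm M (\<lambda>\<omega>. Y j \<omega> - Y k \<omega>) < (1/2)^i"
    by (rule subsequence_choice[where P="\<lambda>i j. \<forall>k\<ge>j. L2_norm M (\<lambda>\<omega>. Y j \<omega> - Y k \<omega>) < (1/2)^i"]) (rule that)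
  have "\<exists>u. simple_function M u \<and> u \<in> SL2 M \<and> L2_norm M (\<lambda>\<omega>. Y (r i) \<omega> - u \<omega>) < (1/2)^i" for i
    by (rule SL2_simple_approx[OF Y]) simp
  then obtain w where ws: "\<And>i. simple_function M (w i)" and w2: "\<And>i. w i \<in> SL2 M"
    and wY: "\<And>i. L2_norm M (\<lambda>\<omega>. Y (r i) \<omega> - w i \<omega>) < (1/2)^i" by metis
  have step: "L2_norm M (\<lambda>\<omega>. w i \<omega> - w (Suc i) \<omega>) \<le> 3 * (1/2)^i" for i
  proof -
    have "r i \<le> r (Suc i)" using r(1) by (simp add: strict_mono_less_eq)
    then have 1: "L2_norm M (\<lambda>\<omega>. Y (r i) \<omega> - Y (r (Suc i)) \<omega>) < (1/2)^i" using r(2)[of i "r i"] by simp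
    have "L2_norm M (\<lambda>\<omega>. w i \<omega> - w (Suc i) \<omega>)
       \<le> L2_norm M (\<lambda>\<omega>. w i \<omega> - Y (r i) \<omega>) + L2_norm M (\<lambda>\<omega>. Y (r i) \<omega> - w (Suc i) \<omega>)"
      by (rule L2_norm_triangle_diff[OF w2 Y w2])
    also have "\<dots> \<le> L2_norm M (\<lambda>\<omega>. w i \<omega> - Y (r i) \<omega>) + (L2_norm M (\<lambda>\<omega>. Y (r i) \<omega> - Y (r (Suc i)) \<omega>)
        + L2_norm M (\<lambda>\<omega>. Y (r (Suc i)) \<omega> - w (Suc i) \<omega>))"
      by (intro add_left_mono L2_norm_triangle_diff[OF Y Y w2])
    also have "\<dots> \<le> (1/2)^i + ((1/2)^i + (1/2)^Suc i)"
      using 1 wY[of i] wY[of "Suc i"] L2_norm_minus[of M "w i" "Y (r i)"] by (intro add_mono) auto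
    also have "\<dots> \<le> 3 * (1/2)^i" by simp
    finally show ?thesis .
  qed
  \<comment> \<open>the subtracted term is what makes the telescoping induction close\<close>
  have tail: "L2_norm M (\<lambda>\<omega>. w i \<omega> - w (i + k) \<omega>) \<le> 6 * (1/2)^i - 6 * (1/2)^(i + k)" for i k
  proof (induction k)
    case 0
    show ?case by (simp add: L2_norm_def)
  next
    case (Suc k)
    have "L2_norm M (\<lambda>\<omega>. w i \<omega> - w (i + Suc k) \<omega>)
        \<le> L2_norm M (\<lambda>\<omega>. w i \<omega> - w (i + k) \<omega>) + L2_norm M (\<lambda>\<omega>. w (i + k) \<omega> - w (i + Suc k) \<omega>)"
      by (rule L2_norm_triangle_diff[OF w2 w2 w2])
    then show ?case using Suc.IH step[of "i + k"] by simp
  qed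
  have "AE \<omega> in M. summable (\<lambda>i. norm (w i \<omega> - w (Suc i) \<omega>))"
    by (rule AE_summable_norm[where c=3]) (use step in \<open>simp_all add: SL2_diff w2\<close>)
  then obtain N where N: "N \<in> null_sets M" "\<And>\<omega>. \<omega> \<in> space M - N \<Longrightarrow> summable (\<lambda>i. norm (w i \<omega> - w (Suc i) \<omega>))"
    by (auto elim!: AE_E3)
  have conv: "convergent (\<lambda>i. w i \<omega>)" if "\<omega> \<in> space M - N" for \<omega>
  proof -
    have "summable (\<lambda>i. w i \<omega> - w (Suc i) \<omega>)" by (rule summable_norm_cancel[OF N(2)[OF that]])
    then have "convergent (\<lambda>n. \<Sum>i<n. w i \<omega> - w (Suc i) \<omega>)" by (simp add: summable_iff_convergent)
    then have "convergent (\<lambda>n. w 0 \<omega> - (\<Sum>i<n. w i \<omega> - w (Suc i) \<omega>))"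
      by (intro convergent_diff convergent_const)
    moreover have "w 0 \<omega> - (\<Sum>i<n. w i \<omega> - w (Suc i) \<omega>) = w n \<omega>" for n
      by (simp add: sum_lessThan_telescope'[of "\<lambda>i. w i \<omega>"])
    ultimately show ?thesis by simp
  qed
  \<comment> \<open>redefined on the exceptional null set, so that the approximating simple functions converge everywhere\<close>
  define Z where "Z = (\<lambda>\<omega>. if \<omega> \<in> N then 0 else lim (\<lambda>i. w i \<omega>))"
  have sZ: "strongly_measurable M Z"
  proof (rule strongly_measurableI[where s="\<lambda>i \<omega>. if \<omega> \<in> N then 0 else w i \<omega>"])
    have "{\<omega> \<in> space M. \<omega> \<in> N} \<in> sets M" using N(1) by (auto dest: null_setsD2)
    then show "simple_function M (\<lambda>\<omega>. if \<omega> \<in> N then 0 else w i \<omega>)" for i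
      by (intro simple_function_If ws) auto
    show "(\<lambda>i. if \<omega> \<in> N then 0 else w i \<omega>) \<longlonglongrightarrow> Z \<omega>" if "\<omega> \<in> space M" for \<omega>
      using conv[of \<omega>] that unfolding Z_def by (cases "\<omega> \<in> N") (simp_all add: convergent_LIMSEQ_iff)
  qed
  have limZ: "AE \<omega> in M. (\<lambda>i. w i \<omega>) \<longlonglongrightarrow> Z \<omega>"
  proof (rule AE_I'[OF N(1)], rule subsetI)
    fix \<omega> assume "\<omega> \<in> {\<omega> \<in> space M. \<not> (\<lambda>i. w i \<omega>) \<longlonglongrightarrow> Z \<omega>}"
    then show "\<omega> \<in> N" using conv[of \<omega>] unfolding Z_def by (cases "\<omega> \<in> N") (simp_all add: convergent_LIMSEQ_iff)
  qed
  have wZ: "(\<lambda>\<omega>. w i \<omega> - Z \<omega>) \<in> SL2 M" "L2_norm M (\<lambda>\<omega>. w i \<omega> - Z \<omega>) \<le> 6 * (1/2)^i" for i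
  proof -
    have sm: "strongly_measurable M (\<lambda>\<omega>. w i \<omega> - Z \<omega>)"
      using w2[of i] sZ unfolding SL2_def by (intro strongly_measurable_diff) auto
    have l: "AE \<omega> in M. (\<lambda>k. w i \<omega> - w (i + k) \<omega>) \<longlonglongrightarrow> w i \<omega> - Z \<omega>"
    proof (rule AE_mp[OF limZ], intro AE_I2 impI)
      fix \<omega> assume "(\<lambda>k. w k \<omega>) \<longlonglongrightarrow> Z \<omega>"
      then have "(\<lambda>k. w (k + i) \<omega>) \<longlonglongrightarrow> Z \<omega>" by (rule LIMSEQ_ignore_initial_segment)
      then have "(\<lambda>k. w (i + k) \<omega>) \<longlonglongrightarrow> Z \<omega>" by (simp only: add.commute)
      then show "(\<lambda>k. w i \<omega> - w (i + k) \<omega>) \<longlonglongrightarrow> w i \<omega> - Z \<omega>" by (intro tendsto_diff tendsto_const)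
    qed
    have b: "L2_norm M (\<lambda>\<omega>. w i \<omega> - w (i + k) \<omega>) \<le> 6 * (1/2)^i" for k
      by (rule order_trans[OF tail]) simp
    note F = L2_Fatou[where w="\<lambda>k \<omega>. w i \<omega> - w (i + k) \<omega>", OF SL2_diff[OF w2 w2] l sm b]
    show "(\<lambda>\<omega>. w i \<omega> - Z \<omega>) \<in> SL2 M" "L2_norm M (\<lambda>\<omega>. w i \<omega> - Z \<omega>) \<le> 6 * (1/2)^i"
      by (rule F)+
  qed
  have Z2: "Z \<in> SL2 M" using SL2_diff[OF w2[of 0] wZ(1)[of 0]] by simp
  have "(\<lambda>i. L2_norm M (\<lambda>\<omega>. Y i \<omega> - Z \<omega>)) \<longlonglongrightarrow> 0"
  proof (rule LIMSEQ_I)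
    fix e :: real assume e: "e > 0"
    obtain m where m: "(1/2)^m < e / 8" using real_arch_pow_inv[of "e / 8" "1/2"] e by auto
    show "\<exists>no. \<forall>i\<ge>no. norm (L2_norm M (\<lambda>\<omega>. Y i \<omega> - Z \<omega>) - 0) < e"
    proof (intro exI[of _ "r m"] allI impI)
      fix i assume i: "r m \<le> i"
      have "L2_norm M (\<lambda>\<omega>. Y i \<omega> - Z \<omega>) \<le> L2_norm M (\<lambda>\<omega>. Y i \<omega> - Y (r m) \<omega>) + L2_norm M (\<lambda>\<omega>. Y (r m) \<omega> - Z \<omega>)"
        by (rule L2_norm_triangle_diff[OF Y Y Z2])
      also have "\<dots> \<le> L2_norm M (\<lambda>\<omega>. Y i \<omega> - Y (r m) \<omega>) + (L2_norm M (\<lambda>\<omega>. Y (r m) \<omega> - w m \<omega>) + L2_norm M (\<lambda>\<omega>. w m \<omega> - Z \<omega>))"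
        by (intro add_left_mono L2_norm_triangle_diff[OF Y w2 Z2])
      also have "\<dots> \<le> (1/2)^m + ((1/2)^m + 6 * (1/2)^m)"
        using r(2)[of m "r m"] i wY[of m] wZ(2)[of m] L2_norm_minus[of M "Y i" "Y (r m)"] by (intro add_mono) auto
      also have "\<dots> < e" using m by simp
      finally show "norm (L2_norm M (\<lambda>\<omega>. Y i \<omega> - Z \<omega>) - 0) < e" by simp
    qed
  qed
  then show thesis by (rule that[OF Z2])
qed

section \<open>Hypercontractivity of the Mehler operators\<close>

text \<open>
  The transition kernel of the Mehler operator is reversible for the standard Gaussian measure;
  this is why the measure is invariant (\<open>nn_integral_mehler_invariant\<close>).
\<close>

lemma normal_density_reversible:
  fixes \<rho> \<sigma> x z :: real
  assumes "\<sigma> > 0" "\<sigma>\<^sup>2 = 1 - \<rho>\<^sup>2"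
  shows "normal_density (\<rho> * x) \<sigma> z * std_normal_density x = normal_density (\<rho> * z) \<sigma> x * std_normal_density z"
proof -
  have "- (z - \<rho> * x)\<^sup>2 / (2 * \<sigma>\<^sup>2) + - x\<^sup>2 / 2 = - (x - \<rho> * z)\<^sup>2 / (2 * \<sigma>\<^sup>2) + - z\<^sup>2 / 2"
  proof -
    have "\<sigma>\<^sup>2 \<noteq> 0" using assms(1) by simp
    have "(- (z - \<rho> * x)\<^sup>2 / (2 * \<sigma>\<^sup>2) + - x\<^sup>2 / 2) * (2 * \<sigma>\<^sup>2) = - (z - \<rho> * x)\<^sup>2 - x\<^sup>2 * \<sigma>\<^sup>2"
      using \<open>\<sigma>\<^sup>2 \<noteq> 0\<close> by (simp add: field_simps)
    also have "\<dots> = - (x - \<rho> * z)\<^sup>2 - z\<^sup>2 * \<sigma>\<^sup>2"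
      unfolding assms(2) by (simp add: power2_eq_square algebra_simps)
    also have "\<dots> = (- (x - \<rho> * z)\<^sup>2 / (2 * \<sigma>\<^sup>2) + - z\<^sup>2 / 2) * (2 * \<sigma>\<^sup>2)"
      using \<open>\<sigma>\<^sup>2 \<noteq> 0\<close> by (simp add: field_simps)
    finally show ?thesis using \<open>\<sigma>\<^sup>2 \<noteq> 0\<close> by simp
  qed
  then show ?thesis
    unfolding normal_density_def std_normal_density_def
    by (simp add: mult.commute mult.left_commute flip: exp_add)
qed

lemma nn_integral_affine_normal:
  fixes f :: "real \<Rightarrow> ennreal"
  assumes "\<sigma> \<noteq> 0" and [measurable]: "f \<in> borel_measurable borel"
  shows "(\<integral>\<^sup>+y. f (m + \<sigma> * y) \<partial>std_normal_distribution) = (\<integral>\<^sup>+z. f z * ennreal (normal_density m \<bar>\<sigma>\<bar> z) \<partial>lborel)"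
proof -
  have "(\<integral>\<^sup>+z. f z * ennreal (normal_density m \<bar>\<sigma>\<bar> z) \<partial>lborel)
     = ennreal \<bar>\<sigma>\<bar> * (\<integral>\<^sup>+y. f (m + \<sigma> * y) * ennreal (normal_density m \<bar>\<sigma>\<bar> (m + \<sigma> * y)) \<partial>lborel)"
    by (rule nn_integral_real_affine[OF _ assms(1)]) measurable
  also have "\<dots> = (\<integral>\<^sup>+y. ennreal \<bar>\<sigma>\<bar> * (f (m + \<sigma> * y) * ennreal (normal_density m \<bar>\<sigma>\<bar> (m + \<sigma> * y))) \<partial>lborel)"
    by (rule nn_integral_cmult[symmetric]) measurable
  also have "\<dots> = (\<integral>\<^sup>+y. ennreal (std_normal_density y) * f (m + \<sigma> * y) \<partial>lborel)"
  proof (rule nn_integral_cong)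
    fix y
    have "\<bar>\<sigma>\<bar> * normal_density m \<bar>\<sigma>\<bar> (m + \<sigma> * y) = std_normal_density y"
      using assms(1) unfolding normal_density_def std_normal_density_def
      by (simp add: power_mult_distrib real_sqrt_mult)
    then have "ennreal \<bar>\<sigma>\<bar> * ennreal (normal_density m \<bar>\<sigma>\<bar> (m + \<sigma> * y)) = ennreal (std_normal_density y)"
      by (simp flip: ennreal_mult'')
    then show "ennreal \<bar>\<sigma>\<bar> * (f (m + \<sigma> * y) * ennreal (normal_density m \<bar>\<sigma>\<bar> (m + \<sigma> * y)))
       = ennreal (std_normal_density y) * f (m + \<sigma> * y)"
      by (metis mult.commute mult.left_commute)
  qed
  also have "\<dots> = (\<integral>\<^sup>+y. f (m + \<sigma> * y) \<partial>std_normal_distribution)"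
    by (subst nn_integral_density) auto
  finally show ?thesis by simp
qed

text \<open>
  Completing the square in \<open>z\<close>: the quotient is a Gaussian density in \<open>z\<close> up to a factor depending
  on \<open>x\<close>, so its integral over \<open>z\<close> can be read off.
\<close>

lemma normal_density_square_ratio:
  fixes \<rho> \<sigma> x z :: real
  assumes "\<sigma> > 0" "\<sigma>\<^sup>2 = 1 - \<rho>\<^sup>2"
  shows "(normal_density (\<rho> * x) \<sigma> z)\<^sup>2 / std_normal_density z
    = 1 / sqrt (1 - \<rho>^4) * exp (\<rho>\<^sup>2 / (1 + \<rho>\<^sup>2) * x\<^sup>2) * normal_density (2 * \<rho> * x / (1 + \<rho>\<^sup>2)) (\<sigma> / sqrt (1 + \<rho>\<^sup>2)) z"
proof -
  define s where "s = 1 + \<rho>\<^sup>2"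
  have s: "s > 0" "s = 2 - \<sigma>\<^sup>2" unfolding s_def by (simp add: add_pos_nonneg, simp add: assms)
  have sq: "(\<sigma> / sqrt s)\<^sup>2 = \<sigma>\<^sup>2 / s" using s by (simp add: power_divide)
  have p4: "1 - \<rho>^4 = \<sigma>\<^sup>2 * s" unfolding s_def assms(2) by (simp add: power2_eq_square power4_eq_xxxx algebra_simps)
  have e: "2 * (- (z - \<rho> * x)\<^sup>2 / (2 * \<sigma>\<^sup>2)) - (- z\<^sup>2 / 2)
      = \<rho>\<^sup>2 / s * x\<^sup>2 + - (z - 2 * \<rho> * x / s)\<^sup>2 / (2 * (\<sigma>\<^sup>2 / s))" (is "?L = ?R")
  proof -
    have nz: "\<sigma>\<^sup>2 \<noteq> 0" "s \<noteq> 0" using assms s by auto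
    have "?L * (2 * \<sigma>\<^sup>2 * s) = (- 2 * (z - \<rho> * x)\<^sup>2 + z\<^sup>2 * \<sigma>\<^sup>2) * s"
      using nz by (simp add: field_simps)
    also have "\<dots> = 2 * \<rho>\<^sup>2 * \<sigma>\<^sup>2 * x\<^sup>2 - (z * s - 2 * \<rho> * x)\<^sup>2"
      unfolding s_def assms(2) by (simp add: power2_eq_square algebra_simps)
    also have "\<dots> = ?R * (2 * \<sigma>\<^sup>2 * s)"
    proof -
      have "(z * s - 2 * \<rho> * x) = s * (z - 2 * \<rho> * x / s)" using nz by (simp add: field_simps)
      then have "(z * s - 2 * \<rho> * x)\<^sup>2 = s\<^sup>2 * (z - 2 * \<rho> * x / s)\<^sup>2" by (simp add: power_mult_distrib)
      then show ?thesis using nz by (simp add: field_simps power2_eq_square)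
    qed
    finally show ?thesis using nz by simp
  qed
  have c: "(1 / sqrt (2 * pi * \<sigma>\<^sup>2))\<^sup>2 / (1 / sqrt (2 * pi)) = 1 / sqrt (\<sigma>\<^sup>2 * s) * (1 / sqrt (2 * pi * (\<sigma>\<^sup>2 / s)))"
    (is "?A = ?B")
  proof -
    have "?A = sqrt (2 * pi) / (2 * pi * \<sigma>\<^sup>2)" by (simp add: power_divide)
    also have "\<dots> = 1 / (sqrt (2 * pi) * \<sigma>\<^sup>2)"
      using assms(1) by (simp add: field_simps)
    also have "\<dots> = ?B" using assms(1) s by (simp add: real_sqrt_mult real_sqrt_divide power2_eq_square)
    finally show ?thesis .
  qed
  have "(normal_density (\<rho> * x) \<sigma> z)\<^sup>2 / std_normal_density z
     = ?A * exp ?L"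
    unfolding normal_density_def std_normal_density_def exp_diff
    by (simp only: power_mult_distrib power_divide exp_double power2_eq_square) (simp add: exp_double[symmetric] mult_ac)
  also have "\<dots> = ?B * exp ?R" unfolding c e ..
  also have "\<dots> = 1 / sqrt (1 - \<rho>^4) * exp (\<rho>\<^sup>2 / s * x\<^sup>2) * normal_density (2 * \<rho> * x / s) (\<sigma> / sqrt s) z"
    unfolding normal_density_def sq p4 exp_add by simp
  finally show ?thesis unfolding s_def .
qed

lemma exp_square_times_std_normal:
  assumes "2 * c < 1"
  shows "exp (c * x\<^sup>2) * std_normal_density x = 1 / sqrt (1 - 2 * c) * normal_density 0 (1 / sqrt (1 - 2 * c)) x"
proof -
  have "c * x\<^sup>2 + - x\<^sup>2 / 2 = - x\<^sup>2 * (1 - 2 * c) / 2" by (simp add: field_simps)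
  moreover have "- (x - 0)\<^sup>2 / (2 * (1 / sqrt (1 - 2 * c))\<^sup>2) = - x\<^sup>2 * (1 - 2 * c) / 2"
    using assms by (simp add: power_divide)
  moreover have "1 / sqrt (2 * pi) = 1 / sqrt (1 - 2 * c) * (1 / sqrt (2 * pi * (1 / sqrt (1 - 2 * c))\<^sup>2))"
    using assms by (simp add: power_divide real_sqrt_mult real_sqrt_divide)
  moreover have "exp (c * x\<^sup>2) * std_normal_density x = 1 / sqrt (2 * pi) * exp (c * x\<^sup>2 + - x\<^sup>2 / 2)"
    unfolding std_normal_density_def by (simp only: exp_add mult_ac)
  ultimately show ?thesis
    unfolding normal_density_def by (simp only: mult.assoc)
qed

lemma nn_integral_exp_square:
  assumes "2 * c < 1"
  shows "(\<integral>\<^sup>+x. ennreal (exp (c * x\<^sup>2)) \<partial>std_normal_distribution) = ennreal (1 / sqrt (1 - 2 * c))"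
proof -
  have "(\<integral>\<^sup>+x. ennreal (exp (c * x\<^sup>2)) \<partial>std_normal_distribution)
     = (\<integral>\<^sup>+x. ennreal (std_normal_density x) * ennreal (exp (c * x\<^sup>2)) \<partial>lborel)"
    by (subst nn_integral_density) auto
  also have "\<dots> = (\<integral>\<^sup>+x. ennreal (1 / sqrt (1 - 2 * c) * normal_density 0 (1 / sqrt (1 - 2 * c)) x) \<partial>lborel)"
    by (intro nn_integral_cong, subst exp_square_times_std_normal[OF assms, symmetric]) (simp add: mult.commute flip: ennreal_mult'')
  also have "\<dots> = ennreal (\<integral>x. 1 / sqrt (1 - 2 * c) * normal_density 0 (1 / sqrt (1 - 2 * c)) x \<partial>lborel)"
    using assms by (intro nn_integral_eq_integral) auto
  also have "\<dots> = ennreal (1 / sqrt (1 - 2 * c))"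
    using assms by simp
  finally show ?thesis .
qed

lemma space_std_normal_distribution [simp]: "space std_normal_distribution = UNIV"
  by simp

lemma prob_space_std_normal: "prob_space std_normal_distribution"
  by (rule prob_space_normal_density) simp

text \<open>
  The square of the \<open>L\<^sup>2\<close> norm of the Mehler kernel minus one, both taken as densities with respect
  to the standard Gaussian measure.
\<close>

lemma nn_integral_kernel_variance:
  fixes \<rho> \<sigma> x :: real
  assumes "\<sigma> > 0" "\<sigma>\<^sup>2 = 1 - \<rho>\<^sup>2"
  shows "(\<integral>\<^sup>+z. ennreal ((normal_density (\<rho> * x) \<sigma> z - std_normal_density z)\<^sup>2 / std_normal_density z) \<partial>lborel)
     = ennreal (1 / sqrt (1 - \<rho>^4) * exp (\<rho>\<^sup>2 / (1 + \<rho>\<^sup>2) * x\<^sup>2) - 1)"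
proof -
  let ?A = "1 / sqrt (1 - \<rho>^4) * exp (\<rho>\<^sup>2 / (1 + \<rho>\<^sup>2) * x\<^sup>2)"
  let ?n = "normal_density (2 * \<rho> * x / (1 + \<rho>\<^sup>2)) (\<sigma> / sqrt (1 + \<rho>\<^sup>2))"
  have s: "\<sigma> / sqrt (1 + \<rho>\<^sup>2) > 0" using assms(1) by (simp add: add_pos_nonneg)
  have "(normal_density (\<rho> * x) \<sigma> z - std_normal_density z)\<^sup>2 / std_normal_density z
     = ?A * ?n z - 2 * normal_density (\<rho> * x) \<sigma> z + std_normal_density z" for z
  proof -
    have "std_normal_density z \<noteq> 0" using normal_density_pos[of 1 0 z] by simp
    then have "(normal_density (\<rho> * x) \<sigma> z - std_normal_density z)\<^sup>2 / std_normal_density z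
      = (normal_density (\<rho> * x) \<sigma> z)\<^sup>2 / std_normal_density z - 2 * normal_density (\<rho> * x) \<sigma> z + std_normal_density z"
      by (simp add: field_simps power2_eq_square)
    then show ?thesis using normal_density_square_ratio[OF assms, of x z] by simp
  qed
  note eq = this
  have "(\<integral>\<^sup>+z. ennreal ((normal_density (\<rho> * x) \<sigma> z - std_normal_density z)\<^sup>2 / std_normal_density z) \<partial>lborel)
     = ennreal (\<integral>z. ?A * ?n z - 2 * normal_density (\<rho> * x) \<sigma> z + std_normal_density z \<partial>lborel)"
    unfolding eq
  proof (rule nn_integral_eq_integral)
    show "integrable lborel (\<lambda>z. ?A * ?n z - 2 * normal_density (\<rho> * x) \<sigma> z + std_normal_density z)"
      using assms(1) s by (intro Bochner_Integration.integrable_add Bochner_Integration.integrable_diff integrable_mult_right integrable_normal_density) auto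
    show "AE z in lborel. 0 \<le> ?A * ?n z - 2 * normal_density (\<rho> * x) \<sigma> z + std_normal_density z"
      unfolding eq[symmetric] by simp
  qed
  also have "(\<integral>z. ?A * ?n z - 2 * normal_density (\<rho> * x) \<sigma> z + std_normal_density z \<partial>lborel) = ?A - 2 + 1"
  proof -
    have "integrable lborel ?n" "integrable lborel (normal_density (\<rho> * x) \<sigma>)" "integrable lborel std_normal_density"
      using assms(1) s by (auto intro!: integrable_normal_density)
    moreover have "integral\<^sup>L lborel ?n = 1" "integral\<^sup>L lborel (normal_density (\<rho> * x) \<sigma>) = 1"
      "integral\<^sup>L lborel std_normal_density = 1"
      using assms(1) s by (auto intro!: integral_normal_density)
    ultimately show ?thesis
      by simp
  qed
  finally show ?thesis by simp
qed

text \<open>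
  Here \<open>g = P\<^sub>\<rho> f(x) - E f\<close>. It is the pairing of \<open>f - E f\<close> with the kernel minus one, so
  Cauchy--Schwarz bounds it by the variance \<open>b\<close> of \<open>f\<close> and the quantity in
  \<open>nn_integral_kernel_variance\<close>.
\<close>

lemma mehler_deviation:
  fixes f :: "real \<Rightarrow> real"
  assumes \<sigma>: "\<sigma> > 0" "\<sigma>\<^sup>2 = 1 - \<rho>\<^sup>2"
    and [measurable]: "f \<in> borel_measurable borel" and nn: "\<And>z. 0 \<le> f z"
    and f2: "integrable std_normal_distribution (\<lambda>z. (f z)\<^sup>2)"
    and a_def: "a = (\<integral>z. f z \<partial>std_normal_distribution)"
    and b_def: "b = (\<integral>z. (f z - a)\<^sup>2 \<partial>std_normal_distribution)"
  shows "\<exists>g. (\<integral>\<^sup>+y. ennreal (f (\<rho> * x + \<sigma> * y)) \<partial>std_normal_distribution) = ennreal (a + g) \<and> 0 \<le> a + g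
    \<and> g\<^sup>2 \<le> (1 / sqrt (1 - \<rho>^4) * exp (\<rho>\<^sup>2 / (1 + \<rho>\<^sup>2) * x\<^sup>2) - 1) * b"
proof -
  interpret G: prob_space std_normal_distribution by (rule prob_space_std_normal)
  define n where "n = normal_density (\<rho> * x) \<sigma>"
  define k where "k = (\<lambda>z. n z - std_normal_density z)"
  define \<kappa> where "\<kappa> = 1 / sqrt (1 - \<rho>^4) * exp (\<rho>\<^sup>2 / (1 + \<rho>\<^sup>2) * x\<^sup>2) - 1"
  have pos: "std_normal_density z > 0" for z by (rule normal_density_pos) simp
  have [measurable]: "n \<in> borel_measurable borel" "k \<in> borel_measurable borel" unfolding n_def k_def by measurable
  have nint: "integrable lborel n" "integral\<^sup>L lborel n = 1" unfolding n_def using \<sigma>(1) by (auto intro!: integral_normal_density)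
  have fint: "integrable std_normal_distribution f"
    by (rule G.square_integrable_imp_integrable[OF _ f2]) measurable
  have f0_2: "integrable std_normal_distribution (\<lambda>z. (f z - a)\<^sup>2)"
    unfolding power2_diff using f2 fint by auto
  have f0\<phi>: "integrable lborel (\<lambda>z. std_normal_density z * (f z - a))" "(\<integral>z. std_normal_density z * (f z - a) \<partial>lborel) = 0"
  proof -
    have 1: "integrable std_normal_distribution (\<lambda>z. f z - a)" using fint by auto
    then show "integrable lborel (\<lambda>z. std_normal_density z * (f z - a))"
      by (subst (asm) integrable_density) auto
    have "(\<integral>z. f z - a \<partial>std_normal_distribution) = 0"
      using fint G.prob_space by (simp add: a_def del: space_density)
    then show "(\<integral>z. std_normal_density z * (f z - a) \<partial>lborel) = 0"
      by (subst (asm) integral_density) auto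
  qed
  have b: "(\<integral>\<^sup>+z. ennreal (\<bar>f z - a\<bar> * sqrt (std_normal_density z))^2 \<partial>lborel) = ennreal b"
  proof -
    have "ennreal b = (\<integral>\<^sup>+z. ennreal ((f z - a)\<^sup>2) \<partial>std_normal_distribution)"
      unfolding b_def by (rule nn_integral_eq_integral[symmetric, OF f0_2]) simp
    also have "\<dots> = (\<integral>\<^sup>+z. ennreal (std_normal_density z) * ennreal ((f z - a)\<^sup>2) \<partial>lborel)"
      by (rule nn_integral_density) auto
    also have "\<dots> = (\<integral>\<^sup>+z. ennreal (\<bar>f z - a\<bar> * sqrt (std_normal_density z))^2 \<partial>lborel)"
      by (intro nn_integral_cong) (simp add: power_mult_distrib ennreal_power mult.commute flip: ennreal_mult'')
    finally show ?thesis by simp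
  qed
  \<comment> \<open>the two factors for Cauchy--Schwarz: the Gaussian density is split evenly between them\<close>
  have "(\<integral>\<^sup>+z. ennreal (\<bar>k z\<bar> / sqrt (std_normal_density z))^2 \<partial>lborel)
     = (\<integral>\<^sup>+z. ennreal ((k z)\<^sup>2 / std_normal_density z) \<partial>lborel)"
    by (intro nn_integral_cong) (simp add: power_divide ennreal_power)
  also have "\<dots> = ennreal \<kappa>"
    unfolding k_def n_def \<kappa>_def by (rule nn_integral_kernel_variance[OF \<sigma>])
  finally have kk: "(\<integral>\<^sup>+z. ennreal (\<bar>k z\<bar> / sqrt (std_normal_density z))^2 \<partial>lborel) = ennreal \<kappa>" .
  have "(\<integral>\<^sup>+z. ennreal \<bar>(f z - a) * k z\<bar> \<partial>lborel)^2
     = (\<integral>\<^sup>+z. ennreal (\<bar>f z - a\<bar> * sqrt (std_normal_density z)) * ennreal (\<bar>k z\<bar> / sqrt (std_normal_density z)) \<partial>lborel)^2"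
  proof -
    have "ennreal \<bar>(f z - a) * k z\<bar> = ennreal (\<bar>f z - a\<bar> * sqrt (std_normal_density z)) * ennreal (\<bar>k z\<bar> / sqrt (std_normal_density z))" for z
      using pos[of z] by (simp add: abs_mult flip: ennreal_mult'')
    then show ?thesis by simp
  qed
  also have "\<dots> \<le> ennreal b * ennreal \<kappa>"
    unfolding b[symmetric] kk[symmetric] by (rule Cauchy_Schwarz_nn_integral) measurable
  finally have CS: "(\<integral>\<^sup>+z. ennreal \<bar>(f z - a) * k z\<bar> \<partial>lborel)^2 \<le> ennreal b * ennreal \<kappa>" .
  then have fin: "(\<integral>\<^sup>+z. ennreal \<bar>(f z - a) * k z\<bar> \<partial>lborel) < \<infinity>"
  proof (cases "(\<integral>\<^sup>+z. ennreal \<bar>(f z - a) * k z\<bar> \<partial>lborel) = \<infinity>")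
    case True
    have "ennreal b * ennreal \<kappa> < \<infinity>" by (simp add: ennreal_mult_less_top)
    with CS True show ?thesis by (simp add: power2_eq_square)
  qed (simp add: less_top)
  have kint: "integrable lborel (\<lambda>z. (f z - a) * k z)"
    using fin by (intro integrableI_bounded) auto
  define g where "g = (\<integral>z. (f z - a) * k z \<partial>lborel)"
  have "integrable lborel (\<lambda>z. (f z - a) * k z + std_normal_density z * (f z - a) + a * n z)"
    using kint f0\<phi>(1) nint(1) by auto
  moreover have "(\<integral>z. (f z - a) * k z + std_normal_density z * (f z - a) + a * n z \<partial>lborel) = a + g"
    using kint f0\<phi> nint by (simp add: g_def)
  moreover have "(f z - a) * k z + std_normal_density z * (f z - a) + a * n z = f z * n z" for z
    unfolding k_def by (simp add: algebra_simps)
  ultimately have fn: "integrable lborel (\<lambda>z. f z * n z)" "(\<integral>z. f z * n z \<partial>lborel) = a + g" by auto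
  have "(\<integral>\<^sup>+y. ennreal (f (\<rho> * x + \<sigma> * y)) \<partial>std_normal_distribution) = (\<integral>\<^sup>+z. ennreal (f z) * ennreal (n z) \<partial>lborel)"
    using nn_integral_affine_normal[of \<sigma> "\<lambda>z. ennreal (f z)" "\<rho> * x"] \<sigma>(1) unfolding n_def by simp
  also have "\<dots> = (\<integral>\<^sup>+z. ennreal (f z * n z) \<partial>lborel)"
    by (intro nn_integral_cong) (simp add: n_def flip: ennreal_mult'')
  also have "\<dots> = ennreal (a + g)"
    unfolding fn(2)[symmetric] by (rule nn_integral_eq_integral[OF fn(1)]) (simp add: nn n_def)
  finally have 1: "(\<integral>\<^sup>+y. ennreal (f (\<rho> * x + \<sigma> * y)) \<partial>std_normal_distribution) = ennreal (a + g)" .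
  have 2: "0 \<le> a + g" unfolding fn(2)[symmetric] by (intro integral_nonneg_AE) (simp add: nn n_def)
  have bnn: "b \<ge> 0" unfolding b_def by simp
  have 3: "g\<^sup>2 \<le> \<kappa> * b \<or> \<kappa> < 0"
  proof (cases "\<kappa> < 0")
    case False
    have "ennreal \<bar>g\<bar> \<le> (\<integral>\<^sup>+z. ennreal \<bar>(f z - a) * k z\<bar> \<partial>lborel)"
      using integral_norm_bound_ennreal[OF kint] unfolding g_def by simp
    then have "ennreal \<bar>g\<bar> ^ 2 \<le> ennreal b * ennreal \<kappa>"
      using CS by (meson order_trans power_mono zero_le)
    then have "ennreal (g\<^sup>2) \<le> ennreal (\<kappa> * b)"
      using False bnn by (simp add: ennreal_power mult.commute flip: ennreal_mult'')
    then show ?thesis using False bnn by (subst (asm) ennreal_le_iff) auto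
  qed simp
  have "\<not> \<kappa> < 0"
  proof -
    have "0 < 1 - \<rho>^4" "1 - \<rho>^4 \<le> 1"
    proof -
      have "1 - \<rho>^4 = \<sigma>\<^sup>2 * (1 + \<rho>\<^sup>2)" unfolding \<sigma>(2) by (simp add: power2_eq_square power4_eq_xxxx algebra_simps)
      then show "0 < 1 - \<rho>^4" using \<sigma>(1) by (simp add: add_pos_nonneg)
    qed auto
    then have h1: "1 \<le> 1 / sqrt (1 - \<rho>^4)" by simp
    have h2: "1 \<le> exp (\<rho>\<^sup>2 / (1 + \<rho>\<^sup>2) * x\<^sup>2)" by simp
    have "1 * 1 \<le> 1 / sqrt (1 - \<rho>^4) * exp (\<rho>\<^sup>2 / (1 + \<rho>\<^sup>2) * x\<^sup>2)"
      by (rule mult_mono[OF h1 h2]) (use h1 in linarith, simp)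
    then show ?thesis unfolding \<kappa>_def by simp
  qed
  with 1 2 3 show ?thesis unfolding \<kappa>_def by blast
qed

text \<open>
  The bounds \<open>1/4\<close> and \<open>1/3\<close> are what the fourth power expansion in \<open>mehler_contractive\<close> can
  absorb; the range of \<open>\<rho>\<close> is chosen small enough to meet them with crude estimates.
\<close>

lemma mehler_kernel_bounds:
  fixes \<rho> :: real
  assumes "0 \<le> \<rho>" "\<rho> \<le> 1/10"
  defines "\<kappa> \<equiv> \<lambda>x. 1 / sqrt (1 - \<rho>^4) * exp (\<rho>\<^sup>2 / (1 + \<rho>\<^sup>2) * x\<^sup>2) - 1"
  shows "\<kappa> x \<ge> 0"
    and "(\<integral>\<^sup>+x. ennreal (\<kappa> x) \<partial>std_normal_distribution) \<le> ennreal (1/4)"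
    and "(\<integral>\<^sup>+x. ennreal ((\<kappa> x)\<^sup>2) \<partial>std_normal_distribution) \<le> ennreal (1/3)"
proof -
  interpret G: prob_space std_normal_distribution by (rule prob_space_std_normal)
  define q where "q = \<rho>\<^sup>2"
  define A where "A = 1 / sqrt (1 - \<rho>^4)"
  define c where "c = q / (1 + q)"
  have \<kappa>: "\<kappa> = (\<lambda>x. A * exp (c * x\<^sup>2) - 1)" unfolding \<kappa>_def A_def c_def q_def ..
  have q: "0 \<le> q" "q \<le> 1/100"
    unfolding q_def using assms(1,2) power_mono[of \<rho> "1/10" 2] by (auto simp: power_divide)
  have q2: "\<rho>^4 = q\<^sup>2" unfolding q_def by simp
  have q4: "0 \<le> \<rho>^4" "\<rho>^4 \<le> 1/10000" unfolding q2 using q power_mono[of q "1/100" 2] by (auto simp: power_divide)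
  have c: "0 \<le> c" "c \<le> 1/100" unfolding c_def using q by (auto simp: field_simps)
  have A2: "A\<^sup>2 = 1 / (1 - \<rho>^4)" unfolding A_def using q4 by (simp add: power_divide)
  have A: "1 \<le> A" "A\<^sup>2 \<le> 10/9"
    using q4 by (simp add: A_def, simp add: A2 field_simps)
  then have A': "A \<le> 10/9" using self_le_power[of A 2] by simp
  have inv: "1 / sqrt y \<le> 25/24" if "0.96 \<le> y" "y \<le> 1" for y :: real
  proof -
    have "y \<le> sqrt y" using that by (intro real_le_rsqrt) (simp add: power2_eq_square mult_left_le)
    then show ?thesis using that by (simp add: field_simps)
  qed
  have e1: "1 \<le> A * exp (c * x\<^sup>2)" for x
    using mult_mono[of 1 A 1 "exp (c * x\<^sup>2)"] A c by simp
  show nn: "\<kappa> x \<ge> 0" for x unfolding \<kappa> using e1[of x] by simp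
  \<comment> \<open>subtraction of the constant \<open>1\<close> is done by adding it on both sides, as the integrals are extended nonnegative\<close>
  have shift: "ennreal u \<le> ennreal v" if "ennreal u + 1 \<le> ennreal (v + 1)" "u \<ge> 0" "v \<ge> 0" for u v
    using that by (simp add: ennreal_1[symmetric] del: ennreal_1 flip: ennreal_plus)
  have shift': "I \<le> ennreal v" if "I + 1 \<le> ennreal (v + 1)" "v \<ge> 0" for v and I :: ennreal
  proof (cases I)
    case (real r)
    then show ?thesis using that shift[of r v] by simp
  next
    case top
    then show ?thesis using that by (simp add: top_unique)
  qed
  have "(\<integral>\<^sup>+x. ennreal (\<kappa> x) \<partial>std_normal_distribution) + 1 = (\<integral>\<^sup>+x. ennreal (\<kappa> x) + 1 \<partial>std_normal_distribution)"
    using G.emeasure_space_1 by (subst nn_integral_add) (auto simp: \<kappa>)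
  also have "\<dots> = (\<integral>\<^sup>+x. ennreal A * ennreal (exp (c * x\<^sup>2)) \<partial>std_normal_distribution)"
    using nn A by (intro nn_integral_cong) (simp add: \<kappa> ennreal_1[symmetric] ennreal_plus[symmetric] del: ennreal_1 ennreal_plus flip: ennreal_mult)
  also have "\<dots> = ennreal A * ennreal (1 / sqrt (1 - 2 * c))"
    using c by (subst nn_integral_cmult) (auto simp: nn_integral_exp_square)
  also have "\<dots> = ennreal (A * (1 / sqrt (1 - 2 * c)))"
    using A c by (simp flip: ennreal_mult)
  also have "\<dots> \<le> ennreal (1/4 + 1)"
  proof (rule ennreal_leI)
    have "A * (1 / sqrt (1 - 2 * c)) \<le> 10/9 * (25/24)"
      using A A' c by (intro mult_mono inv) auto
    also have "\<dots> \<le> 1/4 + (1::real)" by simp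
    finally show "A * (1 / sqrt (1 - 2 * c)) \<le> 1/4 + 1" .
  qed
  finally show "(\<integral>\<^sup>+x. ennreal (\<kappa> x) \<partial>std_normal_distribution) \<le> ennreal (1/4)"
    by (rule shift') simp
  have "(\<integral>\<^sup>+x. ennreal ((\<kappa> x)\<^sup>2) \<partial>std_normal_distribution) + 1 = (\<integral>\<^sup>+x. ennreal ((\<kappa> x)\<^sup>2) + 1 \<partial>std_normal_distribution)"
    using G.emeasure_space_1 by (subst nn_integral_add) (auto simp: \<kappa>)
  also have "\<dots> \<le> (\<integral>\<^sup>+x. ennreal (A\<^sup>2) * ennreal (exp (2 * c * x\<^sup>2)) \<partial>std_normal_distribution)"
  proof (rule nn_integral_mono)
    fix x
    have "(\<kappa> x)\<^sup>2 + 1 \<le> A\<^sup>2 * exp (2 * c * x\<^sup>2)"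
    proof -
      have "exp (2 * c * x\<^sup>2) = (exp (c * x\<^sup>2))\<^sup>2" by (simp add: exp_double[symmetric] mult.assoc)
      then have E: "A\<^sup>2 * exp (2 * c * x\<^sup>2) = (A * exp (c * x\<^sup>2))\<^sup>2" by (simp add: power_mult_distrib)
      have "(t - 1)\<^sup>2 + 1 \<le> t\<^sup>2" if "1 \<le> t" for t :: real using that by (simp add: power2_eq_square algebra_simps)
      then show ?thesis using e1[of x] unfolding \<kappa> E by blast
    qed
    then show "ennreal ((\<kappa> x)\<^sup>2) + 1 \<le> ennreal (A\<^sup>2) * ennreal (exp (2 * c * x\<^sup>2))"
      by (simp add: ennreal_1[symmetric] ennreal_plus[symmetric] del: ennreal_1 ennreal_plus flip: ennreal_mult)
  qed
  also have "\<dots> = ennreal (A\<^sup>2) * ennreal (1 / sqrt (1 - 2 * (2 * c)))"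
    using c nn_integral_exp_square[of "2 * c"] by (subst nn_integral_cmult) auto
  also have "\<dots> = ennreal (A\<^sup>2 * (1 / sqrt (1 - 2 * (2 * c))))"
    using A c by (simp flip: ennreal_mult)
  also have "\<dots> \<le> ennreal (1/3 + 1)"
  proof (rule ennreal_leI)
    have "A\<^sup>2 * (1 / sqrt (1 - 2 * (2 * c))) \<le> 10/9 * (25/24)"
      using A c by (intro mult_mono inv) auto
    also have "\<dots> \<le> 1/3 + (1::real)" by simp
    finally show "A\<^sup>2 * (1 / sqrt (1 - 2 * (2 * c))) \<le> 1/3 + 1" .
  qed
  finally show "(\<integral>\<^sup>+x. ennreal ((\<kappa> x)\<^sup>2) \<partial>std_normal_distribution) \<le> ennreal (1/3)"
    by (rule shift') simp
qed

lemma nn_integral_mehler_invariant: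
  fixes f :: "real \<Rightarrow> ennreal"
  assumes \<sigma>: "\<sigma> > 0" "\<sigma>\<^sup>2 = 1 - \<rho>\<^sup>2" and [measurable]: "f \<in> borel_measurable borel"
  shows "(\<integral>\<^sup>+x. (\<integral>\<^sup>+y. f (\<rho> * x + \<sigma> * y) \<partial>std_normal_distribution) \<partial>std_normal_distribution)
       = (\<integral>\<^sup>+z. f z \<partial>std_normal_distribution)"
proof -
  have [measurable]: "(\<lambda>(x, z). normal_density (\<rho> * x) \<sigma> z) \<in> borel_measurable (borel \<Otimes>\<^sub>M borel)"
    unfolding normal_density_def by measurable
  have "(\<integral>\<^sup>+x. (\<integral>\<^sup>+y. f (\<rho> * x + \<sigma> * y) \<partial>std_normal_distribution) \<partial>std_normal_distribution)
     = (\<integral>\<^sup>+x. (\<integral>\<^sup>+z. f z * ennreal (normal_density (\<rho> * x) \<sigma> z) \<partial>lborel) \<partial>std_normal_distribution)"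
    using \<sigma>(1) by (subst nn_integral_affine_normal) auto
  also have "\<dots> = (\<integral>\<^sup>+x. ennreal (std_normal_density x) * (\<integral>\<^sup>+z. f z * ennreal (normal_density (\<rho> * x) \<sigma> z) \<partial>lborel) \<partial>lborel)"
    by (rule nn_integral_density) measurable
  also have "\<dots> = (\<integral>\<^sup>+x. (\<integral>\<^sup>+z. ennreal (std_normal_density x) * (f z * ennreal (normal_density (\<rho> * x) \<sigma> z)) \<partial>lborel) \<partial>lborel)"
    by (intro nn_integral_cong nn_integral_cmult[symmetric]) measurable
  also have "\<dots> = (\<integral>\<^sup>+z. (\<integral>\<^sup>+x. ennreal (std_normal_density x) * (f z * ennreal (normal_density (\<rho> * x) \<sigma> z)) \<partial>lborel) \<partial>lborel)"
    by (rule lborel_pair.Fubini') measurable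
  also have "\<dots> = (\<integral>\<^sup>+z. ennreal (std_normal_density z) * f z \<partial>lborel)"
  proof (rule nn_integral_cong)
    fix z
    have "(\<integral>\<^sup>+x. ennreal (std_normal_density x) * (f z * ennreal (normal_density (\<rho> * x) \<sigma> z)) \<partial>lborel)
      = (\<integral>\<^sup>+x. (ennreal (std_normal_density z) * f z) * ennreal (normal_density (\<rho> * z) \<sigma> x) \<partial>lborel)"
    proof (rule nn_integral_cong)
      fix x
      have "ennreal (std_normal_density x) * ennreal (normal_density (\<rho> * x) \<sigma> z)
         = ennreal (std_normal_density z) * ennreal (normal_density (\<rho> * z) \<sigma> x)"
        using normal_density_reversible[OF \<sigma>, of x z] by (simp add: mult.commute flip: ennreal_mult'')
      then show "ennreal (std_normal_density x) * (f z * ennreal (normal_density (\<rho> * x) \<sigma> z))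
        = (ennreal (std_normal_density z) * f z) * ennreal (normal_density (\<rho> * z) \<sigma> x)"
        by (metis mult.commute mult.left_commute)
    qed
    also have "\<dots> = (ennreal (std_normal_density z) * f z) * (\<integral>\<^sup>+x. ennreal (normal_density (\<rho> * z) \<sigma> x) \<partial>lborel)"
      by (rule nn_integral_cmult) measurable
    also have "(\<integral>\<^sup>+x. ennreal (normal_density (\<rho> * z) \<sigma> x) \<partial>lborel) = 1"
      using \<sigma>(1) by (subst nn_integral_eq_integral) auto
    finally show "(\<integral>\<^sup>+x. ennreal (std_normal_density x) * (f z * ennreal (normal_density (\<rho> * x) \<sigma> z)) \<partial>lborel)
      = ennreal (std_normal_density z) * f z" by simp
  qed
  also have "\<dots> = (\<integral>\<^sup>+z. f z \<partial>std_normal_distribution)"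
    by (subst nn_integral_density) auto
  finally show ?thesis .
qed

text \<open>
  Write \<open>P\<^sub>\<rho> f = a + g\<close> with \<open>a = E f\<close> and \<open>E g = 0\<close>, and let \<open>b\<close> be the variance of \<open>f\<close>. Expanding
  the fourth power and removing the cubic term by \<open>4 a g\<^sup>3 \<le> 2 a\<^sup>2 g\<^sup>2 + 2 g\<^sup>4\<close> leaves
  \<open>E (a + g)\<^sup>4 \<le> a\<^sup>4 + 8 a\<^sup>2 E g\<^sup>2 + 3 E g\<^sup>4\<close>. Since \<open>g\<^sup>2 \<le> \<kappa> b\<close>, the bounds on \<open>\<kappa>\<close> turn this into
  \<open>a\<^sup>4 + 2 a\<^sup>2 b + b\<^sup>2 = (E f\<^sup>2)\<^sup>2\<close>.
\<close>

lemma mehler_contractive: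
  fixes f :: "real \<Rightarrow> real"
  assumes \<rho>: "0 \<le> \<rho>" "\<rho> \<le> 1/10" and \<sigma>: "\<sigma> > 0" "\<sigma>\<^sup>2 = 1 - \<rho>\<^sup>2"
    and [measurable]: "f \<in> borel_measurable borel" and nn: "\<And>z. 0 \<le> f z"
    and f2: "integrable std_normal_distribution (\<lambda>z. (f z)\<^sup>2)"
  shows "(\<integral>\<^sup>+x. (\<integral>\<^sup>+y. ennreal (f (\<rho> * x + \<sigma> * y)) \<partial>std_normal_distribution)^4 \<partial>std_normal_distribution)
       \<le> (\<integral>\<^sup>+z. ennreal (f z)^2 \<partial>std_normal_distribution)^2"
proof -
  interpret G: prob_space std_normal_distribution by (rule prob_space_std_normal)
  define a where "a = (\<integral>z. f z \<partial>std_normal_distribution)"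
  define b where "b = (\<integral>z. (f z - a)\<^sup>2 \<partial>std_normal_distribution)"
  define \<kappa> where "\<kappa> = (\<lambda>x. 1 / sqrt (1 - \<rho>^4) * exp (\<rho>\<^sup>2 / (1 + \<rho>\<^sup>2) * x\<^sup>2) - 1)"
  have \<kappa>: "\<kappa> x \<ge> 0" "(\<integral>\<^sup>+x. ennreal (\<kappa> x) \<partial>std_normal_distribution) \<le> ennreal (1/4)"
    "(\<integral>\<^sup>+x. ennreal ((\<kappa> x)\<^sup>2) \<partial>std_normal_distribution) \<le> ennreal (1/3)" for x
    unfolding \<kappa>_def by (rule mehler_kernel_bounds[OF \<rho>])+
  have [measurable]: "\<kappa> \<in> borel_measurable borel" unfolding \<kappa>_def by measurable
  have fint: "integrable std_normal_distribution f"
    by (rule G.square_integrable_imp_integrable[OF _ f2]) measurable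
  have a0: "a \<ge> 0" and b0: "b \<ge> 0" unfolding a_def b_def by (auto intro: integral_nonneg_AE simp: nn)
  have ab: "(\<integral>\<^sup>+z. ennreal (f z)^2 \<partial>std_normal_distribution) = ennreal (a\<^sup>2 + b)"
  proof -
    have "b = (\<integral>z. (f z)\<^sup>2 \<partial>std_normal_distribution) - a\<^sup>2"
      using f2 fint G.prob_space unfolding b_def power2_diff
      by (simp add: a_def[symmetric] power2_eq_square del: space_density)
    moreover have "(\<integral>\<^sup>+z. ennreal (f z)^2 \<partial>std_normal_distribution) = ennreal (\<integral>z. (f z)\<^sup>2 \<partial>std_normal_distribution)"
      using nn_integral_eq_integral[OF f2] by (simp add: nn ennreal_power)
    ultimately show ?thesis by simp
  qed
  define Q where "Q = (\<lambda>x. \<integral>\<^sup>+y. ennreal (f (\<rho> * x + \<sigma> * y)) \<partial>std_normal_distribution)"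
  have [measurable]: "Q \<in> borel_measurable borel" unfolding Q_def by measurable
  \<comment> \<open>the linear term \<open>4 a\<^sup>3 g\<close> is written as \<open>4 a\<^sup>3 (a + g) - 4 a\<^sup>4\<close>, so that only nonnegative quantities are integrated; the invariance of the measure then replaces \<open>E g = 0\<close>\<close>
  have pointwise: "Q x ^ 4 + ennreal (3 * a^4) \<le> ennreal (4 * a^3) * Q x + ennreal (8 * a\<^sup>2 * b) * ennreal (\<kappa> x) + ennreal (3 * b\<^sup>2) * ennreal ((\<kappa> x)\<^sup>2)" for x
  proof -
    obtain g where g: "Q x = ennreal (a + g)" "0 \<le> a + g" "g\<^sup>2 \<le> \<kappa> x * b"
      using mehler_deviation[OF \<sigma> assms(5) nn f2 a_def b_def, of x] unfolding Q_def \<kappa>_def by blast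
    have "4 * (a * g^3) \<le> 2 * (a\<^sup>2 * g\<^sup>2 + g^4)"
    proof -
      have "0 \<le> 2 * g\<^sup>2 * (a - g)\<^sup>2" by simp
      then show ?thesis by (simp add: power2_eq_square power3_eq_cube power4_eq_xxxx algebra_simps)
    qed
    moreover have "(a + g)^4 = a^4 + 4 * (a^3 * g) + 6 * (a\<^sup>2 * g\<^sup>2) + 4 * (a * g^3) + g^4"
      by (simp add: power2_eq_square power3_eq_cube power4_eq_xxxx algebra_simps)
    moreover have "a^4 + 4 * (a^3 * g) = 4 * a^3 * (a + g) - 3 * a^4"
      by (simp add: power3_eq_cube power4_eq_xxxx algebra_simps)
    moreover have "P + 3 * A \<le> F + 8 * C + 3 * D"
      if "4 * B \<le> 2 * (C + D)" "P = A + 4 * E + 6 * C + 4 * B + D" "A + 4 * E = F - 3 * A" for P A B C D E F :: real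
    proof -
      have "P + 3 * A = F + 6 * C + 4 * B + D" using that by simp
      then show ?thesis using that(1) by simp
    qed
    ultimately have "(a + g)^4 + 3 * a^4 \<le> 4 * a^3 * (a + g) + 8 * (a\<^sup>2 * g\<^sup>2) + 3 * g^4"
      by blast
    moreover have "a\<^sup>2 * g\<^sup>2 \<le> a\<^sup>2 * (\<kappa> x * b)" using g(3) by (intro mult_left_mono) auto
    moreover have "g^4 \<le> (\<kappa> x * b)\<^sup>2"
      using power_mono[OF g(3), of 2] by simp
    ultimately have "(a + g)^4 + 3 * a^4 \<le> 4 * a^3 * (a + g) + 8 * a\<^sup>2 * b * \<kappa> x + 3 * b\<^sup>2 * (\<kappa> x)\<^sup>2"
      by (simp add: power_mult_distrib algebra_simps)
    then have "ennreal ((a + g)^4 + 3 * a^4) \<le> ennreal (4 * a^3 * (a + g) + 8 * a\<^sup>2 * b * \<kappa> x + 3 * b\<^sup>2 * (\<kappa> x)\<^sup>2)"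
      by (rule ennreal_leI)
    then show ?thesis
      using g(2) a0 b0 \<kappa>(1)[of x] unfolding g(1) by (simp add: ennreal_plus ennreal_mult ennreal_power)
  qed
  have "(\<integral>\<^sup>+x. Q x ^ 4 \<partial>std_normal_distribution) + ennreal (3 * a^4)
     = (\<integral>\<^sup>+x. Q x ^ 4 + ennreal (3 * a^4) \<partial>std_normal_distribution)"
    using G.emeasure_space_1 by (subst nn_integral_add) (auto simp del: space_density)
  also have "\<dots> \<le> (\<integral>\<^sup>+x. ennreal (4 * a^3) * Q x + ennreal (8 * a\<^sup>2 * b) * ennreal (\<kappa> x) + ennreal (3 * b\<^sup>2) * ennreal ((\<kappa> x)\<^sup>2) \<partial>std_normal_distribution)"
    by (intro nn_integral_mono pointwise)
  also have "\<dots> = ennreal (4 * a^3) * (\<integral>\<^sup>+x. Q x \<partial>std_normal_distribution)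
       + ennreal (8 * a\<^sup>2 * b) * (\<integral>\<^sup>+x. ennreal (\<kappa> x) \<partial>std_normal_distribution)
       + ennreal (3 * b\<^sup>2) * (\<integral>\<^sup>+x. ennreal ((\<kappa> x)\<^sup>2) \<partial>std_normal_distribution)"
    by (subst nn_integral_add, measurable)+ (simp add: nn_integral_cmult)
  also have "(\<integral>\<^sup>+x. Q x \<partial>std_normal_distribution) = ennreal a"
    unfolding Q_def a_def using nn_integral_eq_integral[OF fint]
    by (subst nn_integral_mehler_invariant[OF \<sigma>, where f="\<lambda>z. ennreal (f z)"]) (auto simp: nn)
  also have "ennreal (4 * a^3) * ennreal a + ennreal (8 * a\<^sup>2 * b) * (\<integral>\<^sup>+x. ennreal (\<kappa> x) \<partial>std_normal_distribution)
       + ennreal (3 * b\<^sup>2) * (\<integral>\<^sup>+x. ennreal ((\<kappa> x)\<^sup>2) \<partial>std_normal_distribution)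
     \<le> ennreal (4 * a^3) * ennreal a + ennreal (8 * a\<^sup>2 * b) * ennreal (1/4) + ennreal (3 * b\<^sup>2) * ennreal (1/3)"
    by (intro add_mono mult_left_mono \<kappa>) auto
  also have "\<dots> = ennreal (4 * a^3 * a + 8 * a\<^sup>2 * b * (1/4) + 3 * b\<^sup>2 * (1/3))"
    using a0 b0 by (simp add: ennreal_plus ennreal_mult del: times_divide_eq_right)
  also have "4 * a^3 * a + 8 * a\<^sup>2 * b * (1/4) + 3 * b\<^sup>2 * (1/3) = (a\<^sup>2 + b)\<^sup>2 + 3 * a^4"
    by (simp add: power2_eq_square power3_eq_cube power4_eq_xxxx algebra_simps)
  also have "ennreal \<dots> = ennreal ((a\<^sup>2 + b)\<^sup>2) + ennreal (3 * a^4)"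
    using a0 by (simp add: ennreal_plus)
  finally have "(\<integral>\<^sup>+x. Q x ^ 4 \<partial>std_normal_distribution) \<le> ennreal ((a\<^sup>2 + b)\<^sup>2)"
    by (simp add: ennreal_add_left_cancel_le add.commute)
  then show ?thesis
    unfolding ab using b0 by (simp add: Q_def ennreal_power del: ennreal_plus)
qed

text \<open>
  The operator \<open>f \<mapsto> (\<lambda>x. \<integral> f (m x y) dM(y))\<close> is a contraction from \<open>L\<^sup>2\<close> to \<open>L\<^sup>4\<close>, tested on
  nonnegative functions. With nonnegative extended values Tonelli's theorem applies without
  integrability conditions.
\<close>

definition hypercontractive :: "'a measure \<Rightarrow> ('a \<Rightarrow> 'a \<Rightarrow> 'a) \<Rightarrow> bool" where
  "hypercontractive M m \<longleftrightarrow> (\<lambda>(x, y). m x y) \<in> M \<Otimes>\<^sub>M M \<rightarrow>\<^sub>M M \<and>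
     (\<forall>f\<in>borel_measurable M. (\<integral>\<^sup>+x. (\<integral>\<^sup>+y. f (m x y) \<partial>M)^4 \<partial>M) \<le> (\<integral>\<^sup>+z. (f z :: ennreal)^2 \<partial>M)^2)"

lemma hypercontractive_normal:
  assumes \<rho>: "0 \<le> \<rho>" "\<rho> \<le> 1/10" and \<sigma>2: "\<rho>\<^sup>2 + \<sigma>\<^sup>2 = 1"
  shows "hypercontractive std_normal_distribution (\<lambda>x y. \<rho> * x + \<sigma> * y)"
  unfolding hypercontractive_def
proof (intro conjI ballI)
  show "(\<lambda>(x, y). \<rho> * x + \<sigma> * y) \<in> std_normal_distribution \<Otimes>\<^sub>M std_normal_distribution \<rightarrow>\<^sub>M std_normal_distribution"
    by measurable
  fix f :: "real \<Rightarrow> ennreal" assume "f \<in> borel_measurable std_normal_distribution"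
  then have [measurable]: "f \<in> borel_measurable borel" by simp
  have s: "\<bar>\<sigma>\<bar>\<^sup>2 = 1 - \<rho>\<^sup>2" using \<sigma>2 by simp
  have "\<rho>\<^sup>2 < 1" using \<rho> power_mono[of \<rho> "1/10" 2] by (simp add: power_divide)
  then have "\<sigma> \<noteq> 0" using \<sigma>2 by auto
  then have s': "\<bar>\<sigma>\<bar> > 0" by simp
  show "(\<integral>\<^sup>+x. (\<integral>\<^sup>+y. f (\<rho> * x + \<sigma> * y) \<partial>std_normal_distribution)^4 \<partial>std_normal_distribution)
     \<le> (\<integral>\<^sup>+z. (f z)^2 \<partial>std_normal_distribution)^2"
  proof (cases "(\<integral>\<^sup>+z. (f z)^2 \<partial>std_normal_distribution) = \<infinity>")
    case False
    then have "AE z in std_normal_distribution. (f z)^2 \<noteq> \<infinity>"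
      by (intro nn_integral_PInf_AE) auto
    then have "AE z in lborel. 0 < std_normal_density z \<longrightarrow> (f z)^2 \<noteq> \<infinity>"
      by (subst (asm) AE_density) auto
    moreover have "0 < std_normal_density z" for z by (rule normal_density_pos) simp
    ultimately have ae: "AE z in lborel. f z = ennreal (enn2real (f z))"
      by (auto elim!: eventually_mono simp: less_top power2_eq_square ennreal_mult_eq_top_iff)
    define h where "h = (\<lambda>z. enn2real (f z))"
    have [measurable]: "h \<in> borel_measurable borel" unfolding h_def by measurable
    have eq: "(\<integral>\<^sup>+y. f (\<rho> * x + \<sigma> * y) \<partial>std_normal_distribution)
        = (\<integral>\<^sup>+y. ennreal (h (\<rho> * x + \<bar>\<sigma>\<bar> * y)) \<partial>std_normal_distribution)" for x
      using \<open>\<sigma> \<noteq> 0\<close> ae unfolding h_def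
      by (subst nn_integral_affine_normal, simp, simp, subst nn_integral_affine_normal[where f="\<lambda>z. ennreal (enn2real (f z))"])
         (auto intro!: nn_integral_cong_AE elim!: eventually_mono)
    have aeG: "AE z in std_normal_distribution. f z = ennreal (h z)"
      using ae unfolding h_def by (subst AE_density) (auto elim!: eventually_mono)
    have eq2: "(\<integral>\<^sup>+z. (f z)^2 \<partial>std_normal_distribution) = (\<integral>\<^sup>+z. ennreal (h z)^2 \<partial>std_normal_distribution)"
      using aeG by (intro nn_integral_cong_AE) (auto elim!: eventually_mono)
    have "integrable std_normal_distribution (\<lambda>z. (h z)\<^sup>2)"
    proof (rule integrableI_bounded)
      have "ennreal (norm ((h z)\<^sup>2)) = ennreal (h z)^2" for z by (simp add: h_def ennreal_power)
      then show "(\<integral>\<^sup>+z. ennreal (norm ((h z)\<^sup>2)) \<partial>std_normal_distribution) < \<infinity>"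
        using False unfolding eq2 by (simp add: less_top)
    qed simp
    from mehler_contractive[OF \<rho> s' s _ _ this] show ?thesis
      unfolding eq eq2 by (simp add: h_def)
  qed simp
qed

text \<open>
  Apply the operator of the first factor for fixed second coordinate. The remaining integral
  \<open>\<integral> (\<integral> T(x\<^sub>2,z)\<^sup>2 dz)\<^sup>2 dx\<^sub>2\<close> is the integral over \<open>(z, w)\<close> of \<open>\<integral> T(x\<^sub>2,z)\<^sup>2 T(x\<^sub>2,w)\<^sup>2 dx\<^sub>2\<close>;
  Cauchy--Schwarz in \<open>x\<^sub>2\<close> separates \<open>z\<close> from \<open>w\<close>, and contractivity in the second factor applies to
  each of the two. This is Minkowski's inequality for the exponent two.
\<close>

lemma hypercontractive_pair:
  assumes "sigma_finite_measure M1" "sigma_finite_measure M2"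
    and h1: "hypercontractive M1 m1" and h2: "hypercontractive M2 m2"
  shows "hypercontractive (M1 \<Otimes>\<^sub>M M2) (\<lambda>x y. (m1 (fst x) (fst y), m2 (snd x) (snd y)))"
  unfolding hypercontractive_def
proof (intro conjI ballI)
  interpret M1: sigma_finite_measure M1 by fact
  interpret M2: sigma_finite_measure M2 by fact
  interpret P: pair_sigma_finite M1 M2 ..
  have m1: "(\<lambda>(x, y). m1 x y) \<in> M1 \<Otimes>\<^sub>M M1 \<rightarrow>\<^sub>M M1" and m2: "(\<lambda>(x, y). m2 x y) \<in> M2 \<Otimes>\<^sub>M M2 \<rightarrow>\<^sub>M M2"
    using h1 h2 unfolding hypercontractive_def by auto
  have m1' [measurable]: "(\<lambda>w. m1 (g w) (h w)) \<in> N \<rightarrow>\<^sub>M M1" if "g \<in> N \<rightarrow>\<^sub>M M1" "h \<in> N \<rightarrow>\<^sub>M M1" for g h and N :: "'d measure"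
    using measurable_compose[OF measurable_Pair[OF that] m1] by simp
  have m2' [measurable]: "(\<lambda>w. m2 (g w) (h w)) \<in> N \<rightarrow>\<^sub>M M2" if "g \<in> N \<rightarrow>\<^sub>M M2" "h \<in> N \<rightarrow>\<^sub>M M2" for g h and N :: "'d measure"
    using measurable_compose[OF measurable_Pair[OF that] m2] by simp
  show "(\<lambda>(x, y). (m1 (fst x) (fst y), m2 (snd x) (snd y))) \<in> (M1 \<Otimes>\<^sub>M M2) \<Otimes>\<^sub>M (M1 \<Otimes>\<^sub>M M2) \<rightarrow>\<^sub>M M1 \<Otimes>\<^sub>M M2"
    by measurable
  fix f :: "_ \<Rightarrow> ennreal" assume [measurable]: "f \<in> borel_measurable (M1 \<Otimes>\<^sub>M M2)"
  let ?T = "\<lambda>x2 z1. \<integral>\<^sup>+y2. f (z1, m2 x2 y2) \<partial>M2"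
  have [measurable]: "(\<lambda>p. ?T (fst p) (snd p)) \<in> borel_measurable (M2 \<Otimes>\<^sub>M M1)"
    by measurable
  define B where "B = (\<lambda>z1. \<integral>\<^sup>+z2. (f (z1, z2))^2 \<partial>M2)"
  have [measurable]: "B \<in> borel_measurable M1" unfolding B_def by measurable
  have T4: "(\<integral>\<^sup>+x2. ?T x2 z ^ 4 \<partial>M2) \<le> (B z)^2" if "z \<in> space M1" for z
  proof -
    have "(\<lambda>u. f (z, u)) \<in> borel_measurable M2" using that by measurable
    from bspec[OF conjunct2[OF h2[unfolded hypercontractive_def]] this] show ?thesis unfolding B_def .
  qed
  have "(\<integral>\<^sup>+x. (\<integral>\<^sup>+y. f (m1 (fst x) (fst y), m2 (snd x) (snd y)) \<partial>(M1 \<Otimes>\<^sub>M M2))^4 \<partial>(M1 \<Otimes>\<^sub>M M2))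
     = (\<integral>\<^sup>+x2. (\<integral>\<^sup>+x1. (\<integral>\<^sup>+y. f (m1 x1 (fst y), m2 x2 (snd y)) \<partial>(M1 \<Otimes>\<^sub>M M2))^4 \<partial>M1) \<partial>M2)"
    by (subst P.nn_integral_snd[symmetric]) (simp_all, measurable)
  also have "\<dots> = (\<integral>\<^sup>+x2. (\<integral>\<^sup>+x1. (\<integral>\<^sup>+y1. ?T x2 (m1 x1 y1) \<partial>M1)^4 \<partial>M1) \<partial>M2)"
  proof (intro nn_integral_cong arg_cong[where f="\<lambda>x. x^4"])
    fix x2 x1 assume [measurable]: "x2 \<in> space M2" "x1 \<in> space M1"
    show "(\<integral>\<^sup>+y. f (m1 x1 (fst y), m2 x2 (snd y)) \<partial>(M1 \<Otimes>\<^sub>M M2)) = (\<integral>\<^sup>+y1. ?T x2 (m1 x1 y1) \<partial>M1)"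
      by (subst M2.nn_integral_fst[symmetric]) (simp_all, measurable)
  qed
  also have "\<dots> \<le> (\<integral>\<^sup>+x2. (\<integral>\<^sup>+z. (?T x2 z)^2 \<partial>M1)^2 \<partial>M2)"
  proof (rule nn_integral_mono)
    fix x2 assume "x2 \<in> space M2"
    then have "?T x2 \<in> borel_measurable M1" by measurable
    from bspec[OF conjunct2[OF h1[unfolded hypercontractive_def]] this]
    show "(\<integral>\<^sup>+x1. (\<integral>\<^sup>+y1. ?T x2 (m1 x1 y1) \<partial>M1)^4 \<partial>M1) \<le> (\<integral>\<^sup>+z. (?T x2 z)^2 \<partial>M1)^2" .
  qed
  also have "\<dots> = (\<integral>\<^sup>+x2. (\<integral>\<^sup>+z. (\<integral>\<^sup>+w. (?T x2 z)^2 * (?T x2 w)^2 \<partial>M1) \<partial>M1) \<partial>M2)"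
  proof (rule nn_integral_cong)
    fix x2 assume x2: "x2 \<in> space M2"
    have [measurable]: "?T x2 \<in> borel_measurable M1" using x2 by measurable
    show "(\<integral>\<^sup>+z. (?T x2 z)^2 \<partial>M1)^2 = (\<integral>\<^sup>+z. (\<integral>\<^sup>+w. (?T x2 z)^2 * (?T x2 w)^2 \<partial>M1) \<partial>M1)"
      by (simp add: nn_integral_cmult nn_integral_multc power2_eq_square[of "nn_integral M1 _"])
  qed
  also have "\<dots> = (\<integral>\<^sup>+z. (\<integral>\<^sup>+x2. (\<integral>\<^sup>+w. (?T x2 z)^2 * (?T x2 w)^2 \<partial>M1) \<partial>M2) \<partial>M1)"
    by (rule P.Fubini') measurable
  also have "\<dots> = (\<integral>\<^sup>+z. (\<integral>\<^sup>+w. (\<integral>\<^sup>+x2. (?T x2 z)^2 * (?T x2 w)^2 \<partial>M2) \<partial>M1) \<partial>M1)"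
  proof (rule nn_integral_cong)
    fix z assume [measurable]: "z \<in> space M1"
    show "(\<integral>\<^sup>+x2. (\<integral>\<^sup>+w. (?T x2 z)^2 * (?T x2 w)^2 \<partial>M1) \<partial>M2) = (\<integral>\<^sup>+w. (\<integral>\<^sup>+x2. (?T x2 z)^2 * (?T x2 w)^2 \<partial>M2) \<partial>M1)"
      by (rule P.Fubini') measurable
  qed
  also have "\<dots> \<le> (\<integral>\<^sup>+z. (\<integral>\<^sup>+w. B z * B w \<partial>M1) \<partial>M1)"
  proof (intro nn_integral_mono)
    fix z w assume z [measurable]: "z \<in> space M1" and w [measurable]: "w \<in> space M1"
    have "(\<integral>\<^sup>+x2. (?T x2 z)^2 * (?T x2 w)^2 \<partial>M2)^2
        \<le> (\<integral>\<^sup>+x2. ((?T x2 z)^2)^2 \<partial>M2) * (\<integral>\<^sup>+x2. ((?T x2 w)^2)^2 \<partial>M2)"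
      by (rule Cauchy_Schwarz_nn_integral) measurable
    also have "\<dots> = (\<integral>\<^sup>+x2. (?T x2 z)^4 \<partial>M2) * (\<integral>\<^sup>+x2. (?T x2 w)^4 \<partial>M2)"
      by (simp flip: power_mult)
    also have "\<dots> \<le> (B z)^2 * (B w)^2"
      by (intro mult_mono T4 z w) auto
    also have "\<dots> = (B z * B w)^2" by (simp add: power_mult_distrib)
    finally show "(\<integral>\<^sup>+x2. (?T x2 z)^2 * (?T x2 w)^2 \<partial>M2) \<le> B z * B w"
      by (rule ennreal_power2_le_imp_le)
  qed
  also have "\<dots> = (\<integral>\<^sup>+z. B z \<partial>M1)^2"
    by (simp add: nn_integral_cmult nn_integral_multc power2_eq_square)
  also have "(\<integral>\<^sup>+z. B z \<partial>M1) = (\<integral>\<^sup>+z. (f z)^2 \<partial>(M1 \<Otimes>\<^sub>M M2))"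
    unfolding B_def by (subst M2.nn_integral_fst[symmetric]) auto
  finally show "(\<integral>\<^sup>+x. (\<integral>\<^sup>+y. f ((\<lambda>x y. (m1 (fst x) (fst y), m2 (snd x) (snd y))) x y) \<partial>(M1 \<Otimes>\<^sub>M M2))^4 \<partial>(M1 \<Otimes>\<^sub>M M2))
     \<le> (\<integral>\<^sup>+z. (f z)^2 \<partial>(M1 \<Otimes>\<^sub>M M2))^2" by simp
qed

lemma hypercontractive_PiM:
  assumes "finite I" and M: "prob_space M" and h: "hypercontractive M m"
  shows "hypercontractive (PiM I (\<lambda>_. M)) (\<lambda>x y. \<lambda>i\<in>I. m (x i) (y i))"
  using assms(1)
proof (induction I)
  case empty
  have "(\<lambda>(x, y). \<lambda>i\<in>{}. m (x i) (y i)) \<in> PiM {} (\<lambda>_. M) \<Otimes>\<^sub>M PiM {} (\<lambda>_. M) \<rightarrow>\<^sub>M PiM {} (\<lambda>_. M)"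
    unfolding case_prod_beta by (intro measurable_restrict) auto
  then show ?case unfolding hypercontractive_def
    by (simp add: PiM_empty nn_integral_count_space_finite flip: power_mult)
next
  case (insert i I)
  interpret M: prob_space M by fact
  interpret product_sigma_finite "\<lambda>_. M" by standard
  interpret PI: prob_space "PiM I (\<lambda>_. M)" by (rule prob_space_PiM) (rule M)
  interpret PI': prob_space "PiM (insert i I) (\<lambda>_. M)" by (rule prob_space_PiM) (rule M)
  let ?P = "PiM I (\<lambda>_. M)" and ?P' = "PiM (insert i I) (\<lambda>_. M)"
  have m: "(\<lambda>(x, y). m x y) \<in> M \<Otimes>\<^sub>M M \<rightarrow>\<^sub>M M" using h unfolding hypercontractive_def by auto
  have m' [measurable]: "(\<lambda>w. m (g w) (k w)) \<in> N \<rightarrow>\<^sub>M M" if "g \<in> N \<rightarrow>\<^sub>M M" "k \<in> N \<rightarrow>\<^sub>M M" for g k and N :: "'d measure"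
    using measurable_compose[OF measurable_Pair[OF that] m] by simp
  have meas: "(\<lambda>(x, y). \<lambda>i\<in>insert i I. m (x i) (y i)) \<in> ?P' \<Otimes>\<^sub>M ?P' \<rightarrow>\<^sub>M ?P'"
    unfolding case_prod_beta by (intro measurable_restrict m') measurable
  have pair: "hypercontractive (?P \<Otimes>\<^sub>M M) (\<lambda>x y. ((\<lambda>i\<in>I. m (fst x i) (fst y i)), m (snd x) (snd y)))"
    using hypercontractive_pair[OF PI.sigma_finite_measure_axioms M.sigma_finite_measure_axioms insert.IH h] .
  have nn: "(\<integral>\<^sup>+x. g x \<partial>?P') = (\<integral>\<^sup>+p. g ((fst p)(i := snd p)) \<partial>(?P \<Otimes>\<^sub>M M))"
    if [measurable]: "g \<in> borel_measurable ?P'" for g :: "_ \<Rightarrow> ennreal"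
  proof -
    have "(\<integral>\<^sup>+x. g x \<partial>?P') = (\<integral>\<^sup>+x. (\<integral>\<^sup>+y. g (x(i := y)) \<partial>M) \<partial>?P)"
      by (rule product_nn_integral_insert[OF insert.hyps that])
    also have "\<dots> = (\<integral>\<^sup>+p. g ((fst p)(i := snd p)) \<partial>(?P \<Otimes>\<^sub>M M))"
      by (subst M.nn_integral_fst[symmetric]) auto
    finally show ?thesis .
  qed
  show ?case unfolding hypercontractive_def
  proof (intro conjI ballI meas)
    fix f :: "_ \<Rightarrow> ennreal" assume f [measurable]: "f \<in> borel_measurable ?P'"
    have f' [measurable]: "(\<lambda>p. f ((fst p)(i := snd p))) \<in> borel_measurable (?P \<Otimes>\<^sub>M M)" by measurable
    have mm [measurable]: "(\<lambda>w. \<lambda>j\<in>insert i I. m (g w j) (k w j)) \<in> N \<rightarrow>\<^sub>M ?P'"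
      if [measurable]: "g \<in> N \<rightarrow>\<^sub>M ?P'" "k \<in> N \<rightarrow>\<^sub>M ?P'" for g k and N :: "'d measure"
      by (intro measurable_restrict m') measurable
    have "(\<integral>\<^sup>+x. (\<integral>\<^sup>+y. f (\<lambda>j\<in>insert i I. m (x j) (y j)) \<partial>?P')^4 \<partial>?P')
       = (\<integral>\<^sup>+p. (\<integral>\<^sup>+y. f (\<lambda>j\<in>insert i I. m (((fst p)(i := snd p)) j) (y j)) \<partial>?P')^4 \<partial>(?P \<Otimes>\<^sub>M M))"
      by (rule nn) measurable
    also have "\<dots> = (\<integral>\<^sup>+p. (\<integral>\<^sup>+q. f ((fst (((\<lambda>j\<in>I. m (fst p j) (fst q j)), m (snd p) (snd q))))
        (i := snd (((\<lambda>j\<in>I. m (fst p j) (fst q j)), m (snd p) (snd q))))) \<partial>(?P \<Otimes>\<^sub>M M))^4 \<partial>(?P \<Otimes>\<^sub>M M))"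
    proof (intro nn_integral_cong arg_cong[where f="\<lambda>x. x^4"])
      fix p assume p: "p \<in> space (?P \<Otimes>\<^sub>M M)"
      have [measurable]: "(fst p)(i := snd p) \<in> space ?P'"
        using p by (auto simp: space_pair_measure space_PiM PiE_iff extensional_def)
      have "(\<integral>\<^sup>+y. f (\<lambda>j\<in>insert i I. m (((fst p)(i := snd p)) j) (y j)) \<partial>?P')
         = (\<integral>\<^sup>+q. f (\<lambda>j\<in>insert i I. m (((fst p)(i := snd p)) j) (((fst q)(i := snd q)) j)) \<partial>(?P \<Otimes>\<^sub>M M))"
        by (rule nn) measurable
      also have "\<dots> = (\<integral>\<^sup>+q. f ((fst (((\<lambda>j\<in>I. m (fst p j) (fst q j)), m (snd p) (snd q))))
        (i := snd (((\<lambda>j\<in>I. m (fst p j) (fst q j)), m (snd p) (snd q))))) \<partial>(?P \<Otimes>\<^sub>M M))"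
        using insert.hyps by (intro nn_integral_cong arg_cong[where f=f]) (auto simp: fun_eq_iff restrict_def)
      finally show "(\<integral>\<^sup>+y. f (\<lambda>j\<in>insert i I. m (((fst p)(i := snd p)) j) (y j)) \<partial>?P') = \<dots>" .
    qed
    also have "\<dots> \<le> (\<integral>\<^sup>+p. (f ((fst p)(i := snd p)))^2 \<partial>(?P \<Otimes>\<^sub>M M))^2"
      by (rule bspec[OF conjunct2[OF pair[unfolded hypercontractive_def]] f'])
    also have "\<dots> = (\<integral>\<^sup>+z. (f z)^2 \<partial>?P')^2"
      by (subst nn) auto
    finally show "(\<integral>\<^sup>+x. (\<integral>\<^sup>+y. f (\<lambda>j\<in>insert i I. m (x j) (y j)) \<partial>?P')^4 \<partial>?P') \<le> (\<integral>\<^sup>+z. (f z)^2 \<partial>?P')^2" .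
  qed
qed

section \<open>Polynomials on Gaussian space\<close>

text \<open>
  A stand-in for polynomials of degree at most \<open>d\<close> in \<open>N\<close> variables: only the restrictions to
  ellipses \<open>\<rho> x + \<sigma> y\<close> matter, and these are trigonometric polynomials of degree \<open>d\<close>, written with
  the even powers of \<open>\<sigma>\<close> eliminated. The condition on \<open>pCons 0 R\<close> says that \<open>R\<close> has degree at most
  \<open>d - 1\<close>, or vanishes when \<open>d = 0\<close>.
\<close>

definition trig_degree :: "nat \<Rightarrow> nat \<Rightarrow> ((nat \<Rightarrow> real) \<Rightarrow> real) \<Rightarrow> bool" where
  "trig_degree N d F \<longleftrightarrow> (\<forall>x y. \<exists>Q R. degree Q \<le> d \<and> degree (pCons 0 R) \<le> d \<and>
     (\<forall>\<rho> \<sigma>. \<rho>\<^sup>2 + \<sigma>\<^sup>2 = 1 \<longrightarrow> F (\<lambda>i\<in>{..<N}. \<rho> * x i + \<sigma> * y i) = poly Q \<rho> + \<sigma> * poly R \<rho>))"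

lemma trig_degree_mono: "trig_degree N d F \<Longrightarrow> d \<le> e \<Longrightarrow> trig_degree N e F"
  unfolding trig_degree_def by (meson order_trans)

lemma trig_degree_const: "trig_degree N d (\<lambda>_. c)"
  unfolding trig_degree_def by (intro allI exI[of _ "[:c:]"] exI[of _ 0]) auto

lemma trig_degree_linear: "trig_degree N 1 (\<lambda>x. \<Sum>i<N. a i * x i)"
  unfolding trig_degree_def
proof (intro allI)
  fix x y :: "nat \<Rightarrow> real"
  show "\<exists>Q R. degree Q \<le> 1 \<and> degree (pCons 0 R) \<le> 1 \<and>
     (\<forall>\<rho> \<sigma>. \<rho>\<^sup>2 + \<sigma>\<^sup>2 = 1 \<longrightarrow> (\<Sum>i<N. a i * (\<lambda>i\<in>{..<N}. \<rho> * x i + \<sigma> * y i) i) = poly Q \<rho> + \<sigma> * poly R \<rho>)"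
    by (intro exI[of _ "[:0, \<Sum>i<N. a i * x i:]"] exI[of _ "[:\<Sum>i<N. a i * y i:]"])
       (auto simp: sum_distrib_left sum.distrib algebra_simps intro!: degree_pCons_le[THEN order_trans])
qed

lemma trig_degree_add:
  assumes "trig_degree N d F" "trig_degree N d G"
  shows "trig_degree N d (\<lambda>x. F x + G x)"
  unfolding trig_degree_def
proof (intro allI)
  fix x y :: "nat \<Rightarrow> real"
  from assms(1)[unfolded trig_degree_def, rule_format, of x y] obtain Q R where Q1: "degree Q \<le> d" "degree (pCons 0 R) \<le> d"
    and F: "\<And>\<rho> \<sigma>. \<rho>\<^sup>2 + \<sigma>\<^sup>2 = 1 \<Longrightarrow> F (\<lambda>i\<in>{..<N}. \<rho> * x i + \<sigma> * y i) = poly Q \<rho> + \<sigma> * poly R \<rho>"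
    by blast
  from assms(2)[unfolded trig_degree_def, rule_format, of x y] obtain Q' R' where Q2: "degree Q' \<le> d" "degree (pCons 0 R') \<le> d"
    and G: "\<And>\<rho> \<sigma>. \<rho>\<^sup>2 + \<sigma>\<^sup>2 = 1 \<Longrightarrow> G (\<lambda>i\<in>{..<N}. \<rho> * x i + \<sigma> * y i) = poly Q' \<rho> + \<sigma> * poly R' \<rho>"
    by blast
  note Q = Q1 Q2
  have "pCons 0 (R + R') = pCons 0 R + pCons 0 R'" by simp
  then have "degree (pCons 0 (R + R')) \<le> d" using Q by (simp only: degree_add_le)
  then show "\<exists>Q R. degree Q \<le> d \<and> degree (pCons 0 R) \<le> d \<and>
     (\<forall>\<rho> \<sigma>. \<rho>\<^sup>2 + \<sigma>\<^sup>2 = 1 \<longrightarrow> F (\<lambda>i\<in>{..<N}. \<rho> * x i + \<sigma> * y i) + G (\<lambda>i\<in>{..<N}. \<rho> * x i + \<sigma> * y i) = poly Q \<rho> + \<sigma> * poly R \<rho>)"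
    using Q by (intro exI[of _ "Q + Q'"] exI[of _ "R + R'"]) (auto simp: F G degree_add_le algebra_simps)
qed

text \<open>
  The product of the two odd parts is reduced with \<open>\<sigma>\<^sup>2 = 1 - \<rho>\<^sup>2\<close>.
\<close>

lemma trig_degree_mult:
  assumes "trig_degree N d F" "trig_degree N e G"
  shows "trig_degree N (d + e) (\<lambda>x. F x * G x)"
  unfolding trig_degree_def
proof (intro allI)
  fix x y :: "nat \<Rightarrow> real"
  from assms(1)[unfolded trig_degree_def, rule_format, of x y] obtain Q R where Q1: "degree Q \<le> d" "degree (pCons 0 R) \<le> d"
    and F: "\<And>\<rho> \<sigma>. \<rho>\<^sup>2 + \<sigma>\<^sup>2 = 1 \<Longrightarrow> F (\<lambda>i\<in>{..<N}. \<rho> * x i + \<sigma> * y i) = poly Q \<rho> + \<sigma> * poly R \<rho>"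
    by blast
  from assms(2)[unfolded trig_degree_def, rule_format, of x y] obtain Q' R' where Q2: "degree Q' \<le> e" "degree (pCons 0 R') \<le> e"
    and G: "\<And>\<rho> \<sigma>. \<rho>\<^sup>2 + \<sigma>\<^sup>2 = 1 \<Longrightarrow> G (\<lambda>i\<in>{..<N}. \<rho> * x i + \<sigma> * y i) = poly Q' \<rho> + \<sigma> * poly R' \<rho>"
    by blast
  note Q = Q1 Q2
  let ?P = "[:1, 0, -1:] :: real poly"
  have "degree (Q * Q') \<le> d + e" using degree_mult_le[of Q Q'] Q by simp
  moreover have "degree (?P * (R * R')) \<le> d + e"
  proof (cases "R = 0 \<or> R' = 0")
    case False
    then have "Suc (degree R) \<le> d" "Suc (degree R') \<le> e" using Q by auto
    moreover have "degree (?P * (R * R')) \<le> 2 + (degree R + degree R')"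
      using degree_mult_le[of ?P "R * R'"] degree_mult_le[of R R'] by (simp add: numeral_2_eq_2)
    ultimately show ?thesis by simp
  qed auto
  ultimately have 1: "degree (Q * Q' + ?P * (R * R')) \<le> d + e" by (rule degree_add_le)
  have "pCons 0 (Q * R' + Q' * R) = Q * pCons 0 R' + Q' * pCons 0 R" by simp
  moreover have "degree (Q * pCons 0 R') \<le> d + e" "degree (Q' * pCons 0 R) \<le> d + e"
    using degree_mult_le[of Q "pCons 0 R'"] degree_mult_le[of Q' "pCons 0 R"] Q by linarith+
  ultimately have 2: "degree (pCons 0 (Q * R' + Q' * R)) \<le> d + e" by (simp only: degree_add_le)
  have 3: "F (\<lambda>i\<in>{..<N}. \<rho> * x i + \<sigma> * y i) * G (\<lambda>i\<in>{..<N}. \<rho> * x i + \<sigma> * y i)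
     = poly (Q * Q' + ?P * (R * R')) \<rho> + \<sigma> * poly (Q * R' + Q' * R) \<rho>" if h: "\<rho>\<^sup>2 + \<sigma>\<^sup>2 = 1" for \<rho> \<sigma>
  proof -
    have "poly ?P \<rho> = \<sigma> * \<sigma>" using h by (simp add: power2_eq_square algebra_simps)
    then show ?thesis unfolding F[OF h] G[OF h] by (simp only: poly_add poly_mult) (simp add: algebra_simps)
  qed
  show "\<exists>Q R. degree Q \<le> d + e \<and> degree (pCons 0 R) \<le> d + e \<and>
     (\<forall>\<rho> \<sigma>. \<rho>\<^sup>2 + \<sigma>\<^sup>2 = 1 \<longrightarrow> F (\<lambda>i\<in>{..<N}. \<rho> * x i + \<sigma> * y i) * G (\<lambda>i\<in>{..<N}. \<rho> * x i + \<sigma> * y i) = poly Q \<rho> + \<sigma> * poly R \<rho>)"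
    using 1 2 3 by blast
qed

lemma trig_degree_scale: "trig_degree N d F \<Longrightarrow> trig_degree N d (\<lambda>x. c * F x)"
  using trig_degree_mult[OF trig_degree_const[of N 0 c], of d F] by simp

lemma trig_degree_sum:
  assumes "finite A" "\<And>k. k \<in> A \<Longrightarrow> trig_degree N d (F k)"
  shows "trig_degree N d (\<lambda>x. \<Sum>k\<in>A. F k x)"
  using assms
proof (induction A)
  case empty
  show ?case using trig_degree_const[of N d 0] by simp
next
  case (insert a A)
  then show ?case using trig_degree_add[of N d "F a" "\<lambda>x. \<Sum>k\<in>A. F k x"] by simp
qed

lemma trig_degree_power: "trig_degree N d F \<Longrightarrow> trig_degree N (k * d) (\<lambda>x. F x ^ k)"
proof (induction k)
  case 0
  show ?case using trig_degree_const[of N 0 1] by simp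
next
  case (Suc k)
  then show ?case using trig_degree_mult[of N d F "k * d" "\<lambda>x. F x ^ k"] by simp
qed

text \<open>
  Lagrange interpolation at the nodes \<open>\<rho> i\<close>, evaluated at \<open>t\<close>.
\<close>

lemma polynomial_extrapolation:
  fixes \<rho> :: "nat \<Rightarrow> real"
  assumes inj: "inj_on \<rho> {..d}"
  shows "\<exists>c. \<forall>Q. degree Q \<le> d \<longrightarrow> poly Q t = (\<Sum>i\<le>d. c i * poly Q (\<rho> i))"
proof -
  define L where "L = (\<lambda>i. \<Prod>j\<in>{..d} - {i}. smult (1 / (\<rho> i - \<rho> j)) [:- \<rho> j, 1:])"
  have L: "poly (L i) (\<rho> k) = (if i = k then 1 else 0)" if "i \<le> d" "k \<le> d" for i k
  proof (cases "i = k")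
    case True
    have "poly (L i) (\<rho> i) = (\<Prod>j\<in>{..d} - {i}. 1)"
      unfolding L_def poly_prod
    proof (rule prod.cong)
      fix j assume "j \<in> {..d} - {i}"
      then have "\<rho> i \<noteq> \<rho> j" using that inj by (auto dest: inj_onD)
      then show "poly (smult (1 / (\<rho> i - \<rho> j)) [:- \<rho> j, 1:]) (\<rho> i) = 1" by (simp add: diff_divide_distrib[symmetric])
    qed simp
    then show ?thesis using True by simp
  next
    case False
    then show ?thesis unfolding L_def poly_prod using that
      by (auto intro!: prod_zero bexI[of _ k])
  qed
  have dL: "degree (L i) \<le> d" if "i \<le> d" for i
  proof -
    have "degree (L i) \<le> (\<Sum>j\<in>{..d} - {i}. degree (smult (1 / (\<rho> i - \<rho> j)) [:- \<rho> j, 1:]))"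
      unfolding L_def using degree_prod_sum_le[of "{..d} - {i}" "\<lambda>j. smult (1 / (\<rho> i - \<rho> j)) [:- \<rho> j, 1:]"]
      by (simp only: o_def finite_Diff finite_atMost)
    also have "\<dots> \<le> (\<Sum>j\<in>{..d} - {i}. 1)"
      by (intro sum_mono order_trans[OF degree_smult_le]) simp
    finally show ?thesis using that by simp
  qed
  show ?thesis
  proof (intro exI[of _ "\<lambda>i. poly (L i) t"] allI impI)
    fix Q :: "real poly" assume Q: "degree Q \<le> d"
    have "Q = (\<Sum>i\<le>d. smult (poly Q (\<rho> i)) (L i))"
    proof (rule poly_eqI_degree)
      show "poly Q x = poly (\<Sum>i\<le>d. smult (poly Q (\<rho> i)) (L i)) x" if "x \<in> \<rho> ` {..d}" for x
        using that by (auto simp: poly_sum L if_distrib cong: if_cong)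
      have "degree (\<Sum>i\<le>d. smult (poly Q (\<rho> i)) (L i)) \<le> d"
        by (intro degree_sum_le) (auto intro!: order_trans[OF degree_smult_le] dL)
      then show "card (\<rho> ` {..d}) > degree Q" "card (\<rho> ` {..d}) > degree (\<Sum>i\<le>d. smult (poly Q (\<rho> i)) (L i))"
        using Q by (auto simp: card_image[OF inj])
    qed
    then have "poly Q t = poly (\<Sum>i\<le>d. smult (poly Q (\<rho> i)) (L i)) t" by simp
    then show "poly Q t = (\<Sum>i\<le>d. poly (L i) t * poly Q (\<rho> i))"
      by (simp add: poly_sum mult.commute)
  qed
qed

abbreviation gaussian_space :: "nat \<Rightarrow> (nat \<Rightarrow> real) measure" where
  "gaussian_space N \<equiv> \<Pi>\<^sub>M k\<in>{..<N}. std_normal_distribution"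

lemma prob_space_gaussian_space: "prob_space (gaussian_space N)"
  by (intro prob_space_PiM prob_space_std_normal)

text \<open>
  The functions \<open>x \<mapsto> sup |p(x)|\<close> over a family of polynomials of degree at most \<open>d\<close>, with the
  supremum attained at every \<open>x\<close>. The norm of a vector valued polynomial has this form, with the
  family given by the functionals in the dual unit ball.
\<close>

definition polynomial_sup :: "nat \<Rightarrow> nat \<Rightarrow> ((nat \<Rightarrow> real) \<Rightarrow> real) \<Rightarrow> bool" where
  "polynomial_sup N d f \<longleftrightarrow> (\<forall>x\<in>space (gaussian_space N). \<exists>p. trig_degree N d p \<and> \<bar>p x\<bar> = f x \<and>
     (\<forall>z\<in>space (gaussian_space N). \<bar>p z\<bar> \<le> f z))"

text \<open>The powers of the polynomials in the family form a family for the power of the supremum.\<close>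

lemma polynomial_sup_power:
  assumes "polynomial_sup N d f"
  shows "polynomial_sup N (k * d) (\<lambda>x. f x ^ k)"
  unfolding polynomial_sup_def
proof
  fix x assume "x \<in> space (gaussian_space N)"
  with assms obtain p where "trig_degree N d p" "\<bar>p x\<bar> = f x" "\<forall>z\<in>space (gaussian_space N). \<bar>p z\<bar> \<le> f z"
    unfolding polynomial_sup_def by blast
  then show "\<exists>p. trig_degree N (k * d) p \<and> \<bar>p x\<bar> = f x ^ k \<and> (\<forall>z\<in>space (gaussian_space N). \<bar>p z\<bar> \<le> f z ^ k)"
    by (intro exI[of _ "\<lambda>x. p x ^ k"]) (auto simp: trig_degree_power power_abs intro: power_mono)
qed

lemma ennreal_sum_power_le:
  fixes a :: "'i \<Rightarrow> ennreal"
  assumes "finite S" "k > 0"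
  shows "(\<Sum>s\<in>S. a s)^k \<le> of_nat (card S)^k * (\<Sum>s\<in>S. a s ^ k)"
proof (cases "S = {}")
  case False
  define m where "m = Max (a ` S)"
  have "m \<in> a ` S" unfolding m_def using assms False by (intro Max_in) auto
  then obtain t where t: "t \<in> S" "m = a t" by auto
  have "(\<Sum>s\<in>S. a s) \<le> of_nat (card S) * m"
    unfolding m_def using assms by (intro sum_bounded_above) auto
  then have "(\<Sum>s\<in>S. a s)^k \<le> (of_nat (card S) * m)^k" by (rule power_mono) simp
  also have "\<dots> = of_nat (card S)^k * a t ^ k" by (simp add: power_mult_distrib t)
  also have "\<dots> \<le> of_nat (card S)^k * (\<Sum>s\<in>S. a s ^ k)"
    using assms t by (intro mult_left_mono member_le_sum) auto
  finally show ?thesis .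
qed (use assms in simp)

text \<open>
  For the polynomial \<open>p\<close> that attains the supremum at \<open>x\<close>, extrapolation to \<open>\<rho> = 1\<close> expresses
  \<open>p(x)\<close> by the values \<open>p(\<rho>\<^sub>i x \<plusminus> \<sigma>\<^sub>i y)\<close>, which are bounded by \<open>f\<close> at the same points. Integrating
  over \<open>y\<close> bounds \<open>f\<close> by finitely many Mehler operators applied to \<open>f\<close>, and each of them is
  contractive from \<open>L\<^sup>2\<close> to \<open>L\<^sup>4\<close>.
\<close>

lemma polynomial_sup_fourth_moment:
  "\<exists>C\<ge>0. \<forall>N f. polynomial_sup N d f \<longrightarrow> f \<in> borel_measurable (gaussian_space N) \<longrightarrow>
     (\<integral>\<^sup>+x. ennreal (f x)^4 \<partial>gaussian_space N) \<le> ennreal C * (\<integral>\<^sup>+x. ennreal (f x)^2 \<partial>gaussian_space N)^2"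
proof -
  \<comment> \<open>\<open>d + 1\<close> distinct nodes in the interval where the Mehler operators are hypercontractive\<close>
  define \<rho> where "\<rho> = (\<lambda>i::nat. (real i + 1) / (10 * (real d + 1)))"
  define \<sigma> where "\<sigma> = (\<lambda>i. sqrt (1 - (\<rho> i)\<^sup>2))"
  have inj: "inj_on \<rho> {..d}" unfolding \<rho>_def by (auto intro!: inj_onI simp: field_simps)
  have \<rho>: "0 \<le> \<rho> i" "i \<le> d \<Longrightarrow> \<rho> i \<le> 1/10" for i unfolding \<rho>_def by (auto simp: field_simps)
  have \<sigma>: "(\<rho> i)\<^sup>2 + (\<sigma> i)\<^sup>2 = 1" if "i \<le> d" for i
  proof -
    have "(\<rho> i)\<^sup>2 \<le> (1/10)\<^sup>2" using \<rho>[of i] that by (intro power_mono) auto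
    then show ?thesis unfolding \<sigma>_def by (simp add: power_divide)
  qed
  obtain c where c: "\<And>Q. degree Q \<le> d \<Longrightarrow> poly Q 1 = (\<Sum>i\<le>d. c i * poly Q (\<rho> i))"
    using polynomial_extrapolation[OF inj, of 1] by blast
  \<comment> \<open>pairs of a node and a sign of \<open>\<sigma>\<close>; adding the two signs cancels the part odd in \<open>\<sigma>\<close>\<close>
  define S where "S = {..d} \<times> {1, -1::real}"
  define C where "C = real (card S)^4 * (\<Sum>s\<in>S. \<bar>c (fst s)\<bar>^4)"
  have fS: "finite S" unfolding S_def by simp
  have C0: "C \<ge> 0" unfolding C_def by (simp add: sum_nonneg)
  show ?thesis
  proof (intro exI[of _ C] conjI allI impI C0)
    fix N and f :: "(nat \<Rightarrow> real) \<Rightarrow> real"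
    assume ps: "polynomial_sup N d f" and [measurable]: "f \<in> borel_measurable (gaussian_space N)"
    interpret G: prob_space "gaussian_space N" by (rule prob_space_gaussian_space)
    define m where "m = (\<lambda>s x y. \<lambda>j\<in>{..<N}. \<rho> (fst s) * x j + (snd s * \<sigma> (fst s)) * y j)"
    have hyp: "hypercontractive (gaussian_space N) (m s)" if "s \<in> S" for s
      unfolding m_def using that \<rho> \<sigma> unfolding S_def
      by (intro hypercontractive_PiM prob_space_std_normal hypercontractive_normal) (auto simp: power_mult_distrib)
    have mm: "(\<lambda>(x, y). m s x y) \<in> gaussian_space N \<Otimes>\<^sub>M gaussian_space N \<rightarrow>\<^sub>M gaussian_space N" if "s \<in> S" for s
      using hyp[OF that] unfolding hypercontractive_def by blast
    have fm: "(\<lambda>p. ennreal (f (m s (fst p) (snd p)))) \<in> borel_measurable (gaussian_space N \<Otimes>\<^sub>M gaussian_space N)" if "s \<in> S" for s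
    proof -
      have "(\<lambda>p. ennreal (f ((\<lambda>(x, y). m s x y) p))) \<in> borel_measurable (gaussian_space N \<Otimes>\<^sub>M gaussian_space N)"
        using mm[OF that] by measurable
      then show ?thesis by (simp add: case_prod_beta)
    qed
    define h where "h = (\<lambda>s x. \<integral>\<^sup>+y. ennreal (f (m s x y)) \<partial>gaussian_space N)"
    have hm: "h s \<in> borel_measurable (gaussian_space N)" if "s \<in> S" for s
      unfolding h_def using G.borel_measurable_nn_integral[of "\<lambda>x y. ennreal (f (m s x y))" "gaussian_space N"] fm[OF that]
      by (simp add: case_prod_beta)
    have h4: "(\<integral>\<^sup>+x. h s x ^ 4 \<partial>gaussian_space N) \<le> (\<integral>\<^sup>+x. ennreal (f x)^2 \<partial>gaussian_space N)^2" if "s \<in> S" for s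
    proof -
      have "(\<lambda>x. ennreal (f x)) \<in> borel_measurable (gaussian_space N)" by measurable
      from bspec[OF conjunct2[OF hyp[OF that, unfolded hypercontractive_def]] this]
      show ?thesis unfolding h_def .
    qed
    have pointwise: "ennreal (f x) \<le> (\<Sum>s\<in>S. ennreal \<bar>c (fst s)\<bar> * ennreal (f (m s x y)))"
      if x: "x \<in> space (gaussian_space N)" and y: "y \<in> space (gaussian_space N)" for x y
    proof -
      obtain p where p: "trig_degree N d p" "\<bar>p x\<bar> = f x" "\<And>z. z \<in> space (gaussian_space N) \<Longrightarrow> \<bar>p z\<bar> \<le> f z"
        using ps x unfolding polynomial_sup_def by blast
      obtain Q R where Q: "degree Q \<le> d"
        and QR: "\<And>\<rho> \<sigma>. \<rho>\<^sup>2 + \<sigma>\<^sup>2 = 1 \<Longrightarrow> p (\<lambda>i\<in>{..<N}. \<rho> * x i + \<sigma> * y i) = poly Q \<rho> + \<sigma> * poly R \<rho>"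
        using p(1) unfolding trig_degree_def by blast
      have "(\<lambda>i\<in>{..<N}. x i) = x" using x by (auto simp: space_PiM PiE_def extensional_restrict)
      then have "p x = poly Q 1" using QR[of 1 0] by simp
      have ms: "m s x y \<in> space (gaussian_space N)" if "s \<in> S" for s
        unfolding m_def by (simp add: space_PiM)
      have fnn: "0 \<le> f (m s x y)" if "s \<in> S" for s using p(3)[OF ms[OF that]] by linarith
      have "f x = \<bar>\<Sum>i\<le>d. c i * poly Q (\<rho> i)\<bar>" unfolding p(2)[symmetric] \<open>p x = poly Q 1\<close> c[OF Q] ..
      also have "\<dots> \<le> (\<Sum>i\<le>d. \<bar>c i\<bar> * \<bar>poly Q (\<rho> i)\<bar>)"
        by (rule order_trans[OF sum_abs]) (simp add: abs_mult)
      also have "\<dots> \<le> (\<Sum>i\<le>d. \<bar>c i\<bar> * f (m (i, 1) x y) + \<bar>c i\<bar> * f (m (i, -1) x y))"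
      proof (rule sum_mono)
        fix i assume "i \<in> {..d}"
        then have i: "i \<le> d" and S: "(i, 1) \<in> S" "(i, -1) \<in> S" unfolding S_def by auto
        have "p (m (i, 1) x y) = poly Q (\<rho> i) + \<sigma> i * poly R (\<rho> i)"
          "p (m (i, -1) x y) = poly Q (\<rho> i) + (- \<sigma> i) * poly R (\<rho> i)"
          using QR[of "\<rho> i" "\<sigma> i"] QR[of "\<rho> i" "- \<sigma> i"] \<sigma>[OF i] unfolding m_def by auto
        then have "2 * poly Q (\<rho> i) = p (m (i, 1) x y) + p (m (i, -1) x y)" by simp
        moreover have "\<bar>p (m (i, 1) x y)\<bar> \<le> f (m (i, 1) x y)" "\<bar>p (m (i, -1) x y)\<bar> \<le> f (m (i, -1) x y)"
          using p(3) ms S by auto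
        ultimately have "\<bar>poly Q (\<rho> i)\<bar> \<le> f (m (i, 1) x y) + f (m (i, -1) x y)" by linarith
        then show "\<bar>c i\<bar> * \<bar>poly Q (\<rho> i)\<bar> \<le> \<bar>c i\<bar> * f (m (i, 1) x y) + \<bar>c i\<bar> * f (m (i, -1) x y)"
          by (simp add: mult_left_mono flip: distrib_left)
      qed
      also have "\<dots> = (\<Sum>s\<in>S. \<bar>c (fst s)\<bar> * f (m s x y))"
        unfolding S_def by (subst sum.cartesian_product') simp
      finally have "ennreal (f x) \<le> ennreal (\<Sum>s\<in>S. \<bar>c (fst s)\<bar> * f (m s x y))" by (rule ennreal_leI)
      also have "\<dots> = (\<Sum>s\<in>S. ennreal (\<bar>c (fst s)\<bar> * f (m s x y)))"
        using fnn by (intro sum_ennreal[symmetric]) auto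
      also have "\<dots> = (\<Sum>s\<in>S. ennreal \<bar>c (fst s)\<bar> * ennreal (f (m s x y)))"
        by (intro sum.cong ennreal_mult') auto
      finally show ?thesis .
    qed
    have le: "ennreal (f x) \<le> (\<Sum>s\<in>S. ennreal \<bar>c (fst s)\<bar> * h s x)" if x: "x \<in> space (gaussian_space N)" for x
    proof -
      have fmx: "(\<lambda>y. ennreal (f (m s x y))) \<in> borel_measurable (gaussian_space N)" if "s \<in> S" for s
        using measurable_compose[OF measurable_Pair1'[OF x] fm[OF that]] by simp
      have "ennreal (f x) = (\<integral>\<^sup>+y. ennreal (f x) \<partial>gaussian_space N)"
        using G.emeasure_space_1 by simp
      also have "\<dots> \<le> (\<integral>\<^sup>+y. (\<Sum>s\<in>S. ennreal \<bar>c (fst s)\<bar> * ennreal (f (m s x y))) \<partial>gaussian_space N)"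
        by (intro nn_integral_mono pointwise x)
      also have "\<dots> = (\<Sum>s\<in>S. ennreal \<bar>c (fst s)\<bar> * h s x)"
        using fmx unfolding h_def by (subst nn_integral_sum) (auto intro!: sum.cong nn_integral_cmult)
      finally show ?thesis .
    qed
    have "(\<integral>\<^sup>+x. ennreal (f x)^4 \<partial>gaussian_space N) \<le> (\<integral>\<^sup>+x. of_nat (card S)^4 * (\<Sum>s\<in>S. (ennreal \<bar>c (fst s)\<bar> * h s x)^4) \<partial>gaussian_space N)"
      by (intro nn_integral_mono order_trans[OF power_mono[OF le] ennreal_sum_power_le[OF fS zero_less_numeral]]) auto
    also have "\<dots> = of_nat (card S)^4 * (\<Sum>s\<in>S. ennreal \<bar>c (fst s)\<bar>^4 * (\<integral>\<^sup>+x. h s x^4 \<partial>gaussian_space N))"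
      using hm by (subst nn_integral_cmult, measurable, subst nn_integral_sum)
        (auto intro!: sum.cong arg_cong2[where f="(*)"] simp: power_mult_distrib nn_integral_cmult)
    also have "\<dots> \<le> of_nat (card S)^4 * (\<Sum>s\<in>S. ennreal \<bar>c (fst s)\<bar>^4 * (\<integral>\<^sup>+x. ennreal (f x)^2 \<partial>gaussian_space N)^2)"
      by (intro mult_left_mono sum_mono h4) auto
    also have "\<dots> = ennreal C * (\<integral>\<^sup>+x. ennreal (f x)^2 \<partial>gaussian_space N)^2"
    proof -
      have "ennreal C = of_nat (card S)^4 * (\<Sum>s\<in>S. ennreal \<bar>c (fst s)\<bar>^4)"
        unfolding C_def by (simp add: ennreal_mult sum_nonneg ennreal_power sum_ennreal ennreal_of_nat_eq_real_of_nat)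
      then show ?thesis by (simp add: sum_distrib_right mult.assoc)
    qed
    finally show "(\<integral>\<^sup>+x. ennreal (f x)^4 \<partial>gaussian_space N) \<le> ennreal C * (\<integral>\<^sup>+x. ennreal (f x)^2 \<partial>gaussian_space N)^2" .
  qed
qed

text \<open>
  The fourth moment inequality for \<open>f\<^bsup>k\<^esup>\<close> with \<open>k = 2\<^bsup>j\<^esup>\<close> bounds the moment of order \<open>4k\<close> by the
  square of that of order \<open>2k\<close>.
\<close>

lemma polynomial_sup_moments:
  "\<exists>C\<ge>0. \<forall>N f. polynomial_sup N d f \<longrightarrow> f \<in> borel_measurable (gaussian_space N) \<longrightarrow>
     (\<integral>\<^sup>+x. ennreal (f x)^(2^Suc j) \<partial>gaussian_space N) \<le> ennreal C * (\<integral>\<^sup>+x. ennreal (f x)^2 \<partial>gaussian_space N)^(2^j)"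
proof (induction j)
  case 0
  show ?case by (intro exI[of _ 1]) auto
next
  case (Suc j)
  then obtain C where C: "C \<ge> 0" "\<And>N f. polynomial_sup N d f \<Longrightarrow> f \<in> borel_measurable (gaussian_space N) \<Longrightarrow>
     (\<integral>\<^sup>+x. ennreal (f x)^(2^Suc j) \<partial>gaussian_space N) \<le> ennreal C * (\<integral>\<^sup>+x. ennreal (f x)^2 \<partial>gaussian_space N)^(2^j)"
    by blast
  obtain K where K: "K \<ge> 0" "\<And>N f. polynomial_sup N (2^j * d) f \<Longrightarrow> f \<in> borel_measurable (gaussian_space N) \<Longrightarrow>
     (\<integral>\<^sup>+x. ennreal (f x)^4 \<partial>gaussian_space N) \<le> ennreal K * (\<integral>\<^sup>+x. ennreal (f x)^2 \<partial>gaussian_space N)^2"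
    using polynomial_sup_fourth_moment[of "2^j * d"] by blast
  show ?case
  proof (intro exI[of _ "K * C^2"] conjI allI impI)
    show "0 \<le> K * C^2" using K(1) C(1) by simp
    fix N and f :: "(nat \<Rightarrow> real) \<Rightarrow> real"
    assume ps: "polynomial_sup N d f" and f [measurable]: "f \<in> borel_measurable (gaussian_space N)"
    let ?G = "gaussian_space N"
    have fnn: "0 \<le> f x" if "x \<in> space ?G" for x
      using ps that unfolding polynomial_sup_def by (metis abs_ge_zero)
    have "(\<integral>\<^sup>+x. ennreal (f x)^(2^Suc (Suc j)) \<partial>?G) = (\<integral>\<^sup>+x. ennreal (f x ^ (2^j))^4 \<partial>?G)"
    proof (rule nn_integral_cong)
      fix x assume "x \<in> space ?G"
      have "(2::nat)^Suc (Suc j) = 2^j * 4" by simp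
      then show "ennreal (f x)^(2^Suc (Suc j)) = ennreal (f x ^ (2^j))^4"
        using fnn[OF \<open>x \<in> space ?G\<close>] by (simp only: ennreal_power[symmetric] power_mult)
    qed
    also have "\<dots> \<le> ennreal K * (\<integral>\<^sup>+x. ennreal (f x ^ (2^j))^2 \<partial>?G)^2"
      by (rule K(2)[OF polynomial_sup_power[OF ps]]) measurable
    also have "(\<integral>\<^sup>+x. ennreal (f x ^ (2^j))^2 \<partial>?G) = (\<integral>\<^sup>+x. ennreal (f x)^(2^Suc j) \<partial>?G)"
    proof (rule nn_integral_cong)
      fix x assume "x \<in> space ?G"
      have "(2::nat)^Suc j = 2^j * 2" by simp
      then show "ennreal (f x ^ (2^j))^2 = ennreal (f x)^(2^Suc j)"
        using fnn[OF \<open>x \<in> space ?G\<close>] by (simp only: ennreal_power[symmetric] power_mult)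
    qed
    also have "ennreal K * (\<integral>\<^sup>+x. ennreal (f x)^(2^Suc j) \<partial>?G)^2 \<le> ennreal K * (ennreal C * (\<integral>\<^sup>+x. ennreal (f x)^2 \<partial>?G)^(2^j))^2"
      by (intro mult_left_mono power_mono C(2) ps f) auto
    also have "\<dots> = ennreal (K * C^2) * (\<integral>\<^sup>+x. ennreal (f x)^2 \<partial>?G)^(2^Suc j)"
    proof -
      have "(2::nat)^Suc j = 2^j * 2" by simp
      then show ?thesis using K(1) C(1) by (simp only: power_mult power_mult_distrib ennreal_mult ennreal_power mult.assoc zero_le_power)
    qed
    finally show "(\<integral>\<^sup>+x. ennreal (f x)^(2^Suc (Suc j)) \<partial>?G) \<le> ennreal (K * C^2) * (\<integral>\<^sup>+x. ennreal (f x)^2 \<partial>?G)^(2^Suc j)" .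
  qed
qed

text \<open>
  For the upper bound, \<open>N\<^sup>r \<le> s\<^sup>r + s\<^bsup>r-q\<^esup> N\<^sup>q\<close> with a power of two \<open>q > r\<close>. For the lower bound,
  the second moment is split at a level \<open>t\<close>. If \<open>r \<ge> 2\<close>, the part below \<open>t\<close> contributes at most half
  of it; if \<open>r < 2\<close>, the part above \<open>t\<close> does, by the fourth moment. In both cases the other part is
  controlled by the moment of order \<open>r\<close>.
\<close>

lemma moment_comparison:
  fixes K :: "nat \<Rightarrow> real"
  assumes K: "\<And>j. K j \<ge> 0" and r: "r > 0"
  shows "\<exists>a>0. \<exists>b>0. \<forall>(M :: 'o measure) N s. prob_space M \<longrightarrow> N \<in> borel_measurable M \<longrightarrow> (\<forall>\<omega>. 0 \<le> N \<omega>) \<longrightarrow> 0 \<le> s \<longrightarrow>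
     (\<integral>\<^sup>+\<omega>. ennreal (N \<omega>)^2 \<partial>M) = ennreal (s^2) \<longrightarrow>
     (\<forall>j. (\<integral>\<^sup>+\<omega>. ennreal (N \<omega>)^(2^Suc j) \<partial>M) \<le> ennreal (K j) * ennreal (s^2)^(2^j)) \<longrightarrow>
     integrable M (\<lambda>\<omega>. N \<omega> powr r) \<and> (\<integral>\<omega>. N \<omega> powr r \<partial>M) powr (1 / r) \<le> a * s \<and> s \<le> b * (\<integral>\<omega>. N \<omega> powr r \<partial>M) powr (1 / r)"
proof -
  obtain j where j: "r < 2^Suc j"
  proof -
    obtain n where "r < of_nat n" using reals_Archimedean2 by blast
    also have "real n < 2^n" by (rule of_nat_less_two_power)
    also have "(2::real)^n \<le> 2^Suc n" by simp
    finally show ?thesis using that by blast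
  qed
  define q where "q = (2::nat)^Suc j"
  \<comment> \<open>the level \<open>t = L s\<close> makes the part of the second moment above \<open>t\<close> at most \<open>K 1 / L\<^sup>2 \<le> 1/2\<close> of the whole\<close>
  define L where "L = sqrt (2 * (K 1 + 1))"
  define a where "a = (1 + K j) powr (1 / r)"
  \<comment> \<open>the sum of the constants for the two cases \<open>r \<ge> 2\<close> and \<open>r < 2\<close>\<close>
  define b where "b = sqrt 2 + (2 * L\<^sup>2) powr (1 / r)"
  have L: "L \<ge> 1" "L\<^sup>2 = 2 * (K 1 + 1)" unfolding L_def using K[of 1] by auto
  have ab: "a > 0" "b > 0" unfolding a_def b_def using K[of j] by (auto intro: add_pos_nonneg)
  have main: "integrable M (\<lambda>\<omega>. N \<omega> powr r) \<and> (\<integral>\<omega>. N \<omega> powr r \<partial>M) powr (1 / r) \<le> a * s \<and> s \<le> b * (\<integral>\<omega>. N \<omega> powr r \<partial>M) powr (1 / r)"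
    if M: "prob_space M" and [measurable]: "N \<in> borel_measurable M" and N: "\<forall>\<omega>. 0 \<le> N \<omega>" and s: "0 \<le> s"
      and N2: "(\<integral>\<^sup>+\<omega>. ennreal (N \<omega>)^2 \<partial>M) = ennreal (s^2)"
      and Nj: "\<forall>j. (\<integral>\<^sup>+\<omega>. ennreal (N \<omega>)^(2^Suc j) \<partial>M) \<le> ennreal (K j) * ennreal (s^2)^(2^j)"
    for M :: "'o measure" and N s
  proof -
    interpret prob_space M by fact
    have mom: "integrable M (\<lambda>\<omega>. N \<omega> ^ (2^Suc j))" "(\<integral>\<omega>. N \<omega> ^ (2^Suc j) \<partial>M) \<le> K j * s ^ (2^Suc j)" for j
    proof -
      have le: "(\<integral>\<^sup>+\<omega>. ennreal (N \<omega> ^ (2^Suc j)) \<partial>M) \<le> ennreal (K j * s ^ (2^Suc j))"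
      proof -
        have "(s\<^sup>2)^(2^j) = s^(2^Suc j)" by (simp flip: power_mult)
        then show ?thesis using Nj[rule_format, of j] N K[of j] s by (simp add: ennreal_power ennreal_mult)
      qed
      show i: "integrable M (\<lambda>\<omega>. N \<omega> ^ (2^Suc j))"
      proof (rule integrableI_bounded)
        show "(\<integral>\<^sup>+\<omega>. ennreal (norm (N \<omega> ^ (2^Suc j))) \<partial>M) < \<infinity>"
          using order_le_less_trans[OF le ennreal_less_top] N by simp
      qed measurable
      have "(\<integral>\<^sup>+\<omega>. ennreal (N \<omega> ^ (2^Suc j)) \<partial>M) = ennreal (\<integral>\<omega>. N \<omega> ^ (2^Suc j) \<partial>M)"
        using N by (intro nn_integral_eq_integral i) auto
      then show "(\<integral>\<omega>. N \<omega> ^ (2^Suc j) \<partial>M) \<le> K j * s ^ (2^Suc j)"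
        using le K[of j] s by (simp add: ennreal_le_iff)
    qed
    have i2: "integrable M (\<lambda>\<omega>. (N \<omega>)\<^sup>2)" using mom(1)[of 0] by (simp add: numeral_2_eq_2)
    have e2: "(\<integral>\<omega>. (N \<omega>)\<^sup>2 \<partial>M) = s\<^sup>2"
    proof -
      have "ennreal (\<integral>\<omega>. (N \<omega>)\<^sup>2 \<partial>M) = ennreal (s\<^sup>2)"
        using nn_integral_eq_integral[OF i2] N2 N by (simp add: ennreal_power)
      then show ?thesis by (subst (asm) ennreal_inj) auto
    qed
    show ?thesis
    proof (cases "s = 0")
      case True
      have "AE \<omega> in M. (N \<omega>)\<^sup>2 = 0"
        using integral_nonneg_eq_0_iff_AE[OF i2] e2 True by auto
      then have z: "AE \<omega> in M. N \<omega> powr r = 0" by auto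
      have "integrable M (\<lambda>\<omega>. N \<omega> powr r) \<longleftrightarrow> integrable M (\<lambda>\<omega>. 0::real)"
        by (rule integrable_cong_AE) (use z in auto)
      moreover have "(\<integral>\<omega>. N \<omega> powr r \<partial>M) = (\<integral>\<omega>. 0 \<partial>M)"
        by (rule integral_cong_AE) (use z in auto)
      ultimately show ?thesis using True by simp
    next
      case False
      then have s0: "s > 0" using s by simp
      have up: "N \<omega> powr r \<le> s powr r + N \<omega> ^ q * s powr (r - q)" for \<omega>
      proof (cases "N \<omega> \<le> s")
        case True
        then show ?thesis using N r s0 by (intro order_trans[OF powr_mono2[of r "N \<omega>" s]]) auto
      next
        case False
        then have "N \<omega> > 0" using s0 by linarith
        then have "N \<omega> powr r = N \<omega> ^ q * N \<omega> powr (r - q)"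
          by (simp add: powr_realpow[symmetric] powr_add[symmetric])
        also have "\<dots> \<le> N \<omega> ^ q * s powr (r - q)"
          using False s0 j N unfolding q_def by (intro mult_left_mono powr_mono2') auto
        finally show ?thesis by (simp add: add_increasing)
      qed
      have iq: "integrable M (\<lambda>\<omega>. s powr r + N \<omega> ^ q * s powr (r - q))"
        using mom(1)[of j] unfolding q_def by auto
      have int: "integrable M (\<lambda>\<omega>. N \<omega> powr r)"
        by (rule Bochner_Integration.integrable_bound[OF iq]) (use up N in \<open>auto intro!: AE_I2 order_trans[OF up] simp: abs_of_nonneg\<close>)
      define I where "I = (\<integral>\<omega>. N \<omega> powr r \<partial>M)"
      have I0: "I \<ge> 0" unfolding I_def by simp
      have "I \<le> (\<integral>\<omega>. s powr r + N \<omega> ^ q * s powr (r - q) \<partial>M)"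
        unfolding I_def by (rule integral_mono[OF int iq up])
      also have "\<dots> = s powr r + (\<integral>\<omega>. N \<omega> ^ q \<partial>M) * s powr (r - q)"
        using mom(1)[of j] unfolding q_def by (simp add: prob_space)
      also have "\<dots> \<le> s powr r + K j * s ^ q * s powr (r - q)"
        using mom(2)[of j] unfolding q_def by (intro add_left_mono mult_right_mono) auto
      also have "\<dots> = (1 + K j) * s powr r"
        using s0 by (simp add: powr_realpow[symmetric] powr_add[symmetric] algebra_simps)
      finally have "I powr (1 / r) \<le> ((1 + K j) * s powr r) powr (1 / r)"
        using I0 r by (intro powr_mono2) auto
      also have "\<dots> = a * s" unfolding a_def using K[of j] r s0 by (simp add: powr_mult powr_powr)
      finally have 1: "I powr (1 / r) \<le> a * s" .
      have 2: "s \<le> b * I powr (1 / r)"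
      proof (cases "r \<ge> 2")
        case True
        define t where "t = s / sqrt 2"
        have t: "t > 0" "s\<^sup>2 = 2 * t\<^sup>2" unfolding t_def using s0 by (auto simp: power_divide)
        have low: "(N \<omega>)\<^sup>2 \<le> t\<^sup>2 + N \<omega> powr r * t powr (2 - r)" for \<omega>
        proof (cases "N \<omega> \<le> t")
          case True
          then show ?thesis using N by (intro order_trans[OF power_mono[of "N \<omega>" t 2]]) auto
        next
          case False
          then have "N \<omega> > 0" using t by linarith
          then have "(N \<omega>)\<^sup>2 = N \<omega> powr r * N \<omega> powr (2 - r)"
            using powr_add[of "N \<omega>" r "2 - r"] by simp
          also have "\<dots> \<le> N \<omega> powr r * t powr (2 - r)"
            using False t True by (intro mult_left_mono powr_mono2') auto
          finally show ?thesis by (simp add: add_increasing)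
        qed
        have "s\<^sup>2 \<le> (\<integral>\<omega>. t\<^sup>2 + N \<omega> powr r * t powr (2 - r) \<partial>M)"
          unfolding e2[symmetric] using int by (intro integral_mono[OF i2 _ low]) auto
        also have "\<dots> = t\<^sup>2 + I * t powr (2 - r)" using int unfolding I_def by (simp add: prob_space)
        finally have "t\<^sup>2 \<le> I * t powr (2 - r)" using t by simp
        then have "t powr r * t powr (2 - r) \<le> I * t powr (2 - r)"
          using t powr_add[of t r "2 - r"] by simp
        then have "t powr r \<le> I" using t by simp
        then have "t \<le> I powr (1 / r)"
          using powr_mono2[of "1 / r" "t powr r" I] r t by (simp add: powr_powr)
        then have "s \<le> sqrt 2 * I powr (1 / r)" unfolding t_def by (simp add: field_simps)
        also have "\<dots> \<le> b * I powr (1 / r)" unfolding b_def by (intro mult_right_mono) auto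
        finally show ?thesis .
      next
        case False
        define t where "t = L * s"
        have t: "t > 0" unfolding t_def using s0 L by auto
        have low: "(N \<omega>)\<^sup>2 \<le> N \<omega> powr r * t powr (2 - r) + N \<omega> ^ 4 / t\<^sup>2" for \<omega>
        proof (cases "N \<omega> \<le> t")
          case True
          show ?thesis
          proof (cases "N \<omega> = 0")
            case False
            then have "N \<omega> > 0" using N by (simp add: less_le)
            then have "(N \<omega>)\<^sup>2 = N \<omega> powr r * N \<omega> powr (2 - r)"
              using powr_add[of "N \<omega>" r "2 - r"] by simp
            also have "\<dots> \<le> N \<omega> powr r * t powr (2 - r)"
              using True N \<open>\<not> r \<ge> 2\<close> by (intro mult_left_mono powr_mono2) auto
            finally show ?thesis by (simp add: add_increasing2)
          qed simp
        next
          case False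
          then have "(N \<omega>)\<^sup>2 * t\<^sup>2 \<le> (N \<omega>)\<^sup>2 * (N \<omega>)\<^sup>2"
            using t by (intro mult_left_mono power_mono) auto
          then have "(N \<omega>)\<^sup>2 \<le> N \<omega> ^ 4 / t\<^sup>2" using t by (simp add: field_simps flip: power_add)
          then show ?thesis by (simp add: add_increasing)
        qed
        have i4: "integrable M (\<lambda>\<omega>. N \<omega> ^ 4)" and e4: "(\<integral>\<omega>. N \<omega> ^ 4 \<partial>M) \<le> K 1 * s ^ 4"
          using mom[of 1] by simp_all
        have "s\<^sup>2 \<le> (\<integral>\<omega>. N \<omega> powr r * t powr (2 - r) + N \<omega> ^ 4 / t\<^sup>2 \<partial>M)"
          unfolding e2[symmetric] using int i4 by (intro integral_mono[OF i2 _ low]) auto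
        also have "\<dots> = I * t powr (2 - r) + (\<integral>\<omega>. N \<omega> ^ 4 \<partial>M) / t\<^sup>2" using int i4 unfolding I_def by simp
        also have "\<dots> \<le> I * t powr (2 - r) + K 1 * s ^ 4 / t\<^sup>2" using e4 by (intro add_left_mono divide_right_mono) auto
        also have "K 1 * s ^ 4 / t\<^sup>2 = K 1 / L\<^sup>2 * s\<^sup>2"
          unfolding t_def using s0 L by (simp add: power_mult_distrib field_simps power2_eq_square power4_eq_xxxx)
        also have "K 1 / L\<^sup>2 * s\<^sup>2 \<le> 1 / 2 * s\<^sup>2"
          unfolding L(2) using K[of 1] by (intro mult_right_mono) (auto simp: field_simps)
        finally have "s\<^sup>2 \<le> 2 * I * t powr (2 - r)" by simp
        then have "L\<^sup>2 * s\<^sup>2 \<le> L\<^sup>2 * (2 * I * t powr (2 - r))" by (intro mult_left_mono) auto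
        then have "t\<^sup>2 \<le> (2 * L\<^sup>2 * I) * t powr (2 - r)" unfolding t_def by (simp add: power_mult_distrib mult_ac)
        then have "t powr r * t powr (2 - r) \<le> (2 * L\<^sup>2 * I) * t powr (2 - r)"
          using t powr_add[of t r "2 - r"] by simp
        then have "t powr r \<le> 2 * L\<^sup>2 * I" using t by simp
        then have "t \<le> (2 * L\<^sup>2 * I) powr (1 / r)"
          using powr_mono2[of "1 / r" "t powr r" "2 * L\<^sup>2 * I"] r t by (simp add: powr_powr)
        also have "\<dots> = (2 * L\<^sup>2) powr (1 / r) * I powr (1 / r)" using I0 by (subst powr_mult) auto
        also have "\<dots> \<le> b * I powr (1 / r)" unfolding b_def by (intro mult_right_mono) auto
        finally have "t \<le> b * I powr (1 / r)" .
        moreover have "1 * s \<le> L * s" using L(1) s0 by (intro mult_right_mono) auto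
        ultimately show ?thesis unfolding t_def by simp
      qed
      show ?thesis using int 1 2 unfolding I_def by blast
    qed
  qed
  show ?thesis
    by (rule exI[of _ a], rule conjI[OF ab(1)], rule exI[of _ b], rule conjI[OF ab(2)]) (use main in blast)
qed

section \<open>Gaussian laws\<close>

text \<open>
  Uniqueness of characteristic functions for the probability measure with density \<open>g / c\<close>. Complex
  weights \<open>exp(iS)\<close> are reached through the nonnegative weights \<open>1\<close>, \<open>1 + cos S\<close> and \<open>1 + sin S\<close>.
\<close>

lemma (in prob_space) weighted_law_std_normal:
  fixes Y g :: "'a \<Rightarrow> real"
  assumes [measurable]: "Y \<in> borel_measurable M" "g \<in> borel_measurable M"
    and g: "\<And>\<omega>. 0 \<le> g \<omega>" "\<And>\<omega>. g \<omega> \<le> 2" and c: "c > 0" "expectation g = c"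
    and ch: "\<And>t. (CLINT \<omega>|M. g \<omega> *\<^sub>R iexp (t * Y \<omega>)) = complex_of_real (c * exp (- (t\<^sup>2) / 2))"
    and B: "B \<in> sets borel"
  shows "expectation (\<lambda>\<omega>. g \<omega> * indicator B (Y \<omega>)) = c * measure std_normal_distribution B"
proof -
  note B [measurable]
  define M1 where "M1 = density M (\<lambda>\<omega>. ennreal (g \<omega> / c))"
  have gint: "integrable M g" by (rule integrable_const_bound[where B=2]) (use g in auto)
  have "emeasure M1 (space M1) = 1"
  proof -
    have "emeasure M1 (space M1) = (\<integral>\<^sup>+\<omega>. ennreal (g \<omega> / c) \<partial>M)"
      unfolding M1_def by (subst emeasure_density) (auto intro!: nn_integral_cong)
    also have "\<dots> = ennreal (\<integral>\<omega>. g \<omega> / c \<partial>M)"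
      using gint g c by (intro nn_integral_eq_integral) auto
    finally show ?thesis using c by simp
  qed
  then interpret M1: prob_space M1 by (rule prob_spaceI)
  have [measurable]: "Y \<in> borel_measurable M1" unfolding M1_def by simp
  interpret D: real_distribution "distr M1 borel Y"
    by (rule M1.real_distribution_distr) measurable
  have int_M1: "(CLINT \<omega>|M1. f \<omega>) = (CLINT \<omega>|M. (g \<omega> / c) *\<^sub>R f \<omega>)" if [measurable]: "f \<in> borel_measurable M" for f :: "'a \<Rightarrow> complex"
    unfolding M1_def using g c by (intro integral_density) auto
  have "char (distr M1 borel Y) = char std_normal_distribution"
  proof
    fix t
    have "char (distr M1 borel Y) t = (CLINT \<omega>|M1. iexp (t * Y \<omega>))"
      unfolding char_def by (subst integral_distr) auto
    also have "\<dots> = (CLINT \<omega>|M. (1 / c) *\<^sub>R (g \<omega> *\<^sub>R iexp (t * Y \<omega>)))"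
      by (subst int_M1) auto
    also have "\<dots> = (1 / c) *\<^sub>R (CLINT \<omega>|M. g \<omega> *\<^sub>R iexp (t * Y \<omega>))"
      by (rule integral_scaleR_right)
    also have "\<dots> = char std_normal_distribution t"
      unfolding ch char_std_normal_distribution using c by (simp add: scaleR_conv_of_real)
    finally show "char (distr M1 borel Y) t = char std_normal_distribution t" .
  qed
  then have "distr M1 borel Y = std_normal_distribution"
    by (intro Levy_uniqueness D.real_distribution_axioms real_dist_normal_dist)
  then have "measure std_normal_distribution B = measure (distr M1 borel Y) B" by simp
  also have "\<dots> = (\<integral>\<omega>. indicator B (Y \<omega>) \<partial>M1)"
  proof -
    have "(\<integral>x. indicator B x \<partial>distr M1 borel Y) = (\<integral>\<omega>. indicator B (Y \<omega>) \<partial>M1 :: real)"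
      by (rule integral_distr) measurable
    then show ?thesis by simp
  qed
  also have "\<dots> = (\<integral>\<omega>. (g \<omega> / c) *\<^sub>R indicator B (Y \<omega>) \<partial>M)"
    unfolding M1_def using g c by (intro integral_density) auto
  also have "\<dots> = expectation (\<lambda>\<omega>. g \<omega> * indicator B (Y \<omega>)) / c"
    by (simp add: mult.commute)
  finally show ?thesis using c by simp
qed

text \<open>
  A joint characteristic function of product form determines the joint law, reduced to the one
  dimensional uniqueness theorem: conditioning on \<open>Y\<^sub>N \<in> A\<^sub>N\<close> leaves the characteristic function of
  the remaining variables unchanged, so the induction hypothesis applies under the conditioned
  measure.
\<close>

lemma gaussian_characteristic_independent:
  fixes M :: "'o measure" and Y :: "nat \<Rightarrow> 'o \<Rightarrow> real" and N :: nat
  assumes "prob_space M" and Y: "\<And>j. j < N \<Longrightarrow> Y j \<in> borel_measurable M"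
    and ch: "\<And>a. (CLINT \<omega>|M. iexp (\<Sum>j<N. a j * Y j \<omega>)) = complex_of_real (exp (- (\<Sum>j<N. (a j)\<^sup>2) / 2))"
    and A: "\<And>j. j < N \<Longrightarrow> A j \<in> sets borel"
  shows "measure M {\<omega> \<in> space M. \<forall>j<N. Y j \<omega> \<in> A j} = (\<Prod>j<N. measure std_normal_distribution (A j))"
  using assms
proof (induction N arbitrary: M)
  case 0
  then interpret prob_space M by simp
  show ?case using prob_space by simp
next
  case (Suc N)
  interpret prob_space M by (rule Suc.prems(1))
  have [measurable]: "Y N \<in> borel_measurable M" using Suc.prems(2) by simp
  have Ym: "Y j \<in> borel_measurable M" if "j < N" for j using Suc.prems(2) that by simp
  have B [measurable]: "A N \<in> sets borel" using Suc.prems(4) by simp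
  define p where "p = measure std_normal_distribution (A N)"
  have ch: "(CLINT \<omega>|M. iexp ((\<Sum>j<N. a j * Y j \<omega>) + t * Y N \<omega>)) = complex_of_real (exp (- (\<Sum>j<N. (a j)\<^sup>2) / 2) * exp (- (t\<^sup>2) / 2))" for a t
  proof -
    have "(\<Sum>j<Suc N. (a(N := t)) j * Y j \<omega>) = (\<Sum>j<N. a j * Y j \<omega>) + t * Y N \<omega>" for \<omega> by simp
    moreover have "(\<Sum>j<Suc N. ((a(N := t)) j)\<^sup>2) = (\<Sum>j<N. (a j)\<^sup>2) + t\<^sup>2" by simp
    moreover have "exp (- (\<Sum>j<N. (a j)\<^sup>2) / 2) * exp (- (t\<^sup>2) / 2) = exp (- ((\<Sum>j<N. (a j)\<^sup>2) + t\<^sup>2) / 2)"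
      by (simp only: exp_add[symmetric] minus_add_distrib add_divide_distrib)
    ultimately show ?thesis using Suc.prems(3)[of "a(N := t)"] by (simp only:)
  qed
  have weighted: "(CLINT \<omega>|M. indicator (A N) (Y N \<omega>) *\<^sub>R iexp (\<Sum>j<N. a j * Y j \<omega>)) = complex_of_real (p * exp (- (\<Sum>j<N. (a j)\<^sup>2) / 2))" for a
  proof -
    define S where "S = (\<lambda>\<omega>. \<Sum>j<N. a j * Y j \<omega>)"
    define q where "q = exp (- (\<Sum>j<N. (a j)\<^sup>2) / 2)"
    have [measurable]: "S \<in> borel_measurable M" unfolding S_def using Ym by measurable
    have cisx: "iexp x = Complex (cos x) (sin x)" for x
      by (simp add: cis_conv_exp[symmetric] complex_eq_iff)
    have ie: "integrable M (\<lambda>\<omega>. iexp (X \<omega>))" if [measurable]: "X \<in> borel_measurable M" for X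
      by (rule integrable_iexp) auto
    have plus: "(CLINT \<omega>|M. iexp (S \<omega> + t * Y N \<omega>)) = of_real (q * exp (- (t\<^sup>2) / 2))" for t
      using ch[of a t] unfolding S_def q_def .
    have minus: "(CLINT \<omega>|M. iexp (- S \<omega> + t * Y N \<omega>)) = of_real (q * exp (- (t\<^sup>2) / 2))" for t
      using ch[of "\<lambda>j. - a j" t] unfolding S_def q_def by (simp add: sum_negf)
    have zero: "(CLINT \<omega>|M. iexp (t * Y N \<omega>)) = of_real (exp (- (t\<^sup>2) / 2))" for t
      using ch[of "\<lambda>j. 0" t] by simp
    have eq_cos: "(CLINT \<omega>|M. (1 + cos (S \<omega>)) *\<^sub>R iexp (t * Y N \<omega>)) = of_real ((1 + q) * exp (- (t\<^sup>2) / 2))" for t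
    proof -
      have "(1 + cos (S \<omega>)) *\<^sub>R iexp (t * Y N \<omega>)
         = iexp (t * Y N \<omega>) + (1/2) * iexp (S \<omega> + t * Y N \<omega>) + (1/2) * iexp (- S \<omega> + t * Y N \<omega>)" for \<omega>
        unfolding cisx by (simp add: complex_eq_iff cos_add sin_add cos_diff sin_diff field_simps)
      then have "(CLINT \<omega>|M. (1 + cos (S \<omega>)) *\<^sub>R iexp (t * Y N \<omega>))
        = (CLINT \<omega>|M. iexp (t * Y N \<omega>)) + (1/2) * (CLINT \<omega>|M. iexp (S \<omega> + t * Y N \<omega>)) + (1/2) * (CLINT \<omega>|M. iexp (- S \<omega> + t * Y N \<omega>))"
        using ie[of "\<lambda>\<omega>. t * Y N \<omega>"] ie[of "\<lambda>\<omega>. S \<omega> + t * Y N \<omega>"] ie[of "\<lambda>\<omega>. - S \<omega> + t * Y N \<omega>"] by simp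
      then show ?thesis unfolding plus minus zero by (simp add: algebra_simps)
    qed
    have eq_sin: "(CLINT \<omega>|M. (1 + sin (S \<omega>)) *\<^sub>R iexp (t * Y N \<omega>)) = of_real (1 * exp (- (t\<^sup>2) / 2))" for t
    proof -
      have "(1 + sin (S \<omega>)) *\<^sub>R iexp (t * Y N \<omega>)
         = iexp (t * Y N \<omega>) + (- \<i>/2) * iexp (S \<omega> + t * Y N \<omega>) + (\<i>/2) * iexp (- S \<omega> + t * Y N \<omega>)" for \<omega>
        unfolding cisx by (simp add: complex_eq_iff cos_add sin_add cos_diff sin_diff field_simps)
      then have "(CLINT \<omega>|M. (1 + sin (S \<omega>)) *\<^sub>R iexp (t * Y N \<omega>))
        = (CLINT \<omega>|M. iexp (t * Y N \<omega>)) + (- \<i>/2) * (CLINT \<omega>|M. iexp (S \<omega> + t * Y N \<omega>)) + (\<i>/2) * (CLINT \<omega>|M. iexp (- S \<omega> + t * Y N \<omega>))"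
        using ie[of "\<lambda>\<omega>. t * Y N \<omega>"] ie[of "\<lambda>\<omega>. S \<omega> + t * Y N \<omega>"] ie[of "\<lambda>\<omega>. - S \<omega> + t * Y N \<omega>"] by simp
      then show ?thesis unfolding plus minus zero by (simp add: algebra_simps)
    qed
    have icos: "integrable M (\<lambda>\<omega>. cos (S \<omega>))" and isin: "integrable M (\<lambda>\<omega>. sin (S \<omega>))"
      by (rule integrable_const_bound[where B=1]; simp)+
    have "complex_of_real (\<integral>\<omega>. 1 + cos (S \<omega>) \<partial>M) = of_real (1 + q)"
      using eq_cos[of 0] by (simp add: scaleR_conv_of_real flip: integral_complex_of_real)
    then have ecos: "expectation (\<lambda>\<omega>. 1 + cos (S \<omega>)) = 1 + q" by (simp only: of_real_eq_iff)
    have "complex_of_real (\<integral>\<omega>. 1 + sin (S \<omega>) \<partial>M) = of_real 1"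
      using eq_sin[of 0] by (simp add: scaleR_conv_of_real flip: integral_complex_of_real)
    then have esin: "expectation (\<lambda>\<omega>. 1 + sin (S \<omega>)) = 1" by (simp only: of_real_eq_iff)
    have q0: "1 + q > 0" unfolding q_def by (simp add: add_pos_pos)
    have lb: "0 \<le> 1 + cos (x::real)" "0 \<le> 1 + sin x" "1 + cos x \<le> 2" "1 + sin x \<le> 2" for x
      using cos_ge_minus_one[of x] sin_ge_minus_one[of x] cos_le_one[of x] sin_le_one[of x] by linarith+
    have wcos: "expectation (\<lambda>\<omega>. (1 + cos (S \<omega>)) * indicator (A N) (Y N \<omega>)) = (1 + q) * p"
      unfolding p_def by (rule weighted_law_std_normal[OF _ _ lb(1) lb(3) q0 ecos eq_cos B]) measurable
    have wsin: "expectation (\<lambda>\<omega>. (1 + sin (S \<omega>)) * indicator (A N) (Y N \<omega>)) = 1 * p"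
      unfolding p_def by (rule weighted_law_std_normal[OF _ _ lb(2) lb(4) zero_less_one esin eq_sin B]) measurable
    have w1: "expectation (\<lambda>\<omega>. 1 * indicator (A N) (Y N \<omega>)) = 1 * p"
      unfolding p_def
    proof (rule weighted_law_std_normal[where g="\<lambda>_. 1", OF _ _ _ _ zero_less_one _ _ B])
      show "(CLINT \<omega>|M. 1 *\<^sub>R iexp (t * Y N \<omega>)) = complex_of_real (1 * exp (- (t\<^sup>2) / 2))" for t
        by (simp only: scaleR_one mult_1_left zero)
    qed (simp_all add: prob_space)
    have iind: "integrable M (\<lambda>\<omega>. indicator (A N) (Y N \<omega>) * f \<omega> :: real)"
      if [measurable]: "f \<in> borel_measurable M" and "\<And>\<omega>. \<bar>f \<omega>\<bar> \<le> 1" for f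
      by (rule integrable_const_bound[where B=1]) (use that(2) in \<open>auto simp: indicator_def\<close>)
    have i1: "integrable M (\<lambda>\<omega>. indicator (A N) (Y N \<omega>) * 1 :: real)" by (rule iind) auto
    have ic: "integrable M (\<lambda>\<omega>. indicator (A N) (Y N \<omega>) * cos (S \<omega>) :: real)" by (rule iind) auto
    have isn: "integrable M (\<lambda>\<omega>. indicator (A N) (Y N \<omega>) * sin (S \<omega>) :: real)" by (rule iind) auto
    have rc: "expectation (\<lambda>\<omega>. indicator (A N) (Y N \<omega>) * cos (S \<omega>)) = p * q"
      using wcos w1 i1 ic by (simp add: algebra_simps)
    have rs: "expectation (\<lambda>\<omega>. indicator (A N) (Y N \<omega>) * sin (S \<omega>)) = 0"
      using wsin w1 i1 isn by (simp add: algebra_simps)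
    have "(CLINT \<omega>|M. indicator (A N) (Y N \<omega>) *\<^sub>R iexp (S \<omega>))
       = (CLINT \<omega>|M. of_real (indicator (A N) (Y N \<omega>) * cos (S \<omega>)) + \<i> * of_real (indicator (A N) (Y N \<omega>) * sin (S \<omega>)))"
      unfolding cisx by (intro Bochner_Integration.integral_cong) (auto simp: complex_eq_iff)
    also have "\<dots> = (CLINT \<omega>|M. of_real (indicator (A N) (Y N \<omega>) * cos (S \<omega>))) + \<i> * (CLINT \<omega>|M. of_real (indicator (A N) (Y N \<omega>) * sin (S \<omega>)))"
      using integrable_of_real[OF ic, where 'a=complex] integrable_of_real[OF isn, where 'a=complex] by simp
    also have "\<dots> = complex_of_real (p * q)"
      unfolding integral_complex_of_real rc rs by simp
    finally show ?thesis unfolding S_def q_def .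
  qed
  have pN: "measure M {\<omega> \<in> space M. Y N \<omega> \<in> A N} = p"
  proof -
    have "complex_of_real (\<integral>\<omega>. indicator (A N) (Y N \<omega>) \<partial>M) = of_real p"
      using weighted[of "\<lambda>_. 0"] by (simp add: scaleR_conv_of_real flip: integral_complex_of_real)
    then have "(\<integral>\<omega>. indicator (A N) (Y N \<omega>) \<partial>M) = p" by (simp only: of_real_eq_iff)
    moreover have "(\<integral>\<omega>. indicator (A N) (Y N \<omega>) \<partial>M) = (\<integral>\<omega>. indicator {\<omega> \<in> space M. Y N \<omega> \<in> A N} \<omega> \<partial>M :: real)"
      by (intro Bochner_Integration.integral_cong) (auto simp: indicator_def)
    moreover have "{\<omega> \<in> space M. Y N \<omega> \<in> A N} \<inter> space M = {\<omega> \<in> space M. Y N \<omega> \<in> A N}" by auto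
    ultimately show ?thesis by simp
  qed
  have set_eq: "{\<omega> \<in> space M. \<forall>j<Suc N. Y j \<omega> \<in> A j} = {\<omega> \<in> space M. Y N \<omega> \<in> A N} \<inter> {\<omega> \<in> space M. \<forall>j<N. Y j \<omega> \<in> A j}"
    by (auto simp: less_Suc_eq)
  have m1 [measurable]: "{\<omega> \<in> space M. Y N \<omega> \<in> A N} \<in> sets M" by measurable
  have m2: "{\<omega> \<in> space M. \<forall>j<N. Y j \<omega> \<in> A j} \<in> sets M"
  proof -
    have "{\<omega> \<in> space M. \<forall>j<N. Y j \<omega> \<in> A j} = {\<omega> \<in> space M. \<forall>j\<in>{..<N}. Y j \<omega> \<in> A j}" by auto
    moreover have "{\<omega> \<in> space M. Y j \<omega> \<in> A j} \<in> sets M" if "j < N" for j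
      using measurable_sets[OF Ym[OF that], of "A j"] Suc.prems(4)[of j] that
      by (simp add: vimage_def Int_def conj_commute)
    ultimately show ?thesis by (simp only:) (rule sets.sets_Collect_finite_All, auto)
  qed
  show ?case
  proof (cases "p = 0")
    case True
    have "measure M {\<omega> \<in> space M. \<forall>j<Suc N. Y j \<omega> \<in> A j} \<le> measure M {\<omega> \<in> space M. Y N \<omega> \<in> A N}"
      unfolding set_eq using m1 by (intro finite_measure_mono) auto
    then have "measure M {\<omega> \<in> space M. \<forall>j<Suc N. Y j \<omega> \<in> A j} = 0"
      unfolding pN True using measure_nonneg[of M] by (simp add: antisym)
    then show ?thesis using True by (simp add: p_def)
  next
    case False
    then have p0: "p > 0" unfolding p_def by (simp add: zero_less_measure_iff)
    define M' where "M' = density M (\<lambda>\<omega>. ennreal (indicator (A N) (Y N \<omega>) / p))"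
    have em: "measure M' C = measure M ({\<omega> \<in> space M. Y N \<omega> \<in> A N} \<inter> C) / p" if C: "C \<in> sets M" for C
    proof -
      have "emeasure M' C = (\<integral>\<^sup>+\<omega>. ennreal (1 / p) * indicator ({\<omega> \<in> space M. Y N \<omega> \<in> A N} \<inter> C) \<omega> \<partial>M)"
        unfolding M'_def using C by (subst emeasure_density) (auto intro!: nn_integral_cong simp: indicator_def)
      also have "\<dots> = ennreal (1 / p) * emeasure M ({\<omega> \<in> space M. Y N \<omega> \<in> A N} \<inter> C)"
        using C m1 by (intro nn_integral_cmult_indicator) auto
      finally show ?thesis using p0 unfolding measure_def by (simp add: enn2real_mult)
    qed
    have "prob_space M'"
    proof (rule prob_spaceI)
      have "emeasure M' (space M') = (\<integral>\<^sup>+\<omega>. ennreal (1 / p) * indicator {\<omega> \<in> space M. Y N \<omega> \<in> A N} \<omega> \<partial>M)"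
        unfolding M'_def by (subst emeasure_density) (auto intro!: nn_integral_cong simp: indicator_def)
      also have "\<dots> = ennreal (1 / p) * emeasure M {\<omega> \<in> space M. Y N \<omega> \<in> A N}"
        by (intro nn_integral_cmult_indicator m1)
      also have "\<dots> = 1" using pN p0 by (simp add: emeasure_eq_measure flip: ennreal_mult)
      finally show "emeasure M' (space M') = 1" .
    qed
    moreover have "Y j \<in> borel_measurable M'" if "j < N" for j unfolding M'_def using Ym[OF that] by simp
    moreover have "(CLINT \<omega>|M'. iexp (\<Sum>j<N. a j * Y j \<omega>)) = complex_of_real (exp (- (\<Sum>j<N. (a j)\<^sup>2) / 2))" for a
    proof -
      have [measurable]: "(\<lambda>\<omega>. \<Sum>j<N. a j * Y j \<omega>) \<in> borel_measurable M" using Ym by measurable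
      have gen: "(CLINT \<omega>|M'. iexp (X \<omega>)) = (CLINT \<omega>|M. (indicator (A N) (Y N \<omega>) / p) *\<^sub>R iexp (X \<omega>))"
        if [measurable]: "X \<in> borel_measurable M" for X
        unfolding M'_def using p0 by (intro integral_density) auto
      have "(CLINT \<omega>|M'. iexp (\<Sum>j<N. a j * Y j \<omega>)) = (CLINT \<omega>|M. (indicator (A N) (Y N \<omega>) / p) *\<^sub>R iexp (\<Sum>j<N. a j * Y j \<omega>))"
        by (rule gen) fact
      also have "\<dots> = (CLINT \<omega>|M. (1 / p) *\<^sub>R (indicator (A N) (Y N \<omega>) *\<^sub>R iexp (\<Sum>j<N. a j * Y j \<omega>)))"
        by simp
      also have "\<dots> = (1 / p) *\<^sub>R (CLINT \<omega>|M. (indicator (A N) (Y N \<omega>) *\<^sub>R iexp (\<Sum>j<N. a j * Y j \<omega>)))"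
        by (rule integral_scaleR_right)
      also have "\<dots> = complex_of_real (exp (- (\<Sum>j<N. (a j)\<^sup>2) / 2))"
        unfolding weighted using p0 by (simp add: scaleR_conv_of_real)
      finally show ?thesis .
    qed
    ultimately have "measure M' {\<omega> \<in> space M'. \<forall>j<N. Y j \<omega> \<in> A j} = (\<Prod>j<N. measure std_normal_distribution (A j))"
      using Suc.prems(4) by (intro Suc.IH) auto
    moreover have "space M' = space M" unfolding M'_def by simp
    ultimately have "measure M {\<omega> \<in> space M. \<forall>j<Suc N. Y j \<omega> \<in> A j} / p = (\<Prod>j<N. measure std_normal_distribution (A j))"
      using em[OF m2] by (simp only: set_eq)
    then show ?thesis using p0 by (simp add: field_simps flip: p_def)
  qed
qed

lemma gaussian_law:
  fixes M :: "'o measure" and Y :: "nat \<Rightarrow> 'o \<Rightarrow> real" and N :: nat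
  assumes M: "prob_space M" and Y: "\<And>j. j < N \<Longrightarrow> Y j \<in> borel_measurable M"
    and ch: "\<And>a. (CLINT \<omega>|M. iexp (\<Sum>j<N. a j * Y j \<omega>)) = complex_of_real (exp (- (\<Sum>j<N. (a j)\<^sup>2) / 2))"
  shows "(\<lambda>\<omega>. \<lambda>j\<in>{..<N}. Y j \<omega>) \<in> M \<rightarrow>\<^sub>M gaussian_space N"
    and "distr M (gaussian_space N) (\<lambda>\<omega>. \<lambda>j\<in>{..<N}. Y j \<omega>) = gaussian_space N"
proof -
  interpret prob_space M by fact
  interpret G: prob_space std_normal_distribution by (rule prob_space_std_normal)
  interpret P: product_sigma_finite "\<lambda>_::nat. std_normal_distribution" by standard
  show m [measurable]: "(\<lambda>\<omega>. \<lambda>j\<in>{..<N}. Y j \<omega>) \<in> M \<rightarrow>\<^sub>M gaussian_space N"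
    using Y by (intro measurable_restrict) auto
  show "distr M (gaussian_space N) (\<lambda>\<omega>. \<lambda>j\<in>{..<N}. Y j \<omega>) = gaussian_space N"
  proof (rule P.PiM_eqI)
    fix A assume A: "\<And>i. i \<in> {..<N} \<Longrightarrow> A i \<in> sets std_normal_distribution"
    have "emeasure (distr M (gaussian_space N) (\<lambda>\<omega>. \<lambda>j\<in>{..<N}. Y j \<omega>)) (Pi\<^sub>E {..<N} A)
       = emeasure M ((\<lambda>\<omega>. \<lambda>j\<in>{..<N}. Y j \<omega>) -` Pi\<^sub>E {..<N} A \<inter> space M)"
      by (rule emeasure_distr[OF m], rule sets_PiM_I_finite) (simp_all only: finite_lessThan A)
    also have "(\<lambda>\<omega>. \<lambda>j\<in>{..<N}. Y j \<omega>) -` Pi\<^sub>E {..<N} A \<inter> space M = {\<omega> \<in> space M. \<forall>j<N. Y j \<omega> \<in> A j}"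
      unfolding vimage_def restrict_PiE_iff by auto
    also have "emeasure M {\<omega> \<in> space M. \<forall>j<N. Y j \<omega> \<in> A j} = ennreal (\<Prod>j<N. measure std_normal_distribution (A j))"
    proof -
      have "A j \<in> sets borel" if "j < N" for j using A[unfolded lessThan_iff, OF that] by (simp only: sets_density sets_lborel)
      from gaussian_characteristic_independent[where M=M and Y=Y and N=N and A=A, OF M Y ch this] show ?thesis
        unfolding emeasure_eq_measure by (simp only:)
    qed
    also have "\<dots> = (\<Prod>j\<in>{..<N}. emeasure std_normal_distribution (A j))"
      unfolding G.emeasure_eq_measure by (rule prod_ennreal[symmetric]) simp
    finally show "emeasure (distr M (gaussian_space N) (\<lambda>\<omega>. \<lambda>j\<in>{..<N}. Y j \<omega>)) (Pi\<^sub>E {..<N} A)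
       = (\<Prod>j\<in>{..<N}. emeasure std_normal_distribution (A j))" .
  qed (rule finite_lessThan, rule sets_distr)
qed

lemma gaussian_space_characteristic:
  "(CLINT x|gaussian_space N. iexp (\<Sum>l<N. b l * x l)) = complex_of_real (exp (- (\<Sum>l<N. (b l)\<^sup>2) / 2))"
proof -
  interpret G: prob_space std_normal_distribution by (rule prob_space_std_normal)
  interpret P: product_sigma_finite "\<lambda>_::nat. std_normal_distribution" by standard
  have "(CLINT x|gaussian_space N. iexp (\<Sum>l<N. b l * x l)) = (CLINT x|gaussian_space N. (\<Prod>l<N. iexp (b l * x l)))"
    by (simp add: exp_sum sum_distrib_left)
  also have "\<dots> = (\<Prod>l<N. (CLINT x|std_normal_distribution. iexp (b l * x)))"
    by (rule P.product_integral_prod) (auto intro!: G.integrable_iexp)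
  also have "\<dots> = (\<Prod>l<N. char std_normal_distribution (b l))"
    unfolding char_def ..
  also have "\<dots> = complex_of_real (exp (\<Sum>l<N. - (b l)\<^sup>2 / 2))"
    unfolding char_std_normal_distribution by (simp add: exp_sum)
  also have "(\<Sum>l<N. - (b l)\<^sup>2 / 2) = - (\<Sum>l<N. (b l)\<^sup>2) / 2"
    by (simp add: sum_negf sum_divide_distrib)
  finally show ?thesis .
qed

text \<open>
  Invariance of the standard Gaussian measure under coisometries; \<open>c\<close> is the matrix of the adjoint,
  whose columns are orthonormal.
\<close>

lemma gaussian_space_rotation:
  fixes c :: "nat \<Rightarrow> nat \<Rightarrow> real"
  assumes orth: "\<And>k k'. k < p \<Longrightarrow> k' < p \<Longrightarrow> (\<Sum>l<N. c l k * c l k') = (if k = k' then 1 else 0)"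
  defines "T \<equiv> \<lambda>x. \<lambda>k\<in>{..<p}. \<Sum>l<N. c l k * x l"
  shows "T \<in> gaussian_space N \<rightarrow>\<^sub>M gaussian_space p" and "distr (gaussian_space N) (gaussian_space p) T = gaussian_space p"
proof -
  have Y: "(\<lambda>x. \<Sum>l<N. c l k * x l) \<in> borel_measurable (gaussian_space N)" for k
    by measurable
  have ch: "(CLINT x|gaussian_space N. iexp (\<Sum>k<p. a k * (\<Sum>l<N. c l k * x l))) = complex_of_real (exp (- (\<Sum>k<p. (a k)\<^sup>2) / 2))" for a
  proof -
    define b where "b = (\<lambda>l. \<Sum>k<p. a k * c l k)"
    have e1: "(\<Sum>k<p. a k * (\<Sum>l<N. c l k * x l)) = (\<Sum>l<N. b l * x l)" for x
      unfolding b_def sum_distrib_left sum_distrib_right by (subst sum.swap) (simp add: mult.assoc)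
    have "(\<Sum>l<N. (b l)\<^sup>2) = (\<Sum>l<N. \<Sum>k<p. \<Sum>k'<p. a k * a k' * (c l k * c l k'))"
      unfolding b_def power2_eq_square sum_product by (simp add: mult_ac)
    also have "\<dots> = (\<Sum>k<p. \<Sum>k'<p. a k * a k' * (\<Sum>l<N. c l k * c l k'))"
      unfolding sum_distrib_left by (subst sum.swap, rule sum.cong, simp, subst sum.swap, simp)
    also have "\<dots> = (\<Sum>k<p. \<Sum>k'<p. if k = k' then (a k)\<^sup>2 else 0)"
      by (intro sum.cong refl) (auto simp: orth power2_eq_square)
    also have "\<dots> = (\<Sum>k<p. (a k)\<^sup>2)" by simp
    finally have e2: "(\<Sum>l<N. (b l)\<^sup>2) = (\<Sum>k<p. (a k)\<^sup>2)" .
    show ?thesis using gaussian_space_characteristic[of N b] by (simp only: e1 e2)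
  qed
  note L = gaussian_law[OF prob_space_gaussian_space, of p "\<lambda>k x. \<Sum>l<N. c l k * x l", OF Y ch]
  show "T \<in> gaussian_space N \<rightarrow>\<^sub>M gaussian_space p" and "distr (gaussian_space N) (gaussian_space p) T = gaussian_space p"
    unfolding T_def by (rule L)+
qed

lemma (in prob_space) centered_gaussian_moments:
  assumes "centered_gaussian M Y" and s: "expectation (\<lambda>\<omega>. Y \<omega> * Y \<omega>) = s"
  shows "Y \<in> L2 M" and "expectation Y = 0" and "(CLINT \<omega>|M. iexp (Y \<omega>)) = complex_of_real (exp (- s / 2))"
proof -
  have [measurable]: "Y \<in> borel_measurable M" using assms(1) unfolding centered_gaussian_def by blast
  have "(Y \<in> L2 M \<and> expectation Y = 0) \<and> (CLINT \<omega>|M. iexp (Y \<omega>)) = complex_of_real (exp (- s / 2))"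
  proof (cases "AE \<omega> in M. Y \<omega> = 0")
    case True
    have 1: "integrable M (\<lambda>\<omega>. (Y \<omega>)\<^sup>2) \<longleftrightarrow> integrable M (\<lambda>\<omega>. 0::real)"
      by (rule integrable_cong_AE) (use True in auto)
    have 2: "expectation Y = expectation (\<lambda>_. 0)" by (rule integral_cong_AE) (use True in auto)
    have 3: "expectation (\<lambda>\<omega>. Y \<omega> * Y \<omega>) = expectation (\<lambda>_. 0)" by (rule integral_cong_AE) (use True in auto)
    have 4: "(CLINT \<omega>|M. iexp (Y \<omega>)) = (CLINT \<omega>|M. 1)" by (rule integral_cong_AE) (use True in auto)
    show ?thesis using 1 2 3 4 s by (simp add: L2_def prob_space)
  next
    case False
    then obtain \<sigma> where \<sigma>: "\<sigma> > 0" "distributed M lborel Y (normal_density 0 \<sigma>)"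
      using assms(1) unfolding centered_gaussian_def by blast
    have i2: "integrable M (\<lambda>\<omega>. (Y \<omega>)\<^sup>2)"
      using distributed_integrable[OF \<sigma>(2), of "\<lambda>x. x\<^sup>2"] integrable_normal_moment[OF \<sigma>(1), of 0 2] by simp
    have e: "expectation Y = 0" using normal_distributed_expectation[OF \<sigma>] .
    have "s = \<sigma>\<^sup>2" using normal_distributed_variance[OF \<sigma>] s e by (simp add: power2_eq_square)
    have std: "distributed M lborel (\<lambda>\<omega>. Y \<omega> / \<sigma>) std_normal_density"
      using normal_standard_normal_convert[OF \<sigma>(1), of Y 0] \<sigma>(2) by simp
    have "char std_normal_distribution \<sigma> = (CLINT x|distr M lborel (\<lambda>\<omega>. Y \<omega> / \<sigma>). iexp (\<sigma> * x))"
      unfolding char_def distributed_distr_eq_density[OF std] ..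
    also have "\<dots> = (CLINT \<omega>|M. iexp (\<sigma> * (Y \<omega> / \<sigma>)))"
      by (rule integral_distr) measurable
    also have "\<dots> = (CLINT \<omega>|M. iexp (Y \<omega>))" using \<sigma>(1) by simp
    finally have "(CLINT \<omega>|M. iexp (Y \<omega>)) = complex_of_real (exp (- s / 2))"
      unfolding char_std_normal_distribution \<open>s = \<sigma>\<^sup>2\<close> by simp
    then show ?thesis using i2 e by (simp add: L2_def)
  qed
  then show "Y \<in> L2 M" "expectation Y = 0" "(CLINT \<omega>|M. iexp (Y \<omega>)) = complex_of_real (exp (- s / 2))" by blast+
qed

section \<open>Linear maps into square integrable random variables and isonormal processes\<close>

lemma L2_mult_integrable:
  assumes "f \<in> L2 M" "g \<in> L2 M"
  shows "integrable M (\<lambda>\<omega>. f \<omega> * g \<omega>)"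
  by (rule integral_Cauchy_Schwarz(1)) (use assms in \<open>simp_all add: L2_def\<close>)

lemma L2_Cauchy_Schwarz:
  assumes "f \<in> L2 M" "g \<in> L2 M"
  shows "\<bar>\<integral>\<omega>. f \<omega> * g \<omega> \<partial>M\<bar> \<le> L2_norm M f * L2_norm M g"
  using integral_Cauchy_Schwarz(2)[of M f g] integral_Cauchy_Schwarz(2)[of M "\<lambda>\<omega>. - f \<omega>" g] assms
  unfolding L2_def L2_norm_def by (simp add: abs_le_iff)

lemma L2_operatorD:
  assumes "L2_operator M A"
  shows "A x \<in> L2 M" "A x \<in> SL2 M" "AE \<omega> in M. A (x + y) \<omega> = A x \<omega> + A y \<omega>" "AE \<omega> in M. A (c *\<^sub>R x) \<omega> = c * A x \<omega>"
  using assms unfolding L2_operator_def SL2_real by blast+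

lemma L2_operator_zero: "L2_operator M A \<Longrightarrow> AE \<omega> in M. A 0 \<omega> = 0"
  using L2_operatorD(4)[of M A 0 0] by simp

lemma L2_operator_sum:
  assumes A: "L2_operator M A" and "finite S"
  shows "AE \<omega> in M. A (\<Sum>k\<in>S. c k *\<^sub>R x k) \<omega> = (\<Sum>k\<in>S. c k * A (x k) \<omega>)"
  using assms(2)
proof (induction S)
  case empty
  show ?case using L2_operator_zero[OF A] by simp
next
  case (insert k S)
  have "AE \<omega> in M. A (c k *\<^sub>R x k + (\<Sum>k\<in>S. c k *\<^sub>R x k)) \<omega> = A (c k *\<^sub>R x k) \<omega> + A (\<Sum>k\<in>S. c k *\<^sub>R x k) \<omega>"
    by (rule L2_operatorD(3)[OF A])
  with insert.IH L2_operatorD(4)[OF A, of "c k" "x k"] show ?case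
  proof eventually_elim
    case (elim \<omega>)
    then show ?case using insert.hyps by simp
  qed
qed

lemma L2_operator_diff:
  assumes A: "L2_operator M A"
  shows "AE \<omega> in M. A (x - y) \<omega> = A x \<omega> - A y \<omega>"
  using L2_operatorD(3)[OF A, of x "(-1) *\<^sub>R y"] L2_operatorD(4)[OF A, of "-1" y] by eventually_elim simp

text \<open>Polarization.\<close>

lemma L2_operator_isometry_inner:
  assumes A: "L2_operator M A" and iso: "\<And>x. L2_norm M (A x) = norm x"
  shows "(\<integral>\<omega>. A x \<omega> * A y \<omega> \<partial>M) = x \<bullet> y"
proof -
  have i: "integrable M (\<lambda>\<omega>. A x \<omega> * A y \<omega>)" "integrable M (\<lambda>\<omega>. (A x \<omega>)\<^sup>2)" for x y
    using L2_mult_integrable[OF L2_operatorD(1)[OF A] L2_operatorD(1)[OF A]] L2_operatorD(1)[OF A, of x] unfolding L2_def by simp_all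
  have n: "(\<integral>\<omega>. (A z \<omega>)\<^sup>2 \<partial>M) = z \<bullet> z" for z
    using L2_norm_power2[of M "A z"] iso[of z] by (simp add: power2_norm_eq_inner)
  have m: "A z \<in> borel_measurable M" for z using L2_operatorD(1)[OF A, of z] unfolding L2_def by simp
  note m[measurable]
  have "(x + y) \<bullet> (x + y) = (\<integral>\<omega>. (A (x + y) \<omega>)\<^sup>2 \<partial>M)" by (rule n[symmetric])
  also have "\<dots> = (\<integral>\<omega>. (A x \<omega>)\<^sup>2 + (A y \<omega>)\<^sup>2 + 2 * (A x \<omega> * A y \<omega>) \<partial>M)"
  proof (rule integral_cong_AE)
    show "AE \<omega> in M. (A (x + y) \<omega>)\<^sup>2 = (A x \<omega>)\<^sup>2 + (A y \<omega>)\<^sup>2 + 2 * (A x \<omega> * A y \<omega>)"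
      using L2_operatorD(3)[OF A, of x y] by eventually_elim (simp add: power2_sum)
  qed measurable
  also have "\<dots> = x \<bullet> x + y \<bullet> y + 2 * (\<integral>\<omega>. A x \<omega> * A y \<omega> \<partial>M)"
    using i by (simp add: n)
  finally show ?thesis by (simp add: inner_add_left inner_add_right inner_commute)
qed

lemma isonormalD:
  assumes "isonormal_process M W"
  shows "prob_space M" "centered_gaussian M (W v)" "(\<integral>\<omega>. W v \<omega> * W w \<omega> \<partial>M) = v \<bullet> w"
proof -
  show "prob_space M" "(\<integral>\<omega>. W v \<omega> * W w \<omega> \<partial>M) = v \<bullet> w" using assms unfolding isonormal_process_def by blast+
  have "\<forall>F a. finite F \<longrightarrow> centered_gaussian M (\<lambda>\<omega>. \<Sum>v\<in>F. a v * W v \<omega>)"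
    using assms unfolding isonormal_process_def by blast
  from this[rule_format, of "{v}" "\<lambda>_. 1"] show "centered_gaussian M (W v)" by simp
qed

lemma isonormal_L2:
  assumes iso: "isonormal_process M W"
  shows "W v \<in> L2 M" "(CLINT \<omega>|M. iexp (W v \<omega>)) = complex_of_real (exp (- (v \<bullet> v) / 2))"
    "L2_norm M (W v) = norm v"
proof -
  interpret prob_space M by (rule isonormalD(1)[OF iso])
  show "W v \<in> L2 M" "(CLINT \<omega>|M. iexp (W v \<omega>)) = complex_of_real (exp (- (v \<bullet> v) / 2))"
    using centered_gaussian_moments[OF isonormalD(2)[OF iso] isonormalD(3)[OF iso]] by blast+
  show "L2_norm M (W v) = norm v"
    using isonormalD(3)[OF iso, of v v] unfolding L2_norm_def by (simp add: power2_eq_square norm_eq_sqrt_inner)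
qed

text \<open>
  Linearity up to null sets is a consequence of the covariance: \<open>W (v + w) - W v - W w\<close> and
  \<open>W (r v) - r W v\<close> have second moment zero.
\<close>

lemma isonormal_L2_operator:
  assumes iso: "isonormal_process M W"
  shows "L2_operator M W"
proof -
  interpret prob_space M by (rule isonormalD(1)[OF iso])
  note W2 = isonormal_L2(1)[OF iso]
  have W2': "W v \<in> SL2 M" for v using W2 by (simp add: SL2_real)
  have i: "integrable M (\<lambda>\<omega>. W v \<omega> * W w \<omega>)" for v w by (rule L2_mult_integrable[OF W2 W2])
  note c = isonormalD(3)[OF iso]
  have zero: "AE \<omega> in M. Y \<omega> = 0" if "Y \<in> SL2 M" "(\<integral>\<omega>. Y \<omega> * Y \<omega> \<partial>M) = 0" for Y :: "_ \<Rightarrow> real"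
    using L2_norm_eq_0[OF that(1)] that(2) unfolding L2_norm_def by (simp add: power2_eq_square)
  have add: "AE \<omega> in M. W (v + w) \<omega> = W v \<omega> + W w \<omega>" for v w
  proof -
    have "AE \<omega> in M. W (v + w) \<omega> - (W v \<omega> + W w \<omega>) = 0"
    proof (rule zero)
      show "(\<lambda>\<omega>. W (v + w) \<omega> - (W v \<omega> + W w \<omega>)) \<in> SL2 M" by (intro SL2_diff SL2_add W2')
      have "(\<integral>\<omega>. (W (v + w) \<omega> - (W v \<omega> + W w \<omega>)) * (W (v + w) \<omega> - (W v \<omega> + W w \<omega>)) \<partial>M)
        = (\<integral>\<omega>. W (v + w) \<omega> * W (v + w) \<omega> + W v \<omega> * W v \<omega> + W w \<omega> * W w \<omega> + 2 * (W v \<omega> * W w \<omega>)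
            - 2 * (W (v + w) \<omega> * W v \<omega>) - 2 * (W (v + w) \<omega> * W w \<omega>) \<partial>M)"
        by (intro Bochner_Integration.integral_cong refl) (simp add: algebra_simps)
      also have "\<dots> = 0" using i by (simp add: c inner_add_left inner_add_right inner_commute)
      finally show "(\<integral>\<omega>. (W (v + w) \<omega> - (W v \<omega> + W w \<omega>)) * (W (v + w) \<omega> - (W v \<omega> + W w \<omega>)) \<partial>M) = 0" .
    qed
    then show ?thesis by (rule AE_mp) simp
  qed
  have scale: "AE \<omega> in M. W (r *\<^sub>R v) \<omega> = r * W v \<omega>" for r v
  proof -
    have "AE \<omega> in M. W (r *\<^sub>R v) \<omega> - r *\<^sub>R W v \<omega> = 0"
    proof (rule zero)
      show "(\<lambda>\<omega>. W (r *\<^sub>R v) \<omega> - r *\<^sub>R W v \<omega>) \<in> SL2 M" by (intro SL2_diff SL2_scaleR W2')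
      have "(\<integral>\<omega>. (W (r *\<^sub>R v) \<omega> - r *\<^sub>R W v \<omega>) * (W (r *\<^sub>R v) \<omega> - r *\<^sub>R W v \<omega>) \<partial>M)
        = (\<integral>\<omega>. W (r *\<^sub>R v) \<omega> * W (r *\<^sub>R v) \<omega> + r\<^sup>2 * (W v \<omega> * W v \<omega>) - 2 * r * (W (r *\<^sub>R v) \<omega> * W v \<omega>) \<partial>M)"
        by (intro Bochner_Integration.integral_cong refl) (simp add: algebra_simps power2_eq_square)
      also have "\<dots> = 0" using i by (simp add: c power2_eq_square)
      finally show "(\<integral>\<omega>. (W (r *\<^sub>R v) \<omega> - r *\<^sub>R W v \<omega>) * (W (r *\<^sub>R v) \<omega> - r *\<^sub>R W v \<omega>) \<partial>M) = 0" .
    qed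
    then show ?thesis by (rule AE_mp) simp
  qed
  show ?thesis unfolding L2_operator_def
    using W2 add scale isonormal_L2(3)[OF iso] by (intro conjI allI exI[of _ 1]) simp_all
qed

definition orthonormal :: "nat \<Rightarrow> (nat \<Rightarrow> 'h::real_inner) \<Rightarrow> bool" where
  "orthonormal N h \<longleftrightarrow> (\<forall>j<N. \<forall>k<N. h j \<bullet> h k = (if j = k then 1 else 0))"

lemma orthonormalD: "orthonormal N h \<Longrightarrow> j < N \<Longrightarrow> k < N \<Longrightarrow> h j \<bullet> h k = (if j = k then 1 else 0)"
  unfolding orthonormal_def by blast

lemma orthonormal_norm_sum:
  assumes "orthonormal N h"
  shows "(\<Sum>j<N. a j *\<^sub>R h j) \<bullet> (\<Sum>j<N. b j *\<^sub>R h j) = (\<Sum>j<N. a j * b j)"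
proof -
  have "(\<Sum>j<N. a j *\<^sub>R h j) \<bullet> (\<Sum>j<N. b j *\<^sub>R h j) = (\<Sum>j<N. \<Sum>k<N. a j * (b k * (h j \<bullet> h k)))"
    by (simp add: inner_sum_left inner_sum_right sum_distrib_left mult_ac, rule sum.swap)
  also have "\<dots> = (\<Sum>j<N. \<Sum>k<N. if j = k then a j * b j else 0)"
    by (intro sum.cong refl) (auto simp: orthonormalD[OF assms])
  finally show ?thesis by simp
qed

text \<open>
  The linear combinations of the \<open>W (h j)\<close> are values of \<open>W\<close>, so the joint characteristic function
  is known.
\<close>

lemma isonormal_law:
  assumes iso: "isonormal_process M W" and h: "orthonormal N h"
  shows "(\<lambda>\<omega>. \<lambda>j\<in>{..<N}. W (h j) \<omega>) \<in> M \<rightarrow>\<^sub>M gaussian_space N"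
    and "distr M (gaussian_space N) (\<lambda>\<omega>. \<lambda>j\<in>{..<N}. W (h j) \<omega>) = gaussian_space N"
proof -
  have Wm [measurable]: "W v \<in> borel_measurable M" for v using isonormal_L2(1)[OF iso, of v] unfolding L2_def by simp
  have ch: "(CLINT \<omega>|M. iexp (\<Sum>j<N. a j * W (h j) \<omega>)) = complex_of_real (exp (- (\<Sum>j<N. (a j)\<^sup>2) / 2))" for a
  proof -
    let ?u = "\<Sum>j<N. a j *\<^sub>R h j"
    have gen: "(CLINT \<omega>|M. iexp (X \<omega>)) = (CLINT \<omega>|M. iexp (W ?u \<omega>))"
      if [measurable]: "X \<in> borel_measurable M" and eq: "AE \<omega> in M. W ?u \<omega> = X \<omega>" for X
      by (rule integral_cong_AE) (measurable, use eq in \<open>auto elim: AE_mp\<close>)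
    have "(CLINT \<omega>|M. iexp (\<Sum>j<N. a j * W (h j) \<omega>)) = (CLINT \<omega>|M. iexp (W ?u \<omega>))"
      by (rule gen) (measurable, rule L2_operator_sum[OF isonormal_L2_operator[OF iso]], simp)
    also have "?u \<bullet> ?u = (\<Sum>j<N. (a j)\<^sup>2)" by (simp add: orthonormal_norm_sum[OF h] power2_eq_square)
    then have "(CLINT \<omega>|M. iexp (W ?u \<omega>)) = complex_of_real (exp (- (\<Sum>j<N. (a j)\<^sup>2) / 2))"
      using isonormal_L2(2)[OF iso, of ?u] by simp
    finally show ?thesis .
  qed
  note L = gaussian_law[where M=M and N=N and Y="\<lambda>j. W (h j)", OF isonormalD(1)[OF iso] Wm ch]
  show "(\<lambda>\<omega>. \<lambda>j\<in>{..<N}. W (h j) \<omega>) \<in> M \<rightarrow>\<^sub>M gaussian_space N"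
    and "distr M (gaussian_space N) (\<lambda>\<omega>. \<lambda>j\<in>{..<N}. W (h j) \<omega>) = gaussian_space N"
    by (rule L)+
qed

lemma isonormal_unit_law:
  assumes iso: "isonormal_process M W" and v: "norm v = 1"
  shows "W v \<in> borel_measurable M" "distr M borel (W v) = std_normal_distribution"
proof -
  interpret prob_space M by (rule isonormalD(1)[OF iso])
  show Wm [measurable]: "W v \<in> borel_measurable M" using isonormal_L2(1)[OF iso, of v] unfolding L2_def by simp
  interpret D: real_distribution "distr M borel (W v)" by (rule real_distribution_distr) measurable
  have "char (distr M borel (W v)) t = char std_normal_distribution t" for t
  proof -
    have "char (distr M borel (W v)) t = (CLINT \<omega>|M. iexp (t * W v \<omega>))"
      unfolding char_def by (subst integral_distr) auto
    also have "\<dots> = (CLINT \<omega>|M. iexp (W (t *\<^sub>R v) \<omega>))"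
    proof (rule integral_cong_AE)
      have [measurable]: "W (t *\<^sub>R v) \<in> borel_measurable M" using isonormal_L2(1)[OF iso, of "t *\<^sub>R v"] unfolding L2_def by simp
      show "(\<lambda>\<omega>. iexp (W (t *\<^sub>R v) \<omega>)) \<in> borel_measurable M" by measurable
      show "AE \<omega> in M. iexp (t * W v \<omega>) = iexp (W (t *\<^sub>R v) \<omega>)"
        using L2_operatorD(4)[OF isonormal_L2_operator[OF iso], of t v] by eventually_elim simp
    qed measurable
    also have "\<dots> = char std_normal_distribution t"
      unfolding isonormal_L2(2)[OF iso] char_std_normal_distribution using v by (simp add: power2_eq_square norm_eq_1)
    finally show ?thesis .
  qed
  then show "distr M borel (W v) = std_normal_distribution"
    by (intro Levy_uniqueness D.real_distribution_axioms real_dist_normal_dist ext)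
qed

section \<open>Hermite polynomials\<close>

text \<open>
  The recursion is the one produced by differentiating \<open>H\<^sub>k(x) exp(- x\<^sup>2/2)\<close>.
\<close>

fun hermite_poly :: "nat \<Rightarrow> real poly" where
  "hermite_poly 0 = 1"
| "hermite_poly (Suc k) = smult (1 / real (Suc k)) ([:0, 1:] * hermite_poly k - pderiv (hermite_poly k))"

lemma hermite_poly_rec: "smult (real (Suc k)) (hermite_poly (Suc k)) = [:0, 1:] * hermite_poly k - pderiv (hermite_poly k)"
  by simp

declare hermite_poly.simps(2) [simp del]

lemma pderiv_hermite_poly: "pderiv (hermite_poly (Suc k)) = hermite_poly k"
proof (induction k)
  case 0
  show ?case by (simp add: hermite_poly.simps(2) pderiv_smult pderiv_pCons)
next
  case (Suc k)
  have "smult (real (Suc (Suc k))) (pderiv (hermite_poly (Suc (Suc k))))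
      = pderiv ([:0, 1:] * hermite_poly (Suc k) - pderiv (hermite_poly (Suc k)))"
    by (simp only: pderiv_smult[symmetric] hermite_poly_rec)
  also have "\<dots> = hermite_poly (Suc k) + ([:0, 1:] * hermite_poly k - pderiv (hermite_poly k))"
    by (simp add: pderiv_diff pderiv_mult Suc.IH pderiv_pCons)
  also have "\<dots> = hermite_poly (Suc k) + smult (real (Suc k)) (hermite_poly (Suc k))"
    by (simp only: hermite_poly_rec)
  also have "\<dots> = smult (1 + real (Suc k)) (hermite_poly (Suc k))"
    by (simp only: smult_add_left smult_1_left)
  also have "1 + real (Suc k) = real (Suc (Suc k))" by simp
  finally show ?case by (simp only: smult_eq_iff) simp
qed

lemma hermite_eq_poly: "hermite k x = poly (hermite_poly k) x"
proof -
  have "(deriv ^^ k) (\<lambda>y. exp (- (y\<^sup>2) / 2)) = (\<lambda>y. (- 1) ^ k * fact k * poly (hermite_poly k) y * exp (- (y\<^sup>2) / 2))"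
  proof (induction k)
    case (Suc k)
    have "(deriv ^^ Suc k) (\<lambda>y. exp (- (y\<^sup>2) / 2)) = deriv (\<lambda>y. (- 1) ^ k * fact k * poly (hermite_poly k) y * exp (- (y\<^sup>2) / 2))"
      by (simp only: funpow.simps o_def Suc.IH)
    also have "\<dots> = (\<lambda>y. (- 1) ^ Suc k * fact (Suc k) * poly (hermite_poly (Suc k)) y * exp (- (y\<^sup>2) / 2))"
    proof
      fix y :: real
      have "((\<lambda>y. (- 1) ^ k * fact k * poly (hermite_poly k) y * exp (- (y\<^sup>2) / 2)) has_real_derivative
          (- 1) ^ k * fact k * (poly (pderiv (hermite_poly k)) y * exp (- (y\<^sup>2) / 2) + poly (hermite_poly k) y * (exp (- (y\<^sup>2) / 2) * - y))) (at y)"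
        by (auto intro!: derivative_eq_intros simp: algebra_simps)
      moreover have "(- 1) ^ k * fact k * (poly (pderiv (hermite_poly k)) y * exp (- (y\<^sup>2) / 2) + poly (hermite_poly k) y * (exp (- (y\<^sup>2) / 2) * - y))
         = (- 1) ^ Suc k * fact (Suc k) * poly (hermite_poly (Suc k)) y * exp (- (y\<^sup>2) / 2)"
      proof -
        have "real (Suc k) * poly (hermite_poly (Suc k)) y = y * poly (hermite_poly k) y - poly (pderiv (hermite_poly k)) y"
          using arg_cong[OF hermite_poly_rec[of k], of "\<lambda>p. poly p y"] by simp
        then have "fact (Suc k) * poly (hermite_poly (Suc k)) y = fact k * (y * poly (hermite_poly k) y - poly (pderiv (hermite_poly k)) y)"
          unfolding fact_Suc of_nat_mult by (simp add: mult.commute mult.left_commute)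
        note A = this
        have "(- 1) ^ Suc k * fact (Suc k) * poly (hermite_poly (Suc k)) y * exp (- (y\<^sup>2) / 2)
          = (- 1) ^ Suc k * (fact (Suc k) * poly (hermite_poly (Suc k)) y) * exp (- (y\<^sup>2) / 2)" by (simp only: mult.assoc)
        also have "\<dots> = (- 1) ^ k * fact k * (poly (pderiv (hermite_poly k)) y * exp (- (y\<^sup>2) / 2) + poly (hermite_poly k) y * (exp (- (y\<^sup>2) / 2) * - y))"
          unfolding A by (simp only: power_Suc) (simp add: algebra_simps)
        finally show ?thesis by (rule sym)
      qed
      ultimately show "deriv (\<lambda>y. (- 1) ^ k * fact k * poly (hermite_poly k) y * exp (- (y\<^sup>2) / 2)) y
         = (- 1) ^ Suc k * fact (Suc k) * poly (hermite_poly (Suc k)) y * exp (- (y\<^sup>2) / 2)"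
        by (simp only: DERIV_imp_deriv)
    qed
    finally show ?case .
  qed simp
  then have "hermite k x = ((- 1) ^ k * (- 1) ^ k) * (fact k / fact k) * (exp (x\<^sup>2 / 2) * exp (- (x\<^sup>2) / 2)) * poly (hermite_poly k) x"
    unfolding hermite_def by (simp add: mult_ac)
  also have "(- 1) ^ k * (- 1) ^ k = (1::real)" by (simp flip: power_mult_distrib)
  also have "exp (x\<^sup>2 / 2) * exp (- (x\<^sup>2) / 2) = 1" by (simp flip: exp_add)
  finally show ?thesis by simp
qed

lemma hermite_rec: "real (Suc k) * hermite (Suc k) x = x * hermite k x - poly (pderiv (hermite_poly k)) x"
  using arg_cong[OF hermite_poly_rec[of k], of "\<lambda>p. poly p x"] by (simp add: hermite_eq_poly)

lemma degree_hermite_poly: "degree (hermite_poly k) \<le> k"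
proof (induction k)
  case (Suc k)
  have "degree ([:0, 1:] * hermite_poly k) \<le> Suc k"
    using degree_mult_le[of "[:0, 1:]" "hermite_poly k"] Suc.IH by simp
  moreover have "degree (pderiv (hermite_poly k)) \<le> Suc k" using degree_pderiv[of "hermite_poly k"] Suc.IH by simp
  ultimately have "degree ([:0, 1:] * hermite_poly k - pderiv (hermite_poly k)) \<le> Suc k" by (rule degree_diff_le)
  then show ?case unfolding hermite_poly.simps by (rule order_trans[OF degree_smult_le])
qed simp

lemma integrable_gaussian_poly: "integrable std_normal_distribution (\<lambda>x. poly p x)"
  unfolding poly_altdef by (intro Bochner_Integration.integrable_sum integrable_mult_right integrable_std_normal_distribution_moment)

text \<open>On monomials this is the recursion between the explicit Gaussian moments.\<close>

lemma gaussian_integration_by_parts: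
  "(\<integral>x. x * poly p x \<partial>std_normal_distribution) = (\<integral>x. poly (pderiv p) x \<partial>std_normal_distribution)"
proof -
  have mono: "(\<integral>x. x * x ^ i \<partial>std_normal_distribution) = real i * (\<integral>x. x ^ (i - 1) \<partial>std_normal_distribution)" for i
  proof (cases "even i")
    case True
    have "(\<integral>x. x ^ Suc i \<partial>std_normal_distribution) = 0"
      using True by (intro integral_std_normal_distribution_moment_odd) simp
    moreover have "real i * (\<integral>x. x ^ (i - 1) \<partial>std_normal_distribution) = 0"
      using True by (cases "i = 0") (auto intro!: integral_std_normal_distribution_moment_odd)
    ultimately show ?thesis by simp
  next
    case False
    then obtain k where k: "i = 2 * k + 1" by (rule oddE)
    have e: "(\<integral>x. x ^ (2 * k) \<partial>std_normal_distribution) = fact (2 * k) / (2 ^ k * fact k)" for k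
      using std_normal_distribution_even_moments(1)[of k] by simp
    have "(\<integral>x. x * x ^ i \<partial>std_normal_distribution) = (\<integral>x. x ^ (2 * Suc k) \<partial>std_normal_distribution)"
      unfolding k by simp
    also have "\<dots> = real i * (fact (2 * k) / (2 ^ k * fact k))"
    proof -
      have a: "fact (2 * Suc k) = (2 * real k + 2) * ((2 * real k + 1) * fact (2 * k))" by (simp add: algebra_simps)
      have b: "2 ^ Suc k * fact (Suc k) = (2 * real k + 2) * (2 ^ k * fact k)" by (simp add: algebra_simps)
      have c: "2 * real k + 2 \<noteq> 0" by (simp add: add_nonneg_eq_0_iff)
      show ?thesis unfolding e[of "Suc k"] a b mult_divide_mult_cancel_left[OF c] k by simp
    qed
    also have "\<dots> = real i * (\<integral>x. x ^ (i - 1) \<partial>std_normal_distribution)" unfolding e[symmetric] k by simp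
    finally show ?thesis .
  qed
  have i: "integrable std_normal_distribution (\<lambda>x. x ^ i)" for i by (rule integrable_std_normal_distribution_moment)
  have i': "integrable std_normal_distribution (\<lambda>x. x * x ^ i)" for i
    using integrable_std_normal_distribution_moment[of "Suc i"] by simp
  have "(\<integral>x. x * poly p x \<partial>std_normal_distribution) = (\<integral>x. (\<Sum>i\<le>degree p. coeff p i * (x * x ^ i)) \<partial>std_normal_distribution)"
    by (simp add: poly_altdef sum_distrib_left mult_ac)
  also have "\<dots> = (\<Sum>i\<le>degree p. coeff p i * (real i * (\<integral>x. x ^ (i - 1) \<partial>std_normal_distribution)))"
    using i' by (subst Bochner_Integration.integral_sum) (simp_all add: mono)
  also have "\<dots> = (\<integral>x. (\<Sum>i\<le>degree p. coeff p i * (real i * x ^ (i - 1))) \<partial>std_normal_distribution)"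
    using i by (subst Bochner_Integration.integral_sum) simp_all
  also have "(\<lambda>x. \<Sum>i\<le>degree p. coeff p i * (real i * x ^ (i - 1))) = (\<lambda>x. poly (pderiv p) x)"
  proof
    fix x :: real
    have "((\<lambda>x. \<Sum>i\<le>degree p. coeff p i * x ^ i) has_real_derivative (\<Sum>i\<le>degree p. coeff p i * (real i * x ^ (i - 1)))) (at x)"
      by (intro DERIV_sum DERIV_cmult DERIV_pow[unfolded One_nat_def[symmetric]])
    then have "(poly p has_real_derivative (\<Sum>i\<le>degree p. coeff p i * (real i * x ^ (i - 1)))) (at x)"
      by (simp only: poly_altdef[symmetric, abs_def])
    from DERIV_unique[OF this poly_DERIV] show "(\<Sum>i\<le>degree p. coeff p i * (real i * x ^ (i - 1))) = poly (pderiv p) x" .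
  qed
  finally show ?thesis .
qed

lemma integrable_gaussian_hermite_mult: "integrable std_normal_distribution (\<lambda>x. hermite j x * hermite k x)"
  using integrable_gaussian_poly[of "hermite_poly j * hermite_poly k"] by (simp add: hermite_eq_poly)

text \<open>
  Integration by parts lowers both indices: \<open>(k + 1) E H\<^sub>j H\<^bsub>k+1\<^esub> = E H\<^bsub>j-1\<^esub> H\<^sub>k\<close>. Repeating it
  ends with \<open>E H\<^sub>0 H\<^sub>l = 0\<close> for some \<open>l > 0\<close>.
\<close>

lemma hermite_orthogonal:
  "j \<noteq> k \<Longrightarrow> (\<integral>x. hermite j x * hermite k x \<partial>std_normal_distribution) = 0"
proof -
  have step: "real (Suc k) * (\<integral>x. hermite j x * hermite (Suc k) x \<partial>std_normal_distribution)
     = (\<integral>x. poly (pderiv (hermite_poly j)) x * hermite k x \<partial>std_normal_distribution)" for j k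
  proof -
    let ?j = "hermite_poly j" and ?k = "hermite_poly k"
    note I = integrable_gaussian_poly
    have "real (Suc k) * (\<integral>x. hermite j x * hermite (Suc k) x \<partial>std_normal_distribution)
       = (\<integral>x. hermite j x * (real (Suc k) * hermite (Suc k) x) \<partial>std_normal_distribution)"
      by (simp only: mult.left_commute[of _ "real (Suc k)"] integral_mult_right_zero)
    also have "\<dots> = (\<integral>x. x * poly (?j * ?k) x - poly (?j * pderiv ?k) x \<partial>std_normal_distribution)"
      unfolding hermite_rec by (simp add: hermite_eq_poly algebra_simps)
    also have "\<dots> = (\<integral>x. x * poly (?j * ?k) x \<partial>std_normal_distribution) - (\<integral>x. poly (?j * pderiv ?k) x \<partial>std_normal_distribution)"
      by (rule Bochner_Integration.integral_diff) (use I[of "[:0, 1:] * (?j * ?k)"] I[of "?j * pderiv ?k"] in simp_all)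
    also have "(\<integral>x. x * poly (?j * ?k) x \<partial>std_normal_distribution)
       = (\<integral>x. poly (?j * pderiv ?k) x \<partial>std_normal_distribution) + (\<integral>x. poly (pderiv ?j * ?k) x \<partial>std_normal_distribution)"
      unfolding gaussian_integration_by_parts pderiv_mult poly_add
      by (subst Bochner_Integration.integral_add[OF I I]) (simp add: mult.commute)
    finally show ?thesis by (simp add: hermite_eq_poly)
  qed
  have zero: "(\<integral>x. hermite 0 x * hermite (Suc k) x \<partial>std_normal_distribution) = 0" for k
    using step[of k 0] by (simp add: pderiv_1)
  show "j \<noteq> k \<Longrightarrow> (\<integral>x. hermite j x * hermite k x \<partial>std_normal_distribution) = 0"
  proof (induction j arbitrary: k)
    case 0
    then obtain k' where "k = Suc k'" by (cases k) auto
    then show ?case using zero by simp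
  next
    case (Suc j)
    show ?case
    proof (cases k)
      case 0
      then show ?thesis using zero[of j] by (simp add: mult.commute)
    next
      case (Suc k')
      then have "(\<integral>x. hermite j x * hermite k' x \<partial>std_normal_distribution) = 0" using Suc.IH Suc.prems by simp
      then show ?thesis using step[of k' "Suc j"] Suc by (simp add: pderiv_hermite_poly hermite_eq_poly)
    qed
  qed
qed

text \<open>
  Hermite polynomials are eigenfunctions of the Mehler operators; the integrated recursion for
  \<open>H\<^sub>k\<close> is the recursion for \<open>r\<^sup>k H\<^sub>k\<close>.
\<close>

lemma hermite_mehler:
  assumes rs: "r\<^sup>2 + s\<^sup>2 = 1"
  shows "(\<integral>z. hermite k (r * x + s * z) \<partial>std_normal_distribution) = r ^ k * hermite k x"
proof -
  interpret G: prob_space std_normal_distribution by (rule prob_space_std_normal)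
  define E where "E = (\<lambda>p. \<integral>z. poly p (r * x + s * z) \<partial>std_normal_distribution)"
  have comp: "poly p (r * x + s * z) = poly (pcompose p [:r * x, s:]) z" for p z by (simp add: poly_pcompose mult.commute)
  have I: "integrable std_normal_distribution (\<lambda>z. poly p (r * x + s * z))" for p unfolding comp by (rule integrable_gaussian_poly)
  have step: "real (Suc k) * E (hermite_poly (Suc k)) = r * x * E (hermite_poly k) - r\<^sup>2 * E (pderiv (hermite_poly k))" for k
  proof -
    let ?p = "hermite_poly k"
    have I2: "integrable std_normal_distribution (\<lambda>z. z * poly ?p (r * x + s * z))"
      using integrable_gaussian_poly[of "[:0, 1:] * pcompose ?p [:r * x, s:]"] by (simp add: comp)
    have "(\<integral>z. z * poly ?p (r * x + s * z) \<partial>std_normal_distribution) = s * E (pderiv ?p)"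
    proof -
      have "poly (pderiv (pcompose ?p [:r * x, s:])) = (\<lambda>z. s * poly (pderiv ?p) (r * x + s * z))"
        by (rule ext) (simp add: pderiv_pcompose pderiv_pCons poly_pcompose mult.commute)
      then show ?thesis
        unfolding comp[of ?p] gaussian_integration_by_parts E_def by simp
    qed
    moreover have "real (Suc k) * E (hermite_poly (Suc k))
       = (\<integral>z. r * x * poly ?p (r * x + s * z) + s * (z * poly ?p (r * x + s * z)) - poly (pderiv ?p) (r * x + s * z) \<partial>std_normal_distribution)"
    proof -
      have "real (Suc k) * E (hermite_poly (Suc k)) = (\<integral>z. real (Suc k) * hermite (Suc k) (r * x + s * z) \<partial>std_normal_distribution)"
        unfolding E_def hermite_eq_poly by simp
      then show ?thesis unfolding hermite_rec by (simp add: hermite_eq_poly algebra_simps)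
    qed
    moreover have "\<dots> = r * x * E ?p + s * (\<integral>z. z * poly ?p (r * x + s * z) \<partial>std_normal_distribution) - E (pderiv ?p)"
      using I[of ?p] I2 I[of "pderiv ?p"] unfolding E_def by simp
    ultimately have "real (Suc k) * E (hermite_poly (Suc k)) = r * x * E ?p + (s\<^sup>2 - 1) * E (pderiv ?p)"
      by (simp add: power2_eq_square algebra_simps)
    also have "s\<^sup>2 - 1 = - r\<^sup>2" using rs by simp
    finally show ?thesis by simp
  qed
  have E0: "E (hermite_poly 0) = 1" unfolding E_def using G.prob_space by (simp del: space_density)
  have E0': "E (pderiv (hermite_poly 0)) = 0" unfolding E_def by (simp add: pderiv_1)
  have main: "E (hermite_poly k) = r ^ k * hermite k x \<and> E (hermite_poly (Suc k)) = r ^ Suc k * hermite (Suc k) x" for k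
  proof (induction k)
    case 0
    show ?case using step[of 0] E0 E0' hermite_rec[of 0 x] by (simp add: hermite_eq_poly)
  next
    case (Suc k)
    have "real (Suc (Suc k)) * E (hermite_poly (Suc (Suc k))) = r * x * (r ^ Suc k * hermite (Suc k) x) - r\<^sup>2 * (r ^ k * hermite k x)"
      using step[of "Suc k"] Suc by (simp add: pderiv_hermite_poly)
    also have "\<dots> = r ^ Suc (Suc k) * (real (Suc (Suc k)) * hermite (Suc (Suc k)) x)"
      unfolding hermite_rec[of "Suc k" x] pderiv_hermite_poly hermite_eq_poly[symmetric] by (simp add: power2_eq_square algebra_simps)
    finally have "real (Suc (Suc k)) * E (hermite_poly (Suc (Suc k))) = real (Suc (Suc k)) * (r ^ Suc (Suc k) * hermite (Suc (Suc k)) x)"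
      by (simp add: algebra_simps)
    then show ?case using Suc by (simp only: mult_cancel_left) simp
  qed
  then show ?thesis using main[of k] unfolding E_def hermite_eq_poly by simp
qed

section \<open>Orthogonality and closedness of Wiener chaoses\<close>

lemma L2_real_intros:
  shows "f \<in> L2 M \<Longrightarrow> g \<in> L2 M \<Longrightarrow> (\<lambda>\<omega>. f \<omega> + g \<omega>) \<in> L2 M"
    and "f \<in> L2 M \<Longrightarrow> g \<in> L2 M \<Longrightarrow> (\<lambda>\<omega>. f \<omega> - g \<omega>) \<in> L2 M"
    and "f \<in> L2 M \<Longrightarrow> (\<lambda>\<omega>. c * f \<omega>) \<in> L2 M"
  using SL2_add[of f M g] SL2_diff[of f M g] SL2_scaleR[of f M c] by (simp_all add: SL2_real)

lemma L2_real_sum: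
  assumes "finite A" "\<And>k. k \<in> A \<Longrightarrow> f k \<in> L2 M"
  shows "(\<lambda>\<omega>. \<Sum>k\<in>A. c k * f k \<omega>) \<in> L2 M"
  unfolding SL2_real[symmetric]
  by (rule SL2_sum[OF assms(1)]) (simp add: SL2_real L2_real_intros(3) assms(2))

lemma hermite_measurable [measurable]: "hermite k \<in> borel_measurable borel"
proof -
  have "hermite k = poly (hermite_poly k)" by (rule ext) (rule hermite_eq_poly)
  moreover have "continuous_on UNIV (poly (hermite_poly k))" by (intro continuous_intros)
  ultimately show ?thesis by (simp only: borel_measurable_continuous_onI)
qed

lemma hermite_chaos_L2:
  assumes iso: "isonormal_process M W" and v: "norm v = 1"
  shows "(\<lambda>\<omega>. hermite k (W v \<omega>)) \<in> L2 M"
proof -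
  note L [measurable] = isonormal_unit_law(1)[OF assms]
  have "integrable (distr M borel (W v)) (\<lambda>x. hermite k x * hermite k x)"
    unfolding isonormal_unit_law(2)[OF assms] by (rule integrable_gaussian_hermite_mult)
  then have "integrable M (\<lambda>\<omega>. hermite k (W v \<omega>) * hermite k (W v \<omega>))"
    by (subst (asm) integrable_distr_eq) auto
  then show ?thesis unfolding L2_def by (simp add: power2_eq_square)
qed

text \<open>
  Decompose \<open>w = r v + s z\<close> with \<open>z\<close> a unit vector orthogonal to \<open>v\<close>. Then \<open>W v\<close> and \<open>W z\<close> are
  independent standard Gaussian variables, and averaging over \<open>W z\<close> turns \<open>H\<^sub>k (W w)\<close> into
  \<open>r\<^sup>k H\<^sub>k (W v)\<close>, which is orthogonal to \<open>H\<^sub>j (W v)\<close>. The case \<open>s = 0\<close>, where there is no \<open>z\<close>, is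
  separate.
\<close>

lemma hermite_chaos_orthogonal:
  assumes iso: "isonormal_process M W" and v: "norm v = 1" and w: "norm w = 1" and jk: "j \<noteq> k"
  shows "(\<integral>\<omega>. hermite j (W v \<omega>) * hermite k (W w \<omega>) \<partial>M) = 0"
proof -
  interpret prob_space M by (rule isonormalD(1)[OF iso])
  interpret G: prob_space std_normal_distribution by (rule prob_space_std_normal)
  interpret P: product_sigma_finite "\<lambda>_::nat. std_normal_distribution" by standard
  have Wm [measurable]: "W v \<in> borel_measurable M" for v using isonormal_L2(1)[OF iso, of v] unfolding L2_def by simp
  have HH: "(\<integral>x. hermite j x * (r ^ k * hermite k x) \<partial>std_normal_distribution) = 0" for r :: real
    by (simp only: mult.left_commute[of _ "r ^ k"] integral_mult_right_zero hermite_orthogonal[OF jk] mult_zero_right)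
  define r where "r = v \<bullet> w"
  define d where "d = w - r *\<^sub>R v"
  have vv: "v \<bullet> v = 1" and ww: "w \<bullet> w = 1" using v w by (simp_all add: norm_eq_1)
  have dv: "v \<bullet> d = 0" "d \<bullet> v = 0" unfolding d_def r_def by (simp_all add: inner_diff_right inner_diff_left vv inner_commute)
  have dd: "r\<^sup>2 + (norm d)\<^sup>2 = 1"
    unfolding power2_norm_eq_inner d_def by (simp add: inner_diff_right inner_diff_left vv ww r_def inner_commute power2_eq_square)
  show ?thesis
  proof (cases "norm d = 0")
    case True
    then have "w = r *\<^sub>R v" "r\<^sup>2 + 0\<^sup>2 = 1" using dd unfolding d_def by simp_all
    then have ae: "AE \<omega> in M. W w \<omega> = r * W v \<omega>" using L2_operatorD(4)[OF isonormal_L2_operator[OF iso], of r v] by simp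
    have scale: "hermite k (r * x) = r ^ k * hermite k x" for x
      using hermite_mehler[OF \<open>r\<^sup>2 + 0\<^sup>2 = 1\<close>, of k x] G.prob_space by (simp del: space_density)
    have "(\<integral>\<omega>. hermite j (W v \<omega>) * hermite k (W w \<omega>) \<partial>M) = (\<integral>\<omega>. hermite j (W v \<omega>) * (r ^ k * hermite k (W v \<omega>)) \<partial>M)"
    proof (rule integral_cong_AE)
      show "AE \<omega> in M. hermite j (W v \<omega>) * hermite k (W w \<omega>) = hermite j (W v \<omega>) * (r ^ k * hermite k (W v \<omega>))"
        using ae by eventually_elim (simp only: scale)
    qed measurable
    also have "\<dots> = (\<integral>x. hermite j x * (r ^ k * hermite k x) \<partial>distr M borel (W v))"
      by (subst integral_distr) auto
    finally show ?thesis unfolding isonormal_unit_law(2)[OF iso v] HH .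
  next
    case False
    define s where "s = norm d"
    define z where "z = d /\<^sub>R s"
    have s0: "s \<noteq> 0" using False unfolding s_def .
    have weq: "w = r *\<^sub>R v + s *\<^sub>R z" unfolding z_def d_def using s0 by simp
    define h where "h = (\<lambda>i::nat. if i = 0 then v else z)"
    have zz: "z \<bullet> z = 1" unfolding z_def s_def using False by (simp add: power2_norm_eq_inner[symmetric] power2_eq_square[symmetric] field_simps)
    have h: "orthonormal 2 h"
      unfolding orthonormal_def h_def using vv zz dv by (auto simp: z_def less_2_cases_iff)
    note L = isonormal_law[OF iso h]
    note L(1)[measurable]
    let ?T = "\<lambda>\<omega>. \<lambda>j\<in>{..<2}. W (h j) \<omega>"
    define f where "f = (\<lambda>x::nat \<Rightarrow> real. hermite j (x 0) * hermite k (r * x 0 + s * x 1))"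
    have [measurable]: "f \<in> borel_measurable (gaussian_space 2)"
      unfolding f_def by measurable
    have fT: "f (?T \<omega>) = hermite j (W v \<omega>) * hermite k (r * W v \<omega> + s * W z \<omega>)" for \<omega>
      unfolding f_def h_def by simp
    have ae: "AE \<omega> in M. hermite j (W v \<omega>) * hermite k (W w \<omega>) = f (?T \<omega>)"
      using L2_operatorD(3)[OF isonormal_L2_operator[OF iso], of "r *\<^sub>R v" "s *\<^sub>R z"]
        L2_operatorD(4)[OF isonormal_L2_operator[OF iso], of r v] L2_operatorD(4)[OF isonormal_L2_operator[OF iso], of s z]
      unfolding fT weq[symmetric] by eventually_elim simp
    have fTm [measurable]: "(\<lambda>\<omega>. f (?T \<omega>)) \<in> borel_measurable M" by measurable
    have "integrable M (\<lambda>\<omega>. hermite j (W v \<omega>) * hermite k (W w \<omega>))"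
      by (intro L2_mult_integrable hermite_chaos_L2 iso v w)
    then have "integrable M (\<lambda>\<omega>. f (?T \<omega>))"
      by (subst integrable_cong_AE[symmetric, OF _ _ ae]) measurable
    then have "integrable (distr M (gaussian_space 2) ?T) f"
      by (subst integrable_distr_eq) measurable
    then have fi: "integrable (gaussian_space 2) f" unfolding L(2) .
    have two: "{..<2::nat} = insert 1 {0}" by auto
    have "(\<integral>\<omega>. hermite j (W v \<omega>) * hermite k (W w \<omega>) \<partial>M) = (\<integral>\<omega>. f (?T \<omega>) \<partial>M)"
      by (rule integral_cong_AE[OF _ _ ae]) measurable
    also have "\<dots> = (\<integral>x. f x \<partial>distr M (gaussian_space 2) ?T)"
      by (rule integral_distr[symmetric]) measurable
    also have "\<dots> = (\<integral>x. f x \<partial>gaussian_space 2)" unfolding L(2) ..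
    also have "\<dots> = (\<integral>x. f x \<partial>PiM (insert 1 {0}) (\<lambda>_. std_normal_distribution))" unfolding two ..
    also have "\<dots> = (\<integral>x. (\<integral>y. f (x(1 := y)) \<partial>std_normal_distribution) \<partial>PiM {0::nat} (\<lambda>_. std_normal_distribution))"
      using fi unfolding two by (intro P.product_integral_insert) simp_all
    also have "\<dots> = (\<integral>x. hermite j (x 0) * (r ^ k * hermite k (x 0)) \<partial>PiM {0::nat} (\<lambda>_. std_normal_distribution))"
      using hermite_mehler[of r s k] dd unfolding f_def s_def by simp
    also have "\<dots> = (\<integral>x. hermite j x * (r ^ k * hermite k x) \<partial>std_normal_distribution)"
      by (rule P.product_integral_singleton[where f="\<lambda>x. hermite j x * (r ^ k * hermite k x)"]) measurable
    finally show ?thesis unfolding HH .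
  qed
qed

lemma closed_span_approx:
  assumes "Y \<in> L2_closed_span M A" "e > 0"
  obtains F a where "finite F" "F \<subseteq> A" "L2_norm M (\<lambda>\<omega>. Y \<omega> - (\<Sum>f\<in>F. a f * f \<omega>)) < e"
proof -
  from assms have "\<exists>F a. finite F \<and> F \<subseteq> A \<and> L2_norm M (\<lambda>\<omega>. Y \<omega> - (\<Sum>f\<in>F. a f * f \<omega>)) < e"
    unfolding L2_closed_span_def by blast
  then show thesis by (elim exE conjE) (rule that)
qed

lemma closed_span_L2: "Y \<in> L2_closed_span M A \<Longrightarrow> Y \<in> L2 M"
  unfolding L2_closed_span_def by blast

lemma closed_spanI:
  assumes "Y \<in> L2 M" "\<And>e. e > 0 \<Longrightarrow> \<exists>F a. finite F \<and> F \<subseteq> A \<and> L2_norm M (\<lambda>\<omega>. Y \<omega> - (\<Sum>f\<in>F. a f * f \<omega>)) < e"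
  shows "Y \<in> L2_closed_span M A"
  unfolding L2_closed_span_def using assms by blast

lemma closed_span_limit:
  assumes A: "A \<subseteq> L2 M" and Y: "Y \<in> L2 M"
    and lim: "\<And>e. e > 0 \<Longrightarrow> \<exists>Z\<in>L2_closed_span M A. L2_norm M (\<lambda>\<omega>. Y \<omega> - Z \<omega>) < e"
  shows "Y \<in> L2_closed_span M A"
proof (rule closed_spanI[OF Y])
  fix e :: real assume "e > 0"
  then have e2: "e / 2 > 0" by simp
  obtain Z where Z: "Z \<in> L2_closed_span M A" "L2_norm M (\<lambda>\<omega>. Y \<omega> - Z \<omega>) < e / 2" using lim[OF e2] by blast
  obtain F a where F: "finite F" "F \<subseteq> A" "L2_norm M (\<lambda>\<omega>. Z \<omega> - (\<Sum>f\<in>F. a f * f \<omega>)) < e / 2"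
    by (rule closed_span_approx[OF Z(1) e2]) (rule that)
  have S: "(\<lambda>\<omega>. \<Sum>f\<in>F. a f * f \<omega>) \<in> L2 M" using F A by (intro L2_real_sum) auto
  have "L2_norm M (\<lambda>\<omega>. Y \<omega> - (\<Sum>f\<in>F. a f * f \<omega>)) < e"
    using L2_norm_triangle_diff[of Y M Z "\<lambda>\<omega>. \<Sum>f\<in>F. a f * f \<omega>"] Y closed_span_L2[OF Z(1)] S Z(2) F(3)
    by (simp add: SL2_real)
  then show "\<exists>F a. finite F \<and> F \<subseteq> A \<and> L2_norm M (\<lambda>\<omega>. Y \<omega> - (\<Sum>f\<in>F. a f * f \<omega>)) < e" using F by blast
qed

lemma closed_span_linear:
  assumes A: "A \<subseteq> L2 M" and Y: "Y \<in> L2_closed_span M A" and Z: "Z \<in> L2_closed_span M A"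
  shows "(\<lambda>\<omega>. Y \<omega> + c * Z \<omega>) \<in> L2_closed_span M A"
proof (rule closed_spanI)
  note Y2 = closed_span_L2[OF Y] and Z2 = closed_span_L2[OF Z]
  show "(\<lambda>\<omega>. Y \<omega> + c * Z \<omega>) \<in> L2 M" by (intro L2_real_intros Y2 Z2)
  fix e :: real assume "e > 0"
  then have e2: "e / 2 > 0" "e / (2 * (\<bar>c\<bar> + 1)) > 0" by simp_all
  obtain F a where F: "finite F" "F \<subseteq> A" "L2_norm M (\<lambda>\<omega>. Y \<omega> - (\<Sum>f\<in>F. a f * f \<omega>)) < e / 2"
    by (rule closed_span_approx[OF Y e2(1)]) (rule that)
  obtain G b where G: "finite G" "G \<subseteq> A" "L2_norm M (\<lambda>\<omega>. Z \<omega> - (\<Sum>f\<in>G. b f * f \<omega>)) < e / (2 * (\<bar>c\<bar> + 1))"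
    by (rule closed_span_approx[OF Z e2(2)]) (rule that)
  define d where "d = (\<lambda>f. (if f \<in> F then a f else 0) + c * (if f \<in> G then b f else 0))"
  have FG: "(\<Sum>f\<in>F \<union> G. d f * f \<omega>) = (\<Sum>f\<in>F. a f * f \<omega>) + c * (\<Sum>f\<in>G. b f * f \<omega>)" for \<omega>
  proof -
    have "(\<Sum>f\<in>F \<union> G. d f * f \<omega>) = (\<Sum>f\<in>F \<union> G. (if f \<in> F then a f * f \<omega> else 0)) + c * (\<Sum>f\<in>F \<union> G. (if f \<in> G then b f * f \<omega> else 0))"
      unfolding sum_distrib_left sum.distrib[symmetric] d_def by (intro sum.cong refl) (simp add: algebra_simps)
    also have "(\<Sum>f\<in>F \<union> G. (if f \<in> F then a f * f \<omega> else 0)) = (\<Sum>f\<in>F. a f * f \<omega>)"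
      using F G by (simp add: sum.inter_restrict[symmetric] Int_absorb1)
    also have "(\<Sum>f\<in>F \<union> G. (if f \<in> G then b f * f \<omega> else 0)) = (\<Sum>f\<in>G. b f * f \<omega>)"
      using F G by (simp add: sum.inter_restrict[symmetric] Int_absorb1)
    finally show ?thesis .
  qed
  have S: "(\<lambda>\<omega>. \<Sum>f\<in>F. a f * f \<omega>) \<in> SL2 M" "(\<lambda>\<omega>. \<Sum>f\<in>G. b f * f \<omega>) \<in> SL2 M"
    unfolding SL2_real using F G A by (auto intro!: L2_real_sum)
  have YF: "(\<lambda>\<omega>. Y \<omega> - (\<Sum>f\<in>F. a f * f \<omega>)) \<in> SL2 M" and ZG: "(\<lambda>\<omega>. Z \<omega> - (\<Sum>f\<in>G. b f * f \<omega>)) \<in> SL2 M"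
    using Y2 Z2 by (auto intro!: SL2_diff S simp: SL2_real[symmetric])
  have "L2_norm M (\<lambda>\<omega>. (Y \<omega> + c * Z \<omega>) - (\<Sum>f\<in>F \<union> G. d f * f \<omega>))
     = L2_norm M (\<lambda>\<omega>. (Y \<omega> - (\<Sum>f\<in>F. a f * f \<omega>)) + c *\<^sub>R (Z \<omega> - (\<Sum>f\<in>G. b f * f \<omega>)))"
    unfolding FG by (simp add: algebra_simps)
  also have "\<dots> \<le> L2_norm M (\<lambda>\<omega>. Y \<omega> - (\<Sum>f\<in>F. a f * f \<omega>)) + \<bar>c\<bar> * L2_norm M (\<lambda>\<omega>. Z \<omega> - (\<Sum>f\<in>G. b f * f \<omega>))"
    using L2_norm_triangle[OF YF SL2_scaleR[OF ZG]] unfolding L2_norm_scaleR .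
  also have "\<dots> < e / 2 + e / 2"
  proof (rule add_less_le_mono[OF F(3)])
    have "\<bar>c\<bar> * L2_norm M (\<lambda>\<omega>. Z \<omega> - (\<Sum>f\<in>G. b f * f \<omega>)) \<le> (\<bar>c\<bar> + 1) * (e / (2 * (\<bar>c\<bar> + 1)))"
      using G(3) by (intro mult_mono) auto
    also have "\<dots> = e / 2"
    proof -
      have *: "x * (e / (2 * x)) = e / 2" if "x \<noteq> 0" for x :: real using that by simp
      show ?thesis by (rule *) (simp add: add_nonneg_eq_0_iff)
    qed
    finally show "\<bar>c\<bar> * L2_norm M (\<lambda>\<omega>. Z \<omega> - (\<Sum>f\<in>G. b f * f \<omega>)) \<le> e / 2" .
  qed
  finally have "L2_norm M (\<lambda>\<omega>. (Y \<omega> + c * Z \<omega>) - (\<Sum>f\<in>F \<union> G. d f * f \<omega>)) < e" by simp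
  then show "\<exists>F a. finite F \<and> F \<subseteq> A \<and> L2_norm M (\<lambda>\<omega>. (Y \<omega> + c * Z \<omega>) - (\<Sum>f\<in>F. a f * f \<omega>)) < e"
    using F(1,2) G(1,2) by (intro exI[of _ "F \<union> G"] exI[of _ d]) simp
qed

lemma closed_span_zero: "(\<lambda>_. 0) \<in> L2_closed_span M A"
proof (rule closed_spanI)
  show "(\<lambda>_. 0) \<in> L2 M" using SL2_zero[where 'b=real] by (simp add: SL2_real)
  show "\<exists>F a. finite F \<and> F \<subseteq> A \<and> L2_norm M (\<lambda>\<omega>. 0 - (\<Sum>f\<in>F. a f * f \<omega>)) < e" if "e > 0" for e
    using that by (intro exI[of _ "{}"]) (simp add: L2_norm_def)
qed

lemma closed_span_base:
  assumes "f \<in> A" "f \<in> L2 M" shows "f \<in> L2_closed_span M A"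
proof (rule closed_spanI[OF assms(2)])
  show "\<exists>F a. finite F \<and> F \<subseteq> A \<and> L2_norm M (\<lambda>\<omega>. f \<omega> - (\<Sum>f\<in>F. a f * f \<omega>)) < e" if "e > 0" for e
    using that assms(1) by (intro exI[of _ "{f}"] exI[of _ "\<lambda>_. 1"]) (simp add: L2_norm_def)
qed

text \<open>Approximate one argument at a time.\<close>

lemma closed_span_orthogonal:
  assumes A: "A \<subseteq> L2 M" and B: "B \<subseteq> L2 M" and AB: "\<And>f g. f \<in> A \<Longrightarrow> g \<in> B \<Longrightarrow> (\<integral>\<omega>. f \<omega> * g \<omega> \<partial>M) = 0"
    and Y: "Y \<in> L2_closed_span M A" and Z: "Z \<in> L2_closed_span M B"
  shows "(\<integral>\<omega>. Y \<omega> * Z \<omega> \<partial>M) = 0"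
proof -
  have one: "(\<integral>\<omega>. Y \<omega> * g \<omega> \<partial>M) = 0"
    if A: "A \<subseteq> L2 M" and g: "g \<in> L2 M" and o: "\<And>f. f \<in> A \<Longrightarrow> (\<integral>\<omega>. f \<omega> * g \<omega> \<partial>M) = 0" and Y: "Y \<in> L2_closed_span M A"
    for A g and Y :: "_ \<Rightarrow> real"
  proof -
    note Y2 = closed_span_L2[OF Y]
    have "\<bar>\<integral>\<omega>. Y \<omega> * g \<omega> \<partial>M\<bar> \<le> e" if e: "e > 0" for e
    proof -
      have e': "e / (L2_norm M g + 1) > 0" using e by (simp add: add_nonneg_pos)
      obtain F a where F: "finite F" "F \<subseteq> A" "L2_norm M (\<lambda>\<omega>. Y \<omega> - (\<Sum>f\<in>F. a f * f \<omega>)) < e / (L2_norm M g + 1)"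
        by (rule closed_span_approx[OF Y e']) (rule that)
      have S: "(\<lambda>\<omega>. \<Sum>f\<in>F. a f * f \<omega>) \<in> L2 M" using F A by (auto intro!: L2_real_sum)
      have i: "integrable M (\<lambda>\<omega>. f \<omega> * g \<omega>)" if "f \<in> F" for f using that F A g by (intro L2_mult_integrable) auto
      have "(\<integral>\<omega>. (\<Sum>f\<in>F. a f * f \<omega>) * g \<omega> \<partial>M) = (\<integral>\<omega>. (\<Sum>f\<in>F. a f * (f \<omega> * g \<omega>)) \<partial>M)"
        by (simp add: sum_distrib_right mult.assoc)
      also have "\<dots> = (\<Sum>f\<in>F. a f * (\<integral>\<omega>. f \<omega> * g \<omega> \<partial>M))"
        using i by (subst Bochner_Integration.integral_sum) simp_all
      also have "\<dots> = 0" using F o by (intro sum.neutral) auto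
      finally have 0: "(\<integral>\<omega>. (\<Sum>f\<in>F. a f * f \<omega>) * g \<omega> \<partial>M) = 0" .
      have "(\<integral>\<omega>. Y \<omega> * g \<omega> \<partial>M) = (\<integral>\<omega>. (Y \<omega> - (\<Sum>f\<in>F. a f * f \<omega>)) * g \<omega> \<partial>M)"
        unfolding left_diff_distrib
        by (subst Bochner_Integration.integral_diff[OF L2_mult_integrable[OF Y2 g] L2_mult_integrable[OF S g]]) (simp add: 0)
      also have "\<bar>\<dots>\<bar> \<le> L2_norm M (\<lambda>\<omega>. Y \<omega> - (\<Sum>f\<in>F. a f * f \<omega>)) * L2_norm M g"
        by (rule L2_Cauchy_Schwarz) (intro L2_real_intros Y2 S g)+
      also have "\<dots> \<le> e / (L2_norm M g + 1) * (L2_norm M g + 1)"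
        using F(3) e by (intro mult_mono) (simp_all add: add_nonneg_nonneg)
      also have "\<dots> = e" using L2_norm_nonneg[of M g] by (simp add: add_nonneg_eq_0_iff)
      finally show ?thesis .
    qed
    then show ?thesis by (metis abs_le_zero_iff field_le_epsilon add_0)
  qed
  have "(\<integral>\<omega>. f \<omega> * Z \<omega> \<partial>M) = 0" if f: "f \<in> A" for f
    using one[OF B _ _ Z, of f] A f AB[OF f] by (auto simp: mult.commute)
  then show ?thesis by (intro one[OF A closed_span_L2[OF Z] _ Y])
qed

abbreviation hermite_generators :: "('v::{real_inner,polish_space} \<Rightarrow> 'o \<Rightarrow> real) \<Rightarrow> nat \<Rightarrow> ('o \<Rightarrow> real) set" where
  "hermite_generators W k \<equiv> {(\<lambda>\<omega>. hermite k (W v \<omega>)) | v. norm v = 1}"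

lemma hermite_generators_L2: "isonormal_process M W \<Longrightarrow> hermite_generators W k \<subseteq> L2 M"
  using hermite_chaos_L2[of M W] by blast

lemma wiener_chaos_orthogonal:
  assumes iso: "isonormal_process M W" and "j \<noteq> k" "Y \<in> wiener_chaos M W j" "Z \<in> wiener_chaos M W k"
  shows "(\<integral>\<omega>. Y \<omega> * Z \<omega> \<partial>M) = 0"
proof (rule closed_span_orthogonal[OF hermite_generators_L2[OF iso] hermite_generators_L2[OF iso]])
  show "Y \<in> L2_closed_span M (hermite_generators W j)" "Z \<in> L2_closed_span M (hermite_generators W k)"
    using assms(3,4) unfolding wiener_chaos_def .
  fix f g assume "f \<in> hermite_generators W j" "g \<in> hermite_generators W k"
  then obtain v w where f: "f = (\<lambda>\<omega>. hermite j (W v \<omega>))" "norm v = 1" and g: "g = (\<lambda>\<omega>. hermite k (W w \<omega>))" "norm w = 1" by blast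
  show "(\<integral>\<omega>. f \<omega> * g \<omega> \<partial>M) = 0" unfolding f(1) g(1) by (rule hermite_chaos_orthogonal[OF iso f(2) g(2) assms(2)])
qed

lemma wiener_chaos_L2: "Y \<in> wiener_chaos M W k \<Longrightarrow> Y \<in> L2 M"
  unfolding wiener_chaos_def by (rule closed_span_L2)

lemma wiener_chaos_linear:
  "isonormal_process M W \<Longrightarrow> Y \<in> wiener_chaos M W k \<Longrightarrow> Z \<in> wiener_chaos M W k \<Longrightarrow> (\<lambda>\<omega>. Y \<omega> + c * Z \<omega>) \<in> wiener_chaos M W k"
  unfolding wiener_chaos_def by (rule closed_span_linear[OF hermite_generators_L2])

lemma chaos_uptoE:
  assumes "Y \<in> wiener_chaos_upto M W n"
  obtains Ys where "\<And>i. i \<le> n \<Longrightarrow> Ys i \<in> wiener_chaos M W i" "AE \<omega> in M. Y \<omega> = (\<Sum>i\<le>n. Ys i \<omega>)" "Y \<in> L2 M"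
  using assms unfolding wiener_chaos_upto_def by blast

lemma chaos_uptoI:
  assumes "Y \<in> L2 M" "\<And>i. i \<le> n \<Longrightarrow> Ys i \<in> wiener_chaos M W i" "AE \<omega> in M. Y \<omega> = (\<Sum>i\<le>n. Ys i \<omega>)"
  shows "Y \<in> wiener_chaos_upto M W n"
  unfolding wiener_chaos_upto_def using assms by blast

lemma chaos_upto_L2: "Y \<in> wiener_chaos_upto M W n \<Longrightarrow> Y \<in> L2 M"
  unfolding wiener_chaos_upto_def by blast

lemma chaos_upto_cong_AE:
  assumes "Y \<in> wiener_chaos_upto M W n" "Z \<in> L2 M" "AE \<omega> in M. Z \<omega> = Y \<omega>"
  shows "Z \<in> wiener_chaos_upto M W n"
proof -
  obtain Ys where Ys: "\<And>i. i \<le> n \<Longrightarrow> Ys i \<in> wiener_chaos M W i" "AE \<omega> in M. Y \<omega> = (\<Sum>i\<le>n. Ys i \<omega>)"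
    by (rule chaos_uptoE[OF assms(1)]) (rule that)
  have "AE \<omega> in M. Z \<omega> = (\<Sum>i\<le>n. Ys i \<omega>)" using assms(3) Ys(2) by eventually_elim simp
  from chaos_uptoI[OF assms(2) Ys(1) this] show ?thesis .
qed

lemma chaos_upto_linear:
  assumes iso: "isonormal_process M W" and Y: "Y \<in> wiener_chaos_upto M W n" and Z: "Z \<in> wiener_chaos_upto M W n"
  shows "(\<lambda>\<omega>. Y \<omega> + c * Z \<omega>) \<in> wiener_chaos_upto M W n"
proof -
  obtain Ys where Ys: "\<And>i. i \<le> n \<Longrightarrow> Ys i \<in> wiener_chaos M W i" "AE \<omega> in M. Y \<omega> = (\<Sum>i\<le>n. Ys i \<omega>)"
    by (rule chaos_uptoE[OF Y]) (rule that)
  obtain Zs where Zs: "\<And>i. i \<le> n \<Longrightarrow> Zs i \<in> wiener_chaos M W i" "AE \<omega> in M. Z \<omega> = (\<Sum>i\<le>n. Zs i \<omega>)"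
    by (rule chaos_uptoE[OF Z]) (rule that)
  show ?thesis
  proof (rule chaos_uptoI[where Ys="\<lambda>i \<omega>. Ys i \<omega> + c * Zs i \<omega>"])
    show "(\<lambda>\<omega>. Y \<omega> + c * Z \<omega>) \<in> L2 M" by (intro L2_real_intros chaos_upto_L2[OF Y] chaos_upto_L2[OF Z])
    show "AE \<omega> in M. Y \<omega> + c * Z \<omega> = (\<Sum>i\<le>n. Ys i \<omega> + c * Zs i \<omega>)"
      using Ys(2) Zs(2) by eventually_elim (simp add: sum.distrib sum_distrib_left)
  qed (rule wiener_chaos_linear[OF iso Ys(1) Zs(1)])
qed

lemma chaos_upto_zero: "(\<lambda>_. 0) \<in> wiener_chaos_upto M W n"
proof (rule chaos_uptoI[where Ys="\<lambda>_ _. 0"])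
  show "(\<lambda>_. 0) \<in> L2 M" by (rule closed_span_L2[OF closed_span_zero])
qed (simp_all add: wiener_chaos_def closed_span_zero)

text \<open>
  By orthogonality the components of a sequence in the finite chaos are Cauchy whenever the
  sequence is, so they converge in the individual chaoses.
\<close>

lemma chaos_upto_closed:
  assumes iso: "isonormal_process M W" and Y: "Y \<in> L2 M"
    and lim: "\<And>e. e > 0 \<Longrightarrow> \<exists>Z\<in>wiener_chaos_upto M W n. L2_norm M (\<lambda>\<omega>. Y \<omega> - Z \<omega>) < e"
  shows "Y \<in> wiener_chaos_upto M W n"
proof -
  interpret prob_space M by (rule isonormalD(1)[OF iso])
  have "\<exists>Z\<in>wiener_chaos_upto M W n. L2_norm M (\<lambda>\<omega>. Y \<omega> - Z \<omega>) < (1/2)^i" for i :: nat by (rule lim) simp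
  then obtain Z where Z: "\<And>i. Z i \<in> wiener_chaos_upto M W n" and YZ: "\<And>i::nat. L2_norm M (\<lambda>\<omega>. Y \<omega> - Z i \<omega>) < (1/2)^i" by metis
  have "\<exists>Ys. (\<forall>k\<le>n. Ys k \<in> wiener_chaos M W k) \<and> (AE \<omega> in M. Z i \<omega> = (\<Sum>k\<le>n. Ys k \<omega>))" for i
    using Z[of i] unfolding wiener_chaos_upto_def by blast
  then obtain C where C: "\<And>i k. k \<le> n \<Longrightarrow> C i k \<in> wiener_chaos M W k" and ZC: "\<And>i. AE \<omega> in M. Z i \<omega> = (\<Sum>k\<le>n. C i k \<omega>)" by metis
  have C2: "C i k \<in> SL2 M" if "k \<le> n" for i k using wiener_chaos_L2[OF C[OF that]] by (simp add: SL2_real)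
  have Y2: "Y \<in> SL2 M" and Z2: "Z i \<in> SL2 M" for i using Y chaos_upto_L2[OF Z] by (simp_all add: SL2_real)
  have comp: "L2_norm M (\<lambda>\<omega>. C i k \<omega> - C j k \<omega>) \<le> L2_norm M (\<lambda>\<omega>. Z i \<omega> - Z j \<omega>)" if k: "k \<le> n" for i j k
  proof -
    define D where "D = (\<lambda>k \<omega>. C i k \<omega> + (-1) * C j k \<omega>)"
    have D: "D k \<in> wiener_chaos M W k" if "k \<le> n" for k
      unfolding D_def by (intro wiener_chaos_linear iso C that)
    have DD: "integrable M (\<lambda>\<omega>. D k \<omega> * D l \<omega>)" if "k \<le> n" "l \<le> n" for k l
      by (intro L2_mult_integrable wiener_chaos_L2[OF D] that)
    have m [measurable]: "D k \<in> borel_measurable M" if "k \<le> n" for k using wiener_chaos_L2[OF D[OF that]] unfolding L2_def by blast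
    have "(L2_norm M (\<lambda>\<omega>. Z i \<omega> - Z j \<omega>))\<^sup>2 = (\<integral>\<omega>. (Z i \<omega> - Z j \<omega>)\<^sup>2 \<partial>M)" by (simp add: L2_norm_power2)
    also have "\<dots> = (\<integral>\<omega>. (\<Sum>k\<le>n. \<Sum>l\<le>n. D k \<omega> * D l \<omega>) \<partial>M)"
    proof (rule integral_cong_AE)
      show "(\<lambda>\<omega>. (Z i \<omega> - Z j \<omega>)\<^sup>2) \<in> borel_measurable M"
        using SL2_diff[OF Z2[of i] Z2[of j]] unfolding SL2_def by (simp add: borel_measurable_integrable)
      show "(\<lambda>\<omega>. \<Sum>k\<le>n. \<Sum>l\<le>n. D k \<omega> * D l \<omega>) \<in> borel_measurable M"
        by (intro borel_measurable_sum borel_measurable_times m) simp_all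
      show "AE \<omega> in M. (Z i \<omega> - Z j \<omega>)\<^sup>2 = (\<Sum>k\<le>n. \<Sum>l\<le>n. D k \<omega> * D l \<omega>)"
        using ZC[of i] ZC[of j]
      proof eventually_elim
        case (elim \<omega>)
        have "Z i \<omega> - Z j \<omega> = (\<Sum>k\<le>n. D k \<omega>)" unfolding elim D_def by (simp add: sum_subtractf)
        then show ?case by (simp add: power2_eq_square sum_product)
      qed
    qed
    also have "\<dots> = (\<Sum>k\<le>n. \<Sum>l\<le>n. (\<integral>\<omega>. D k \<omega> * D l \<omega> \<partial>M))"
    proof -
      have "(\<integral>\<omega>. (\<Sum>k\<le>n. \<Sum>l\<le>n. D k \<omega> * D l \<omega>) \<partial>M) = (\<Sum>k\<le>n. (\<integral>\<omega>. (\<Sum>l\<le>n. D k \<omega> * D l \<omega>) \<partial>M))"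
        by (rule Bochner_Integration.integral_sum) (rule Bochner_Integration.integrable_sum, simp add: DD)
      also have "\<dots> = (\<Sum>k\<le>n. \<Sum>l\<le>n. (\<integral>\<omega>. D k \<omega> * D l \<omega> \<partial>M))"
        by (rule sum.cong[OF refl]) (rule Bochner_Integration.integral_sum, simp add: DD)
      finally show ?thesis .
    qed
    also have "\<dots> = (\<Sum>k\<le>n. \<Sum>l\<le>n. if k = l then (\<integral>\<omega>. D k \<omega> * D k \<omega> \<partial>M) else 0)"
      using wiener_chaos_orthogonal[OF iso _ D D] by (intro sum.cong refl) auto
    also have "\<dots> = (\<Sum>k\<le>n. (\<integral>\<omega>. D k \<omega> * D k \<omega> \<partial>M))" by simp
    also have "\<dots> \<ge> (\<integral>\<omega>. D k \<omega> * D k \<omega> \<partial>M)"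
      using k by (intro member_le_sum) simp_all
    also have "(\<integral>\<omega>. D k \<omega> * D k \<omega> \<partial>M) = (L2_norm M (\<lambda>\<omega>. C i k \<omega> - C j k \<omega>))\<^sup>2"
      unfolding L2_norm_power2 by (simp add: D_def power2_eq_square)
    finally show ?thesis by (rule power2_le_imp_le) simp
  qed
  have tail: "L2_norm M (\<lambda>\<omega>. Z i \<omega> - Z j \<omega>) < (1/2)^i + (1/2)^j" for i j
    using L2_norm_triangle_diff[OF Z2[of i] Y2 Z2[of j]] YZ[of i] YZ[of j] L2_norm_minus[of M "Z i" Y] by linarith
  have "\<exists>L. L \<in> wiener_chaos M W k \<and> (\<lambda>i. L2_norm M (\<lambda>\<omega>. C i k \<omega> - L \<omega>)) \<longlonglongrightarrow> 0" if k: "k \<le> n" for k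
  proof -
    have cau: "\<exists>N. \<forall>i\<ge>N. \<forall>j\<ge>N. L2_norm M (\<lambda>\<omega>. C i k \<omega> - C j k \<omega>) < e" if e: "e > 0" for e
    proof -
      obtain N where N: "(1/2)^N < e / 2" using real_arch_pow_inv[of "e / 2" "1/2"] e by auto
      have "L2_norm M (\<lambda>\<omega>. C i k \<omega> - C j k \<omega>) < e" if "i \<ge> N" "j \<ge> N" for i j
      proof -
        have "(1/2::real)^i \<le> (1/2)^N" "(1/2::real)^j \<le> (1/2)^N"
          by (rule power_decreasing; use that in simp)+
        then show ?thesis using comp[OF k, of i j] tail[of i j] N by linarith
      qed
      then show ?thesis by blast
    qed
    obtain L where L: "L \<in> SL2 M" "(\<lambda>i. L2_norm M (\<lambda>\<omega>. C i k \<omega> - L \<omega>)) \<longlonglongrightarrow> 0"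
      by (rule SL2_complete[of "\<lambda>i. C i k", OF C2[OF k] cau]) (assumption, rule that)
    have "L \<in> wiener_chaos M W k" unfolding wiener_chaos_def
    proof (rule closed_span_limit[OF hermite_generators_L2[OF iso]])
      show "L \<in> L2 M" using L(1) by (simp add: SL2_real)
      fix e :: real assume "e > 0"
      then obtain i where "L2_norm M (\<lambda>\<omega>. C i k \<omega> - L \<omega>) < e"
        using order_tendstoD(2)[OF L(2), of e] by (auto simp: eventually_sequentially)
      then show "\<exists>Z\<in>L2_closed_span M (hermite_generators W k). L2_norm M (\<lambda>\<omega>. L \<omega> - Z \<omega>) < e"
        using C[OF k, of i] unfolding wiener_chaos_def by (intro bexI[of _ "C i k"]) (simp_all only: L2_norm_minus[of M L])
    qed
    then show ?thesis using L(2) by blast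
  qed
  then obtain L where L: "\<And>k. k \<le> n \<Longrightarrow> L k \<in> wiener_chaos M W k" "\<And>k. k \<le> n \<Longrightarrow> (\<lambda>i. L2_norm M (\<lambda>\<omega>. C i k \<omega> - L k \<omega>)) \<longlonglongrightarrow> 0" by metis
  have L2: "L k \<in> SL2 M" if "k \<le> n" for k using wiener_chaos_L2[OF L(1)[OF that]] by (simp add: SL2_real)
  have S2: "(\<lambda>\<omega>. \<Sum>k\<le>n. L k \<omega>) \<in> SL2 M" by (rule SL2_sum) (simp_all add: L2)
  have "L2_norm M (\<lambda>\<omega>. Y \<omega> - (\<Sum>k\<le>n. L k \<omega>)) \<le> (1/2)^i + (\<Sum>k\<le>n. L2_norm M (\<lambda>\<omega>. C i k \<omega> - L k \<omega>))" for i
  proof -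
    have "L2_norm M (\<lambda>\<omega>. Z i \<omega> - (\<Sum>k\<le>n. L k \<omega>)) = L2_norm M (\<lambda>\<omega>. \<Sum>k\<le>n. C i k \<omega> - L k \<omega>)"
    proof (rule L2_norm_cong_AE)
      show "(\<lambda>\<omega>. Z i \<omega> - (\<Sum>k\<le>n. L k \<omega>)) \<in> SL2 M" by (rule SL2_diff[OF Z2 S2])
      show "(\<lambda>\<omega>. \<Sum>k\<le>n. C i k \<omega> - L k \<omega>) \<in> SL2 M" by (rule SL2_sum) (simp_all add: SL2_diff C2 L2)
      show "AE \<omega> in M. Z i \<omega> - (\<Sum>k\<le>n. L k \<omega>) = (\<Sum>k\<le>n. C i k \<omega> - L k \<omega>)"
        using ZC[of i] by eventually_elim (simp add: sum_subtractf)
    qed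
    also have "\<dots> \<le> (\<Sum>k\<le>n. L2_norm M (\<lambda>\<omega>. C i k \<omega> - L k \<omega>))"
      by (rule L2_norm_sum) (simp_all add: SL2_diff C2 L2)
    finally show ?thesis using L2_norm_triangle_diff[OF Y2 Z2[of i] S2] YZ[of i] by linarith
  qed
  moreover have "(\<lambda>i. (1/2)^i + (\<Sum>k\<le>n. L2_norm M (\<lambda>\<omega>. C i k \<omega> - L k \<omega>))) \<longlonglongrightarrow> 0 + (\<Sum>k\<le>n. 0)"
    by (intro tendsto_add tendsto_sum L(2) LIMSEQ_power_zero) simp_all
  ultimately have "L2_norm M (\<lambda>\<omega>. Y \<omega> - (\<Sum>k\<le>n. L k \<omega>)) \<le> 0 + (\<Sum>k\<le>n. 0)"
    by (intro LIMSEQ_le_const) blast+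
  then have "L2_norm M (\<lambda>\<omega>. Y \<omega> - (\<Sum>k\<le>n. L k \<omega>)) = 0" using L2_norm_nonneg[of M "\<lambda>\<omega>. Y \<omega> - (\<Sum>k\<le>n. L k \<omega>)"] by simp
  then have "AE \<omega> in M. Y \<omega> - (\<Sum>k\<le>n. L k \<omega>) = 0" using L2_norm_eq_0[OF SL2_diff[OF Y2 S2]] by simp
  then have "AE \<omega> in M. Y \<omega> = (\<Sum>k\<le>n. L k \<omega>)" by (rule AE_mp) simp
  from chaos_uptoI[OF Y L(1) this] show ?thesis .
qed

text \<open>
  A density principle: any linear class of square integrable functions that contains the generating
  Hermite functions is dense in the finite chaos. It is used for cylindrical polynomials and for
  spans of finitely many functions.
\<close>

lemma chaos_upto_approx:
  assumes iso: "isonormal_process M W" and Y: "Y \<in> wiener_chaos_upto M W n" and e: "e > 0"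
    and zero: "P (\<lambda>_. 0)" and lin: "\<And>f g c. P f \<Longrightarrow> P g \<Longrightarrow> P (\<lambda>\<omega>. f \<omega> + c * g \<omega>)"
    and L2: "\<And>f. P f \<Longrightarrow> f \<in> L2 M"
    and gen: "\<And>v i. norm v = 1 \<Longrightarrow> i \<le> n \<Longrightarrow> P (\<lambda>\<omega>. hermite i (W v \<omega>))"
  shows "\<exists>f. P f \<and> L2_norm M (\<lambda>\<omega>. Y \<omega> - f \<omega>) < e"
proof -
  have P_sum: "P (\<lambda>\<omega>. \<Sum>f\<in>F. a f * g f \<omega>)" if "finite F" "\<And>f. f \<in> F \<Longrightarrow> P (g f)"
    for F :: "'i set" and a and g :: "'i \<Rightarrow> _"
    using that
  proof (induction F)
    case empty
    show ?case using zero by simp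
  next
    case (insert f F)
    have "P (\<lambda>\<omega>. (\<Sum>f\<in>F. a f * g f \<omega>) + a f * g f \<omega>)" by (rule lin) (use insert in simp_all)
    then show ?case using insert.hyps by (simp add: add.commute)
  qed
  obtain Ys where Ys: "\<And>i. i \<le> n \<Longrightarrow> Ys i \<in> wiener_chaos M W i" "AE \<omega> in M. Y \<omega> = (\<Sum>i\<le>n. Ys i \<omega>)"
    by (rule chaos_uptoE[OF Y]) (rule that)
  have ex: "\<exists>f. P f \<and> L2_norm M (\<lambda>\<omega>. Ys i \<omega> - f \<omega>) < e / real (Suc n)" if i: "i \<le> n" for i
  proof -
    have "e / real (Suc n) > 0" using e by simp
    then obtain F a where F: "finite F" "F \<subseteq> hermite_generators W i" "L2_norm M (\<lambda>\<omega>. Ys i \<omega> - (\<Sum>f\<in>F. a f * f \<omega>)) < e / real (Suc n)"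
      by (rule closed_span_approx[OF Ys(1)[OF i, unfolded wiener_chaos_def]]) (rule that)
    have "P f" if "f \<in> F" for f
    proof -
      obtain v where "f = (\<lambda>\<omega>. hermite i (W v \<omega>))" "norm v = 1" using F(2) \<open>f \<in> F\<close> by blast
      then show ?thesis using gen[OF _ i] by simp
    qed
    then have "P (\<lambda>\<omega>. \<Sum>f\<in>F. a f * f \<omega>)" using P_sum[of F "\<lambda>f. f" a] F(1) by simp
    then show ?thesis using F(3) by blast
  qed
  define f where "f = (\<lambda>i. SOME f. P f \<and> L2_norm M (\<lambda>\<omega>. Ys i \<omega> - f \<omega>) < e / real (Suc n))"
  have f: "P (f i)" "L2_norm M (\<lambda>\<omega>. Ys i \<omega> - f i \<omega>) < e / real (Suc n)" if "i \<le> n" for i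
    using someI_ex[OF ex[OF that]] unfolding f_def by simp_all
  define g where "g = (\<lambda>\<omega>. \<Sum>i\<in>{..n}. 1 * f i \<omega>)"
  have g: "P g" unfolding g_def by (rule P_sum) (simp_all add: f(1))
  have f2: "f i \<in> SL2 M" if "i \<le> n" for i using L2[OF f(1)[OF that]] by (simp add: SL2_real)
  have Ys2: "Ys i \<in> SL2 M" if "i \<le> n" for i using wiener_chaos_L2[OF Ys(1)[OF that]] by (simp add: SL2_real)
  have "L2_norm M (\<lambda>\<omega>. Y \<omega> - g \<omega>) = L2_norm M (\<lambda>\<omega>. \<Sum>i\<in>{..n}. Ys i \<omega> - f i \<omega>)"
  proof (rule L2_norm_cong_AE)
    show "(\<lambda>\<omega>. Y \<omega> - g \<omega>) \<in> SL2 M"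
      using chaos_upto_L2[OF Y] L2[OF g] by (intro SL2_diff) (simp_all add: SL2_real)
    show "(\<lambda>\<omega>. \<Sum>i\<in>{..n}. Ys i \<omega> - f i \<omega>) \<in> SL2 M" by (rule SL2_sum) (simp_all add: SL2_diff f2 Ys2)
    show "AE \<omega> in M. Y \<omega> - g \<omega> = (\<Sum>i\<in>{..n}. Ys i \<omega> - f i \<omega>)"
      using Ys(2) by eventually_elim (simp add: g_def sum_subtractf)
  qed
  also have "\<dots> \<le> (\<Sum>i\<in>{..n}. L2_norm M (\<lambda>\<omega>. Ys i \<omega> - f i \<omega>))"
    by (rule L2_norm_sum) (simp_all add: SL2_diff f2 Ys2)
  also have "\<dots> < (\<Sum>i\<in>{..n}. e / real (Suc n))" by (rule sum_strict_mono) (simp, simp, rule f(2), simp)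
  also have "\<dots> = e" by simp
  finally show ?thesis using g by blast
qed

section \<open>Moments of sums with chaos coefficients\<close>

definition in_orthonormal_span :: "nat \<Rightarrow> (nat \<Rightarrow> 'h::real_inner) \<Rightarrow> 'h \<Rightarrow> bool" where
  "in_orthonormal_span N h u \<longleftrightarrow> u = (\<Sum>j<N. (u \<bullet> h j) *\<^sub>R h j)"

lemma in_orthonormal_span_mono:
  assumes o: "orthonormal N' h'" and N: "N \<le> N'" and eq: "\<And>j. j < N \<Longrightarrow> h' j = h j" and u: "in_orthonormal_span N h u"
  shows "in_orthonormal_span N' h' u"
proof -
  have u': "u = (\<Sum>j<N. (u \<bullet> h j) *\<^sub>R h' j)" using u eq unfolding in_orthonormal_span_def by simp
  have z: "u \<bullet> h' i = 0" if "i < N'" "\<not> i < N" for i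
  proof -
    have "u \<bullet> h' i = (\<Sum>j<N. (u \<bullet> h j) * (h' j \<bullet> h' i))" by (subst u') (simp add: inner_sum_left)
    also have "\<dots> = 0" using that N by (intro sum.neutral) (auto simp: orthonormalD[OF o])
    finally show ?thesis .
  qed
  have "(\<Sum>j<N'. (u \<bullet> h' j) *\<^sub>R h' j) = (\<Sum>j<N. (u \<bullet> h' j) *\<^sub>R h' j)"
    using N z by (intro sum.mono_neutral_right) auto
  also have "\<dots> = u" using u' eq by simp
  finally show ?thesis unfolding in_orthonormal_span_def by simp
qed

text \<open>
  One step of Gram--Schmidt. The dichotomy at the end records whether the step added a vector.
\<close>

lemma orthonormal_extend:
  fixes h :: "nat \<Rightarrow> 'h::real_inner"
  assumes o: "orthonormal N h"
  obtains N' h' where "orthonormal N' h'" "N \<le> N'" "N' \<le> Suc N" "\<And>j. j < N \<Longrightarrow> h' j = h j" "in_orthonormal_span N' h' v"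
    "in_orthonormal_span N h v \<or> N' = Suc N"
proof (cases "in_orthonormal_span N h v")
  case True
  show ?thesis by (rule that[of N h]) (simp_all add: o True)
next
  case False
  define d where "d = v - (\<Sum>j<N. (v \<bullet> h j) *\<^sub>R h j)"
  have d0: "norm d \<noteq> 0" using False unfolding d_def in_orthonormal_span_def by simp
  have dh: "d \<bullet> h i = 0" if "i < N" for i
  proof -
    have "(\<Sum>j<N. (v \<bullet> h j) *\<^sub>R h j) \<bullet> h i = (\<Sum>j<N. if j = i then v \<bullet> h j else 0)"
      unfolding inner_sum_left using that by (intro sum.cong refl) (simp add: orthonormalD[OF o])
    also have "\<dots> = v \<bullet> h i" using that by simp
    finally show ?thesis unfolding d_def by (simp add: inner_diff_left)
  qed
  define e where "e = d /\<^sub>R norm d"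
  define h' where "h' = h(N := e)"
  have ee: "e \<bullet> e = 1" unfolding e_def using d0 by (simp add: power2_norm_eq_inner[symmetric] power2_eq_square)
  have eh: "e \<bullet> h i = 0" "h i \<bullet> e = 0" if "i < N" for i using dh[OF that] unfolding e_def by (simp_all add: inner_commute)
  have o': "orthonormal (Suc N) h'"
    unfolding orthonormal_def h'_def using ee eh orthonormalD[OF o] by (auto simp: less_Suc_eq)
  have "v = (\<Sum>j<N. (v \<bullet> h j) *\<^sub>R h j) + norm d *\<^sub>R e" unfolding e_def d_def using d0 unfolding d_def by simp
  moreover have "v \<bullet> e = norm d"
  proof -
    have "v \<bullet> e = (\<Sum>j<N. (v \<bullet> h j) *\<^sub>R h j) \<bullet> e + norm d * (e \<bullet> e)"
      by (subst calculation) (simp add: inner_add_left)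
    also have "(\<Sum>j<N. (v \<bullet> h j) *\<^sub>R h j) \<bullet> e = 0" unfolding inner_sum_left by (rule sum.neutral) (simp add: eh)
    finally show ?thesis by (simp add: ee)
  qed
  ultimately have "in_orthonormal_span (Suc N) h' v" unfolding in_orthonormal_span_def h'_def by simp
  then show ?thesis by (intro that[of "Suc N" h'] o') (simp_all add: h'_def)
qed

lemma orthonormal_span_finite:
  fixes S :: "'h::real_inner set"
  assumes "finite S"
  obtains N h where "orthonormal N h" "\<And>v. v \<in> S \<Longrightarrow> in_orthonormal_span N h v"
proof -
  have "\<exists>N h. orthonormal N h \<and> (\<forall>v\<in>S. in_orthonormal_span N h v)"
    using assms
  proof (induction S)
    case empty
    show ?case by (intro exI[of _ 0] exI[of _ "\<lambda>_. 0"]) (simp add: orthonormal_def)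
  next
    case (insert v S)
    then obtain N h where o: "orthonormal N h" and s: "\<forall>v\<in>S. in_orthonormal_span N h v" by blast
    obtain N' h' where "orthonormal N' h'" "N \<le> N'" "\<And>j. j < N \<Longrightarrow> h' j = h j" "in_orthonormal_span N' h' v"
      by (rule orthonormal_extend[OF o, of v]) (rule that)
    then show ?case using in_orthonormal_span_mono[of N' h' N h] s by blast
  qed
  then show thesis using that by blast
qed

text \<open>
  Moments of order \<open>2\<^bsup>j+1\<^esup>\<close> are bounded by the powers of the second moment of the same homogeneity.
\<close>

definition moment_bounded :: "(nat \<Rightarrow> real) \<Rightarrow> 'o measure \<Rightarrow> ('o \<Rightarrow> 'x::real_normed_vector) \<Rightarrow> bool" where
  "moment_bounded K M Y \<longleftrightarrow> (\<forall>j. (\<integral>\<^sup>+\<omega>. ennreal (norm (Y \<omega>))^(2^Suc j) \<partial>M) \<le> ennreal (K j) * ennreal ((L2_norm M Y)\<^sup>2)^(2^j))"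

text \<open>
  Fatou along an almost surely convergent subsequence; the right-hand sides converge since the
  second moments do.
\<close>

lemma (in prob_space) moment_bounded_limit:
  fixes Z :: "'a \<Rightarrow> 'x::real_normed_vector"
  assumes Y: "\<And>i. Y i \<in> SL2 M" and Z: "Z \<in> SL2 M" and lim: "(\<lambda>i. L2_norm M (\<lambda>\<omega>. Y i \<omega> - Z \<omega>)) \<longlonglongrightarrow> 0"
    and mb: "\<And>i. moment_bounded K M (Y i)"
  shows "moment_bounded K M Z"
  unfolding moment_bounded_def
proof
  fix j
  obtain r where r: "strict_mono r" and ae: "AE \<omega> in M. (\<lambda>i. Y (r i) \<omega>) \<longlonglongrightarrow> Z \<omega>"
    by (rule AE_convergent_subsequence[OF Y Z lim]) (rule that)
  have [measurable]: "(\<lambda>\<omega>. norm (Y i \<omega>)) \<in> borel_measurable M" for i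
    using Y[of i] unfolding SL2_def by (simp add: strongly_measurable_norm)
  have "AE \<omega> in M. ennreal (norm (Z \<omega>))^(2^Suc j) \<le> liminf (\<lambda>i. ennreal (norm (Y (r i) \<omega>))^(2^Suc j))"
  proof (rule AE_mp[OF ae], rule AE_I2, rule impI)
    fix \<omega> assume l: "(\<lambda>i. Y (r i) \<omega>) \<longlonglongrightarrow> Z \<omega>"
    have "(\<lambda>i. ennreal ((norm (Y (r i) \<omega>))^(2^Suc j))) \<longlonglongrightarrow> ennreal ((norm (Z \<omega>))^(2^Suc j))"
      by (intro tendsto_ennrealI tendsto_power tendsto_norm l)
    then have "liminf (\<lambda>i. ennreal ((norm (Y (r i) \<omega>))^(2^Suc j))) = ennreal ((norm (Z \<omega>))^(2^Suc j))"
      by (rule lim_imp_Liminf[rotated]) simp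
    then show "ennreal (norm (Z \<omega>))^(2^Suc j) \<le> liminf (\<lambda>i. ennreal (norm (Y (r i) \<omega>))^(2^Suc j))"
      by (simp only: ennreal_power norm_ge_zero)
  qed
  then have "(\<integral>\<^sup>+\<omega>. ennreal (norm (Z \<omega>))^(2^Suc j) \<partial>M) \<le> (\<integral>\<^sup>+\<omega>. liminf (\<lambda>i. ennreal (norm (Y (r i) \<omega>))^(2^Suc j)) \<partial>M)"
    by (rule nn_integral_mono_AE)
  also have "\<dots> \<le> liminf (\<lambda>i. \<integral>\<^sup>+\<omega>. ennreal (norm (Y (r i) \<omega>))^(2^Suc j) \<partial>M)"
    by (rule nn_integral_liminf) measurable
  also have "\<dots> \<le> liminf (\<lambda>i. ennreal (K j) * ennreal (((L2_norm M (Y (r i)))\<^sup>2)^(2^j)))"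
    using mb unfolding moment_bounded_def by (intro Liminf_mono eventuallyI) (simp add: ennreal_power)
  also have "\<dots> = ennreal (K j) * ennreal (((L2_norm M Z)\<^sup>2)^(2^j))"
  proof (rule lim_imp_Liminf)
    have l: "(\<lambda>i. L2_norm M (Y i)) \<longlonglongrightarrow> L2_norm M Z"
    proof (rule LIM_zero_cancel, rule Lim_null_comparison[OF _ lim], rule eventuallyI)
      show "norm (L2_norm M (Y i) - L2_norm M Z) \<le> L2_norm M (\<lambda>\<omega>. Y i \<omega> - Z \<omega>)" for i
        using L2_norm_diff_abs[OF Y[of i] Z] by simp
    qed
    have l: "(\<lambda>i. L2_norm M (Y (r i))) \<longlonglongrightarrow> L2_norm M Z"
      using LIMSEQ_subseq_LIMSEQ[OF l r] by (simp only: o_def)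
    show "(\<lambda>i. ennreal (K j) * ennreal (((L2_norm M (Y (r i)))\<^sup>2)^(2^j))) \<longlonglongrightarrow> ennreal (K j) * ennreal (((L2_norm M Z)\<^sup>2)^(2^j))"
      by (intro ennreal_tendsto_cmult tendsto_ennrealI tendsto_power l) simp
  qed simp
  finally show "(\<integral>\<^sup>+\<omega>. ennreal (norm (Z \<omega>))^(2^Suc j) \<partial>M) \<le> ennreal (K j) * ennreal ((L2_norm M Z)\<^sup>2)^(2^j)"
    by (simp add: ennreal_power)
qed

text \<open>
  Quantifying over all orthonormal systems whose span contains \<open>S\<close>, instead of fixing one, makes it
  trivial to bring several functions into the same coordinates.
\<close>

definition polynomial_over :: "'o measure \<Rightarrow> ('v::real_inner \<Rightarrow> 'o \<Rightarrow> real) \<Rightarrow> nat \<Rightarrow> 'v set \<Rightarrow> ('o \<Rightarrow> real) \<Rightarrow> bool" where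
  "polynomial_over M W d S f \<longleftrightarrow> (\<forall>N h. orthonormal N h \<longrightarrow> (\<forall>v\<in>S. in_orthonormal_span N h v) \<longrightarrow>
     (\<exists>p. trig_degree N d p \<and> p \<in> borel_measurable (gaussian_space N) \<and> (AE \<omega> in M. f \<omega> = p (\<lambda>j\<in>{..<N}. W (h j) \<omega>))))"

definition cylindrical_polynomial :: "'o measure \<Rightarrow> ('v::real_inner \<Rightarrow> 'o \<Rightarrow> real) \<Rightarrow> nat \<Rightarrow> ('o \<Rightarrow> real) \<Rightarrow> bool" where
  "cylindrical_polynomial M W d f \<longleftrightarrow> f \<in> L2 M \<and> (\<exists>S. finite S \<and> polynomial_over M W d S f)"

lemma polynomial_over_mono: "polynomial_over M W d S f \<Longrightarrow> S \<subseteq> S' \<Longrightarrow> polynomial_over M W d S' f"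
  unfolding polynomial_over_def by blast

lemma polynomial_over_linear:
  assumes "polynomial_over M W d S f" "polynomial_over M W d S g"
  shows "polynomial_over M W d S (\<lambda>\<omega>. f \<omega> + c * g \<omega>)"
  unfolding polynomial_over_def
proof (intro allI impI)
  fix N h assume o: "orthonormal N h" "\<forall>v\<in>S. in_orthonormal_span N h v"
  obtain p where p: "trig_degree N d p" "p \<in> borel_measurable (gaussian_space N)" "AE \<omega> in M. f \<omega> = p (\<lambda>j\<in>{..<N}. W (h j) \<omega>)"
    using assms(1) o unfolding polynomial_over_def by blast
  obtain q where q: "trig_degree N d q" "q \<in> borel_measurable (gaussian_space N)" "AE \<omega> in M. g \<omega> = q (\<lambda>j\<in>{..<N}. W (h j) \<omega>)"
    using assms(2) o unfolding polynomial_over_def by blast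
  have ae: "AE \<omega> in M. f \<omega> + c * g \<omega> = p (\<lambda>j\<in>{..<N}. W (h j) \<omega>) + c * q (\<lambda>j\<in>{..<N}. W (h j) \<omega>)"
    using p(3) q(3) by eventually_elim simp
  note p(2)[measurable] q(2)[measurable]
  show "\<exists>p. trig_degree N d p \<and> p \<in> borel_measurable (gaussian_space N) \<and> (AE \<omega> in M. f \<omega> + c * g \<omega> = p (\<lambda>j\<in>{..<N}. W (h j) \<omega>))"
  proof (intro exI[of _ "\<lambda>x. p x + c * q x"] conjI ae)
    show "trig_degree N d (\<lambda>x. p x + c * q x)" by (intro trig_degree_add trig_degree_scale p q)
  qed measurable
qed

lemma cylindrical_polynomial_linear:
  assumes "cylindrical_polynomial M W d f" "cylindrical_polynomial M W d g"
  shows "cylindrical_polynomial M W d (\<lambda>\<omega>. f \<omega> + c * g \<omega>)"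
proof -
  obtain S S' where S: "finite S" "polynomial_over M W d S f" "finite S'" "polynomial_over M W d S' g"
    using assms unfolding cylindrical_polynomial_def by blast
  have "polynomial_over M W d (S \<union> S') (\<lambda>\<omega>. f \<omega> + c * g \<omega>)"
    by (rule polynomial_over_linear[OF polynomial_over_mono[OF S(2)] polynomial_over_mono[OF S(4)]]) auto
  moreover have "(\<lambda>\<omega>. f \<omega> + c * g \<omega>) \<in> L2 M"
    using assms unfolding cylindrical_polynomial_def by (intro L2_real_intros) auto
  ultimately show ?thesis unfolding cylindrical_polynomial_def using S by (intro conjI exI[of _ "S \<union> S'"]) auto
qed

lemma cylindrical_polynomial_zero: "cylindrical_polynomial M W d (\<lambda>_. 0)"
proof -
  have "(\<lambda>_. 0) \<in> L2 M" by (rule closed_span_L2[OF closed_span_zero])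
  moreover have "polynomial_over M W d {} (\<lambda>_. 0)"
    unfolding polynomial_over_def by (intro allI impI exI[of _ "\<lambda>_. 0"]) (simp add: trig_degree_const)
  ultimately show ?thesis unfolding cylindrical_polynomial_def by blast
qed

lemma trig_degree_poly:
  assumes l: "trig_degree N 1 l" and q: "degree q \<le> d"
  shows "trig_degree N d (\<lambda>x. poly q (l x))"
  unfolding poly_altdef
proof (rule trig_degree_sum)
  fix i assume "i \<in> {..degree q}"
  then have "i \<le> d" using q by simp
  have "trig_degree N (i * 1) (\<lambda>x. l x ^ i)" by (rule trig_degree_power[OF l])
  then show "trig_degree N d (\<lambda>x. coeff q i * l x ^ i)"
    by (intro trig_degree_scale) (rule trig_degree_mono, auto simp: \<open>i \<le> d\<close>)
qed simp

lemma hermite_cylindrical: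
  fixes W :: "'v::{real_inner,polish_space} \<Rightarrow> 'o \<Rightarrow> real"
  assumes iso: "isonormal_process M W" and v: "norm v = 1" and k: "k \<le> n"
  shows "cylindrical_polynomial M W n (\<lambda>\<omega>. hermite k (W v \<omega>))"
proof -
  have "polynomial_over M W n {v} (\<lambda>\<omega>. hermite k (W v \<omega>))"
    unfolding polynomial_over_def
  proof (intro allI impI)
    fix N and h :: "nat \<Rightarrow> 'v" assume o: "orthonormal N h" "\<forall>v\<in>{v}. in_orthonormal_span N h v"
    let ?l = "\<lambda>x::nat \<Rightarrow> real. \<Sum>j<N. (v \<bullet> h j) * x j"
    have vs: "v = (\<Sum>j<N. (v \<bullet> h j) *\<^sub>R h j)" using o(2) unfolding in_orthonormal_span_def by simp
    have "AE \<omega> in M. W (\<Sum>j<N. (v \<bullet> h j) *\<^sub>R h j) \<omega> = (\<Sum>j<N. (v \<bullet> h j) * W (h j) \<omega>)"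
      by (rule L2_operator_sum[OF isonormal_L2_operator[OF iso]]) simp
    then have ae: "AE \<omega> in M. hermite k (W v \<omega>) = hermite k (?l (\<lambda>j\<in>{..<N}. W (h j) \<omega>))"
      unfolding vs[symmetric] by eventually_elim simp
    have t: "trig_degree N n (\<lambda>x. hermite k (?l x))"
      unfolding hermite_eq_poly by (rule trig_degree_poly[OF trig_degree_linear]) (rule order_trans[OF degree_hermite_poly k])
    have m: "(\<lambda>x. hermite k (?l x)) \<in> borel_measurable (gaussian_space N)" by measurable
    show "\<exists>p. trig_degree N n p \<and> p \<in> borel_measurable (gaussian_space N) \<and> (AE \<omega> in M. hermite k (W v \<omega>) = p (\<lambda>j\<in>{..<N}. W (h j) \<omega>))"
      by (intro exI[of _ "\<lambda>x. hermite k (?l x)"] conjI t m ae)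
  qed
  then show ?thesis unfolding cylindrical_polynomial_def using hermite_chaos_L2[OF iso v] by (intro conjI exI[of _ "{v}"]) simp_all
qed

lemma strongly_measurable_sum_scaleR:
  fixes x :: "nat \<Rightarrow> 'x::real_normed_vector"
  assumes "\<And>k. k < m \<Longrightarrow> f k \<in> borel_measurable M"
  shows "strongly_measurable M (\<lambda>\<omega>. \<Sum>k<m. f k \<omega> *\<^sub>R x k)"
  using assms
proof (induction m)
  case 0
  show ?case using strongly_measurable_const[of _ "0::'x"] by simp
next
  case (Suc l)
  show ?case unfolding sum.lessThan_Suc
    by (rule strongly_measurable_add[OF Suc.IH strongly_measurable_scaleR_const]) (use Suc.prems in simp_all)
qed

lemma gaussian_space_sum_measurable:
  fixes x :: "nat \<Rightarrow> 'x::real_normed_vector"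
  shows "strongly_measurable (gaussian_space m) (\<lambda>\<gamma>. \<Sum>k<m. \<gamma> k *\<^sub>R x k)"
proof (rule strongly_measurable_sum_scaleR)
  show "(\<lambda>\<gamma>. \<gamma> k) \<in> borel_measurable (gaussian_space m)" if "k < m" for k
    using measurable_component_singleton[of k "{..<m}" "\<lambda>_. std_normal_distribution"] that by simp
qed

text \<open>
  In common coordinates the norm of the sum is the supremum of the polynomials \<open>\<phi> \<circ> F\<close> over
  functionals \<open>\<phi>\<close> in the unit ball, and it is attained at each point by a norming functional. So the
  bounds on Gaussian space apply with constants \<open>K\<close> that do not depend on the target space.
\<close>

lemma cylindrical_sum_moments:
  fixes W :: "'v::{real_inner,polish_space} \<Rightarrow> 'o \<Rightarrow> real" and x :: "nat \<Rightarrow> 'x::real_normed_vector"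
  assumes iso: "isonormal_process M W" and f: "\<And>k. k < m \<Longrightarrow> cylindrical_polynomial M W n (f k)"
    and K: "\<And>j N g. polynomial_sup N n g \<Longrightarrow> g \<in> borel_measurable (gaussian_space N) \<Longrightarrow>
     (\<integral>\<^sup>+x. ennreal (g x)^(2^Suc j) \<partial>gaussian_space N) \<le> ennreal (K j) * (\<integral>\<^sup>+x. ennreal (g x)^2 \<partial>gaussian_space N)^(2^j)"
  shows "moment_bounded K M (\<lambda>\<omega>. \<Sum>k<m. f k \<omega> *\<^sub>R x k)"
proof -
  interpret prob_space M by (rule isonormalD(1)[OF iso])
  let ?Y = "\<lambda>\<omega>. \<Sum>k<m. f k \<omega> *\<^sub>R x k"
  have Y2: "?Y \<in> SL2 M"
    by (rule SL2_sum) (use f in \<open>auto simp: cylindrical_polynomial_def intro: SL2_scaleR_const(1)\<close>)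
  have "\<exists>S. finite S \<and> polynomial_over M W n S (f k)" if "k < m" for k using f[OF that] unfolding cylindrical_polynomial_def by blast
  then obtain S where S: "\<And>k. k < m \<Longrightarrow> finite (S k)" "\<And>k. k < m \<Longrightarrow> polynomial_over M W n (S k) (f k)" by metis
  have fin: "finite (\<Union>k<m. S k)" using S(1) by simp
  obtain N h where o: "orthonormal N h" and sp: "\<And>v. v \<in> (\<Union>k<m. S k) \<Longrightarrow> in_orthonormal_span N h v"
    by (rule orthonormal_span_finite[OF fin]) (rule that)
  let ?T = "\<lambda>\<omega>. \<lambda>j\<in>{..<N}. W (h j) \<omega>"
  note L = isonormal_law[OF iso o]
  note L(1)[measurable]
  have "\<forall>k. \<exists>p. k < m \<longrightarrow> trig_degree N n p \<and> p \<in> borel_measurable (gaussian_space N) \<and> (AE \<omega> in M. f k \<omega> = p (?T \<omega>))"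
  proof
    fix k
    show "\<exists>p. k < m \<longrightarrow> trig_degree N n p \<and> p \<in> borel_measurable (gaussian_space N) \<and> (AE \<omega> in M. f k \<omega> = p (?T \<omega>))"
    proof (cases "k < m")
      case True
      have "\<forall>v\<in>S k. in_orthonormal_span N h v" using sp True by blast
      from S(2)[OF True, unfolded polynomial_over_def, THEN spec, THEN spec, THEN mp, OF o, THEN mp, OF this] show ?thesis by (elim exE) (rule exI, rule impI)
    qed simp
  qed
  from choice[OF this] obtain p where p':
    "\<forall>k. k < m \<longrightarrow> trig_degree N n (p k) \<and> p k \<in> borel_measurable (gaussian_space N) \<and> (AE \<omega> in M. f k \<omega> = p k (?T \<omega>))" by (rule exE)
  have p: "trig_degree N n (p k)" "p k \<in> borel_measurable (gaussian_space N)" "AE \<omega> in M. f k \<omega> = p k (?T \<omega>)" if "k < m" for k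
    using p' that by simp_all
  define F where "F = (\<lambda>z. \<Sum>k<m. p k z *\<^sub>R x k)"
  define g where "g = (\<lambda>z. norm (F z))"
  have gm [measurable]: "g \<in> borel_measurable (gaussian_space N)"
    unfolding g_def F_def by (rule strongly_measurable_norm[OF strongly_measurable_sum_scaleR[OF p(2)]])
  have ps: "polynomial_sup N n g"
    unfolding polynomial_sup_def
  proof
    fix z assume "z \<in> space (gaussian_space N)"
    obtain \<phi> :: "'x \<Rightarrow>\<^sub>L real" where \<phi>: "norm \<phi> \<le> 1" "blinfun_apply \<phi> (F z) = norm (F z)"
      using norming_functional[of "F z"] by blast
    have \<phi>F: "blinfun_apply \<phi> (F y) = (\<Sum>k\<in>{..<m}. blinfun_apply \<phi> (x k) * p k y)" for y
      unfolding F_def by (simp add: blinfun.sum_right blinfun.scaleR_right mult.commute)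
    have "trig_degree N n (\<lambda>y. blinfun_apply \<phi> (F y))"
      unfolding \<phi>F by (rule trig_degree_sum) (simp_all add: trig_degree_scale p(1))
    moreover have "\<bar>blinfun_apply \<phi> (F z)\<bar> = g z" unfolding \<phi>(2) g_def by simp
    moreover have "\<bar>blinfun_apply \<phi> (F y)\<bar> \<le> g y" for y
    proof -
      have "\<bar>blinfun_apply \<phi> (F y)\<bar> \<le> norm \<phi> * norm (F y)" using norm_blinfun[of \<phi> "F y"] by simp
      also have "\<dots> \<le> 1 * norm (F y)" by (intro mult_right_mono \<phi>) simp
      finally show ?thesis unfolding g_def by simp
    qed
    ultimately show "\<exists>q. trig_degree N n q \<and> \<bar>q z\<bar> = g z \<and> (\<forall>y\<in>space (gaussian_space N). \<bar>q y\<bar> \<le> g y)"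
      by (intro exI[of _ "\<lambda>y. blinfun_apply \<phi> (F y)"]) simp
  qed
  have "AE \<omega> in M. \<forall>k\<in>{..<m}. f k \<omega> = p k (?T \<omega>)"
    by (subst AE_ball_countable) (simp_all add: p(3))
  then have ae: "AE \<omega> in M. norm (?Y \<omega>) = g (?T \<omega>)"
    by (rule AE_mp) (intro AE_I2 impI, simp add: g_def F_def)
  have eq: "(\<integral>\<^sup>+\<omega>. ennreal (norm (?Y \<omega>))^q \<partial>M) = (\<integral>\<^sup>+z. ennreal (g z)^q \<partial>gaussian_space N)" for q
  proof -
    have "(\<integral>\<^sup>+\<omega>. ennreal (norm (?Y \<omega>))^q \<partial>M) = (\<integral>\<^sup>+\<omega>. ennreal (g (?T \<omega>))^q \<partial>M)"
    proof (rule nn_integral_cong_AE)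
      show "AE \<omega> in M. ennreal (norm (?Y \<omega>))^q = ennreal (g (?T \<omega>))^q"
        using ae by eventually_elim (simp only:)
    qed
    also have "\<dots> = (\<integral>\<^sup>+z. ennreal (g z)^q \<partial>distr M (gaussian_space N) ?T)"
      by (rule nn_integral_distr[symmetric]) measurable
    finally show ?thesis unfolding L(2) .
  qed
  show ?thesis
    unfolding moment_bounded_def eq using K[OF ps gm] eq[of 2] L2_norm_nn_integral[OF Y2] by simp
qed

text \<open>
  The coefficients are approximated in \<open>L\<^sup>2\<close> by cylindrical polynomials, and the moment bounds pass
  to the limit. The constants depend on \<open>n\<close> only.
\<close>

lemma chaos_sum_moments:
  fixes W :: "'v::{real_inner,polish_space} \<Rightarrow> 'o \<Rightarrow> real"
  assumes iso: "isonormal_process M W"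
  obtains K where "\<And>j. K j \<ge> 0"
    "\<And>m \<epsilon> (x :: nat \<Rightarrow> 'x::banach). (\<And>k. k < m \<Longrightarrow> \<epsilon> k \<in> wiener_chaos_upto M W n) \<Longrightarrow> moment_bounded K M (\<lambda>\<omega>. \<Sum>k<m. \<epsilon> k \<omega> *\<^sub>R x k)"
proof -
  interpret prob_space M by (rule isonormalD(1)[OF iso])
  have "\<forall>j. \<exists>C. C \<ge> 0 \<and> (\<forall>N f. polynomial_sup N n f \<longrightarrow> f \<in> borel_measurable (gaussian_space N) \<longrightarrow>
     (\<integral>\<^sup>+x. ennreal (f x)^(2^Suc j) \<partial>gaussian_space N) \<le> ennreal C * (\<integral>\<^sup>+x. ennreal (f x)^2 \<partial>gaussian_space N)^(2^j))"
    by (rule allI) (rule polynomial_sup_moments)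
  from choice[OF this] obtain K where K': "\<forall>j. K j \<ge> 0 \<and> (\<forall>N f. polynomial_sup N n f \<longrightarrow> f \<in> borel_measurable (gaussian_space N) \<longrightarrow>
     (\<integral>\<^sup>+x. ennreal (f x)^(2^Suc j) \<partial>gaussian_space N) \<le> ennreal (K j) * (\<integral>\<^sup>+x. ennreal (f x)^2 \<partial>gaussian_space N)^(2^j))"
    by (rule exE)
  have K: "\<And>j. K j \<ge> 0" "\<And>j N g. polynomial_sup N n g \<Longrightarrow> g \<in> borel_measurable (gaussian_space N) \<Longrightarrow>
     (\<integral>\<^sup>+x. ennreal (g x)^(2^Suc j) \<partial>gaussian_space N) \<le> ennreal (K j) * (\<integral>\<^sup>+x. ennreal (g x)^2 \<partial>gaussian_space N)^(2^j)"
    using K' by simp_all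
  have "moment_bounded K M (\<lambda>\<omega>. \<Sum>k<m. \<epsilon> k \<omega> *\<^sub>R x k)"
    if \<epsilon>: "\<And>k. k < m \<Longrightarrow> \<epsilon> k \<in> wiener_chaos_upto M W n" for m \<epsilon> and x :: "nat \<Rightarrow> 'x"
  proof -
    have "\<exists>f. cylindrical_polynomial M W n f \<and> L2_norm M (\<lambda>\<omega>. \<epsilon> k \<omega> - f \<omega>) < (1/2)^i" if "k < m" for k and i :: nat
    proof (rule chaos_upto_approx[OF iso \<epsilon>[OF that]])
      show "(1/2::real)^i > 0" by simp
      show "cylindrical_polynomial M W n (\<lambda>_. 0)" by (rule cylindrical_polynomial_zero)
    qed (simp_all add: cylindrical_polynomial_linear hermite_cylindrical[OF iso], simp add: cylindrical_polynomial_def)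
    note ex = this
    define f where "f = (\<lambda>(i::nat) k. SOME f. cylindrical_polynomial M W n f \<and> L2_norm M (\<lambda>\<omega>. \<epsilon> k \<omega> - f \<omega>) < (1/2)^i)"
    have f: "cylindrical_polynomial M W n (f i k)" and \<epsilon>f: "L2_norm M (\<lambda>\<omega>. \<epsilon> k \<omega> - f i k \<omega>) < (1/2)^i" if "k < m" for k i
      using someI_ex[OF ex[OF that, of i]] unfolding f_def by simp_all
    have f2: "f i k \<in> L2 M" if "k < m" for i k using f[OF that] unfolding cylindrical_polynomial_def by blast
    have \<epsilon>2: "\<epsilon> k \<in> L2 M" if "k < m" for k using chaos_upto_L2[OF \<epsilon>[OF that]] .
    let ?Z = "\<lambda>\<omega>. \<Sum>k<m. \<epsilon> k \<omega> *\<^sub>R x k" and ?Y = "\<lambda>i \<omega>. \<Sum>k<m. f i k \<omega> *\<^sub>R x k"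
    have Z2: "?Z \<in> SL2 M" by (rule SL2_sum) (simp_all add: SL2_scaleR_const(1) \<epsilon>2)
    have Y2: "?Y i \<in> SL2 M" for i by (rule SL2_sum) (simp_all add: SL2_scaleR_const(1) f2)
    have le: "L2_norm M (\<lambda>\<omega>. ?Y i \<omega> - ?Z \<omega>) \<le> (\<Sum>k<m. (1/2)^i * norm (x k))" for i
    proof -
      have d2: "(\<lambda>\<omega>. f i k \<omega> - \<epsilon> k \<omega>) \<in> L2 M" if "k < m" for k by (intro L2_real_intros f2 \<epsilon>2 that)
      have "L2_norm M (\<lambda>\<omega>. ?Y i \<omega> - ?Z \<omega>) = L2_norm M (\<lambda>\<omega>. \<Sum>k<m. (f i k \<omega> - \<epsilon> k \<omega>) *\<^sub>R x k)"
        by (simp add: sum_subtractf scaleR_left_diff_distrib)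
      also have "\<dots> \<le> (\<Sum>k<m. L2_norm M (\<lambda>\<omega>. (f i k \<omega> - \<epsilon> k \<omega>) *\<^sub>R x k))"
        by (rule L2_norm_sum) (simp_all add: SL2_scaleR_const(1) d2)
      also have "\<dots> \<le> (\<Sum>k<m. (1/2)^i * norm (x k))"
      proof (rule sum_mono)
        fix k assume "k \<in> {..<m}"
        then have k: "k < m" by simp
        show "L2_norm M (\<lambda>\<omega>. (f i k \<omega> - \<epsilon> k \<omega>) *\<^sub>R x k) \<le> (1/2)^i * norm (x k)"
          unfolding SL2_scaleR_const(2)[OF d2[OF k]]
          using \<epsilon>f[OF k, of i] L2_norm_minus[of M "\<epsilon> k" "f i k"] by (intro mult_right_mono) auto
      qed
      finally show ?thesis .
    qed
    have "(\<lambda>i. L2_norm M (\<lambda>\<omega>. ?Y i \<omega> - ?Z \<omega>)) \<longlonglongrightarrow> 0"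
    proof (rule Lim_null_comparison)
      show "\<forall>\<^sub>F i in sequentially. norm (L2_norm M (\<lambda>\<omega>. ?Y i \<omega> - ?Z \<omega>)) \<le> (\<Sum>k<m. (1/2)^i * norm (x k))"
        by (rule eventuallyI) (simp add: le)
      have "(\<lambda>i. (\<Sum>k<m. (1/2)^i * norm (x k))) \<longlonglongrightarrow> (\<Sum>k<m. 0 * norm (x k))"
        by (intro tendsto_sum tendsto_mult LIMSEQ_power_zero tendsto_const) simp
      then show "(\<lambda>i. (\<Sum>k<m. (1/2)^i * norm (x k))) \<longlonglongrightarrow> 0" by simp
    qed
    moreover have "moment_bounded K M (?Y i)" for i
      by (rule cylindrical_sum_moments[OF iso f K(2)])
    ultimately show ?thesis by (rule moment_bounded_limit[OF Y2 Z2])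
  qed
  with K(1) show thesis by (rule that)
qed

section \<open>Gaussian sums\<close>

lemma isonormal_gaussian_sum_norm:
  fixes x :: "nat \<Rightarrow> 'x::banach"
  assumes iso: "isonormal_process M W" and h: "orthonormal m h"
  shows "L2_norm M (\<lambda>\<omega>. \<Sum>k<m. W (h k) \<omega> *\<^sub>R x k) = gaussian_sum_norm m x"
proof -
  note L = isonormal_law[OF iso h]
  have "(\<integral>\<gamma>. (norm (\<Sum>k<m. \<gamma> k *\<^sub>R x k))\<^sup>2 \<partial>distr M (gaussian_space m) (\<lambda>\<omega>. \<lambda>j\<in>{..<m}. W (h j) \<omega>))
     = (\<integral>\<omega>. (norm (\<Sum>k<m. (\<lambda>j\<in>{..<m}. W (h j) \<omega>) k *\<^sub>R x k))\<^sup>2 \<partial>M)"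
    by (rule integral_distr[OF L(1)]) (intro borel_measurable_power strongly_measurable_norm[OF gaussian_space_sum_measurable])
  then show ?thesis unfolding L(2) gaussian_sum_norm_def L2_norm_def by simp
qed

text \<open>
  This makes the \<open>\<gamma>\<close>-norm of a finite rank operator independent of the representation.
\<close>

lemma gaussian_sum_norm_rotation:
  fixes x :: "nat \<Rightarrow> 'x::banach"
  assumes orth: "\<And>k k'. k < p \<Longrightarrow> k' < p \<Longrightarrow> (\<Sum>l<N. c l k * c l k') = (if k = k' then 1 else 0)"
  shows "gaussian_sum_norm N (\<lambda>l. \<Sum>k<p. c l k *\<^sub>R x k) = gaussian_sum_norm p x"
proof -
  let ?T = "\<lambda>z. \<lambda>k\<in>{..<p}. \<Sum>l<N. c l k * z l"
  have L: "?T \<in> gaussian_space N \<rightarrow>\<^sub>M gaussian_space p" "distr (gaussian_space N) (gaussian_space p) ?T = gaussian_space p"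
    by (rule gaussian_space_rotation[where c=c]; rule orth; assumption)+
  have e: "(\<Sum>l<N. z l *\<^sub>R (\<Sum>k<p. c l k *\<^sub>R x k)) = (\<Sum>k<p. ?T z k *\<^sub>R x k)" for z
  proof -
    have "(\<Sum>l<N. z l *\<^sub>R (\<Sum>k<p. c l k *\<^sub>R x k)) = (\<Sum>l<N. \<Sum>k<p. (c l k * z l) *\<^sub>R x k)"
      by (simp add: scaleR_sum_right mult.commute)
    also have "\<dots> = (\<Sum>k<p. \<Sum>l<N. (c l k * z l) *\<^sub>R x k)" by (rule sum.swap)
    also have "\<dots> = (\<Sum>k<p. ?T z k *\<^sub>R x k)" by (intro sum.cong refl) (simp add: scaleR_sum_left)
    finally show ?thesis .
  qed
  have "(\<integral>\<gamma>. (norm (\<Sum>k<p. \<gamma> k *\<^sub>R x k))\<^sup>2 \<partial>distr (gaussian_space N) (gaussian_space p) ?T)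
     = (\<integral>z. (norm (\<Sum>k<p. ?T z k *\<^sub>R x k))\<^sup>2 \<partial>gaussian_space N)"
    by (rule integral_distr[OF L(1)]) (intro borel_measurable_power strongly_measurable_norm[OF gaussian_space_sum_measurable])
  then show ?thesis unfolding L(2) gaussian_sum_norm_def L2_norm_def e by simp
qed

section \<open>Finite dimensional chaoses\<close>

text \<open>Gaussian elimination of one unknown per equation.\<close>

lemma homogeneous_system_nontrivial:
  fixes A :: "'i \<Rightarrow> 'b \<Rightarrow> real"
  assumes "finite B" "finite I" "card B < card I"
  shows "\<exists>c. (\<exists>k\<in>I. c k \<noteq> 0) \<and> (\<forall>b\<in>B. (\<Sum>k\<in>I. c k * A k b) = 0)"
  using assms
proof (induction B arbitrary: I A rule: finite_induct)
  case empty
  then obtain k where "k \<in> I" by fastforce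
  then show ?case by (intro exI[of _ "\<lambda>_. 1"]) auto
next
  case (insert b B)
  show ?case
  proof (cases "\<forall>k\<in>I. A k b = 0")
    case True
    obtain c where "\<exists>k\<in>I. c k \<noteq> 0" "\<forall>b\<in>B. (\<Sum>k\<in>I. c k * A k b) = 0"
      using insert.IH[of I A] insert.prems insert.hyps by auto
    then show ?thesis using True by (intro exI[of _ c]) simp
  next
    case False
    then obtain q where q: "q \<in> I" "A q b \<noteq> 0" by blast
    define I' where "I' = I - {q}"
    have I': "finite I'" "card B < card I'" "I = insert q I'" "q \<notin> I'"
      unfolding I'_def using insert q by (auto simp: card_Diff_singleton)
    obtain c where c: "\<exists>k\<in>I'. c k \<noteq> 0" "\<forall>d\<in>B. (\<Sum>k\<in>I'. c k * (A k d - A k b / A q b * A q d)) = 0"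
      using insert.IH[of I' "\<lambda>k d. A k d - A k b / A q b * A q d"] I' by auto
    define t where "t = - (\<Sum>k\<in>I'. c k * A k b) / A q b"
    let ?c = "c(q := t)"
    have s: "(\<Sum>k\<in>I. ?c k * A k d) = t * A q d + (\<Sum>k\<in>I'. c k * A k d)" for d
    proof -
      have "(\<Sum>k\<in>I'. ?c k * A k d) = (\<Sum>k\<in>I'. c k * A k d)" using I'(4) by (intro sum.cong) auto
      then show ?thesis unfolding I'(3) using I' by simp
    qed
    have "(\<Sum>k\<in>I. ?c k * A k b) = t * A q b + (\<Sum>k\<in>I'. c k * A k b)" by (rule s)
    then have "(\<Sum>k\<in>I. ?c k * A k b) = 0" using q(2) unfolding t_def by (simp only: nonzero_eq_divide_eq) simp
    moreover have "(\<Sum>k\<in>I. ?c k * A k d) = 0" if "d \<in> B" for d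
    proof -
      have "(\<Sum>k\<in>I'. c k * (A k d - A k b / A q b * A q d)) = (\<Sum>k\<in>I'. c k * A k d) - (\<Sum>k\<in>I'. c k * A k b) / A q b * A q d"
        by (simp add: right_diff_distrib sum_subtractf sum_distrib_right sum_divide_distrib mult.assoc)
      moreover have "(\<Sum>k\<in>I. ?c k * A k d) = t * A q d + (\<Sum>k\<in>I'. c k * A k d)" by (rule s)
      ultimately show ?thesis using c(2) that unfolding t_def by simp
    qed
    moreover have "\<exists>k\<in>I. ?c k \<noteq> 0" using c(1) I' by auto
    ultimately show ?thesis by (intro exI[of _ ?c]) simp
  qed
qed

text \<open>
  Linear combinations up to null sets. It bounds dimensions in a space of representatives, where
  the functions \<open>H\<^sub>i (W v)\<close> depend linearly on a finite family only almost surely.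
\<close>

definition AE_span :: "'o measure \<Rightarrow> ('o \<Rightarrow> real) set \<Rightarrow> ('o \<Rightarrow> real) set" where
  "AE_span M B = {f. \<exists>c. AE \<omega> in M. f \<omega> = (\<Sum>b\<in>B. c b * b \<omega>)}"

lemma AE_spanI: "AE \<omega> in M. f \<omega> = (\<Sum>b\<in>B. c b * b \<omega>) \<Longrightarrow> f \<in> AE_span M B"
  unfolding AE_span_def by blast

lemma AE_spanE:
  assumes "f \<in> AE_span M B" obtains c where "AE \<omega> in M. f \<omega> = (\<Sum>b\<in>B. c b * b \<omega>)"
  using assms unfolding AE_span_def by blast

lemma AE_span_linear:
  assumes "f \<in> AE_span M B" "g \<in> AE_span M B"
  shows "(\<lambda>\<omega>. r * f \<omega> + s * g \<omega>) \<in> AE_span M B"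
proof -
  obtain c where c: "AE \<omega> in M. f \<omega> = (\<Sum>b\<in>B. c b * b \<omega>)" by (rule AE_spanE[OF assms(1)])
  obtain d where d: "AE \<omega> in M. g \<omega> = (\<Sum>b\<in>B. d b * b \<omega>)" by (rule AE_spanE[OF assms(2)])
  have "AE \<omega> in M. r * f \<omega> + s * g \<omega> = (\<Sum>b\<in>B. (r * c b + s * d b) * b \<omega>)"
    using c d by eventually_elim (simp add: sum_distrib_left sum.distrib algebra_simps)
  then show ?thesis by (rule AE_spanI)
qed

lemma AE_span_cong: "f \<in> AE_span M B \<Longrightarrow> AE \<omega> in M. g \<omega> = f \<omega> \<Longrightarrow> g \<in> AE_span M B"
proof -
  assume "f \<in> AE_span M B" and g: "AE \<omega> in M. g \<omega> = f \<omega>"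
  then obtain c where c: "AE \<omega> in M. f \<omega> = (\<Sum>b\<in>B. c b * b \<omega>)" by (elim AE_spanE)
  have "AE \<omega> in M. g \<omega> = (\<Sum>b\<in>B. c b * b \<omega>)" using g c by eventually_elim simp
  then show ?thesis by (rule AE_spanI)
qed

lemma AE_span_zero: "(\<lambda>_. 0) \<in> AE_span M B"
  by (rule AE_spanI[where c="\<lambda>_. 0"]) simp

lemma AE_span_sum:
  assumes "finite F" "\<And>k. k \<in> F \<Longrightarrow> f k \<in> AE_span M B"
  shows "(\<lambda>\<omega>. \<Sum>k\<in>F. c k * f k \<omega>) \<in> AE_span M B"
  using assms
proof (induction F)
  case empty
  show ?case using AE_span_zero by simp
next
  case (insert k F)
  have "(\<lambda>\<omega>. c k * f k \<omega> + 1 * (\<Sum>k\<in>F. c k * f k \<omega>)) \<in> AE_span M B"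
    by (rule AE_span_linear) (use insert in simp_all)
  then show ?case using insert.hyps by simp
qed

lemma AE_span_base:
  assumes "finite B" "b \<in> B" shows "b \<in> AE_span M B"
proof (rule AE_spanI[where c="\<lambda>a. if a = b then 1 else 0"], rule AE_I2)
  fix \<omega>
  have "(\<Sum>a\<in>B. (if a = b then 1 else 0) * a \<omega>) = (\<Sum>a\<in>B. if a = b then a \<omega> else 0)" by (intro sum.cong) auto
  also have "\<dots> = b \<omega>" using assms by simp
  finally show "b \<omega> = (\<Sum>a\<in>B. (if a = b then 1 else 0) * a \<omega>)" by simp
qed

lemma AE_span_mono:
  assumes f: "f \<in> AE_span M B" and "B \<subseteq> B'" "finite B'"
  shows "f \<in> AE_span M B'"
proof -
  obtain c where c: "AE \<omega> in M. f \<omega> = (\<Sum>b\<in>B. c b * b \<omega>)" by (rule AE_spanE[OF f])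
  have "finite B" using assms finite_subset by blast
  have "(\<lambda>\<omega>. \<Sum>b\<in>B. c b * b \<omega>) \<in> AE_span M B'"
    by (rule AE_span_sum[OF \<open>finite B\<close>, where f="\<lambda>b. b"]) (use assms AE_span_base in blast)
  then show ?thesis by (rule AE_span_cong[OF _ c])
qed

text \<open>
  If the \<open>h j\<close> span the whole space, then \<open>W v\<close> is a combination of the finitely many \<open>W (h j)\<close>,
  and the three term recursion adds only the products of these with the functions of lower order.
\<close>

lemma hermite_AE_span_finite:
  fixes W :: "'v::{real_inner,polish_space} \<Rightarrow> 'o \<Rightarrow> real" and h :: "nat \<Rightarrow> 'v"
  assumes iso: "isonormal_process M W" and sp: "\<And>v. in_orthonormal_span N h v"
  shows "\<exists>B. finite B \<and> (\<forall>v. \<forall>i\<le>n. (\<lambda>\<omega>. hermite i (W v \<omega>)) \<in> AE_span M B)"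
proof (induction n)
  case 0
  have "(\<lambda>\<omega>. hermite 0 (W v \<omega>)) \<in> AE_span M {\<lambda>_. 1}" for v
    by (rule AE_spanI[where c="\<lambda>_. 1"]) (simp add: hermite_eq_poly)
  then show ?case by (intro exI[of _ "{\<lambda>_. 1}"]) simp
next
  case (Suc n)
  then obtain B where B: "finite B" "\<And>v i. i \<le> n \<Longrightarrow> (\<lambda>\<omega>. hermite i (W v \<omega>)) \<in> AE_span M B" by blast
  \<comment> \<open>products with the coordinates raise the degree by one\<close>
  define B' where "B' = B \<union> (\<lambda>(j, b) \<omega>. W (h j) \<omega> * b \<omega>) ` ({..<N} \<times> B)"
  have B': "finite B'" "B \<subseteq> B'" unfolding B'_def using B by auto
  have mult: "(\<lambda>\<omega>. W (h j) \<omega> * f \<omega>) \<in> AE_span M B'" if j: "j < N" and f: "f \<in> AE_span M B" for j f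
  proof -
    obtain c where c: "AE \<omega> in M. f \<omega> = (\<Sum>b\<in>B. c b * b \<omega>)" by (rule AE_spanE[OF f])
    have s: "(\<lambda>\<omega>. \<Sum>b\<in>B. c b * (W (h j) \<omega> * b \<omega>)) \<in> AE_span M B'"
      by (rule AE_span_sum[OF B(1), where f="\<lambda>b \<omega>. W (h j) \<omega> * b \<omega>"], rule AE_span_base[OF B'(1)]) (use j in \<open>auto simp: B'_def\<close>)
    show ?thesis
      by (rule AE_span_cong[OF s]) (use c in \<open>eventually_elim, simp add: sum_distrib_left mult_ac\<close>)
  qed
  have "(\<lambda>\<omega>. hermite i (W v \<omega>)) \<in> AE_span M B'" if i: "i \<le> Suc n" for i v
  proof (cases "i \<le> n")
    case True
    then show ?thesis by (rule AE_span_mono[OF B(2) B'(2,1)])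
  next
    case False
    then have i: "i = Suc n" using i by simp
    have vs: "v = (\<Sum>j<N. (v \<bullet> h j) *\<^sub>R h j)" using sp[of v] unfolding in_orthonormal_span_def .
    have ae: "AE \<omega> in M. W (\<Sum>j<N. (v \<bullet> h j) *\<^sub>R h j) \<omega> = (\<Sum>j<N. (v \<bullet> h j) * W (h j) \<omega>)"
      by (rule L2_operator_sum[OF isonormal_L2_operator[OF iso]]) simp
    have a: "(\<lambda>\<omega>. \<Sum>j<N. (v \<bullet> h j) * (W (h j) \<omega> * hermite n (W v \<omega>))) \<in> AE_span M B'"
      by (rule AE_span_sum) (simp_all add: mult B(2))
    have b: "(\<lambda>\<omega>. poly (pderiv (hermite_poly n)) (W v \<omega>)) \<in> AE_span M B'"
    proof (cases n)
      case 0
      then show ?thesis using AE_span_zero by (simp add: pderiv_1)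
    next
      case (Suc n')
      then have "n' \<le> n" by simp
      from AE_span_mono[OF B(2)[OF this] B'(2,1)] show ?thesis unfolding Suc pderiv_hermite_poly hermite_eq_poly .
    qed
    have rec: "hermite (Suc n) y = 1 / real (Suc n) * (y * hermite n y) + (- 1 / real (Suc n)) * poly (pderiv (hermite_poly n)) y" for y
    proof -
      have "hermite (Suc n) y = (real (Suc n) * hermite (Suc n) y) / real (Suc n)" by simp
      also have "\<dots> = (y * hermite n y - poly (pderiv (hermite_poly n)) y) / real (Suc n)" by (simp only: hermite_rec)
      finally show ?thesis by (simp add: diff_divide_distrib)
    qed
    show ?thesis unfolding i
    proof (rule AE_span_cong[OF AE_span_linear[OF a b, of "1 / real (Suc n)" "- 1 / real (Suc n)"]])
      show "AE \<omega> in M. hermite (Suc n) (W v \<omega>) = 1 / real (Suc n) * (\<Sum>j<N. (v \<bullet> h j) * (W (h j) \<omega> * hermite n (W v \<omega>)))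
          + (- 1 / real (Suc n)) * poly (pderiv (hermite_poly n)) (W v \<omega>)"
        using ae unfolding vs[symmetric]
      proof eventually_elim
        case (elim \<omega>)
        have "(\<Sum>j<N. (v \<bullet> h j) * (W (h j) \<omega> * hermite n (W v \<omega>))) = W v \<omega> * hermite n (W v \<omega>)"
          unfolding mult.assoc[symmetric] sum_distrib_right[symmetric] elim[symmetric] ..
        then show ?case by (simp only: rec)
      qed
    qed
  qed
  then show ?case using B'(1) by blast
qed

lemma L2_orthonormal_norm:
  assumes \<epsilon>: "\<And>k. k < m \<Longrightarrow> \<epsilon> k \<in> L2 M" and o: "L2_orthonormal M m \<epsilon>"
  shows "(L2_norm M (\<lambda>\<omega>. \<Sum>k<m. c k * \<epsilon> k \<omega>))\<^sup>2 = (\<Sum>k<m. (c k)\<^sup>2)"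
proof -
  have i: "integrable M (\<lambda>\<omega>. \<epsilon> k \<omega> * \<epsilon> l \<omega>)" if "k < m" "l < m" for k l by (intro L2_mult_integrable \<epsilon> that)
  have "(L2_norm M (\<lambda>\<omega>. \<Sum>k<m. c k * \<epsilon> k \<omega>))\<^sup>2 = (\<integral>\<omega>. (\<Sum>k<m. \<Sum>l<m. c k * c l * (\<epsilon> k \<omega> * \<epsilon> l \<omega>)) \<partial>M)"
    unfolding L2_norm_power2 by (simp add: power2_eq_square sum_product mult_ac)
  also have "\<dots> = (\<Sum>k<m. (\<integral>\<omega>. (\<Sum>l<m. c k * c l * (\<epsilon> k \<omega> * \<epsilon> l \<omega>)) \<partial>M))"
    by (rule Bochner_Integration.integral_sum, rule Bochner_Integration.integrable_sum) (simp add: i)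
  also have "\<dots> = (\<Sum>k<m. \<Sum>l<m. c k * c l * (\<integral>\<omega>. \<epsilon> k \<omega> * \<epsilon> l \<omega> \<partial>M))"
    by (rule sum.cong[OF refl], subst Bochner_Integration.integral_sum) (simp_all add: i)
  also have "\<dots> = (\<Sum>k<m. \<Sum>l<m. if k = l then (c k)\<^sup>2 else 0)"
    using o unfolding L2_orthonormal_def by (intro sum.cong refl) (auto simp: power2_eq_square)
  also have "\<dots> = (\<Sum>k<m. (c k)\<^sup>2)" by simp
  finally show ?thesis .
qed

text \<open>
  Approximate the \<open>\<epsilon> k\<close> within \<open>1/(2m)\<close> by elements of the span. If \<open>m\<close> exceeds the number of
  spanning functions, some combination of the approximants with coefficients of square sum one
  vanishes, whereas the same combination of the orthonormal \<open>\<epsilon> k\<close> has norm one and would have norm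
  at most \<open>1/2\<close>.
\<close>

lemma chaos_upto_dimension_bound:
  assumes iso: "isonormal_process M W" and B: "finite B"
    and sp: "\<And>v i. norm v = 1 \<Longrightarrow> i \<le> n \<Longrightarrow> (\<lambda>\<omega>. hermite i (W v \<omega>)) \<in> AE_span M B"
    and \<epsilon>: "\<And>k. k < m \<Longrightarrow> \<epsilon> k \<in> wiener_chaos_upto M W n" and o: "L2_orthonormal M m \<epsilon>"
  shows "m \<le> card B"
proof (rule ccontr)
  assume "\<not> m \<le> card B"
  then have m: "card B < card {..<m}" by simp
  then have m0: "m > 0" by simp
  \<comment> \<open>\<open>m\<close> errors of this size add up to at most \<open>1/2\<close>\<close>
  define e where "e = 1 / (2 * real m)"
  have e: "e > 0" unfolding e_def using m0 by simp
  have ex: "\<exists>f. f \<in> L2 M \<and> f \<in> AE_span M B \<and> L2_norm M (\<lambda>\<omega>. \<epsilon> k \<omega> - f \<omega>) < e" if "k < m" for k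
  proof -
    have "\<exists>f. (f \<in> L2 M \<and> f \<in> AE_span M B) \<and> L2_norm M (\<lambda>\<omega>. \<epsilon> k \<omega> - f \<omega>) < e"
    proof (rule chaos_upto_approx[OF iso \<epsilon>[OF that] e])
      show "(\<lambda>_. 0) \<in> L2 M \<and> (\<lambda>_. 0) \<in> AE_span M B"
        using closed_span_L2[OF closed_span_zero[of M "{}"]] AE_span_zero by simp
      show "(\<lambda>\<omega>. f \<omega> + c * g \<omega>) \<in> L2 M \<and> (\<lambda>\<omega>. f \<omega> + c * g \<omega>) \<in> AE_span M B"
        if "f \<in> L2 M \<and> f \<in> AE_span M B" "g \<in> L2 M \<and> g \<in> AE_span M B" for f g c
        using that AE_span_linear[of f M B g 1 c] by (simp add: L2_real_intros)
      show "(\<lambda>\<omega>. hermite i (W v \<omega>)) \<in> L2 M \<and> (\<lambda>\<omega>. hermite i (W v \<omega>)) \<in> AE_span M B"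
        if "norm v = 1" "i \<le> n" for v i
        by (intro conjI hermite_chaos_L2[OF iso that(1)] sp that)
    qed simp
    then show ?thesis by simp
  qed
  define f where "f = (\<lambda>k. SOME f. f \<in> L2 M \<and> f \<in> AE_span M B \<and> L2_norm M (\<lambda>\<omega>. \<epsilon> k \<omega> - f \<omega>) < e)"
  have f: "f k \<in> L2 M" "f k \<in> AE_span M B" "L2_norm M (\<lambda>\<omega>. \<epsilon> k \<omega> - f k \<omega>) < e" if "k < m" for k
    using someI_ex[OF ex[OF that]] unfolding f_def by simp_all
  define A where "A = (\<lambda>k. SOME c. AE \<omega> in M. f k \<omega> = (\<Sum>b\<in>B. c b * b \<omega>))"
  have A: "AE \<omega> in M. f k \<omega> = (\<Sum>b\<in>B. A k b * b \<omega>)" if "k < m" for k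
  proof -
    have "\<exists>c. AE \<omega> in M. f k \<omega> = (\<Sum>b\<in>B. c b * b \<omega>)" using f(2)[OF that] unfolding AE_span_def by simp
    from someI_ex[OF this] show ?thesis unfolding A_def .
  qed
  obtain c' where c': "\<exists>k\<in>{..<m}. c' k \<noteq> 0" "\<forall>b\<in>B. (\<Sum>k\<in>{..<m}. c' k * A k b) = 0"
    using homogeneous_system_nontrivial[OF B finite_lessThan m, of A] by blast
  define s where "s = sqrt (\<Sum>k<m. (c' k)\<^sup>2)"
  have s: "s > 0"
  proof -
    obtain k where "k < m" "c' k \<noteq> 0" using c'(1) by auto
    then have "0 < (\<Sum>k<m. (c' k)\<^sup>2)" by (intro sum_pos2[of _ k]) auto
    then show ?thesis unfolding s_def by simp
  qed
  define c where "c = (\<lambda>k. c' k / s)"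
  have "(\<Sum>k<m. (c' k)\<^sup>2) = s\<^sup>2" unfolding s_def by (simp add: sum_nonneg)
  then have c1: "(\<Sum>k<m. (c k)\<^sup>2) = 1" unfolding c_def power_divide sum_divide_distrib[symmetric] using s by simp
  have cb: "\<bar>c k\<bar> \<le> 1" if "k < m" for k
  proof -
    have "(c k)\<^sup>2 \<le> (\<Sum>k<m. (c k)\<^sup>2)" using that by (intro member_le_sum) auto
    then show ?thesis unfolding c1 by (simp add: abs_square_le_1)
  qed
  have cA: "(\<Sum>k<m. c k * A k b) = 0" if "b \<in> B" for b
  proof -
    have "(\<Sum>k<m. c k * A k b) = (\<Sum>k<m. c' k * A k b) / s" unfolding c_def sum_divide_distrib by simp
    then show ?thesis using c'(2) that by simp
  qed
  have "AE \<omega> in M. \<forall>k\<in>{..<m}. f k \<omega> = (\<Sum>b\<in>B. A k b * b \<omega>)"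
    by (subst AE_ball_countable) (simp_all add: A)
  then have z: "AE \<omega> in M. (\<Sum>k<m. c k * f k \<omega>) = 0"
  proof (rule AE_mp, intro AE_I2 impI)
    fix \<omega> assume "\<forall>k\<in>{..<m}. f k \<omega> = (\<Sum>b\<in>B. A k b * b \<omega>)"
    then have "(\<Sum>k<m. c k * f k \<omega>) = (\<Sum>k<m. \<Sum>b\<in>B. c k * A k b * b \<omega>)" by (simp add: sum_distrib_left mult.assoc)
    also have "\<dots> = (\<Sum>b\<in>B. (\<Sum>k<m. c k * A k b) * b \<omega>)" unfolding sum_distrib_right by (rule sum.swap)
    also have "\<dots> = 0" by (simp add: cA)
    finally show "(\<Sum>k<m. c k * f k \<omega>) = 0" .
  qed
  have \<epsilon>2: "\<epsilon> k \<in> L2 M" if "k < m" for k by (rule chaos_upto_L2[OF \<epsilon>[OF that]])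
  have d2: "(\<lambda>\<omega>. c k *\<^sub>R (\<epsilon> k \<omega> - f k \<omega>)) \<in> SL2 M" if "k < m" for k
    using \<epsilon>2[OF that] f(1)[OF that] by (intro SL2_scaleR SL2_diff) (simp_all add: SL2_real)
  have "L2_norm M (\<lambda>\<omega>. \<Sum>k<m. c k * \<epsilon> k \<omega>) = L2_norm M (\<lambda>\<omega>. \<Sum>k<m. c k *\<^sub>R (\<epsilon> k \<omega> - f k \<omega>))"
  proof (rule L2_norm_cong_AE)
    show "(\<lambda>\<omega>. \<Sum>k<m. c k * \<epsilon> k \<omega>) \<in> SL2 M" unfolding SL2_real by (rule L2_real_sum) (simp_all add: \<epsilon>2)
    show "(\<lambda>\<omega>. \<Sum>k<m. c k *\<^sub>R (\<epsilon> k \<omega> - f k \<omega>)) \<in> SL2 M" by (rule SL2_sum) (simp, rule d2, simp)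
    show "AE \<omega> in M. (\<Sum>k<m. c k * \<epsilon> k \<omega>) = (\<Sum>k<m. c k *\<^sub>R (\<epsilon> k \<omega> - f k \<omega>))"
      using z by eventually_elim (simp add: right_diff_distrib sum_subtractf)
  qed
  also have "\<dots> \<le> (\<Sum>k<m. L2_norm M (\<lambda>\<omega>. c k *\<^sub>R (\<epsilon> k \<omega> - f k \<omega>)))"
    by (rule L2_norm_sum) (simp, rule d2, simp)
  also have "\<dots> \<le> (\<Sum>k<m. 1 * e)"
    unfolding L2_norm_scaleR by (intro sum_mono mult_mono) (use f(3) cb in \<open>auto intro: less_imp_le\<close>)
  also have "\<dots> = 1/2" unfolding e_def using m0 by simp
  finally have le: "L2_norm M (\<lambda>\<omega>. \<Sum>k<m. c k * \<epsilon> k \<omega>) \<le> 1/2" .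
  have "(L2_norm M (\<lambda>\<omega>. \<Sum>k<m. c k * \<epsilon> k \<omega>))\<^sup>2 = 1"
    using L2_orthonormal_norm[OF \<epsilon>2 o] c1 by simp
  then have "L2_norm M (\<lambda>\<omega>. \<Sum>k<m. c k * \<epsilon> k \<omega>) = 1"
    using L2_norm_nonneg[of M "\<lambda>\<omega>. \<Sum>k<m. c k * \<epsilon> k \<omega>"] by (simp add: power2_eq_1_iff)
  with le show False by simp
qed

section \<open>Finite rank operators\<close>

lemma gaussian_coordinates:
  shows "k < m \<Longrightarrow> (\<lambda>\<gamma>. \<gamma> k) \<in> L2 (gaussian_space m)" and "L2_orthonormal (gaussian_space m) m (\<lambda>k \<gamma>. \<gamma> k)"
proof -
  interpret G: prob_space std_normal_distribution by (rule prob_space_std_normal)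
  interpret P: product_sigma_finite "\<lambda>_::nat. std_normal_distribution" by standard
  have id: "integrable std_normal_distribution (\<lambda>x. x)" "integrable std_normal_distribution (\<lambda>x. x * x)"
    using integrable_std_normal_distribution_moment[of 1] integrable_std_normal_distribution_moment[of 2] by (simp_all add: power2_eq_square)
  have e1: "(\<integral>x. x \<partial>std_normal_distribution) = 0" using integral_std_normal_distribution_moment_odd[of 1] by simp
  have e2: "(\<integral>x. x * x \<partial>std_normal_distribution) = 1" using std_normal_distribution_even_moments(1)[of 1] by (simp add: power2_eq_square)
  define g where "g = (\<lambda>(j::nat) k i x. (if i = j then x else 1) * (if i = k then x else (1::real)))"
  have gi: "integrable std_normal_distribution (g j k i)" for j k i
    unfolding g_def using id by (cases "i = j"; cases "i = k") (simp_all del: space_density)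
  have gp: "(\<Prod>i<m. g j k i (\<gamma> i)) = \<gamma> j * \<gamma> k" if "j < m" "k < m" for j k and \<gamma> :: "nat \<Rightarrow> real"
    unfolding g_def prod.distrib using that by simp
  have i: "integrable (gaussian_space m) (\<lambda>\<gamma>. \<gamma> j * \<gamma> k)" if "j < m" "k < m" for j k
    using P.product_integrable_prod[of "{..<m}" "g j k"] gi unfolding gp[OF that] by simp
  have e: "(\<integral>\<gamma>. \<gamma> j * \<gamma> k \<partial>gaussian_space m) = (if j = k then 1 else 0)" if jk: "j < m" "k < m" for j k
  proof -
    have "(\<integral>\<gamma>. \<gamma> j * \<gamma> k \<partial>gaussian_space m) = (\<Prod>i<m. (\<integral>x. g j k i x \<partial>std_normal_distribution))"
      using P.product_integral_prod[of "{..<m}" "g j k"] gi unfolding gp[OF jk] by simp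
    also have "\<dots> = (if j = k then 1 else 0)"
    proof (cases "j = k")
      case True
      have "(\<integral>x. g j k i x \<partial>std_normal_distribution) = 1" for i
        unfolding g_def True using e2 G.prob_space by (cases "i = k") (simp_all del: space_density)
      then show ?thesis using True by simp
    next
      case False
      have "(\<integral>x. g j k j x \<partial>std_normal_distribution) = 0" unfolding g_def using False e1 by simp
      then show ?thesis using False jk(1) by (simp add: prod_zero_iff) blast
    qed
    finally show ?thesis .
  qed
  show "(\<lambda>\<gamma>. \<gamma> k) \<in> L2 (gaussian_space m)" if "k < m"
    unfolding L2_def using i[OF that that] measurable_component_singleton[of k "{..<m}" "\<lambda>_. std_normal_distribution"] that
    by (simp add: power2_eq_square)
  show "L2_orthonormal (gaussian_space m) m (\<lambda>k \<gamma>. \<gamma> k)"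
    unfolding L2_orthonormal_def using e by simp
qed

lemma gaussian_sum_SL2:
  fixes x :: "nat \<Rightarrow> 'x::real_normed_vector"
  shows "(\<lambda>\<gamma>. \<Sum>k<m. \<gamma> k *\<^sub>R x k) \<in> SL2 (gaussian_space m)"
  by (rule SL2_sum) (simp_all add: SL2_scaleR_const(1) gaussian_coordinates(1))

lemma gaussian_sum_norm_triangle:
  "\<bar>gaussian_sum_norm m x - gaussian_sum_norm m y\<bar> \<le> gaussian_sum_norm m (\<lambda>k. x k - y k)"
  using L2_norm_diff_abs[OF gaussian_sum_SL2[where m=m and x=x] gaussian_sum_SL2[where m=m and x=y]]
  unfolding gaussian_sum_norm_def by (simp add: sum_subtractf scaleR_right_diff_distrib)

lemma finite_rank_rep_orthonormal: "finite_rank_rep S m e x \<Longrightarrow> orthonormal m e"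
  unfolding finite_rank_rep_def orthonormal_def by blast

lemma finite_rank_repD: "finite_rank_rep S m e x \<Longrightarrow> blinfun_apply S w = (\<Sum>k<m. (w \<bullet> e k) *\<^sub>R x k)"
  unfolding finite_rank_rep_def by blast

text \<open>
  Writing the \<open>e k\<close> in the basis \<open>h\<close> transforms the operator, the Gaussian sum and the integral by
  the same isometric matrix.
\<close>

lemma finite_rank_rep_change_basis:
  fixes S :: "'w::{real_inner,complete_space} \<Rightarrow>\<^sub>L 'x::banach"
  assumes S: "finite_rank_rep S m e x" and h: "orthonormal p h" and sp: "\<And>k. k < m \<Longrightarrow> in_orthonormal_span p h (e k)"
  shows "finite_rank_rep S p h (\<lambda>l. blinfun_apply S (h l))"
    and "gaussian_sum_norm p (\<lambda>l. blinfun_apply S (h l)) = gaussian_sum_norm m x"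
    and "L2_operator M I \<Longrightarrow> AE \<omega> in M. (\<Sum>k<m. I (e k) \<omega> *\<^sub>R x k) = (\<Sum>l<p. I (h l) \<omega> *\<^sub>R blinfun_apply S (h l))"
proof -
  note Sx = finite_rank_repD[OF S]
  have es: "e k = (\<Sum>l<p. (e k \<bullet> h l) *\<^sub>R h l)" if "k < m" for k using sp[OF that] unfolding in_orthonormal_span_def .
  have swap: "(\<Sum>k<m. (\<Sum>l<p. (e k \<bullet> h l) * a l) *\<^sub>R x k) = (\<Sum>l<p. a l *\<^sub>R blinfun_apply S (h l))" for a
  proof -
    have "(\<Sum>k<m. (\<Sum>l<p. (e k \<bullet> h l) * a l) *\<^sub>R x k) = (\<Sum>k<m. \<Sum>l<p. ((e k \<bullet> h l) * a l) *\<^sub>R x k)"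
      by (simp add: scaleR_sum_left)
    also have "\<dots> = (\<Sum>l<p. \<Sum>k<m. ((e k \<bullet> h l) * a l) *\<^sub>R x k)" by (rule sum.swap)
    also have "\<dots> = (\<Sum>l<p. a l *\<^sub>R blinfun_apply S (h l))"
      unfolding Sx scaleR_sum_right by (simp add: inner_commute mult.commute)
    finally show ?thesis .
  qed
  have "blinfun_apply S w = (\<Sum>l<p. (w \<bullet> h l) *\<^sub>R blinfun_apply S (h l))" for w
  proof -
    have "w \<bullet> e k = (\<Sum>l<p. (e k \<bullet> h l) * (w \<bullet> h l))" if "k < m" for k
      by (subst es[OF that]) (simp add: inner_sum_right)
    then have "blinfun_apply S w = (\<Sum>k<m. (\<Sum>l<p. (e k \<bullet> h l) * (w \<bullet> h l)) *\<^sub>R x k)"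
      unfolding Sx by (intro sum.cong refl) simp
    then show ?thesis unfolding swap .
  qed
  then show "finite_rank_rep S p h (\<lambda>l. blinfun_apply S (h l))"
    unfolding finite_rank_rep_def using h unfolding orthonormal_def by blast
  have "gaussian_sum_norm p (\<lambda>l. \<Sum>k<m. (h l \<bullet> e k) *\<^sub>R x k) = gaussian_sum_norm m x"
  proof (rule gaussian_sum_norm_rotation)
    fix k k' assume k: "k < m" "k' < m"
    have "(\<Sum>l<p. (h l \<bullet> e k) * (h l \<bullet> e k')) = (\<Sum>l<p. (e k \<bullet> h l) *\<^sub>R h l) \<bullet> (\<Sum>l<p. (e k' \<bullet> h l) *\<^sub>R h l)"
      unfolding orthonormal_norm_sum[OF h] by (simp add: inner_commute)
    also have "\<dots> = e k \<bullet> e k'" using es k by simp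
    finally show "(\<Sum>l<p. (h l \<bullet> e k) * (h l \<bullet> e k')) = (if k = k' then 1 else 0)"
      using orthonormalD[OF finite_rank_rep_orthonormal[OF S] k] by simp
  qed
  then show "gaussian_sum_norm p (\<lambda>l. blinfun_apply S (h l)) = gaussian_sum_norm m x" unfolding Sx .
  assume I: "L2_operator M I"
  have "AE \<omega> in M. I (e k) \<omega> = (\<Sum>l<p. (e k \<bullet> h l) * I (h l) \<omega>)" if "k < m" for k
    using L2_operator_sum[OF I, where S="{..<p}" and c="\<lambda>l. e k \<bullet> h l" and x=h] es[OF that] by simp
  then have "AE \<omega> in M. \<forall>k\<in>{..<m}. I (e k) \<omega> = (\<Sum>l<p. (e k \<bullet> h l) * I (h l) \<omega>)"
    by (subst AE_ball_countable) simp_all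
  then show "AE \<omega> in M. (\<Sum>k<m. I (e k) \<omega> *\<^sub>R x k) = (\<Sum>l<p. I (h l) \<omega> *\<^sub>R blinfun_apply S (h l))"
  proof (rule AE_mp, intro AE_I2 impI)
    fix \<omega> assume "\<forall>k\<in>{..<m}. I (e k) \<omega> = (\<Sum>l<p. (e k \<bullet> h l) * I (h l) \<omega>)"
    then have "(\<Sum>k<m. I (e k) \<omega> *\<^sub>R x k) = (\<Sum>k<m. (\<Sum>l<p. (e k \<bullet> h l) * I (h l) \<omega>) *\<^sub>R x k)" by simp
    then show "(\<Sum>k<m. I (e k) \<omega> *\<^sub>R x k) = (\<Sum>l<p. I (h l) \<omega> *\<^sub>R blinfun_apply S (h l))" unfolding swap .
  qed
qed

lemma finite_rank_common_basis:
  fixes S S' :: "'w::{real_inner,complete_space} \<Rightarrow>\<^sub>L 'x::banach"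
  assumes "finite_rank_rep S m e x" "finite_rank_rep S' m' e' x'"
  obtains p h where "orthonormal p h" "\<And>k. k < m \<Longrightarrow> in_orthonormal_span p h (e k)" "\<And>k. k < m' \<Longrightarrow> in_orthonormal_span p h (e' k)"
proof -
  have "finite (e ` {..<m} \<union> e' ` {..<m'})" by simp
  then obtain p h where "orthonormal p h" "\<And>v. v \<in> e ` {..<m} \<union> e' ` {..<m'} \<Longrightarrow> in_orthonormal_span p h v"
    by (rule orthonormal_span_finite) (rule that)
  then show thesis by (intro that[of p h]) auto
qed

lemma gamma_norm_finite_rank_eq:
  fixes S :: "'w::{real_inner,complete_space} \<Rightarrow>\<^sub>L 'x::banach"
  assumes S: "finite_rank_rep S m e x"
  shows "gamma_norm_finite_rank S = gaussian_sum_norm m x"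
  unfolding gamma_norm_finite_rank_def
proof (rule the_equality)
  show "\<exists>m' e' x'. finite_rank_rep S m' e' x' \<and> gaussian_sum_norm m x = gaussian_sum_norm m' x'" using S by blast
  fix c assume "\<exists>m e x. finite_rank_rep S m e x \<and> c = gaussian_sum_norm m x"
  then obtain m' e' x' where S': "finite_rank_rep S m' e' x'" and c: "c = gaussian_sum_norm m' x'" by blast
  obtain p h where h: "orthonormal p h" "\<And>k. k < m \<Longrightarrow> in_orthonormal_span p h (e k)" "\<And>k. k < m' \<Longrightarrow> in_orthonormal_span p h (e' k)"
    by (rule finite_rank_common_basis[OF S S']) (rule that)
  show "c = gaussian_sum_norm m x"
    using finite_rank_rep_change_basis(2)[OF S h(1,2)] finite_rank_rep_change_basis(2)[OF S' h(1,3)] c by simp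
qed

text \<open>
  Two finite rank operators are compared in a common orthonormal basis. The last conclusion is
  quantified over \<open>I\<close>, so that it serves any linear map into \<open>L\<^sup>2\<close>.
\<close>

lemma finite_rank_difference:
  fixes S S' :: "'w::{real_inner,complete_space} \<Rightarrow>\<^sub>L 'x::banach"
  assumes S: "finite_rank_rep S m e x" and S': "finite_rank_rep S' m' e' x'"
  obtains p h where "finite_rank_rep (S - S') p h (\<lambda>l. blinfun_apply (S - S') (h l))"
    "\<bar>gamma_norm_finite_rank S - gamma_norm_finite_rank S'\<bar> \<le> gamma_norm_finite_rank (S - S')"
    "\<And>M I. L2_operator M I \<Longrightarrow> AE \<omega> in M. (\<Sum>k<m. I (e k) \<omega> *\<^sub>R x k) - (\<Sum>k<m'. I (e' k) \<omega> *\<^sub>R x' k) = (\<Sum>l<p. I (h l) \<omega> *\<^sub>R blinfun_apply (S - S') (h l))"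
proof -
  obtain p h where h: "orthonormal p h" "\<And>k. k < m \<Longrightarrow> in_orthonormal_span p h (e k)" "\<And>k. k < m' \<Longrightarrow> in_orthonormal_span p h (e' k)"
    by (rule finite_rank_common_basis[OF S S']) (rule that)
  have C: "finite_rank_rep S p h (\<lambda>l. blinfun_apply S (h l))"
    by (rule finite_rank_rep_change_basis(1)[OF S h(1)]) (rule h(2))
  have C': "finite_rank_rep S' p h (\<lambda>l. blinfun_apply S' (h l))"
    by (rule finite_rank_rep_change_basis(1)[OF S' h(1)]) (rule h(3))
  have D: "finite_rank_rep (S - S') p h (\<lambda>l. blinfun_apply (S - S') (h l))"
    unfolding finite_rank_rep_def
  proof (rule conjI)
    show "\<forall>j<p. \<forall>k<p. h j \<bullet> h k = (if j = k then 1 else 0)" using h(1) unfolding orthonormal_def .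
    show "\<forall>w. blinfun_apply (S - S') w = (\<Sum>l<p. (w \<bullet> h l) *\<^sub>R blinfun_apply (S - S') (h l))"
    proof
      fix w
      have "blinfun_apply (S - S') w = (\<Sum>l<p. (w \<bullet> h l) *\<^sub>R blinfun_apply S (h l)) - (\<Sum>l<p. (w \<bullet> h l) *\<^sub>R blinfun_apply S' (h l))"
        unfolding minus_blinfun.rep_eq by (simp only: finite_rank_repD[OF C, symmetric] finite_rank_repD[OF C', symmetric])
      then show "blinfun_apply (S - S') w = (\<Sum>l<p. (w \<bullet> h l) *\<^sub>R blinfun_apply (S - S') (h l))"
        by (simp only: minus_blinfun.rep_eq scaleR_right_diff_distrib sum_subtractf)
    qed
  qed
  show thesis
  proof (rule that[OF D])
    show "\<bar>gamma_norm_finite_rank S - gamma_norm_finite_rank S'\<bar> \<le> gamma_norm_finite_rank (S - S')"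
      unfolding gamma_norm_finite_rank_eq[OF C] gamma_norm_finite_rank_eq[OF C'] gamma_norm_finite_rank_eq[OF D]
      unfolding minus_blinfun.rep_eq by (rule gaussian_sum_norm_triangle)
    fix M :: "'c measure" and I :: "'w \<Rightarrow> 'c \<Rightarrow> real" assume I: "L2_operator M I"
    have "AE \<omega> in M. (\<Sum>k<m. I (e k) \<omega> *\<^sub>R x k) = (\<Sum>l<p. I (h l) \<omega> *\<^sub>R blinfun_apply S (h l))"
      by (rule finite_rank_rep_change_basis(3)[OF S h(1) _ I]) (rule h(2))
    moreover have "AE \<omega> in M. (\<Sum>k<m'. I (e' k) \<omega> *\<^sub>R x' k) = (\<Sum>l<p. I (h l) \<omega> *\<^sub>R blinfun_apply S' (h l))"
      by (rule finite_rank_rep_change_basis(3)[OF S' h(1) _ I]) (rule h(3))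
    ultimately show "AE \<omega> in M. (\<Sum>k<m. I (e k) \<omega> *\<^sub>R x k) - (\<Sum>k<m'. I (e' k) \<omega> *\<^sub>R x' k) = (\<Sum>l<p. I (h l) \<omega> *\<^sub>R blinfun_apply (S - S') (h l))"
      by eventually_elim (simp only: minus_blinfun.rep_eq scaleR_right_diff_distrib sum_subtractf)
  qed
qed

section \<open>Comparison of orthonormal chaos sums with Gaussian sums\<close>

text \<open>
  The lower bound tests the sum with a functional norming \<open>x k\<close> and applies Parseval.
\<close>

lemma orthonormal_sum_crude_bounds:
  fixes x :: "nat \<Rightarrow> 'x::real_normed_vector"
  assumes \<epsilon>: "\<And>k. k < m \<Longrightarrow> \<epsilon> k \<in> L2 M" and o: "L2_orthonormal M m \<epsilon>"
  shows "k < m \<Longrightarrow> norm (x k) \<le> L2_norm M (\<lambda>\<omega>. \<Sum>k<m. \<epsilon> k \<omega> *\<^sub>R x k)"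
    and "L2_norm M (\<lambda>\<omega>. \<Sum>k<m. \<epsilon> k \<omega> *\<^sub>R x k) \<le> (\<Sum>k<m. norm (x k))"
proof -
  let ?Y = "\<lambda>\<omega>. \<Sum>k<m. \<epsilon> k \<omega> *\<^sub>R x k"
  have Y: "?Y \<in> SL2 M" by (rule SL2_sum) (simp_all add: SL2_scaleR_const(1) \<epsilon>)
  show "norm (x k) \<le> L2_norm M ?Y" if k: "k < m"
  proof -
    obtain \<phi> :: "'x \<Rightarrow>\<^sub>L real" where \<phi>: "norm \<phi> \<le> 1" "blinfun_apply \<phi> (x k) = norm (x k)"
      using norming_functional[of "x k"] by blast
    have "(norm (x k))\<^sup>2 \<le> (\<Sum>l<m. (blinfun_apply \<phi> (x l))\<^sup>2)"
      unfolding \<phi>(2)[symmetric] using k by (intro member_le_sum) auto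
    also have "\<dots> = (L2_norm M (\<lambda>\<omega>. \<Sum>l<m. blinfun_apply \<phi> (x l) * \<epsilon> l \<omega>))\<^sup>2"
      by (rule L2_orthonormal_norm[OF \<epsilon> o, symmetric])
    also have "(\<lambda>\<omega>. \<Sum>l<m. blinfun_apply \<phi> (x l) * \<epsilon> l \<omega>) = (\<lambda>\<omega>. blinfun_apply \<phi> (?Y \<omega>))"
      by (simp add: blinfun.sum_right blinfun.scaleR_right mult.commute)
    finally have "norm (x k) \<le> L2_norm M (\<lambda>\<omega>. blinfun_apply \<phi> (?Y \<omega>))" by (rule power2_le_imp_le) simp
    also have "\<dots> \<le> norm \<phi> * L2_norm M ?Y" by (rule SL2_blinfun(2)[OF Y])
    also have "\<dots> \<le> 1 * L2_norm M ?Y" by (intro mult_right_mono \<phi>) simp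
    finally show ?thesis by simp
  qed
  have one: "L2_norm M (\<epsilon> k) = 1" if "k < m" for k
    using o that unfolding L2_orthonormal_def L2_norm_def by (simp add: power2_eq_square)
  have "L2_norm M ?Y \<le> (\<Sum>k<m. L2_norm M (\<lambda>\<omega>. \<epsilon> k \<omega> *\<^sub>R x k))"
    by (rule L2_norm_sum) (simp_all add: SL2_scaleR_const(1) \<epsilon>)
  also have "\<dots> = (\<Sum>k<m. norm (x k))"
    by (intro sum.cong refl) (simp add: SL2_scaleR_const(2) \<epsilon> one)
  finally show "L2_norm M ?Y \<le> (\<Sum>k<m. norm (x k))" .
qed

lemma isonormal_in_chaos_upto:
  assumes iso: "isonormal_process M W" and v: "norm v = 1" and n: "n \<noteq> 0"
  shows "W v \<in> wiener_chaos_upto M W n"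
proof (rule chaos_uptoI[where Ys="\<lambda>i. if i = 1 then W v else (\<lambda>_. 0)"])
  have h1: "hermite 1 y = y" for y using hermite_rec[of 0 y] by (simp add: hermite_eq_poly pderiv_1)
  show "W v \<in> L2 M" by (rule isonormal_L2(1)[OF iso])
  have "W v = (\<lambda>\<omega>. hermite 1 (W v \<omega>))" by (rule ext) (simp only: h1)
  then have "W v \<in> hermite_generators W 1" using v by blast
  then have "W v \<in> wiener_chaos M W 1"
    unfolding wiener_chaos_def by (rule closed_span_base) (rule isonormal_L2(1)[OF iso])
  then show "(if i = 1 then W v else (\<lambda>_. 0)) \<in> wiener_chaos M W i" for i
    by (simp add: wiener_chaos_def closed_span_zero)
  have "(\<Sum>i\<le>n. (if i = 1 then W v else (\<lambda>_. 0)) \<omega>) = W v \<omega>" for \<omega>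
  proof -
    have "(\<Sum>i\<le>n. (if i = 1 then W v else (\<lambda>_. 0)) \<omega>) = (\<Sum>i\<le>n. if i = 1 then W v \<omega> else 0)" by (intro sum.cong) auto
    then show ?thesis using n by simp
  qed
  then show "AE \<omega> in M. W v \<omega> = (\<Sum>i\<le>n. (if i = 1 then W v else (\<lambda>_. 0)) \<omega>)" by simp
qed

text \<open>
  If \<open>V\<close> has no orthonormal system of some length, a maximal one spans it, and
  \<open>hermite_AE_span_finite\<close> applies; if \<open>n = 0\<close>, the chaos consists of constants.
\<close>

lemma chaos_dimension_dichotomy:
  fixes W :: "'v::{real_inner,polish_space} \<Rightarrow> 'o \<Rightarrow> real"
  assumes iso: "isonormal_process M W"
  shows "(n \<noteq> 0 \<and> (\<forall>m. \<exists>h :: nat \<Rightarrow> 'v. orthonormal m h)) \<or>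
    (\<exists>D. \<forall>m \<epsilon>. (\<forall>k<m. \<epsilon> k \<in> wiener_chaos_upto M W n) \<and> L2_orthonormal M m \<epsilon> \<longrightarrow> m \<le> D)"
proof -
  have fin: "\<exists>D. \<forall>m \<epsilon>. (\<forall>k<m. \<epsilon> k \<in> wiener_chaos_upto M W n) \<and> L2_orthonormal M m \<epsilon> \<longrightarrow> m \<le> D"
    if "finite B" and "\<And>v i. i \<le> n \<Longrightarrow> (\<lambda>\<omega>. hermite i (W v \<omega>)) \<in> AE_span M B" for B
  proof (intro exI[of _ "card B"] allI impI)
    fix m \<epsilon> assume "(\<forall>k<m. \<epsilon> k \<in> wiener_chaos_upto M W n) \<and> L2_orthonormal M m \<epsilon>"
    then show "m \<le> card B" by (intro chaos_upto_dimension_bound[OF iso that, where n=n and \<epsilon>=\<epsilon>]) simp_all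
  qed
  consider "n \<noteq> 0 \<and> (\<forall>m. \<exists>h :: nat \<Rightarrow> 'v. orthonormal m h)" | "n = 0" | m where "\<nexists>h :: nat \<Rightarrow> 'v. orthonormal m h" by blast
  then show ?thesis
  proof cases
    case 1
    then show ?thesis by blast
  next
    case 2
    have "(\<lambda>\<omega>. hermite i (W v \<omega>)) \<in> AE_span M {\<lambda>_. 1}" if "i \<le> n" for i v
      by (rule AE_spanI[where c="\<lambda>_. 1"]) (use that 2 in \<open>simp add: hermite_eq_poly\<close>)
    from fin[OF _ this] show ?thesis by simp
  next
    case 3
    \<comment> \<open>an orthonormal system of the largest possible length \<open>m0 - 1\<close> spans \<open>V\<close>, since otherwise it could be extended\<close>
  define m0 where "m0 = (LEAST m. \<nexists>h :: nat \<Rightarrow> 'v. orthonormal m h)"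
    have m0: "\<nexists>h :: nat \<Rightarrow> 'v. orthonormal m0 h" unfolding m0_def by (rule LeastI[of _ m]) (rule 3)
    moreover have "orthonormal 0 (\<lambda>_. 0 :: 'v)" by (simp add: orthonormal_def)
    ultimately have "m0 \<noteq> 0" by metis
    then obtain N where N: "m0 = Suc N" by (cases m0) auto
    have "\<exists>h :: nat \<Rightarrow> 'v. orthonormal N h"
      using not_less_Least[of N "\<lambda>m. \<nexists>h :: nat \<Rightarrow> 'v. orthonormal m h"] N unfolding m0_def by auto
    then obtain h :: "nat \<Rightarrow> 'v" where h: "orthonormal N h" by blast
    have sp: "in_orthonormal_span N h v" for v
    proof -
      obtain N' and h' :: "nat \<Rightarrow> 'v" where e: "orthonormal N' h'" "in_orthonormal_span N h v \<or> N' = Suc N"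
        using orthonormal_extend[OF h, of v] by metis
      have "N' \<noteq> Suc N"
      proof
        assume "N' = Suc N"
        then have "\<exists>h :: nat \<Rightarrow> 'v. orthonormal m0 h" using e(1) N by (intro exI[of _ h']) simp
        then show False using m0 by contradiction
      qed
      then show ?thesis using e(2) by simp
    qed
    obtain B where "finite B" "\<forall>v. \<forall>i\<le>n. (\<lambda>\<omega>. hermite i (W v \<omega>)) \<in> AE_span M B"
      using hermite_AE_span_finite[OF iso sp, of n] by blast
    then show ?thesis using fin[of B] by simp
  qed
qed

text \<open>
  The \<open>n\<close>-good property compares two systems inside the chaos, whereas the \<open>\<gamma>\<close>-norm uses Gaussian
  variables on another space. They meet in the first chaos, whose elements \<open>W (h k)\<close> have the law of
  the coordinates. If \<open>n = 0\<close> or \<open>V\<close> has finite dimension, \<open>m\<close> is bounded and the crude bounds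
  suffice.
\<close>

lemma chaos_gaussian_comparison:
  fixes W :: "'v::{real_inner,polish_space} \<Rightarrow> 'o \<Rightarrow> real"
  assumes iso: "isonormal_process M W" and good: "n_good M W n TYPE('x::banach)"
  obtains c1 c2 where "c1 > 0" "c2 > 0"
    "\<And>m \<epsilon> (x :: nat \<Rightarrow> 'x). (\<And>k. k < m \<Longrightarrow> \<epsilon> k \<in> wiener_chaos_upto M W n) \<Longrightarrow> L2_orthonormal M m \<epsilon> \<Longrightarrow>
       c1 * gaussian_sum_norm m x \<le> L2_norm M (\<lambda>\<omega>. \<Sum>k<m. \<epsilon> k \<omega> *\<^sub>R x k) \<and>
       L2_norm M (\<lambda>\<omega>. \<Sum>k<m. \<epsilon> k \<omega> *\<^sub>R x k) \<le> c2 * gaussian_sum_norm m x"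
proof (cases "n \<noteq> 0 \<and> (\<forall>m. \<exists>h :: nat \<Rightarrow> 'v. orthonormal m h)")
  case True
  from good obtain c1 c2 where c: "c1 > 0" "c2 > 0" and G: "\<forall>m \<epsilon>1 \<epsilon>2. \<forall>x :: nat \<Rightarrow> 'x.
        (\<forall>k<m. \<epsilon>1 k \<in> wiener_chaos_upto M W n) \<and> L2_orthonormal M m \<epsilon>1 \<and>
        (\<forall>k<m. \<epsilon>2 k \<in> wiener_chaos_upto M W n) \<and> L2_orthonormal M m \<epsilon>2 \<longrightarrow>
        c1 * L2_norm M (\<lambda>\<omega>. \<Sum>k<m. \<epsilon>2 k \<omega> *\<^sub>R x k) \<le> L2_norm M (\<lambda>\<omega>. \<Sum>k<m. \<epsilon>1 k \<omega> *\<^sub>R x k) \<and>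
        L2_norm M (\<lambda>\<omega>. \<Sum>k<m. \<epsilon>1 k \<omega> *\<^sub>R x k) \<le> c2 * L2_norm M (\<lambda>\<omega>. \<Sum>k<m. \<epsilon>2 k \<omega> *\<^sub>R x k)"
    unfolding n_good_def by (elim exE conjE)
  show thesis
  proof (rule that[OF c])
    fix m \<epsilon> and x :: "nat \<Rightarrow> 'x"
    assume \<epsilon>: "\<And>k. k < m \<Longrightarrow> \<epsilon> k \<in> wiener_chaos_upto M W n" and o: "L2_orthonormal M m \<epsilon>"
    obtain h :: "nat \<Rightarrow> 'v" where h: "orthonormal m h" using True by blast
    have "\<forall>k<m. W (h k) \<in> wiener_chaos_upto M W n"
      using True orthonormalD[OF h] by (auto intro!: isonormal_in_chaos_upto[OF iso] simp: norm_eq_1)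
    moreover have "L2_orthonormal M m (\<lambda>k. W (h k))"
      unfolding L2_orthonormal_def using isonormalD(3)[OF iso] orthonormalD[OF h] by simp
    ultimately show "c1 * gaussian_sum_norm m x \<le> L2_norm M (\<lambda>\<omega>. \<Sum>k<m. \<epsilon> k \<omega> *\<^sub>R x k) \<and>
       L2_norm M (\<lambda>\<omega>. \<Sum>k<m. \<epsilon> k \<omega> *\<^sub>R x k) \<le> c2 * gaussian_sum_norm m x"
      using G[THEN spec, THEN spec, THEN spec, THEN spec, of m \<epsilon> "\<lambda>k. W (h k)" x] \<epsilon> o
      unfolding isonormal_gaussian_sum_norm[OF iso h] by simp
  qed
next
  case False
  then obtain D where D: "\<And>m \<epsilon>. (\<forall>k<m. \<epsilon> k \<in> wiener_chaos_upto M W n) \<and> L2_orthonormal M m \<epsilon> \<Longrightarrow> m \<le> D"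
    using chaos_dimension_dichotomy[OF iso, of n] by blast
  have c: "1 / (real D + 1) > 0" "real D + 1 > 0" by simp_all
  show thesis
  proof (rule that[OF c])
    fix m \<epsilon> and x :: "nat \<Rightarrow> 'x"
    assume \<epsilon>: "\<And>k. k < m \<Longrightarrow> \<epsilon> k \<in> wiener_chaos_upto M W n" and o: "L2_orthonormal M m \<epsilon>"
    have m: "m \<le> D" by (rule D[of m \<epsilon>]) (simp add: \<epsilon> o)
    have B: "norm (x k) \<le> L2_norm M (\<lambda>\<omega>. \<Sum>k<m. \<epsilon> k \<omega> *\<^sub>R x k)" if "k < m" for k
      by (rule orthonormal_sum_crude_bounds(1)[OF chaos_upto_L2[OF \<epsilon>] o]) (assumption, rule that)
    have B2: "L2_norm M (\<lambda>\<omega>. \<Sum>k<m. \<epsilon> k \<omega> *\<^sub>R x k) \<le> (\<Sum>k<m. norm (x k))"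
      by (rule orthonormal_sum_crude_bounds(2)[OF chaos_upto_L2[OF \<epsilon>] o])
    have BG: "norm (x k) \<le> gaussian_sum_norm m x" if "k < m" for k
      unfolding gaussian_sum_norm_def by (rule orthonormal_sum_crude_bounds(1)[OF gaussian_coordinates]) (assumption, rule that)
    have BG2: "gaussian_sum_norm m x \<le> (\<Sum>k<m. norm (x k))"
      unfolding gaussian_sum_norm_def by (rule orthonormal_sum_crude_bounds(2)[OF gaussian_coordinates])
    have s: "(\<Sum>k<m. norm (x k)) \<le> (real D + 1) * t" if "\<And>k. k < m \<Longrightarrow> norm (x k) \<le> t" "0 \<le> t" for t
    proof -
      have "(\<Sum>k<m. norm (x k)) \<le> (\<Sum>k<m. t)" by (rule sum_mono) (simp add: that)
      also have "\<dots> = real m * t" by simp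
      also have "\<dots> \<le> (real D + 1) * t" using m that(2) by (intro mult_right_mono) auto
      finally show ?thesis .
    qed
    have G0: "0 \<le> gaussian_sum_norm m x" unfolding gaussian_sum_norm_def by simp
    have "gaussian_sum_norm m x \<le> (real D + 1) * L2_norm M (\<lambda>\<omega>. \<Sum>k<m. \<epsilon> k \<omega> *\<^sub>R x k)"
      using BG2 s[OF B] by simp
    moreover have "L2_norm M (\<lambda>\<omega>. \<Sum>k<m. \<epsilon> k \<omega> *\<^sub>R x k) \<le> (real D + 1) * gaussian_sum_norm m x"
      using B2 s[OF BG G0] by simp
    ultimately show "1 / (real D + 1) * gaussian_sum_norm m x \<le> L2_norm M (\<lambda>\<omega>. \<Sum>k<m. \<epsilon> k \<omega> *\<^sub>R x k) \<and>
       L2_norm M (\<lambda>\<omega>. \<Sum>k<m. \<epsilon> k \<omega> *\<^sub>R x k) \<le> (real D + 1) * gaussian_sum_norm m x"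
      using c(2) by (simp add: field_simps)
  qed
qed

section \<open>The range of the cylindrical integral\<close>

text \<open>
  Linearity handles step functions and spans of elementary tensors, continuity their closures.
\<close>

lemma cylindrical_integral_in_chaos:
  fixes Z :: "real \<Rightarrow> 'u::{real_inner,polish_space} \<Rightarrow> 'o \<Rightarrow> real" and \<iota> :: "(real \<Rightarrow> real) \<Rightarrow> 'd::{real_inner,complete_space}"
    and tens :: "'d \<Rightarrow> 'u \<Rightarrow> 'w::{real_inner,complete_space}"
  assumes iso: "isonormal_process M W" and T: "T \<subseteq> TT" and Z: "\<forall>t\<in>TT. \<forall>u. Z t u \<in> wiener_chaos_upto M W n"
    and DH: "DH_completion H T \<iota>" and J: "fractional_integral M T Z \<iota> J" and tens: "hilbert_tensor tens" and I: "cylindrical_integral M tens J I"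
  shows "I w \<in> wiener_chaos_upto M W n"
proof -
  have closure_step: "A g \<in> wiener_chaos_upto M W n"
    if A: "L2_operator M A" and S: "\<And>g. g \<in> S \<Longrightarrow> A g \<in> wiener_chaos_upto M W n" and g: "g \<in> closure S"
    for A :: "'b::real_normed_vector \<Rightarrow> 'o \<Rightarrow> real" and S g
  proof (rule chaos_upto_closed[OF iso L2_operatorD(1)[OF A]])
    fix e :: real assume e: "e > 0"
    obtain C where C: "\<And>x. L2_norm M (A x) \<le> C * norm x" using A unfolding L2_operator_def by blast
    define C' where "C' = \<bar>C\<bar> + 1"
    have C': "C' > 0" "L2_norm M (A x) \<le> C' * norm x" for x
    proof -
      show "C' > 0" unfolding C'_def by simp
      show "L2_norm M (A x) \<le> C' * norm x" unfolding C'_def by (rule order_trans[OF C]) (intro mult_right_mono, simp_all)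
    qed
    obtain s where s: "s \<in> S" "dist s g < e / C'" using g e C'(1) unfolding closure_approachable by (meson divide_pos_pos)
    have "L2_norm M (\<lambda>\<omega>. A g \<omega> - A s \<omega>) = L2_norm M (A (g - s))"
    proof (rule L2_norm_cong_AE)
      show "(\<lambda>\<omega>. A g \<omega> - A s \<omega>) \<in> SL2 M" by (intro SL2_diff L2_operatorD(2)[OF A])
      show "AE \<omega> in M. A g \<omega> - A s \<omega> = A (g - s) \<omega>" using L2_operator_diff[OF A, of g s] by eventually_elim simp
    qed (rule L2_operatorD(2)[OF A])
    also have "\<dots> \<le> C' * norm (g - s)" by (rule C')
    also have "\<dots> < C' * (e / C')" using s(2) C'(1) by (intro mult_strict_left_mono) (simp_all add: dist_norm norm_minus_commute)
    also have "\<dots> = e" using C'(1) by simp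
    finally show "\<exists>Z\<in>wiener_chaos_upto M W n. L2_norm M (\<lambda>\<omega>. A g \<omega> - Z \<omega>) < e" using S[OF s(1)] by blast
  qed
  have JL: "L2_operator M (J u)" for u using J unfolding fractional_integral_def by blast
  have IL: "L2_operator M I" using I unfolding cylindrical_integral_def by blast
  have indicator: "J u (\<iota> (indicat_real {a..<b})) \<in> wiener_chaos_upto M W n" if ab: "a \<in> T" "b \<in> T" "a \<le> b" for u a b
  proof (rule chaos_upto_cong_AE[OF _ L2_operatorD(1)[OF JL]])
    show "(\<lambda>\<omega>. Z b u \<omega> + (-1) * Z a u \<omega>) \<in> wiener_chaos_upto M W n"
      by (intro chaos_upto_linear[OF iso]) (use Z T ab in blast)+
    have "AE \<omega> in M. J u (\<iota> (indicat_real {a..<b})) \<omega> = Z b u \<omega> - Z a u \<omega>" using J ab unfolding fractional_integral_def by blast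
    then show "AE \<omega> in M. J u (\<iota> (indicat_real {a..<b})) \<omega> = Z b u \<omega> + (-1) * Z a u \<omega>" by (rule AE_mp) simp
  qed
  have addi: "\<iota> (\<lambda>x. f x + g x) = \<iota> f + \<iota> g" if "f \<in> step_functions T" "g \<in> step_functions T" for f g
    using DH that unfolding DH_completion_def by blast
  have scali: "\<iota> (\<lambda>x. c * f x) = c *\<^sub>R \<iota> f" if "f \<in> step_functions T" for c f
    using DH that unfolding DH_completion_def by blast
  have step: "J u (\<iota> f) \<in> wiener_chaos_upto M W n" if f: "f \<in> step_functions T" for u f
  proof -
    obtain m :: nat and t c where fe: "f = (\<lambda>x. \<Sum>j<m. c j * indicat_real {t j..<t (Suc j)} x)"
      and t: "\<forall>j<m. t j \<in> T \<and> t (Suc j) \<in> T \<and> t j \<le> t (Suc j)"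
      using f unfolding step_functions_def by blast
    have part: "(\<lambda>x. \<Sum>j<l. c j * indicat_real {t j..<t (Suc j)} x) \<in> step_functions T" if "l \<le> m" for l
      unfolding step_functions_def using t that by (intro CollectI exI[of _ l] exI[of _ t] exI[of _ c]) auto
    have ind: "indicat_real {t j..<t (Suc j)} \<in> step_functions T" if "j < m" for j
      unfolding step_functions_def using t that
      by (intro CollectI exI[of _ "1::nat"] exI[of _ "\<lambda>i. t (j + i)"] exI[of _ "\<lambda>_. 1"]) auto
    have "J u (\<iota> (\<lambda>x. \<Sum>j<l. c j * indicat_real {t j..<t (Suc j)} x)) \<in> wiener_chaos_upto M W n" if "l \<le> m" for l
      using that
    proof (induction l)
      case 0
      have z: "\<iota> (\<lambda>x. 0) = 0" using scali[OF part[of 0], of 0] by simp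
      show ?case
        by (rule chaos_upto_cong_AE[OF chaos_upto_zero L2_operatorD(1)[OF JL]]) (simp add: z L2_operator_zero[OF JL])
    next
      case (Suc l)
      let ?f = "\<lambda>x. \<Sum>j<l. c j * indicat_real {t j..<t (Suc j)} x" and ?i = "indicat_real {t l..<t (Suc l)}"
      have i: "?i \<in> step_functions T" by (rule ind) (use Suc.prems in simp)
      have ci: "(\<lambda>x. c l * ?i x) \<in> step_functions T"
        unfolding step_functions_def using t Suc.prems
        by (intro CollectI exI[of _ "1::nat"] exI[of _ "\<lambda>i. t (l + i)"] exI[of _ "\<lambda>_. c l"]) auto
      have eq: "\<iota> (\<lambda>x. \<Sum>j<Suc l. c j * indicat_real {t j..<t (Suc j)} x) = \<iota> ?f + c l *\<^sub>R \<iota> ?i"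
        unfolding sum.lessThan_Suc using addi[OF part ci] scali[OF i] Suc.prems by simp
      show ?case unfolding eq
      proof (rule chaos_upto_cong_AE[OF _ L2_operatorD(1)[OF JL]])
        show "(\<lambda>\<omega>. J u (\<iota> ?f) \<omega> + c l * J u (\<iota> ?i) \<omega>) \<in> wiener_chaos_upto M W n"
          using t Suc.prems by (intro chaos_upto_linear[OF iso] Suc.IH indicator) auto
        show "AE \<omega> in M. J u (\<iota> ?f + c l *\<^sub>R \<iota> ?i) \<omega> = J u (\<iota> ?f) \<omega> + c l * J u (\<iota> ?i) \<omega>"
          using L2_operatorD(3)[OF JL, of u "\<iota> ?f" "c l *\<^sub>R \<iota> ?i"] L2_operatorD(4)[OF JL, of u "c l" "\<iota> ?i"]
          by eventually_elim simp
      qed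
    qed
    from this[of m] show ?thesis unfolding fe by simp
  qed
  have Jg: "J u g \<in> wiener_chaos_upto M W n" for u g
    by (rule closure_step[OF JL[of u], of "\<iota> ` step_functions T"]) (use step DH in \<open>auto simp: DH_completion_def\<close>)
  have It: "I (tens g u) \<in> wiener_chaos_upto M W n" for g u
    by (rule chaos_upto_cong_AE[OF Jg L2_operatorD(1)[OF IL]]) (use I in \<open>auto simp: cylindrical_integral_def\<close>)
  have sp: "I v \<in> wiener_chaos_upto M W n" if "v \<in> span {tens g u | g u. True}" for v
    using that
  proof (induction rule: span_induct_alt)
    case base
    show ?case by (rule chaos_upto_cong_AE[OF chaos_upto_zero L2_operatorD(1)[OF IL] L2_operator_zero[OF IL]])
  next
    case (step c x y)
    then obtain g u where x: "x = tens g u" by blast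
    show ?case
    proof (rule chaos_upto_cong_AE[OF _ L2_operatorD(1)[OF IL]])
      show "(\<lambda>\<omega>. I y \<omega> + c * I x \<omega>) \<in> wiener_chaos_upto M W n"
        unfolding x by (intro chaos_upto_linear[OF iso] step.IH It)
      show "AE \<omega> in M. I (c *\<^sub>R x + y) \<omega> = I y \<omega> + c * I x \<omega>"
        using L2_operatorD(3)[OF IL, of "c *\<^sub>R x" y] L2_operatorD(4)[OF IL, of c x] by eventually_elim simp
    qed
  qed
  show ?thesis
    by (rule closure_step[OF IL, of "span {tens g u | g u. True}"]) (use sp tens in \<open>auto simp: hilbert_tensor_def\<close>)
qed

section \<open>Integrals of radonifying operators\<close>

text \<open>
  A relation rather than a function, since the representation enters; by
  \<open>finite_rank_integral_difference\<close> different choices agree in \<open>L\<^sup>2\<close>.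
\<close>

definition finite_rank_integral :: "('w::{real_inner,complete_space} \<Rightarrow> 'o \<Rightarrow> real) \<Rightarrow> ('w \<Rightarrow>\<^sub>L 'x::banach) \<Rightarrow> ('o \<Rightarrow> 'x) \<Rightarrow> bool" where
  "finite_rank_integral I S Y \<longleftrightarrow> (\<exists>m e x. finite_rank_rep S m e x \<and> Y = (\<lambda>\<omega>. \<Sum>k<m. I (e k) \<omega> *\<^sub>R x k))"

text \<open>
  What the construction of the integral uses of \<open>I\<close>: it is isometric with values in the finite
  chaos, and sums with chaos coefficients satisfy the moment bounds and the comparison with Gaussian
  sums.
\<close>

locale chaos_isometry = prob_space M for M :: "'o measure" +
  fixes W :: "'v::{real_inner,polish_space} \<Rightarrow> 'o \<Rightarrow> real" and n :: nat
    and I :: "'w::{real_inner,complete_space} \<Rightarrow> 'o \<Rightarrow> real"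
    and K :: "nat \<Rightarrow> real" and c1 c2 :: real and X :: "'x::banach itself"
  assumes operator: "L2_operator M I" and isometry: "\<And>w. L2_norm M (I w) = norm w"
    and chaos: "\<And>w. I w \<in> wiener_chaos_upto M W n"
    and moments: "\<And>m \<epsilon> (x :: nat \<Rightarrow> 'x). (\<And>k. k < m \<Longrightarrow> \<epsilon> k \<in> wiener_chaos_upto M W n) \<Longrightarrow> moment_bounded K M (\<lambda>\<omega>. \<Sum>k<m. \<epsilon> k \<omega> *\<^sub>R x k)"
    and c1: "c1 > 0" and c2: "c2 > 0"
    and comparison: "\<And>m \<epsilon> (x :: nat \<Rightarrow> 'x). (\<And>k. k < m \<Longrightarrow> \<epsilon> k \<in> wiener_chaos_upto M W n) \<Longrightarrow> L2_orthonormal M m \<epsilon> \<Longrightarrow>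
       c1 * gaussian_sum_norm m x \<le> L2_norm M (\<lambda>\<omega>. \<Sum>k<m. \<epsilon> k \<omega> *\<^sub>R x k) \<and>
       L2_norm M (\<lambda>\<omega>. \<Sum>k<m. \<epsilon> k \<omega> *\<^sub>R x k) \<le> c2 * gaussian_sum_norm m x"
begin

lemma integral_SL2:
  fixes x :: "nat \<Rightarrow> 'x"
  shows "(\<lambda>\<omega>. \<Sum>k<m. I (e k) \<omega> *\<^sub>R x k) \<in> SL2 M"
  by (rule SL2_sum) (simp_all add: SL2_scaleR_const(1) L2_operatorD(1)[OF operator])

lemma finite_rank_integral_norm:
  fixes S :: "'w \<Rightarrow>\<^sub>L 'x"
  assumes S: "finite_rank_rep S m e x"
  shows "c1 * gamma_norm_finite_rank S \<le> L2_norm M (\<lambda>\<omega>. \<Sum>k<m. I (e k) \<omega> *\<^sub>R x k)"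
    and "L2_norm M (\<lambda>\<omega>. \<Sum>k<m. I (e k) \<omega> *\<^sub>R x k) \<le> c2 * gamma_norm_finite_rank S"
proof -
  have o: "L2_orthonormal M m (\<lambda>k. I (e k))"
    unfolding L2_orthonormal_def L2_operator_isometry_inner[OF operator isometry]
    using orthonormalD[OF finite_rank_rep_orthonormal[OF S]] by simp
  show "c1 * gamma_norm_finite_rank S \<le> L2_norm M (\<lambda>\<omega>. \<Sum>k<m. I (e k) \<omega> *\<^sub>R x k)"
    and "L2_norm M (\<lambda>\<omega>. \<Sum>k<m. I (e k) \<omega> *\<^sub>R x k) \<le> c2 * gamma_norm_finite_rank S"
    unfolding gamma_norm_finite_rank_eq[OF S] using comparison[OF chaos o] by simp_all
qed

lemma finite_rank_integral_difference:
  fixes S S' :: "'w \<Rightarrow>\<^sub>L 'x"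
  assumes "finite_rank_integral I S Y" "finite_rank_integral I S' Y'"
  shows "c1 * gamma_norm_finite_rank (S - S') \<le> L2_norm M (\<lambda>\<omega>. Y \<omega> - Y' \<omega>)"
    and "L2_norm M (\<lambda>\<omega>. Y \<omega> - Y' \<omega>) \<le> c2 * gamma_norm_finite_rank (S - S')"
    and "\<bar>gamma_norm_finite_rank S - gamma_norm_finite_rank S'\<bar> \<le> gamma_norm_finite_rank (S - S')"
proof -
  obtain m e x where S: "finite_rank_rep S m e x" and Y: "Y = (\<lambda>\<omega>. \<Sum>k<m. I (e k) \<omega> *\<^sub>R x k)"
    using assms(1) unfolding finite_rank_integral_def by blast
  obtain m' e' x' where S': "finite_rank_rep S' m' e' x'" and Y': "Y' = (\<lambda>\<omega>. \<Sum>k<m'. I (e' k) \<omega> *\<^sub>R x' k)"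
    using assms(2) unfolding finite_rank_integral_def by blast
  have "(c1 * gamma_norm_finite_rank (S - S') \<le> L2_norm M (\<lambda>\<omega>. Y \<omega> - Y' \<omega>) \<and> L2_norm M (\<lambda>\<omega>. Y \<omega> - Y' \<omega>) \<le> c2 * gamma_norm_finite_rank (S - S'))
    \<and> \<bar>gamma_norm_finite_rank S - gamma_norm_finite_rank S'\<bar> \<le> gamma_norm_finite_rank (S - S')"
  proof (rule finite_rank_difference[OF S S'])
    fix p h
    assume D: "finite_rank_rep (S - S') p h (\<lambda>l. blinfun_apply (S - S') (h l))"
      and tri: "\<bar>gamma_norm_finite_rank S - gamma_norm_finite_rank S'\<bar> \<le> gamma_norm_finite_rank (S - S')"
      and ae: "\<And>(M :: 'o measure) I. L2_operator M I \<Longrightarrow> AE \<omega> in M. (\<Sum>k<m. I (e k) \<omega> *\<^sub>R x k) - (\<Sum>k<m'. I (e' k) \<omega> *\<^sub>R x' k) = (\<Sum>l<p. I (h l) \<omega> *\<^sub>R blinfun_apply (S - S') (h l))"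
    have eq: "L2_norm M (\<lambda>\<omega>. Y \<omega> - Y' \<omega>) = L2_norm M (\<lambda>\<omega>. \<Sum>l<p. I (h l) \<omega> *\<^sub>R blinfun_apply (S - S') (h l))"
      unfolding Y Y' by (rule L2_norm_cong_AE[OF SL2_diff[OF integral_SL2 integral_SL2] integral_SL2 ae[OF operator]])
    show ?thesis unfolding eq using finite_rank_integral_norm[OF D] tri by (intro conjI)
  qed
  then show "c1 * gamma_norm_finite_rank (S - S') \<le> L2_norm M (\<lambda>\<omega>. Y \<omega> - Y' \<omega>)"
    and "L2_norm M (\<lambda>\<omega>. Y \<omega> - Y' \<omega>) \<le> c2 * gamma_norm_finite_rank (S - S')"
    and "\<bar>gamma_norm_finite_rank S - gamma_norm_finite_rank S'\<bar> \<le> gamma_norm_finite_rank (S - S')" by blast+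
qed

text \<open>
  The adjoint of \<open>S\<close> at \<open>\<phi>\<close> represents the functional applied to the integral.
\<close>

lemma finite_rank_integral_functional:
  fixes S :: "'w \<Rightarrow>\<^sub>L 'x" and \<phi> :: "'x \<Rightarrow>\<^sub>L real"
  assumes "finite_rank_integral I S Y"
  obtains v where "AE \<omega> in M. blinfun_apply \<phi> (Y \<omega>) = I v \<omega>" "\<And>w. w \<bullet> v = blinfun_apply \<phi> (blinfun_apply S w)"
proof -
  obtain m e x where S: "finite_rank_rep S m e x" and Y: "Y = (\<lambda>\<omega>. \<Sum>k<m. I (e k) \<omega> *\<^sub>R x k)"
    using assms(1) unfolding finite_rank_integral_def by blast
  let ?v = "\<Sum>k<m. blinfun_apply \<phi> (x k) *\<^sub>R e k"
  show thesis
  proof (rule that[of ?v])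
    have "AE \<omega> in M. I ?v \<omega> = (\<Sum>k<m. blinfun_apply \<phi> (x k) * I (e k) \<omega>)"
      by (rule L2_operator_sum[OF operator]) simp
    then show "AE \<omega> in M. blinfun_apply \<phi> (Y \<omega>) = I ?v \<omega>"
      by (rule AE_mp) (simp add: Y blinfun.sum_right blinfun.scaleR_right mult.commute)
    show "w \<bullet> ?v = blinfun_apply \<phi> (blinfun_apply S w)" for w
      unfolding finite_rank_repD[OF S] by (simp add: inner_sum_right blinfun.sum_right blinfun.scaleR_right mult.commute)
  qed
qed

text \<open>
  Integrals of the approximating operators form a Cauchy sequence in \<open>L\<^sup>2\<close> because \<open>c2\<close> times the
  \<open>\<gamma>\<close>-norm dominates. The limit is the integral of \<open>R\<close> because, for each functional \<open>\<phi>\<close>, the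
  adjoints of the approximants at \<open>\<phi>\<close> converge to \<open>Gbar \<phi>\<close> in norm. Both inequalities between the
  norms pass to the limit.
\<close>

lemma gamma_approximation_integral:
  fixes R :: "'w \<Rightarrow>\<^sub>L 'x" and Gbar :: "('x \<Rightarrow>\<^sub>L real) \<Rightarrow>\<^sub>L 'w"
  assumes F: "gamma_approximation R F" and adj: "adjoint_is Gbar R"
  obtains Y \<xi> where "\<And>i. finite_rank_integral I (F i) (Y i)" "\<And>i. Y i \<in> SL2 M" "\<xi> \<in> SL2 M" "(\<lambda>i. L2_norm M (\<lambda>\<omega>. Y i \<omega> - \<xi> \<omega>)) \<longlonglongrightarrow> 0"
    "is_integral M I Gbar \<xi>" "moment_bounded K M \<xi>" "convergent (\<lambda>i. gamma_norm_finite_rank (F i))"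
    "\<And>c. (\<lambda>i. gamma_norm_finite_rank (F i)) \<longlonglongrightarrow> c \<Longrightarrow> c1 * c \<le> L2_norm M \<xi> \<and> L2_norm M \<xi> \<le> c2 * c"
proof -
  have rank: "\<forall>i. \<exists>m e x. finite_rank_rep (F i) m e x" and lim: "F \<longlonglongrightarrow> R"
    and cauchy: "\<And>e. e > 0 \<Longrightarrow> \<exists>N. \<forall>i\<ge>N. \<forall>j\<ge>N. gamma_norm_finite_rank (F i - F j) < e"
    using F unfolding gamma_approximation_def by blast+
  have "\<forall>i. \<exists>Y. finite_rank_integral I (F i) Y" using rank unfolding finite_rank_integral_def by blast
  from choice[OF this] obtain Y where "\<forall>i. finite_rank_integral I (F i) (Y i)" by (elim exE)
  then have Y: "finite_rank_integral I (F i) (Y i)" for i by (rule spec)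
  have Y12: "Y i \<in> SL2 M \<and> moment_bounded K M (Y i)" for i
  proof -
    obtain m e and x :: "nat \<Rightarrow> 'x" where Yi: "Y i = (\<lambda>\<omega>. \<Sum>k<m. I (e k) \<omega> *\<^sub>R x k)"
      using Y[of i] unfolding finite_rank_integral_def by (elim exE conjE that)
    show ?thesis unfolding Yi by (intro conjI integral_SL2 moments chaos)
  qed
  have Y2: "Y i \<in> SL2 M" and Ymb: "moment_bounded K M (Y i)" for i using Y12[of i] by simp_all
  have cau: "\<exists>N. \<forall>i\<ge>N. \<forall>j\<ge>N. L2_norm M (\<lambda>\<omega>. Y i \<omega> - Y j \<omega>) < e" if e: "e > 0" for e
  proof -
    have "e / c2 > 0" using e c2 by simp
    then obtain N where N: "\<And>i j. i \<ge> N \<Longrightarrow> j \<ge> N \<Longrightarrow> gamma_norm_finite_rank (F i - F j) < e / c2" using cauchy by blast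
    have "L2_norm M (\<lambda>\<omega>. Y i \<omega> - Y j \<omega>) < e" if "i \<ge> N" "j \<ge> N" for i j
      using finite_rank_integral_difference(2)[OF Y[of i] Y[of j]] N[OF that] c2 by (simp add: field_simps)
    then show ?thesis by blast
  qed
  obtain \<xi> where \<xi>: "\<xi> \<in> SL2 M" "(\<lambda>i. L2_norm M (\<lambda>\<omega>. Y i \<omega> - \<xi> \<omega>)) \<longlonglongrightarrow> 0"
    by (rule SL2_complete[OF Y2 cau]) (assumption, rule that)
  have mb: "moment_bounded K M \<xi>" by (rule moment_bounded_limit[OF Y2 \<xi> Ymb])
  have func: "AE \<omega> in M. blinfun_apply \<phi> (\<xi> \<omega>) = I (blinfun_apply Gbar \<phi>) \<omega>" for \<phi>
  proof -
    let ?g = "blinfun_apply Gbar \<phi>"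
    \<comment> \<open>\<open>R\<close> is the adjoint of \<open>Gbar\<close>, viewed through the embedding into the bidual\<close>
    have adjR: "w \<bullet> ?g = blinfun_apply \<phi> (blinfun_apply R w)" for w
    proof -
      have "bounded_linear (\<lambda>\<phi> :: 'x \<Rightarrow>\<^sub>L real. blinfun_apply \<phi> (blinfun_apply R w))"
        by (rule blinfun.bounded_linear_left)
      then have "blinfun_apply (bidual_embedding (blinfun_apply R w)) \<phi> = blinfun_apply \<phi> (blinfun_apply R w)"
        unfolding bidual_embedding_def by (simp add: bounded_linear_Blinfun_apply)
      moreover have "blinfun_apply (adjoint_into_bidual Gbar w) \<phi> = ?g \<bullet> w \<or> blinfun_apply (adjoint_into_bidual Gbar w) \<phi> = w \<bullet> ?g"
        unfolding adjoint_into_bidual_def by (simp add: blinfun_inner_left.rep_eq)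
      ultimately show ?thesis using adj unfolding adjoint_is_def by (auto simp: inner_commute)
    qed
    have \<xi>\<phi>: "(\<lambda>\<omega>. blinfun_apply \<phi> (\<xi> \<omega>)) \<in> SL2 M" unfolding SL2_real by (rule SL2_blinfun(1)[OF \<xi>(1)])
    have le: "L2_norm M (\<lambda>\<omega>. blinfun_apply \<phi> (\<xi> \<omega>) - I ?g \<omega>) \<le> norm \<phi> * L2_norm M (\<lambda>\<omega>. Y i \<omega> - \<xi> \<omega>) + norm \<phi> * norm (F i - R)" for i
    proof -
      obtain v where v: "AE \<omega> in M. blinfun_apply \<phi> (Y i \<omega>) = I v \<omega>" "\<And>w. w \<bullet> v = blinfun_apply \<phi> (blinfun_apply (F i) w)"
        by (rule finite_rank_integral_functional[OF Y[of i], of \<phi>]) (rule that)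
      have "norm (v - ?g) \<le> norm \<phi> * norm (F i - R)"
      proof (cases "v = ?g")
        case False
        let ?w = "v - ?g"
        have "norm ?w * norm ?w = ?w \<bullet> v - ?w \<bullet> ?g" by (simp add: inner_diff_right[symmetric] power2_norm_eq_inner[symmetric] power2_eq_square)
        also have "\<dots> = blinfun_apply \<phi> (blinfun_apply (F i - R) ?w)"
          unfolding v(2) adjR by (simp add: minus_blinfun.rep_eq blinfun.diff_right)
        also have "\<dots> \<le> norm \<phi> * norm (blinfun_apply (F i - R) ?w)"
          using norm_blinfun[of \<phi> "blinfun_apply (F i - R) ?w"] by (simp add: abs_le_iff)
        also have "\<dots> \<le> norm \<phi> * (norm (F i - R) * norm ?w)" by (intro mult_left_mono norm_blinfun) simp
        finally have "norm ?w * norm ?w \<le> (norm \<phi> * norm (F i - R)) * norm ?w" by (simp only: mult.assoc)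
        then show ?thesis by (rule mult_right_le_imp_le) (use False in simp)
      qed simp
      moreover have "L2_norm M (\<lambda>\<omega>. blinfun_apply \<phi> (\<xi> \<omega>) - I ?g \<omega>)
        \<le> L2_norm M (\<lambda>\<omega>. blinfun_apply \<phi> (\<xi> \<omega>) - I v \<omega>) + L2_norm M (\<lambda>\<omega>. I v \<omega> - I ?g \<omega>)"
        by (rule L2_norm_triangle_diff[OF \<xi>\<phi> L2_operatorD(2)[OF operator] L2_operatorD(2)[OF operator]])
      moreover have "L2_norm M (\<lambda>\<omega>. I v \<omega> - I ?g \<omega>) = L2_norm M (I (v - ?g))"
      proof (rule L2_norm_cong_AE[OF SL2_diff[OF L2_operatorD(2)[OF operator] L2_operatorD(2)[OF operator]] L2_operatorD(2)[OF operator]])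
        show "AE \<omega> in M. I v \<omega> - I ?g \<omega> = I (v - ?g) \<omega>" using L2_operator_diff[OF operator, of v ?g] by eventually_elim simp
      qed
      moreover have "L2_norm M (\<lambda>\<omega>. blinfun_apply \<phi> (\<xi> \<omega>) - I v \<omega>) = L2_norm M (\<lambda>\<omega>. blinfun_apply \<phi> (\<xi> \<omega> - Y i \<omega>))"
      proof (rule L2_norm_cong_AE[OF SL2_diff[OF \<xi>\<phi> L2_operatorD(2)[OF operator]]])
        show "(\<lambda>\<omega>. blinfun_apply \<phi> (\<xi> \<omega> - Y i \<omega>)) \<in> SL2 M" unfolding SL2_real by (rule SL2_blinfun(1)[OF SL2_diff[OF \<xi>(1) Y2]])
        show "AE \<omega> in M. blinfun_apply \<phi> (\<xi> \<omega>) - I v \<omega> = blinfun_apply \<phi> (\<xi> \<omega> - Y i \<omega>)"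
          using v(1) by eventually_elim (simp add: blinfun.diff_right)
      qed
      moreover have "L2_norm M (\<lambda>\<omega>. blinfun_apply \<phi> (\<xi> \<omega> - Y i \<omega>)) \<le> norm \<phi> * L2_norm M (\<lambda>\<omega>. Y i \<omega> - \<xi> \<omega>)"
        using SL2_blinfun(2)[OF SL2_diff[OF \<xi>(1) Y2[of i]], of \<phi>] L2_norm_minus[of M \<xi> "Y i"] by simp
      ultimately show ?thesis using isometry[of "v - ?g"] by linarith
    qed
    have "(\<lambda>i. norm \<phi> * L2_norm M (\<lambda>\<omega>. Y i \<omega> - \<xi> \<omega>) + norm \<phi> * norm (F i - R)) \<longlonglongrightarrow> norm \<phi> * 0 + norm \<phi> * 0"
      by (intro tendsto_add tendsto_mult tendsto_const \<xi>(2) tendsto_norm_zero LIM_zero lim)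
    then have "L2_norm M (\<lambda>\<omega>. blinfun_apply \<phi> (\<xi> \<omega>) - I ?g \<omega>) \<le> norm \<phi> * 0 + norm \<phi> * 0"
      by (rule LIMSEQ_le_const) (use le in simp)
    then have "L2_norm M (\<lambda>\<omega>. blinfun_apply \<phi> (\<xi> \<omega>) - I ?g \<omega>) = 0"
      using L2_norm_nonneg[of M "\<lambda>\<omega>. blinfun_apply \<phi> (\<xi> \<omega>) - I ?g \<omega>"] by simp
    then have "AE \<omega> in M. blinfun_apply \<phi> (\<xi> \<omega>) - I ?g \<omega> = 0"
      using L2_norm_eq_0[OF SL2_diff[OF \<xi>\<phi> L2_operatorD(2)[OF operator]]] by simp
    then show ?thesis by (rule AE_mp) simp
  qed
  have int: "is_integral M I Gbar \<xi>" unfolding is_integral_def using \<xi>(1) func unfolding SL2_def by simp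
  have conv: "convergent (\<lambda>i. gamma_norm_finite_rank (F i))"
  proof (rule Cauchy_convergent, rule metric_CauchyI)
    fix e :: real assume "e > 0"
    then obtain N where N: "\<And>i j. i \<ge> N \<Longrightarrow> j \<ge> N \<Longrightarrow> gamma_norm_finite_rank (F i - F j) < e" using cauchy by blast
    have "dist (gamma_norm_finite_rank (F i)) (gamma_norm_finite_rank (F j)) < e" if "i \<ge> N" "j \<ge> N" for i j
      using finite_rank_integral_difference(3)[OF Y[of i] Y[of j]] N[OF that] by (simp add: dist_real_def)
    then show "\<exists>N. \<forall>m\<ge>N. \<forall>n\<ge>N. dist (gamma_norm_finite_rank (F m)) (gamma_norm_finite_rank (F n)) < e" by blast
  qed
  have norms: "c1 * c \<le> L2_norm M \<xi> \<and> L2_norm M \<xi> \<le> c2 * c" if c: "(\<lambda>i. gamma_norm_finite_rank (F i)) \<longlonglongrightarrow> c" for c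
  proof -
    have l: "(\<lambda>i. L2_norm M (Y i)) \<longlonglongrightarrow> L2_norm M \<xi>"
    proof (rule LIM_zero_cancel, rule Lim_null_comparison[OF _ \<xi>(2)], rule eventuallyI)
      show "norm (L2_norm M (Y i) - L2_norm M \<xi>) \<le> L2_norm M (\<lambda>\<omega>. Y i \<omega> - \<xi> \<omega>)" for i
        using L2_norm_diff_abs[OF Y2[of i] \<xi>(1)] by simp
    qed
    have b: "c1 * gamma_norm_finite_rank (F i) \<le> L2_norm M (Y i)" "L2_norm M (Y i) \<le> c2 * gamma_norm_finite_rank (F i)" for i
    proof -
      obtain m e and x :: "nat \<Rightarrow> 'x" where Yi: "finite_rank_rep (F i) m e x" "Y i = (\<lambda>\<omega>. \<Sum>k<m. I (e k) \<omega> *\<^sub>R x k)"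
        using Y[of i] unfolding finite_rank_integral_def by (elim exE conjE that)
      show "c1 * gamma_norm_finite_rank (F i) \<le> L2_norm M (Y i)" "L2_norm M (Y i) \<le> c2 * gamma_norm_finite_rank (F i)"
        unfolding Yi(2) by (rule finite_rank_integral_norm[OF Yi(1)])+
    qed
    have "c1 * c \<le> L2_norm M \<xi>"
      by (rule LIMSEQ_le[OF tendsto_mult[OF tendsto_const c] l]) (use b(1) in blast)
    moreover have "L2_norm M \<xi> \<le> c2 * c"
      by (rule LIMSEQ_le[OF l tendsto_mult[OF tendsto_const c]]) (use b(2) in blast)
    ultimately show ?thesis by simp
  qed
  show thesis by (rule that[OF Y Y2 \<xi> int mb conv norms])
qed

lemma integral_AE_unique:
  fixes \<xi> \<xi>' :: "'o \<Rightarrow> 'x"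
  assumes \<xi>: "is_integral M I Gbar \<xi>" and \<xi>': "is_integral M I Gbar \<xi>'"
  shows "AE \<omega> in M. \<xi> \<omega> = \<xi>' \<omega>"
proof (rule strongly_measurable_AE_eqI)
  show "strongly_measurable M \<xi>" "strongly_measurable M \<xi>'" using \<xi> \<xi>' unfolding is_integral_def by blast+
  fix \<phi> :: "'x \<Rightarrow>\<^sub>L real"
  have "AE \<omega> in M. blinfun_apply \<phi> (\<xi> \<omega>) = I (blinfun_apply Gbar \<phi>) \<omega>" "AE \<omega> in M. blinfun_apply \<phi> (\<xi>' \<omega>) = I (blinfun_apply Gbar \<phi>) \<omega>"
    using \<xi> \<xi>' unfolding is_integral_def by blast+
  then show "AE \<omega> in M. blinfun_apply \<phi> (\<xi> \<omega>) = blinfun_apply \<phi> (\<xi>' \<omega>)" by eventually_elim simp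
qed

text \<open>
  Well-definedness of the \<open>\<gamma>\<close>-norm. Two approximations of \<open>R\<close> have the same integral, so the \<open>L\<^sup>2\<close>
  distance of their integrals tends to zero, and by the lower comparison so does their distance in
  \<open>\<gamma>\<close>-norm.
\<close>

lemma gamma_norm_eq_limit:
  fixes R :: "'w \<Rightarrow>\<^sub>L 'x" and Gbar :: "('x \<Rightarrow>\<^sub>L real) \<Rightarrow>\<^sub>L 'w"
  assumes F: "gamma_approximation R F" and adj: "adjoint_is Gbar R" and c: "(\<lambda>i. gamma_norm_finite_rank (F i)) \<longlonglongrightarrow> c"
  shows "gamma_norm R = c"
  unfolding gamma_norm_def
proof (rule the_equality)
  show "\<exists>F. gamma_approximation R F \<and> (\<lambda>i. gamma_norm_finite_rank (F i)) \<longlonglongrightarrow> c" using F c by blast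
  fix c' assume "\<exists>F. gamma_approximation R F \<and> (\<lambda>i. gamma_norm_finite_rank (F i)) \<longlonglongrightarrow> c'"
  then obtain F' where F': "gamma_approximation R F'" and c': "(\<lambda>i. gamma_norm_finite_rank (F' i)) \<longlonglongrightarrow> c'" by blast
  obtain Y \<xi> where Y: "\<And>i. finite_rank_integral I (F i) (Y i)" "\<And>i. Y i \<in> SL2 M" and \<xi>: "\<xi> \<in> SL2 M" "(\<lambda>i. L2_norm M (\<lambda>\<omega>. Y i \<omega> - \<xi> \<omega>)) \<longlonglongrightarrow> 0"
    "is_integral M I Gbar \<xi>"
  proof (rule gamma_approximation_integral[OF F adj])
    fix Y \<xi>
    assume "\<And>i. finite_rank_integral I (F i) (Y i)" "\<And>i. Y i \<in> SL2 M" "\<xi> \<in> SL2 M" "(\<lambda>i. L2_norm M (\<lambda>\<omega>. Y i \<omega> - \<xi> \<omega>)) \<longlonglongrightarrow> 0" "is_integral M I Gbar \<xi>"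
    then show thesis by (rule that)
  qed
  obtain Y' \<xi>' where Y': "\<And>i. finite_rank_integral I (F' i) (Y' i)" "\<And>i. Y' i \<in> SL2 M" and \<xi>': "\<xi>' \<in> SL2 M" "(\<lambda>i. L2_norm M (\<lambda>\<omega>. Y' i \<omega> - \<xi>' \<omega>)) \<longlonglongrightarrow> 0"
    "is_integral M I Gbar \<xi>'"
  proof (rule gamma_approximation_integral[OF F' adj])
    fix Y \<xi>
    assume "\<And>i. finite_rank_integral I (F' i) (Y i)" "\<And>i. Y i \<in> SL2 M" "\<xi> \<in> SL2 M" "(\<lambda>i. L2_norm M (\<lambda>\<omega>. Y i \<omega> - \<xi> \<omega>)) \<longlonglongrightarrow> 0" "is_integral M I Gbar \<xi>"
    then show thesis by (rule that)
  qed
  have ae: "AE \<omega> in M. \<xi> \<omega> = \<xi>' \<omega>" by (rule integral_AE_unique[OF \<xi>(3) \<xi>'(3)])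
  have le: "\<bar>gamma_norm_finite_rank (F i) - gamma_norm_finite_rank (F' i)\<bar>
      \<le> (L2_norm M (\<lambda>\<omega>. Y i \<omega> - \<xi> \<omega>) + L2_norm M (\<lambda>\<omega>. Y' i \<omega> - \<xi>' \<omega>)) / c1" for i
  proof -
    have "L2_norm M (\<lambda>\<omega>. \<xi> \<omega> - Y' i \<omega>) = L2_norm M (\<lambda>\<omega>. \<xi>' \<omega> - Y' i \<omega>)"
      by (rule L2_norm_cong_AE[OF SL2_diff[OF \<xi>(1) Y'(2)] SL2_diff[OF \<xi>'(1) Y'(2)]]) (use ae in \<open>eventually_elim, simp\<close>)
    then have "L2_norm M (\<lambda>\<omega>. Y i \<omega> - Y' i \<omega>) \<le> L2_norm M (\<lambda>\<omega>. Y i \<omega> - \<xi> \<omega>) + L2_norm M (\<lambda>\<omega>. Y' i \<omega> - \<xi>' \<omega>)"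
      using L2_norm_triangle_diff[OF Y(2)[of i] \<xi>(1) Y'(2)[of i]] L2_norm_minus[of M \<xi>' "Y' i"] by simp
    then have "c1 * gamma_norm_finite_rank (F i - F' i) \<le> L2_norm M (\<lambda>\<omega>. Y i \<omega> - \<xi> \<omega>) + L2_norm M (\<lambda>\<omega>. Y' i \<omega> - \<xi>' \<omega>)"
      using finite_rank_integral_difference(1)[OF Y(1)[of i] Y'(1)[of i]] by linarith
    then have "gamma_norm_finite_rank (F i - F' i) \<le> (L2_norm M (\<lambda>\<omega>. Y i \<omega> - \<xi> \<omega>) + L2_norm M (\<lambda>\<omega>. Y' i \<omega> - \<xi>' \<omega>)) / c1"
      using c1 by (simp add: field_simps)
    then show ?thesis using finite_rank_integral_difference(3)[OF Y(1)[of i] Y'(1)[of i]] by linarith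
  qed
  have "(\<lambda>i. gamma_norm_finite_rank (F i) - gamma_norm_finite_rank (F' i)) \<longlonglongrightarrow> 0"
  proof (rule Lim_null_comparison)
    show "\<forall>\<^sub>F i in sequentially. norm (gamma_norm_finite_rank (F i) - gamma_norm_finite_rank (F' i))
      \<le> (L2_norm M (\<lambda>\<omega>. Y i \<omega> - \<xi> \<omega>) + L2_norm M (\<lambda>\<omega>. Y' i \<omega> - \<xi>' \<omega>)) / c1"
      by (rule eventuallyI) (simp only: real_norm_def le)
    have "(\<lambda>i. (L2_norm M (\<lambda>\<omega>. Y i \<omega> - \<xi> \<omega>) + L2_norm M (\<lambda>\<omega>. Y' i \<omega> - \<xi>' \<omega>)) / c1) \<longlonglongrightarrow> (0 + 0) / c1"
      by (intro tendsto_divide tendsto_add \<xi>(2) \<xi>'(2) tendsto_const) (use c1 in simp)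
    then show "(\<lambda>i. (L2_norm M (\<lambda>\<omega>. Y i \<omega> - \<xi> \<omega>) + L2_norm M (\<lambda>\<omega>. Y' i \<omega> - \<xi>' \<omega>)) / c1) \<longlonglongrightarrow> 0" by simp
  qed
  from LIMSEQ_unique[OF this tendsto_diff[OF c c']] show "c' = c" by simp
qed

lemma radonifying_integral:
  fixes R :: "'w \<Rightarrow>\<^sub>L 'x" and Gbar :: "('x \<Rightarrow>\<^sub>L real) \<Rightarrow>\<^sub>L 'w"
  assumes R: "gamma_radonifying R" and adj: "adjoint_is Gbar R"
  obtains \<xi> where "is_integral M I Gbar \<xi>" "\<xi> \<in> SL2 M" "moment_bounded K M \<xi>"
    "c1 * gamma_norm R \<le> L2_norm M \<xi>" "L2_norm M \<xi> \<le> c2 * gamma_norm R"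
proof -
  obtain F where F: "gamma_approximation R F" using R unfolding gamma_radonifying_def by blast
  show thesis
  proof (rule gamma_approximation_integral[OF F adj])
    fix Y \<xi> assume \<xi>: "\<xi> \<in> SL2 M" "is_integral M I Gbar \<xi>" "moment_bounded K M \<xi>" and conv: "convergent (\<lambda>i. gamma_norm_finite_rank (F i))"
      and n: "\<And>c. (\<lambda>i. gamma_norm_finite_rank (F i)) \<longlonglongrightarrow> c \<Longrightarrow> c1 * c \<le> L2_norm M \<xi> \<and> L2_norm M \<xi> \<le> c2 * c"
    from conv obtain c where c: "(\<lambda>i. gamma_norm_finite_rank (F i)) \<longlonglongrightarrow> c" unfolding convergent_def by blast
    have "gamma_norm R = c" by (rule gamma_norm_eq_limit[OF F adj c])
    then show thesis using n[OF c] by (intro that[OF \<xi>(2,1,3)]) simp_all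
  qed
qed

end

lemma Lr_norm_equivalence:
  fixes K :: "nat \<Rightarrow> real"
  assumes K: "\<And>j. K j \<ge> 0" and r: "r > 0"
  obtains a b where "a > 0" "b > 0"
    "\<And>(M :: 'o measure) (\<xi> :: 'o \<Rightarrow> 'x::real_normed_vector). prob_space M \<Longrightarrow> \<xi> \<in> SL2 M \<Longrightarrow> moment_bounded K M \<xi> \<Longrightarrow>
       integrable M (\<lambda>\<omega>. norm (\<xi> \<omega>) powr r) \<and> Lr_norm M r \<xi> \<le> a * L2_norm M \<xi> \<and> L2_norm M \<xi> \<le> b * Lr_norm M r \<xi>"
proof -
  from moment_comparison[where 'o='o and K=K, OF K r] obtain a b where ab: "a > 0" "b > 0"
    and C: "\<forall>(M :: 'o measure) N s. prob_space M \<longrightarrow> N \<in> borel_measurable M \<longrightarrow> (\<forall>\<omega>. 0 \<le> N \<omega>) \<longrightarrow> 0 \<le> s \<longrightarrow>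
     (\<integral>\<^sup>+\<omega>. ennreal (N \<omega>)^2 \<partial>M) = ennreal (s^2) \<longrightarrow>
     (\<forall>j. (\<integral>\<^sup>+\<omega>. ennreal (N \<omega>)^(2^Suc j) \<partial>M) \<le> ennreal (K j) * ennreal (s^2)^(2^j)) \<longrightarrow>
     integrable M (\<lambda>\<omega>. N \<omega> powr r) \<and> (\<integral>\<omega>. N \<omega> powr r \<partial>M) powr (1 / r) \<le> a * s \<and> s \<le> b * (\<integral>\<omega>. N \<omega> powr r \<partial>M) powr (1 / r)"
    by (elim exE conjE)
  show thesis
  proof (rule that[OF ab])
    fix M :: "'o measure" and \<xi> :: "'o \<Rightarrow> 'x" assume M: "prob_space M" and \<xi>: "\<xi> \<in> SL2 M" and mb: "moment_bounded K M \<xi>"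
    have m: "(\<lambda>\<omega>. norm (\<xi> \<omega>)) \<in> borel_measurable M" using \<xi> unfolding SL2_def by (simp add: strongly_measurable_norm)
    have nn: "\<forall>\<omega>. 0 \<le> norm (\<xi> \<omega>)" by simp
    show "integrable M (\<lambda>\<omega>. norm (\<xi> \<omega>) powr r) \<and> Lr_norm M r \<xi> \<le> a * L2_norm M \<xi> \<and> L2_norm M \<xi> \<le> b * Lr_norm M r \<xi>"
      unfolding Lr_norm_def
      by (rule C[THEN spec, THEN spec, THEN spec, THEN mp, THEN mp, THEN mp, THEN mp, THEN mp, THEN mp, OF M m nn L2_norm_nonneg L2_norm_nn_integral[OF \<xi>] mb[unfolded moment_bounded_def]])
  qed
qed

theorem theorem3p18:
  fixes M :: "'o measure"
    and W :: "'v::{real_inner,polish_space} \<Rightarrow> 'o \<Rightarrow> real"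
    and n :: nat
    and H :: real
    and TT T :: "real set"
    and Z :: "real \<Rightarrow> 'u::{real_inner,polish_space} \<Rightarrow> 'o \<Rightarrow> real"
    and \<iota> :: "(real \<Rightarrow> real) \<Rightarrow> 'd::{real_inner,complete_space}"
    and J :: "'u \<Rightarrow> 'd \<Rightarrow> 'o \<Rightarrow> real"
    and tens :: "'d \<Rightarrow> 'u \<Rightarrow> 'w::{real_inner,complete_space}"
    and I :: "'w \<Rightarrow> 'o \<Rightarrow> real"
  assumes "isonormal_process M W"
    and "generates_modulo_null M W"
    and "0 < H" and "H < 1"
    and "time_domain TT" and "is_interval T" and "T \<subseteq> TT"
    and "cylindrical_fractional_process M H TT Z"
    and "\<forall>t\<in>TT. \<forall>u. Z t u \<in> wiener_chaos_upto M W n"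
    and "n_good M W n TYPE('x::banach)"
    and "DH_completion H T \<iota>"
    and "fractional_integral M T Z \<iota> J"
    and "hilbert_tensor tens"
    and "cylindrical_integral M tens J I"
  shows "(\<forall>(G :: ('x \<Rightarrow>\<^sub>L real) \<Rightarrow> 'u \<Rightarrow> 'd) Gbar R.
            weakly_integrable G \<and> associated_operator tens G Gbar \<and>
            adjoint_is Gbar R \<and> gamma_radonifying R \<longrightarrow>
            (\<exists>\<xi>. is_integral M I Gbar \<xi>)) \<and>
         (\<forall>r>0. \<exists>c1>0. \<exists>c2>0.
            \<forall>(G :: ('x \<Rightarrow>\<^sub>L real) \<Rightarrow> 'u \<Rightarrow> 'd) Gbar R \<xi>.
              weakly_integrable G \<and> associated_operator tens G Gbar \<and>
              adjoint_is Gbar R \<and> gamma_radonifying R \<and> is_integral M I Gbar \<xi> \<longrightarrow>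
              integrable M (\<lambda>\<omega>. norm (\<xi> \<omega>) powr r) \<and>
              c1 * Lr_norm M r \<xi> \<le> gamma_norm R \<and> gamma_norm R \<le> c2 * Lr_norm M r \<xi>)"
proof -
  have M: "prob_space M" by (rule isonormalD(1)[OF assms(1)])
  obtain K where K: "\<And>j. K j \<ge> 0"
    "\<And>m \<epsilon> (x :: nat \<Rightarrow> 'x). (\<And>k. k < m \<Longrightarrow> \<epsilon> k \<in> wiener_chaos_upto M W n) \<Longrightarrow> moment_bounded K M (\<lambda>\<omega>. \<Sum>k<m. \<epsilon> k \<omega> *\<^sub>R x k)"
    using chaos_sum_moments[OF assms(1), where n=n and ?'x='x] by blast
  obtain d1 d2 where d: "d1 > 0" "d2 > 0"
    "\<And>m \<epsilon> (x :: nat \<Rightarrow> 'x). (\<And>k. k < m \<Longrightarrow> \<epsilon> k \<in> wiener_chaos_upto M W n) \<Longrightarrow> L2_orthonormal M m \<epsilon> \<Longrightarrow>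
       d1 * gaussian_sum_norm m x \<le> L2_norm M (\<lambda>\<omega>. \<Sum>k<m. \<epsilon> k \<omega> *\<^sub>R x k) \<and>
       L2_norm M (\<lambda>\<omega>. \<Sum>k<m. \<epsilon> k \<omega> *\<^sub>R x k) \<le> d2 * gaussian_sum_norm m x"
    using chaos_gaussian_comparison[OF assms(1,10)] by blast
  interpret chaos_isometry M W n I K d1 d2 "TYPE('x)"
  proof (intro chaos_isometry.intro chaos_isometry_axioms.intro M)
    show "L2_operator M I" "\<And>w. L2_norm M (I w) = norm w" using assms(14) unfolding cylindrical_integral_def by blast+
    show "I w \<in> wiener_chaos_upto M W n" for w
      by (rule cylindrical_integral_in_chaos[OF assms(1,7,9,11,12,13,14)])
  qed (fact K(2) d)+
  show ?thesis
  proof (intro conjI allI impI)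
    fix G :: "('x \<Rightarrow>\<^sub>L real) \<Rightarrow> 'u \<Rightarrow> 'd" and Gbar :: "('x \<Rightarrow>\<^sub>L real) \<Rightarrow>\<^sub>L 'w" and R
    assume "weakly_integrable G \<and> associated_operator tens G Gbar \<and> adjoint_is Gbar R \<and> gamma_radonifying R"
    then have "gamma_radonifying R" "adjoint_is Gbar R" by blast+
    then show "\<exists>\<xi>. is_integral M I Gbar \<xi>" by (rule radonifying_integral) (rule exI)
  next
    fix r :: real assume r: "r > 0"
    obtain a b where ab: "a > 0" "b > 0" and E: "\<And>(M :: 'o measure) (\<xi> :: 'o \<Rightarrow> 'x). prob_space M \<Longrightarrow> \<xi> \<in> SL2 M \<Longrightarrow> moment_bounded K M \<xi> \<Longrightarrow>
       integrable M (\<lambda>\<omega>. norm (\<xi> \<omega>) powr r) \<and> Lr_norm M r \<xi> \<le> a * L2_norm M \<xi> \<and> L2_norm M \<xi> \<le> b * Lr_norm M r \<xi>"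
      by (rule Lr_norm_equivalence[where K=K and ?'o='o and ?'x='x, OF K(1) r]) (rule that)
    have c: "1 / (a * d2) > 0" "b / d1 > 0" using ab d by simp_all
    show "\<exists>c1>0. \<exists>c2>0. \<forall>(G :: ('x \<Rightarrow>\<^sub>L real) \<Rightarrow> 'u \<Rightarrow> 'd) Gbar R \<xi>.
              weakly_integrable G \<and> associated_operator tens G Gbar \<and>
              adjoint_is Gbar R \<and> gamma_radonifying R \<and> is_integral M I Gbar \<xi> \<longrightarrow>
              integrable M (\<lambda>\<omega>. norm (\<xi> \<omega>) powr r) \<and>
              c1 * Lr_norm M r \<xi> \<le> gamma_norm R \<and> gamma_norm R \<le> c2 * Lr_norm M r \<xi>"
    proof (rule exI[of _ "1 / (a * d2)"], rule conjI[OF c(1)], rule exI[of _ "b / d1"], rule conjI[OF c(2)], intro allI impI)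
      fix G :: "('x \<Rightarrow>\<^sub>L real) \<Rightarrow> 'u \<Rightarrow> 'd" and Gbar :: "('x \<Rightarrow>\<^sub>L real) \<Rightarrow>\<^sub>L 'w" and R \<xi>
      assume "weakly_integrable G \<and> associated_operator tens G Gbar \<and>
              adjoint_is Gbar R \<and> gamma_radonifying R \<and> is_integral M I Gbar \<xi>"
      then have R: "gamma_radonifying R" "adjoint_is Gbar R" and \<xi>: "is_integral M I Gbar \<xi>" by blast+
      obtain \<eta> where \<eta>: "is_integral M I Gbar \<eta>" "\<eta> \<in> SL2 M" "moment_bounded K M \<eta>"
        "d1 * gamma_norm R \<le> L2_norm M \<eta>" "L2_norm M \<eta> \<le> d2 * gamma_norm R"
        by (rule radonifying_integral[OF R]) (rule that)
      have ae: "AE \<omega> in M. norm (\<xi> \<omega>) powr r = norm (\<eta> \<omega>) powr r"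
        using integral_AE_unique[OF \<xi> \<eta>(1)] by eventually_elim simp
      have m: "(\<lambda>\<omega>. norm (\<xi> \<omega>)) \<in> borel_measurable M" "(\<lambda>\<omega>. norm (\<eta> \<omega>)) \<in> borel_measurable M"
        using \<xi> \<eta>(1) unfolding is_integral_def by (simp_all add: strongly_measurable_norm)
      note m[measurable]
      have int: "integrable M (\<lambda>\<omega>. norm (\<xi> \<omega>) powr r) \<longleftrightarrow> integrable M (\<lambda>\<omega>. norm (\<eta> \<omega>) powr r)"
        by (rule integrable_cong_AE[OF _ _ ae]) measurable
      have Lr: "Lr_norm M r \<xi> = Lr_norm M r \<eta>"
        unfolding Lr_norm_def by (subst integral_cong_AE[OF _ _ ae]) simp_all
      have E\<eta>: "integrable M (\<lambda>\<omega>. norm (\<eta> \<omega>) powr r)" "Lr_norm M r \<eta> \<le> a * L2_norm M \<eta>" "L2_norm M \<eta> \<le> b * Lr_norm M r \<eta>"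
        using E[OF M \<eta>(2,3)] by blast+
      have "Lr_norm M r \<eta> \<le> a * (d2 * gamma_norm R)"
        by (rule order_trans[OF E\<eta>(2)]) (use \<eta>(5) ab in simp)
      then have u: "1 / (a * d2) * Lr_norm M r \<eta> \<le> gamma_norm R" using ab d by (simp add: field_simps)
      have "d1 * gamma_norm R \<le> b * Lr_norm M r \<eta>" using \<eta>(4) E\<eta>(3) by linarith
      then have l: "gamma_norm R \<le> b / d1 * Lr_norm M r \<eta>" using d by (simp add: field_simps)
      show "integrable M (\<lambda>\<omega>. norm (\<xi> \<omega>) powr r) \<and> 1 / (a * d2) * Lr_norm M r \<xi> \<le> gamma_norm R \<and> gamma_norm R \<le> b / d1 * Lr_norm M r \<xi>"
        unfolding Lr int using E\<eta>(1) u l by blast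
    qed
  qed
qed

end
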